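(* Let $F:\hat\Omega\to\overline\Omega$ be one of the two polar mappings below, let $W^\ell_h$ be the associated pushforward tensor-product spline spaces on $\Omega$ (see context), and let $V^0_h:=W^0_h\cap H^1(\Omega)$, $V^1_h:=W^1_h\cap H(\mathrm{curl};\Omega)$, $V^2_h:=W^2_h\cap L^2(\Omega)$. Define $$U^0_h:=W^0_h\cap H^1(\Omega)\cap C^1(\Omega)=V^0_h\cap C^1(\Omega),\qquad U^1_h:=W^1_h\cap H(\mathrm{curl};\Omega)\cap C^0(\Omega)=V^1_h\cap C^0(\Omega),\qquad U^2_h:=W^2_h\cap L^2(\Omega)=V^2_h.$$ (a) If $F$ is the analytical polar mapping $F(s,\theta)=\boldsymbol x_0+(s\cos\theta,s\sin\theta)^T$, then $$U^0_h=\Big\{\phi=\sum_{i,j}\phi_{ij}T^0_{ij}\in W^0_h:\ \phi_{0j}=\gamma_0,\ \phi_{1j}=\gamma_0\ \text{ for all }j\Big\},$$ $$U^1_h=\Big\{\boldsymbol v=\sum_{i,j}v^s_{ij}\boldsymbol T^s_{ij}+\sum_{i,j}v^\theta_{ij}\boldsymbol T^\theta_{ij}\in W^1_h:\ v^s_{0j}=0,\ v^\theta_{0j}=0,\ v^\theta_{1j}=v^s_{0(j+1)}-v^s_{0j}\ \text{ for all }j\Big\},$$ $$U^2_h=\Big\{f=\sum_{i,j}f_{ij}T^2_{ij}\in W^2_h:\ f_{0j}=0\ \text{ for all }j\Big\},$$ where $\gamma_0$ is a real parameter that may differ for each $\phi\in U^0_h$ and corresponds to its value at the pole, $\phi(\boldsymbol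 x_0)=\gamma_0$. Moreover, for any $\phi\in U^0_h$ and any $\boldsymbol v\in U^1_h$, it holds $\mathbf{grad}\,\phi(\boldsymbol x_0)=0$ and $\boldsymbol v(\boldsymbol x_0)=0$. (b) If $F$ is a spline polar mapping (of the form specified in the context), then $$U^0_h=\Big\{\phi=\sum_{i,j}\phi_{ij}T^0_{ij}\in W^0_h:\ \phi_{0j}=\gamma_0,\ \phi_{1j}=\gamma_0+\gamma_1\cos\theta_j+\gamma_2\sin\theta_j\ \text{ for all }j\Big\},$$ $$U^1_h=\Big\{\boldsymbol v=\sum_{i,j}v^s_{ij}\boldsymbol T^s_{ij}+\sum_{i,j}v^\theta_{ij}\boldsymbol T^\theta_{ij}\in W^1_h:\ v^s_{0j}=\eta_1\cos\theta_j+\eta_2\sin\theta_j,\ v^\theta_{0j}=0,\ v^\theta_{1j}=v^s_{0(j+1)}-v^s_{0j}\ \text{ for all }j\Big\},$$ $$U^2_h=\Big\{f=\sum_{i,j}f_{ij}T^2_{ij}\in W^2_h:\ f_{0j}=0\ \text{ for all }j\Big\}.$$ Here $\gamma_0,\gamma_1,\gamma_2$ are real parameters which may differ for each $\phi\in U^0_h$ and correspond to its value and gradient at the pole: $\phi(\boldsymbol x_0)=\gamma_0$, $\mathbf{grad}\,\phi(\boldsymbol x_0)=\frac1{\rho_1}(\gamma_1,\gamma_2)^T$. Similarly $\eta_1,\eta_2$ are real parameters which correspond to the value of each $\boldsymbol v\in U^1_h$ at the pole: $\boldsymbol v(\boldsymbol x_0)=\frac1{\rho_1}(\eta_1,\eta_2)^T$,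 where $\rho_1>0$ is the radius of the first ring of control points of $F$.
   Context: **Splines.** Let $p\ge1$, $L>0$ and $\hat\Omega=[0,L]\times(\mathbb R/2\pi\mathbb Z)$ with coordinates $(s,\theta)$. $B_i$, $0\le i<n_s$, are the normalized (partition of unity) B-splines of degree $p$ on $[0,L]$ for the open knot sequence $0=s_0=\dots=s_p<s_{p+1}<\dots<s_{n_s-1}<s_{n_s}=\dots=s_{n_s+p}=L$. $M_i$, $0\le i<n_s-1$, is $\frac{p}{s_{i+p+1}-s_{i+1}}$ times the normalized B-spline of degree $p-1$ with knots $s_{i+1},\dots,s_{i+p+1}$, so $B_i'=M_{i-1}-M_i$ with $M_{-1}=M_{n_s-1}=0$. In the angle, $\theta_j=j\Delta\theta$ with $\Delta\theta=2\pi/n_\theta$, and the index $j$ is understood modulo $n_\theta$. $\mathring B_j$ is the $2\pi$-periodic normalized B-spline of degree $p$ with knots $\theta_j,\dots,\theta_{j+p+1}$, and $\mathring M_j$ is $\frac1{\Delta\theta}$ times the $2\pi$-periodic normalized B-spline of degree $p-1$ with knots $\theta_{j+1},\dots,\theta_{j+p+1}$, so $\mathring B_j'=\mathring M_{j-1}-\mathring M_j$. **Mappings.** A polar mapping is a surjective $C^1$ map $F:\hat\Omega\to\overline\Omega$, with $\Omega\subset\mathbb R^2$ an open domain, which collapses the edge $\{s=0\}$ to a single point $\boldsymbol x_0\in\Omega$ (the pole) and restricts to a $C^1$ diffeomorphism from $\hat\Omega\setminus\{s=0\}$ onto $\overline\Omega\setminus\{\boldsymbol x_0\}$. $J_F$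 is its Jacobian matrix in $(s,\theta)$. The analytical polar mapping is $F(s,\theta)=\boldsymbol x_0+(s\cos\theta,s\sin\theta)^T$ (so $\Omega$ is a disk). A spline polar mapping is a polar mapping of the form $$F(s,\theta)=\boldsymbol x_0+\sum_{i=0}^{n_s-1}\sum_{j=0}^{n_\theta-1}\boldsymbol P_{ij}B_i(s)\mathring B_j(\theta)$$ (same degree and knots as the spline spaces), with $\boldsymbol P_{ij}=(\rho_i\cos\theta_j,\rho_i\sin\theta_j)^T$ for $i\in\{0,1\}$, $0=\rho_0<\rho_1$, with $\det J_F(s,\theta)>0$ for all $s>0$ and all $\theta$; in the case of a spline polar mapping it is assumed that $n_\theta=4n'$ for an integer $n'\ge p\ge1$. **Pushforward spaces.** With $\boldsymbol x=F(s,\theta)$, $s>0$, define functions a.e. on $\Omega$ by $T^0_{ij}(\boldsymbol x)=B_i(s)\mathring B_j(\theta)$ ($0\le i<n_s$); $\boldsymbol T^s_{ij}(\boldsymbol x)=J_F^{-T}(s,\theta)\,(M_i(s)\mathring B_j(\theta),\,0)^T$ ($0\le i<n_s-1$); $\boldsymbol T^\theta_{ij}(\boldsymbol x)=J_F^{-T}(s,\theta)\,(0,\,B_i(s)\mathring M_j(\theta))^T$ ($0\le i<n_s$); $T^2_{ij}(\boldsymbol x)=(\det J_F(s,\theta))^{-1}M_i(s)\mathring M_j(\theta)$ ($0\le i<n_s-1$); always $0\le j<n_\theta$. $W^0_h=\mathrm{Span}\{T^0_{ij}\}$, $W^1_h=\mathrm{Span}(\{\boldsymbol T^s_{ij}\}\cup\{\boldsymbol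 T^\theta_{ij}\})$, $W^2_h=\mathrm{Span}\{T^2_{ij}\}$. Intersections with function spaces are understood up to the value at the pole, where the pushforwards are not a priori defined. For a vector field, $\mathrm{curl}\,\boldsymbol v=\partial_1v_2-\partial_2v_1$ and $H(\mathrm{curl};\Omega)=\{\boldsymbol v\in L^2(\Omega)^2:\mathrm{curl}\,\boldsymbol v\in L^2(\Omega)\}$.
   Formalization: In (a) with p=1 the equalities for U^0_h and U^1_h fail as stated (degree-1 splines are not C^1 at interior knots); there the right-hand sides are intersected with the elements of V^0_h, resp. V^1_h, that are C^1, resp. C^0, on Ω minus the pole. *)

theory Defs
  imports "HOL-Analysis.Analysis"
begin

section \<open>B-splines\<close>

text \<open>
  Cox--de Boor recursion for the normalized B-spline of degree \<open>q\<close> with knots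
  \<open>t i, \<dots>, t (i + q + 1)\<close>.  Terms with a vanishing denominator are 0 because \<open>x / 0 = 0\<close>.  The
  knot spans are closed on the left; a nonempty span is also closed on the right if its right end
  lies in \<open>E\<close>.  Taking \<open>E = {L}\<close> gives a partition of unity on the whole closed interval \<open>[0, L]\<close>
  for an open knot sequence.
\<close>

primrec bspline :: "(nat \<Rightarrow> real) \<Rightarrow> real set \<Rightarrow> nat \<Rightarrow> nat \<Rightarrow> real \<Rightarrow> real" where
  "bspline t E 0 i x =
     (if t i \<le> x \<and> x < t (i + 1) \<or> t i < x \<and> x = t (i + 1) \<and> x \<in> E then 1 else 0)"
| "bspline t E (Suc q) i x =
     (x - t i) / (t (i + q + 1) - t i) * bspline t E q i x
     + (t (i + q + 2) - x) / (t (i + q + 2) - t (i + 1)) * bspline t E q (i + 1) x"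

text \<open>\<open>degr = p\<close>, \<open>len = L\<close>, \<open>nrad = n\<^sub>s\<close>, \<open>knot i = s\<^sub>i\<close>, \<open>nang = n\<^sub>\<theta>\<close>.\<close>

record spline_data =
  degr :: nat
  len :: real
  nrad :: nat
  knot :: "nat \<Rightarrow> real"
  nang :: nat

definition open_knots :: "spline_data \<Rightarrow> bool" where
  "open_knots D \<longleftrightarrow>
     1 \<le> degr D \<and> 0 < len D \<and> 1 \<le> nang D \<and> degr D < nrad D
     \<and> (\<forall>i\<le>degr D. knot D i = 0)
     \<and> (\<forall>i. degr D \<le> i \<and> i < nrad D \<longrightarrow> knot D i < knot D (Suc i))
     \<and> (\<forall>i. nrad D \<le> i \<and> i \<le> nrad D + degr D \<longrightarrow> knot D i = len D)"

definition Bs :: "spline_data \<Rightarrow> nat \<Rightarrow> real \<Rightarrow> real" where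
  "Bs D i x = bspline (knot D) {len D} (degr D) i x"

definition Ms :: "spline_data \<Rightarrow> nat \<Rightarrow> real \<Rightarrow> real" where
  "Ms D i x = real (degr D) / (knot D (i + degr D + 1) - knot D (i + 1))
                * bspline (knot D) {len D} (degr D - 1) (i + 1) x"

definition angle :: "spline_data \<Rightarrow> nat \<Rightarrow> real" where
  "angle D j = real j * (2 * pi / real (nang D))"

definition periodize :: "(real \<Rightarrow> real) \<Rightarrow> real \<Rightarrow> real" where
  "periodize f t = (\<Sum>\<^sub>\<infinity>k::int. f (t + 2 * pi * of_int k))"

definition Bt :: "spline_data \<Rightarrow> nat \<Rightarrow> real \<Rightarrow> real" where
  "Bt D j = periodize (bspline (angle D) {} (degr D) j)"

definition Mt :: "spline_data \<Rightarrow> nat \<Rightarrow> real \<Rightarrow> real" where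
  "Mt D j t = 1 / (2 * pi / real (nang D))
                * periodize (bspline (angle D) {} (degr D - 1) (j + 1)) t"


section \<open>Function spaces\<close>

text \<open>
  \<open>k\<close> times continuously differentiable on \<open>S\<close>, with derivatives taken within \<open>S\<close> (one-sided at
  boundary points that belong to \<open>S\<close>).  For open \<open>S\<close> this is the usual \<open>C\<^sup>k(S)\<close>.
\<close>

primrec Ck_on :: "nat \<Rightarrow> 'a::real_normed_vector set \<Rightarrow> ('a \<Rightarrow> 'b::real_normed_vector) \<Rightarrow> bool" where
  "Ck_on 0 S f = continuous_on S f"
| "Ck_on (Suc k) S f =
     (f differentiable_on S \<and> (\<forall>v. Ck_on k S (\<lambda>x. frechet_derivative f (at x within S) v)))"

definition C0 :: "(real^2) set \<Rightarrow> (real^2 \<Rightarrow> real^2) set" where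
  "C0 \<Omega> = {v. Ck_on 0 \<Omega> v}"

definition C1 :: "(real^2) set \<Rightarrow> (real^2 \<Rightarrow> real) set" where
  "C1 \<Omega> = {f. Ck_on 1 \<Omega> f}"

definition test_functions :: "(real^2) set \<Rightarrow> (real^2 \<Rightarrow> real) set" where
  "test_functions \<Omega> =
     {\<psi>. (\<forall>k. Ck_on k UNIV \<psi>) \<and> (\<exists>K. compact K \<and> K \<subseteq> \<Omega> \<and> (\<forall>x. x \<notin> K \<longrightarrow> \<psi> x = 0))}"

definition partial :: "2 \<Rightarrow> (real^2 \<Rightarrow> real) \<Rightarrow> real^2 \<Rightarrow> real" where
  "partial k \<psi> x = frechet_derivative \<psi> (at x) (axis k 1)"

definition L2 :: "(real^2) set \<Rightarrow> (real^2 \<Rightarrow> 'b::euclidean_space) set" where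
  "L2 \<Omega> = {f. f \<in> borel_measurable (lebesgue_on \<Omega>)
              \<and> integrable (lebesgue_on \<Omega>) (\<lambda>x. (norm (f x))\<^sup>2)}"

definition weak_gradient ::
  "(real^2) set \<Rightarrow> (real^2 \<Rightarrow> real) \<Rightarrow> (real^2 \<Rightarrow> real^2) \<Rightarrow> bool" where
  "weak_gradient \<Omega> f g \<longleftrightarrow>
     (\<forall>\<psi>\<in>test_functions \<Omega>. \<forall>k.
        (LINT x|lebesgue_on \<Omega>. f x * partial k \<psi> x) = - (LINT x|lebesgue_on \<Omega>. g x $ k * \<psi> x))"

definition weak_curl ::
  "(real^2) set \<Rightarrow> (real^2 \<Rightarrow> real^2) \<Rightarrow> (real^2 \<Rightarrow> real) \<Rightarrow> bool" where
  "weak_curl \<Omega> v c \<longleftrightarrow>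
     (\<forall>\<psi>\<in>test_functions \<Omega>.
        (LINT x|lebesgue_on \<Omega>. v x $ 1 * partial 2 \<psi> x - v x $ 2 * partial 1 \<psi> x)
          = (LINT x|lebesgue_on \<Omega>. c x * \<psi> x))"

definition H1 :: "(real^2) set \<Rightarrow> (real^2 \<Rightarrow> real) set" where
  "H1 \<Omega> = {f \<in> L2 \<Omega>. \<exists>g\<in>L2 \<Omega>. weak_gradient \<Omega> f g}"

definition Hcurl :: "(real^2) set \<Rightarrow> (real^2 \<Rightarrow> real^2) set" where
  "Hcurl \<Omega> = {v \<in> L2 \<Omega>. \<exists>c\<in>L2 \<Omega>. weak_curl \<Omega> v c}"

definition modpole :: "'a \<Rightarrow> ('a \<Rightarrow> 'b) set \<Rightarrow> ('a \<Rightarrow> 'b) set" where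
  "modpole x\<^sub>0 X = {f. \<exists>c. f(x\<^sub>0 := c) \<in> X}"


section \<open>Polar mappings\<close>

text \<open>
  The logical domain \<open>[0, L] \<times> (\<real> / 2\<pi>\<int>)\<close> is represented by the strip \<open>[0, L] \<times> \<real>\<close>, a point being
  the vector \<open>(s, \<theta>)\<close>; mappings on it are \<open>2\<pi>\<close>-periodic in the second component.
\<close>

definition strip :: "real \<Rightarrow> (real^2) set" where
  "strip L = {z. 0 \<le> z $ 1 \<and> z $ 1 \<le> L}"

definition strip_pos :: "real \<Rightarrow> (real^2) set" where
  "strip_pos L = {z. 0 < z $ 1 \<and> z $ 1 \<le> L}"

definition jac :: "real \<Rightarrow> (real^2 \<Rightarrow> real^2) \<Rightarrow> real^2 \<Rightarrow> real^2^2" where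
  "jac L F z = matrix (frechet_derivative F (at z within strip L))"

text \<open>
  The inverse of the diffeomorphism takes values in \<open>(0, L] \<times> (\<real> / 2\<pi>\<int>)\<close>; its \<open>C\<^sup>1\<close> regularity is
  that of its local lifts \<open>G\<close> to the strip.
\<close>

definition polar_mapping ::
  "real \<Rightarrow> (real^2 \<Rightarrow> real^2) \<Rightarrow> (real^2) set \<Rightarrow> real^2 \<Rightarrow> bool" where
  "polar_mapping L F \<Omega> x\<^sub>0 \<longleftrightarrow>
     open \<Omega> \<and> connected \<Omega> \<and> x\<^sub>0 \<in> \<Omega>
     \<and> (\<forall>z\<in>strip L. F (z + vector [0, 2 * pi]) = F z)
     \<and> Ck_on 1 (strip L) F
     \<and> F ` strip L = closure \<Omega>
     \<and> (\<forall>z\<in>strip L. z $ 1 = 0 \<longrightarrow> F z = x\<^sub>0)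
     \<and> F ` strip_pos L = closure \<Omega> - {x\<^sub>0}
     \<and> (\<forall>z\<in>strip_pos L. \<forall>w\<in>strip_pos L. F z = F w \<longrightarrow>
          z $ 1 = w $ 1 \<and> (\<exists>k::int. z $ 2 = w $ 2 + 2 * pi * of_int k))
     \<and> (\<forall>z\<in>strip_pos L. \<exists>U G. open U \<and> F z \<in> U \<and> G (F z) = z
          \<and> (\<forall>x \<in> U \<inter> (closure \<Omega> - {x\<^sub>0}). G x \<in> strip_pos L \<and> F (G x) = x)
          \<and> Ck_on 1 (U \<inter> (closure \<Omega> - {x\<^sub>0})) G)"

definition analytical_map :: "real^2 \<Rightarrow> real^2 \<Rightarrow> real^2" where
  "analytical_map x\<^sub>0 z = x\<^sub>0 + vector [z $ 1 * cos (z $ 2), z $ 1 * sin (z $ 2)]"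

definition spline_map ::
  "spline_data \<Rightarrow> real^2 \<Rightarrow> (nat \<Rightarrow> nat \<Rightarrow> real^2) \<Rightarrow> real^2 \<Rightarrow> real^2" where
  "spline_map D x\<^sub>0 P z =
     x\<^sub>0 + (\<Sum>i<nrad D. \<Sum>j<nang D. (Bs D i (z $ 1) * Bt D j (z $ 2)) *\<^sub>R P i j)"

definition spline_polar_mapping ::
  "spline_data \<Rightarrow> real^2 \<Rightarrow> (nat \<Rightarrow> nat \<Rightarrow> real^2) \<Rightarrow> (nat \<Rightarrow> real) \<Rightarrow> (real^2) set \<Rightarrow> bool" where
  "spline_polar_mapping D x\<^sub>0 P \<rho> \<Omega> \<longleftrightarrow>
     polar_mapping (len D) (spline_map D x\<^sub>0 P) \<Omega> x\<^sub>0
     \<and> \<rho> 0 = 0 \<and> 0 < \<rho> 1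
     \<and> (\<forall>i\<in>{0, 1}. \<forall>j<nang D.
          P i j = vector [\<rho> i * cos (angle D j), \<rho> i * sin (angle D j)])
     \<and> (\<forall>z\<in>strip_pos (len D). 0 < det (jac (len D) (spline_map D x\<^sub>0 P) z))
     \<and> (\<exists>n'. nang D = 4 * n' \<and> degr D \<le> n')"


section \<open>Pushforward spaces\<close>

definition pcoord :: "real \<Rightarrow> (real^2 \<Rightarrow> real^2) \<Rightarrow> real^2 \<Rightarrow> real^2" where
  "pcoord L F x = (THE z. z \<in> strip_pos L \<and> 0 \<le> z $ 2 \<and> z $ 2 < 2 * pi \<and> F z = x)"

text \<open>
  The pushforwards are functions on \<open>\<Omega> - {x\<^sub>0}\<close>, extended by 0 so that equality of functions
  is equality on \<open>\<Omega> - {x\<^sub>0}\<close>.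
\<close>

definition T0 ::
  "spline_data \<Rightarrow> (real^2 \<Rightarrow> real^2) \<Rightarrow> (real^2) set \<Rightarrow> real^2 \<Rightarrow> nat \<Rightarrow> nat \<Rightarrow> real^2 \<Rightarrow> real" where
  "T0 D F \<Omega> x\<^sub>0 i j x =
     (if x \<in> \<Omega> - {x\<^sub>0}
      then (let z = pcoord (len D) F x in Bs D i (z $ 1) * Bt D j (z $ 2))
      else 0)"

definition Ts ::
  "spline_data \<Rightarrow> (real^2 \<Rightarrow> real^2) \<Rightarrow> (real^2) set \<Rightarrow> real^2 \<Rightarrow> nat \<Rightarrow> nat \<Rightarrow> real^2 \<Rightarrow> real^2" where
  "Ts D F \<Omega> x\<^sub>0 i j x =
     (if x \<in> \<Omega> - {x\<^sub>0}
      then (let z = pcoord (len D) F x in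
              transpose (matrix_inv (jac (len D) F z)) *v vector [Ms D i (z $ 1) * Bt D j (z $ 2), 0])
      else 0)"

definition Tt ::
  "spline_data \<Rightarrow> (real^2 \<Rightarrow> real^2) \<Rightarrow> (real^2) set \<Rightarrow> real^2 \<Rightarrow> nat \<Rightarrow> nat \<Rightarrow> real^2 \<Rightarrow> real^2" where
  "Tt D F \<Omega> x\<^sub>0 i j x =
     (if x \<in> \<Omega> - {x\<^sub>0}
      then (let z = pcoord (len D) F x in
              transpose (matrix_inv (jac (len D) F z)) *v vector [0, Bs D i (z $ 1) * Mt D j (z $ 2)])
      else 0)"

definition T2 ::
  "spline_data \<Rightarrow> (real^2 \<Rightarrow> real^2) \<Rightarrow> (real^2) set \<Rightarrow> real^2 \<Rightarrow> nat \<Rightarrow> nat \<Rightarrow> real^2 \<Rightarrow> real" where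
  "T2 D F \<Omega> x\<^sub>0 i j x =
     (if x \<in> \<Omega> - {x\<^sub>0}
      then (let z = pcoord (len D) F x in
              inverse (det (jac (len D) F z)) * (Ms D i (z $ 1) * Mt D j (z $ 2)))
      else 0)"

definition comb0 ::
  "spline_data \<Rightarrow> (real^2 \<Rightarrow> real^2) \<Rightarrow> (real^2) set \<Rightarrow> real^2
    \<Rightarrow> (nat \<Rightarrow> nat \<Rightarrow> real) \<Rightarrow> real^2 \<Rightarrow> real" where
  "comb0 D F \<Omega> x\<^sub>0 c x = (\<Sum>i<nrad D. \<Sum>j<nang D. c i j * T0 D F \<Omega> x\<^sub>0 i j x)"

definition comb1 ::
  "spline_data \<Rightarrow> (real^2 \<Rightarrow> real^2) \<Rightarrow> (real^2) set \<Rightarrow> real^2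
    \<Rightarrow> (nat \<Rightarrow> nat \<Rightarrow> real) \<Rightarrow> (nat \<Rightarrow> nat \<Rightarrow> real) \<Rightarrow> real^2 \<Rightarrow> real^2" where
  "comb1 D F \<Omega> x\<^sub>0 a b x =
     (\<Sum>i<nrad D - 1. \<Sum>j<nang D. a i j *\<^sub>R Ts D F \<Omega> x\<^sub>0 i j x)
     + (\<Sum>i<nrad D. \<Sum>j<nang D. b i j *\<^sub>R Tt D F \<Omega> x\<^sub>0 i j x)"

definition comb2 ::
  "spline_data \<Rightarrow> (real^2 \<Rightarrow> real^2) \<Rightarrow> (real^2) set \<Rightarrow> real^2
    \<Rightarrow> (nat \<Rightarrow> nat \<Rightarrow> real) \<Rightarrow> real^2 \<Rightarrow> real" where
  "comb2 D F \<Omega> x\<^sub>0 c x = (\<Sum>i<nrad D - 1. \<Sum>j<nang D. c i j * T2 D F \<Omega> x\<^sub>0 i j x)"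

definition W0 where "W0 D F \<Omega> x\<^sub>0 = {comb0 D F \<Omega> x\<^sub>0 c | c. True}"
definition W1 where "W1 D F \<Omega> x\<^sub>0 = {comb1 D F \<Omega> x\<^sub>0 a b | a b. True}"
definition W2 where "W2 D F \<Omega> x\<^sub>0 = {comb2 D F \<Omega> x\<^sub>0 c | c. True}"

definition V0 where "V0 D F \<Omega> x\<^sub>0 = W0 D F \<Omega> x\<^sub>0 \<inter> modpole x\<^sub>0 (H1 \<Omega>)"
definition V1 where "V1 D F \<Omega> x\<^sub>0 = W1 D F \<Omega> x\<^sub>0 \<inter> modpole x\<^sub>0 (Hcurl \<Omega>)"
definition V2 where "V2 D F \<Omega> x\<^sub>0 = W2 D F \<Omega> x\<^sub>0 \<inter> modpole x\<^sub>0 (L2 \<Omega>)"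

definition U0 where
  "U0 D F \<Omega> x\<^sub>0 = W0 D F \<Omega> x\<^sub>0 \<inter> modpole x\<^sub>0 (H1 \<Omega>) \<inter> modpole x\<^sub>0 (C1 \<Omega>)"
definition U1 where
  "U1 D F \<Omega> x\<^sub>0 = W1 D F \<Omega> x\<^sub>0 \<inter> modpole x\<^sub>0 (Hcurl \<Omega>) \<inter> modpole x\<^sub>0 (C0 \<Omega>)"
definition U2 where
  "U2 D F \<Omega> x\<^sub>0 = W2 D F \<Omega> x\<^sub>0 \<inter> modpole x\<^sub>0 (L2 \<Omega>)"


end

theory Submission
  imports Defs "HOL-Computational_Algebra.Polynomial"
begin

text \<open>
  Near the pole a tensor-product spline is determined to first order in \<open>s\<close> by its two innermost
  rows of coefficients: its value tends to row 0, and its slope in \<open>s\<close> to a multiple of row 1 minus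
  row 0.  Continuity or differentiability at the pole forces this first-order part to be the pullback
  of a constant covector, i.e. a linear combination of the two components of \<open>\<partial>\<^sub>s F(0, \<theta>)\<close>.  For
  the analytical map these are \<open>cos \<theta>\<close> and \<open>sin \<theta>\<close>, which are not piecewise polynomial, so
  the combination vanishes; for a spline map they are the splines with coefficients \<open>cos \<theta>\<^sub>j\<close> and
  \<open>sin \<theta>\<^sub>j\<close>.  Only the row functions are determined, so coefficients may be replaced by others with
  the same row functions and no linear independence is used.

  Conversely, write \<open>\<partial>\<^sub>\<theta> F = s E\<close>.  The determinant of \<open>(\<partial>\<^sub>s F, E)\<close> stays positive at \<open>s = 0\<close>, so
  fields whose components have the right order in \<open>s\<close> extend continuously to the pole, and the
  weak curl is computed by a change of variables and integration by parts in the chart.  For a spline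
  map of degree 1 the image of a small circle is a polygon, hence the map is not \<open>C\<^sup>1\<close>.
\<close>

section \<open>B-splines\<close>

text \<open>The hypothesis \<open>det J > 0\<close> for \<open>s > 0\<close> only makes the
  determinant of \<open>(Fs, E)\<close> nonnegative in the limit \<open>s = 0\<close>. Strict
  positivity there has to come from the first ring of control points, and this is where
  \<open>n >= 4 p\<close> enters. The constant \<open>\<kappa> = p / h\<close>, with
  \<open>h\<close> the first positive knot, is the common value of \<open>M_0(0)\<close>,
  \<open>B_1'(0)\<close> and \<open>- B_0'(0)\<close>; for a spline map it scales the chart and the
  coefficients alike and so cancels. Square integrability is decided by a logarithm: the square of a
  density \<open>g / (s det)\<close>, times the Jacobian, is of order \<open>g^2 / s\<close>, so row
  0 of its numerator must vanish. Applied to a curl, this is the relation between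
  \<open>v^s_{0j}\<close> and \<open>v^\<theta>_{1j}\<close>. Degree 1 shapes the auxiliary facts:
  there \<open>Ms\<close> and \<open>Mt\<close> are step functions, so the density statements rest
  on measurability, bounds and right continuity instead of continuity, and \<open>U0\<close>,
  \<open>U1\<close> are treated on the first knot ring, where the admissible functions are constant
  and the admissible fields zero.\<close>

lemma bspline_cong:
  assumes "\<And>k. i \<le> k \<Longrightarrow> k \<le> i + q + 1 \<Longrightarrow> t k = t' k"
  shows "bspline t E q i x = bspline t' E q i x"
  using assms
proof (induction q arbitrary: i)
  case 0
  then show ?case by simp
next
  case (Suc q)
  have "bspline t E q i x = bspline t' E q i x"
    by (rule Suc.IH) (use Suc.prems in auto)
  moreover have "bspline t E q (i + 1) x = bspline t' E q (i + 1) x"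
    by (rule Suc.IH) (use Suc.prems in auto)
  ultimately show ?case using Suc.prems by simp
qed

section \<open>Measurability, bounds, support and sign of B-splines\<close>

lemma bspline_measurable [measurable]: "bspline t E q i \<in> borel_measurable borel"
proof (induction q arbitrary: i)
  case 0
  have "{x. t i \<le> x \<and> x < t (i + 1) \<or> t i < x \<and> x = t (i + 1) \<and> x \<in> E}
      = {t i..<t (i + 1)} \<union> (if t i < t (i + 1) \<and> t (i + 1) \<in> E then {t (i + 1)} else {})"
    by auto
  then have "{x. t i \<le> x \<and> x < t (i + 1) \<or> t i < x \<and> x = t (i + 1) \<and> x \<in> E} \<in> sets borel"
    by simp
  then have "(\<lambda>x. if t i \<le> x \<and> x < t (i + 1) \<or> t i < x \<and> x = t (i + 1) \<and> x \<in> E then 1 else 0 :: real)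
     \<in> borel_measurable borel"
    by (intro measurable_If) auto
  then show ?case by (subst measurable_cong[OF bspline.simps(1)])
next
  case (Suc q)
  have [measurable]: "bspline t E q i \<in> borel_measurable borel"
    "bspline t E q (i + 1) \<in> borel_measurable borel" by (rule Suc)+
  show ?case by (subst measurable_cong[OF bspline.simps(2)]) measurable
qed

text \<open>Proved along the recursion, without continuity, because the radial densities of a degree
  1 space are splines of degree 0. The range of \<open>x\<close> is bounded since the affine weights
  are not.\<close>

lemma bspline_bounded: "\<exists>C. \<forall>x. \<bar>x\<bar> \<le> R \<longrightarrow> \<bar>bspline t E q i x\<bar> \<le> C"
proof (induction q arbitrary: i)
  case 0
  show ?case by (rule exI[of _ 1]) auto
next
  case (Suc q)
  obtain C1 where C1: "\<And>x. \<bar>x\<bar> \<le> R \<Longrightarrow> \<bar>bspline t E q i x\<bar> \<le> C1"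
    using Suc by blast
  obtain C2 where C2: "\<And>x. \<bar>x\<bar> \<le> R \<Longrightarrow> \<bar>bspline t E q (i + 1) x\<bar> \<le> C2"
    using Suc by blast
  let ?a = "t (i + q + 1) - t i" and ?b = "t (i + q + 2) - t (i + 1)"
  let ?A = "(R + \<bar>t i\<bar>) / \<bar>?a\<bar>"
    and ?B = "(R + \<bar>t (i + q + 2)\<bar>) / \<bar>?b\<bar>"
  show ?case
  proof (intro exI allI impI)
    fix x assume x: "\<bar>x\<bar> \<le> R"
    have 1: "\<bar>(x - t i) / ?a\<bar> \<le> ?A" unfolding abs_divide
      by (rule divide_right_mono) (use x in auto)
    have 2: "\<bar>(t (i + q + 2) - x) / ?b\<bar> \<le> ?B" unfolding abs_divide
      by (rule divide_right_mono) (use x in auto)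
    have "\<bar>bspline t E (Suc q) i x\<bar>
       \<le> \<bar>(x - t i) / ?a\<bar> * \<bar>bspline t E q i x\<bar> + \<bar>(t (i + q + 2) - x) / ?b\<bar> * \<bar>bspline t E q (i + 1) x\<bar>"
      unfolding bspline.simps(2) by (metis abs_mult abs_triangle_ineq)
    also have "\<dots> \<le> ?A * C1 + ?B * C2"
      by (intro add_mono mult_mono 1 2 C1 C2 x) (use 1 2 order_trans[OF abs_ge_zero] in blast)+
    finally show "\<bar>bspline t E (Suc q) i x\<bar> \<le> ?A * C1 + ?B * C2" .
  qed
qed

lemma bspline_eq_0:
  assumes "mono t" "x < t i \<or> t (i + q + 1) < x"
  shows "bspline t E q i x = 0"
  using assms(2)
proof (induction q arbitrary: i)
  case 0
  then show ?case by auto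
next
  case (Suc q)
  have "t i \<le> t (i + 1)" "t (i + q + 1) \<le> t (i + q + 2)" using assms(1) by (auto simp: mono_def)
  then have "bspline t E q i x = 0" "bspline t E q (i + 1) x = 0"
    using Suc.prems by (intro Suc.IH; auto)+
  then show ?case by simp
qed

lemma bspline_nonneg:
  assumes "mono t"
  shows "0 \<le> bspline t E q i x"
proof (induction q arbitrary: i)
  case 0
  then show ?case by simp
next
  case (Suc q)
  have m: "t i \<le> t (i + q + 1)" "t (i + 1) \<le> t (i + q + 2)" using assms by (auto simp: mono_def)
  \<comment> \<open>Left of \<open>t i\<close> the weight is negative, but there the lower-degree
    spline is zero.\<close>
  have 1: "0 \<le> (x - t i) / (t (i + q + 1) - t i) * bspline t E q i x"
  proof (cases "x < t i")
    case True
    then show ?thesis using bspline_eq_0[OF assms, of x i q] by simp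
  next
    case False
    then show ?thesis using m Suc by simp
  qed
  have 2: "0 \<le> (t (i + q + 2) - x) / (t (i + q + 2) - t (i + 1)) * bspline t E q (i + 1) x"
  proof (cases "x > t (i + q + 2)")
    case True
    then show ?thesis using bspline_eq_0[OF assms, of x "i + 1" q] by simp
  next
    case False
    then show ?thesis using m Suc[of "i + 1"] by (intro mult_nonneg_nonneg divide_nonneg_nonneg) auto
  qed
  show ?case using 1 2 by simp
qed

section \<open>Differentiability and continuity for general knots\<close>

lemma bspline_deriv_step:
  fixes u v w :: real
  assumes d: "c1 - a1 = d1" "c2 - a2 = d2" and v: "d1 = 0 \<or> d2 = 0 \<Longrightarrow> v = 0"
    and u: "d1 = 0 \<Longrightarrow> u = 0" and w: "d2 = 0 \<Longrightarrow> w = 0"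
    and N1: "N1 = (x - a1) * u + (c1 - x) * v" and N2: "N2 = (x - a2) * v + (c2 - x) * w"
  shows "N1 / d1 - N2 / d2 + (x - a1) / d1 * (k * (u - v)) + (c2 - x) / d2 * (k * (v - w))
    = (1 + k) * (N1 / d1 - N2 / d2)"
proof -
  \<comment> \<open>Here \<open>u\<close>, \<open>v\<close>, \<open>w\<close> stand for three
    consecutive splines divided by their knot spans, \<open>N1\<close>, \<open>N2\<close> for the
    two splines one degree higher, and \<open>d1\<close>, \<open>d2\<close> for the spans of those.
    The terms \<open>v\<close> of the two identities cancel, so the \<open>k\<close> copies coming
    from differentiated splines have the same form as the single copy coming from differentiated
    weights. If a span is zero, division yields 0 and the hypotheses make \<open>v\<close> vanish as
    well.\<close>
  have 1: "(x - a1) / d1 * (u - v) = N1 / d1 - v"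
  proof (cases "d1 = 0")
    case False
    have "(x - a1) * (u - v) = N1 - d1 * v" unfolding N1 d(1)[symmetric] by (simp add: algebra_simps)
    then show ?thesis using False by (simp add: field_simps)
  qed (use v in simp)
  have 2: "(c2 - x) / d2 * (v - w) = v - N2 / d2"
  proof (cases "d2 = 0")
    case False
    have "(c2 - x) * (v - w) = d2 * v - N2" unfolding N2 d(2)[symmetric] by (simp add: algebra_simps)
    then show ?thesis using False by (simp add: field_simps)
  qed (use v in simp)
  have "(x - a1) / d1 * (k * (u - v)) + (c2 - x) / d2 * (k * (v - w))
    = k * ((x - a1) / d1 * (u - v) + (c2 - x) / d2 * (v - w))"
    by (simp only: distrib_left mult.assoc mult.left_commute)
  also have "\<dots> = k * (N1 / d1 - N2 / d2)" unfolding 1 2 by simp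
  finally show ?thesis by (simp add: distrib_right)
qed

lemma bspline_0_locally_const:
  assumes "x \<noteq> t i" "x \<noteq> t (i + 1)"
  shows "(bspline t E 0 i has_real_derivative 0) (at x)"
proof -
  define c where "c = bspline t E 0 i x"
  have "open (- {t i, t (i + 1)})" by (simp add: open_Compl)
  then have ev1: "\<forall>\<^sub>F y in nhds x. y \<notin> {t i, t (i + 1)}"
    using assms eventually_nhds by blast
  have ev2: "\<forall>\<^sub>F y in nhds x. (y < t i \<longleftrightarrow> x < t i) \<and> (y < t (i + 1) \<longleftrightarrow> x < t (i + 1))"
  proof (intro eventually_conj)
    have *: "\<forall>\<^sub>F y in nhds x. y < a \<longleftrightarrow> x < a" if "x \<noteq> a" for a
    proof (cases "x < a")
      case True
      then have "x \<in> {..<a}" by simp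
      from eventually_nhds_in_open[OF _ this] show ?thesis using True by (auto elim: eventually_mono)
    next
      case False
      then have "x \<in> {a<..}" using that by simp
      from eventually_nhds_in_open[OF _ this] show ?thesis using False by (auto elim: eventually_mono)
    qed
    show "\<forall>\<^sub>F y in nhds x. y < t i \<longleftrightarrow> x < t i" by (rule *) fact
    show "\<forall>\<^sub>F y in nhds x. y < t (i + 1) \<longleftrightarrow> x < t (i + 1)" by (rule *) fact
  qed
  have "\<forall>\<^sub>F y in nhds x. bspline t E 0 i y = c"
    using ev1 ev2 by eventually_elim (use assms in \<open>auto simp: c_def\<close>)
  then show ?thesis
    by (subst DERIV_cong_ev[OF refl _ refl, of _ "\<lambda>_. c"]) auto
qed

text \<open>For \<open>d = 0\<close> both sides are zero by the convention on division, so
  coincident knots need no case distinction when the recursion is differentiated.\<close>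

lemma affine_deriv:
  fixes a d x :: real
  shows "((\<lambda>x. (x - a) / d) has_real_derivative 1 / d) (at x)"
    and "((\<lambda>x. (a - x) / d) has_real_derivative (- 1) / d) (at x)"
proof -
  have "((\<lambda>x. x - a) has_real_derivative 1) (at x)" "((\<lambda>x. a - x) has_real_derivative (- 1)) (at x)"
    by (auto intro!: derivative_eq_intros)
  from this[THEN DERIV_cdivide[where c = d]]
  show "((\<lambda>x. (x - a) / d) has_real_derivative 1 / d) (at x)"
    and "((\<lambda>x. (a - x) / d) has_real_derivative (- 1) / d) (at x)" by auto
qed

text \<open>The product rule applied to the recursion, with the formula one degree lower inserted,
  leaves the algebra of \<open>bspline_deriv_step\<close>. Knots are excluded because the degree 0
  splines jump there; where the right-hand side is continuous they are restored by
  \<open>has_real_derivative_within_removable\<close>.\<close>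

lemma bspline_has_real_derivative:
  assumes "mono t" "x \<notin> t ` {i..i + q + 2}"
  shows "(bspline t E (Suc q) i has_real_derivative
     real (Suc q) * (bspline t E q i x / (t (i + q + 1) - t i)
       - bspline t E q (i + 1) x / (t (i + q + 2) - t (i + 1)))) (at x)"
  using assms(2)
proof (induction q arbitrary: i)
  case 0
  have d: "(bspline t E 0 i has_real_derivative 0) (at x)"
    "(bspline t E 0 (i + 1) has_real_derivative 0) (at x)"
    by (rule bspline_0_locally_const; use 0 in auto)+
  have "((\<lambda>x. (x - t i) / (t (i + 0 + 1) - t i) * bspline t E 0 i x
     + (t (i + 0 + 2) - x) / (t (i + 0 + 2) - t (i + 1)) * bspline t E 0 (i + 1) x) has_real_derivative
     (x - t i) / (t (i + 0 + 1) - t i) * 0 + 1 / (t (i + 0 + 1) - t i) * bspline t E 0 i x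
    + ((t (i + 0 + 2) - x) / (t (i + 0 + 2) - t (i + 1)) * 0 + (- 1) / (t (i + 0 + 2) - t (i + 1)) * bspline t E 0 (i + 1) x)) (at x)"
    by (intro DERIV_add DERIV_mult' affine_deriv d)
  then show ?case unfolding bspline.simps(2)[abs_def] by (simp add: field_simps)
next
  case (Suc q)
  let ?N = "bspline t E"
  let ?u = "?N q i x / (t (i + q + 1) - t i)"
  let ?v = "?N q (i + 1) x / (t (i + q + 2) - t (i + 1))"
  let ?w = "?N q (i + 2) x / (t (i + q + 3) - t (i + 2))"
  let ?d1 = "t (i + Suc q + 1) - t i" and ?d2 = "t (i + Suc q + 2) - t (i + 1)"
  have m: "t a \<le> t b" if "a \<le> b" for a b using assms(1) that by (auto simp: mono_def)
  have 1: "(?N (Suc q) i has_real_derivative real (Suc q) * (?u - ?v)) (at x)"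
    by (rule Suc.IH) (use Suc.prems in auto)
  have "(?N (Suc q) (i + 1) has_real_derivative real (Suc q) *
     (?N q (i + 1) x / (t (i + 1 + q + 1) - t (i + 1)) - ?N q (i + 1 + 1) x / (t (i + 1 + q + 2) - t (i + 1 + 1)))) (at x)"
    by (rule Suc.IH) (use Suc.prems in auto)
  then have 2: "(?N (Suc q) (i + 1) has_real_derivative real (Suc q) * (?v - ?w)) (at x)"
    by (simp add: numeral_2_eq_2 numeral_3_eq_3)
  have N1: "?N (Suc q) i x = (x - t i) * ?u + (t (i + Suc q + 1) - x) * ?v"
    by (simp add: numeral_2_eq_2)
  have N2: "?N (Suc q) (i + 1) x = (x - t (i + 1)) * ?v + (t (i + Suc q + 2) - x) * ?w"
    by (simp add: numeral_2_eq_2 numeral_3_eq_3)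
  \<comment> \<open>The smaller knot span lies inside the larger one, so by monotonicity it vanishes
    together with it, and the quotient over it is 0.\<close>
  have u0: "?u = 0" if "?d1 = 0"
  proof -
    have "t (i + q + 1) - t i = 0"
      using that m[of i "i + q + 1"] m[of "i + q + 1" "i + Suc q + 1"] by simp
    then show ?thesis by simp
  qed
  have v0: "?v = 0" if "?d1 = 0 \<or> ?d2 = 0"
  proof -
    have "t (i + q + 2) - t (i + 1) = 0"
      using that m[of i "i + 1"] m[of "i + 1" "i + q + 2"] m[of "i + q + 2" "i + Suc q + 2"]
        m[of "i + q + 2" "i + Suc q + 1"] by auto
    then show ?thesis by simp
  qed
  have w0: "?w = 0" if "?d2 = 0"
  proof -
    have "t (i + q + 3) - t (i + 2) = 0"
      using that m[of "i + 1" "i + 2"] m[of "i + 2" "i + q + 3"] m[of "i + q + 3" "i + Suc q + 2"] by simp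
    then show ?thesis by simp
  qed
  have "((\<lambda>x. (x - t i) / ?d1 * ?N (Suc q) i x
     + (t (i + Suc q + 2) - x) / ?d2 * ?N (Suc q) (i + 1) x) has_real_derivative
     (x - t i) / ?d1 * (real (Suc q) * (?u - ?v)) + 1 / ?d1 * ?N (Suc q) i x
    + ((t (i + Suc q + 2) - x) / ?d2 * (real (Suc q) * (?v - ?w)) + (- 1) / ?d2 * ?N (Suc q) (i + 1) x)) (at x)"
    by (intro DERIV_add DERIV_mult' affine_deriv 1 2)
  moreover have "(x - t i) / ?d1 * (real (Suc q) * (?u - ?v)) + 1 / ?d1 * ?N (Suc q) i x
    + ((t (i + Suc q + 2) - x) / ?d2 * (real (Suc q) * (?v - ?w)) + (- 1) / ?d2 * ?N (Suc q) (i + 1) x)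
    = real (Suc (Suc q)) * (?N (Suc q) i x / ?d1 - ?N (Suc q) (i + 1) x / ?d2)"
    using bspline_deriv_step[of "t (i + Suc q + 1)" "t i" ?d1 "t (i + Suc q + 2)" "t (i + 1)" ?d2 ?v ?u ?w
        "?N (Suc q) i x" x "?N (Suc q) (i + 1) x" "real (Suc q)", OF refl refl v0 u0 w0 N1 N2]
    by (simp del: bspline.simps)
  ultimately show ?case by (simp only: bspline.simps(2)[of t E "Suc q" i, abs_def])
qed

text \<open>The weights are affine in \<open>x\<close>, so continuity in all degrees from 1 on is
  inherited from the piecewise linear splines.\<close>

lemma bspline_Suc_continuous_on:
  assumes "\<And>i. i + 2 \<le> m \<Longrightarrow> continuous_on S (bspline t E 1 i)" "i + q + 2 \<le> m"
  shows "continuous_on S (bspline t E (Suc q) i)"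
  using assms(2)
proof (induction q arbitrary: i)
  case 0
  then show ?case using assms(1)[of i] by simp
next
  case (Suc q)
  have "continuous_on S (bspline t E (Suc q) i)" "continuous_on S (bspline t E (Suc q) (i + 1))"
    using Suc.IH[of i] Suc.IH[of "i + 1"] Suc.prems by (simp_all del: bspline.simps)
  then show ?case
    unfolding bspline.simps(2)[of t E "Suc q" i, abs_def]
    by (auto simp: divide_inverse intro!: continuous_intros)
qed

text \<open>The hypotheses list what can break a hat function. If its middle knot belonged to
  \<open>E\<close>, both spans would count it and the value there would be 2. If the left span is
  empty, the function jumps at that knot, so \<open>S\<close> must stay to its right. If the right
  span is empty, \<open>S\<close> must stay to its left, and closing the span there prevents a drop
  to 0.\<close>

lemma bspline_1_continuous_on:
  assumes "t i \<le> t (i + 1)" "t (i + 1) \<le> t (i + 2)"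
    and "t i < t (i + 1) \<Longrightarrow> t (i + 1) < t (i + 2) \<Longrightarrow> t (i + 1) \<notin> E"
    and "t i = t (i + 1) \<Longrightarrow> t (i + 1) < t (i + 2) \<Longrightarrow> S \<subseteq> {t i..}"
    and "t i < t (i + 1) \<Longrightarrow> t (i + 1) = t (i + 2) \<Longrightarrow> S \<subseteq> {..t (i + 1)} \<and> t (i + 1) \<in> E"
  shows "continuous_on S (bspline t E 1 i)"
proof -
  define a b c where "a = t i" "b = t (i + 1)" "c = t (i + 2)"
  have N: "bspline t E 1 i x = (x - a) / (b - a) * (if a \<le> x \<and> x < b \<or> a < x \<and> x = b \<and> x \<in> E then 1 else 0)
    + (c - x) / (c - b) * (if b \<le> x \<and> x < c \<or> b < x \<and> x = c \<and> x \<in> E then 1 else 0)" for x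
    by (simp add: a_b_c_def numeral_2_eq_2)
  consider "a < b" "b < c" | "a = b" "b < c" | "a < b" "b = c" | "a = b" "b = c"
    using assms(1,2) a_b_c_def by linarith
  then show ?thesis
  proof cases
    case 1
    then have bE: "b \<notin> E" using assms(3) a_b_c_def by simp
    have "bspline t E 1 i x = max 0 (min ((x - a) / (b - a)) ((c - x) / (c - b)))" for x
    proof -
      consider "x < a" | "a \<le> x" "x < b" | "x = b" | "b < x" "x \<le> c" | "c < x" by linarith
      then show ?thesis
      proof cases
        case 1
        then have "(x - a) / (b - a) < 0" using \<open>a < b\<close> by (simp add: divide_neg_pos)
        then show ?thesis unfolding N using 1 \<open>a < b\<close> \<open>b < c\<close> by auto
      next
        case 2
        then have "(x - a) / (b - a) \<le> 1" "1 \<le> (c - x) / (c - b)" "0 \<le> (x - a) / (b - a)"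
          using \<open>a < b\<close> \<open>b < c\<close> by (auto simp: field_simps)
        then have "max 0 (min ((x - a) / (b - a)) ((c - x) / (c - b))) = (x - a) / (b - a)" by linarith
        then show ?thesis unfolding N using 2 \<open>a < b\<close> \<open>b < c\<close> by auto
      next
        case 3
        then show ?thesis unfolding N using \<open>a < b\<close> \<open>b < c\<close> bE by auto
      next
        case 4
        then have "(c - x) / (c - b) \<le> 1" "1 \<le> (x - a) / (b - a)" "0 \<le> (c - x) / (c - b)"
          using \<open>a < b\<close> \<open>b < c\<close> by (auto simp: field_simps)
        then have "max 0 (min ((x - a) / (b - a)) ((c - x) / (c - b))) = (c - x) / (c - b)" by linarith
        then show ?thesis unfolding N using 4 \<open>a < b\<close> \<open>b < c\<close>
          by (cases "x = c") auto
      next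
        case 5
        then have "(c - x) / (c - b) < 0" using \<open>b < c\<close> by (simp add: divide_neg_pos)
        then show ?thesis unfolding N using 5 \<open>a < b\<close> \<open>b < c\<close> by auto
      qed
    qed
    then show ?thesis by (auto simp: divide_inverse intro!: continuous_intros)
  next
    case 2
    then have S: "S \<subseteq> {a..}" using assms(4) a_b_c_def by simp
    have "bspline t E 1 i x = max 0 ((c - x) / (c - b))" if "x \<in> S" for x
    proof -
      consider "x < c" | "x = c" | "c < x" by linarith
      then show ?thesis
      proof cases
        case 1
        then have "0 \<le> (c - x) / (c - b)" using \<open>b < c\<close> by auto
        then show ?thesis unfolding N using 1 2 S that by auto
      next
        case 2
        then show ?thesis unfolding N using \<open>b < c\<close> \<open>a = b\<close> by auto
      next
        case 3
        then have "(c - x) / (c - b) < 0" using \<open>b < c\<close> by (simp add: divide_neg_pos)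
        then show ?thesis unfolding N using 3 2 by auto
      qed
    qed
    then show ?thesis
      by (subst continuous_on_cong[OF refl]) (auto simp: divide_inverse intro!: continuous_intros)
  next
    case 3
    then have S: "S \<subseteq> {..b}" "b \<in> E" using assms(5) a_b_c_def by simp_all
    have "bspline t E 1 i x = max 0 ((x - a) / (b - a))" if "x \<in> S" for x
    proof (cases "x < a")
      case True
      then have "(x - a) / (b - a) < 0" using \<open>a < b\<close> by (simp add: divide_neg_pos)
      then show ?thesis unfolding N using True 3 by auto
    next
      case False
      then have "0 \<le> (x - a) / (b - a)" using \<open>a < b\<close> by auto
      then show ?thesis unfolding N using False 3 S that by auto
    qed
    then show ?thesis
      by (subst continuous_on_cong[OF refl]) (auto simp: divide_inverse intro!: continuous_intros)
  next
    case 4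
    then have "bspline t E 1 i = (\<lambda>x. 0)" using N by (intro ext) simp
    then show ?thesis by simp
  qed
qed

text \<open>The fundamental theorem of calculus tolerates finitely many exceptional points, so
  \<open>f\<close> equals its initial value plus the integral of the continuous \<open>g\<close>;
  that expression is differentiable everywhere, also at the knots and at the ends.\<close>

lemma has_real_derivative_within_removable:
  fixes f g :: "real \<Rightarrow> real"
  assumes "finite S" "continuous_on {a..b} f" "continuous_on {a..b} g"
    and "\<And>x. x \<in> {a<..<b} - S \<Longrightarrow> (f has_real_derivative g x) (at x)"
    and x: "x \<in> {a..b}"
  shows "(f has_real_derivative g x) (at x within {a..b})"
proof -
  have *: "f y = f a + integral {a..y} g" if "y \<in> {a..b}" for y
  proof -
    have "(g has_integral (f y - f a)) {a..y}"
      by (rule fundamental_theorem_of_calculus_interior_strong[OF assms(1)])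
        (use that assms in \<open>auto simp: has_real_derivative_iff_has_vector_derivative[symmetric] intro: continuous_on_subset\<close>)
    then show ?thesis by (simp add: integral_unique)
  qed
  have "((\<lambda>y. f a + integral {a..y} g) has_real_derivative 0 + g x) (at x within {a..b})"
    by (intro DERIV_add DERIV_const integral_has_real_derivative assms x)
  then show ?thesis
    unfolding has_field_derivative_def by (intro has_derivative_transform[OF x *]) simp_all
qed

text \<open>With a knot of multiplicity \<open>p + 1\<close> at 0, the number \<open>i + q\<close>
  decides the behaviour on \<open>[0, h)\<close>. Below \<open>p\<close> all knots coincide. At
  \<open>p\<close> only the last knot is \<open>h\<close>, and each step of the recursion multiplies
  by \<open>1 - x / h\<close>. Above \<open>p\<close> the spline vanishes at 0, and \<open>R\<close>
  is what remains after dividing by \<open>x\<close>; \<open>R 0\<close> is the slope at the pole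
  and can be nonzero only directly above \<open>p\<close>. Keeping \<open>R\<close> continuous on
  the whole line makes division by \<open>s\<close> harmless later.\<close>

lemma bspline_near_first_knot:
  assumes "mono t" and zero: "\<And>k. k \<le> p \<Longrightarrow> t k = 0" and h: "t (p + 1) = h" "0 < h"
  shows "i + q < p \<Longrightarrow> 0 \<le> x \<Longrightarrow> x < h \<Longrightarrow> bspline t E q i x = 0"
    and "i + q = p \<Longrightarrow> 0 \<le> x \<Longrightarrow> x < h \<Longrightarrow> bspline t E q i x = (1 - x / h) ^ q"
    and "p < i + q \<Longrightarrow> \<exists>R. continuous_on UNIV R \<and> R 0 = (if i + q = p + 1 then q / h else 0)
           \<and> (\<forall>x. 0 \<le> x \<and> x < h \<longrightarrow> bspline t E q i x = x * R x)"
proof -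
  have m: "t a \<le> t b" if "a \<le> b" for a b using assms(1) that by (auto simp: mono_def)
  have base: "bspline t E 0 i x = (if i = p then 1 else 0)" if "0 \<le> x" "x < h" for i x
  proof -
    consider "i < p" | "i = p" | "i > p" by linarith
    then show ?thesis
    proof cases
      case 1
      then show ?thesis using zero[of i] zero[of "i + 1"] that by auto
    next
      case 2
      then show ?thesis using zero[of i] h that by auto
    next
      case 3
      then show ?thesis using m[of "p + 1" i] h that by auto
    qed
  qed
  show 1: "i + q < p \<Longrightarrow> 0 \<le> x \<Longrightarrow> x < h \<Longrightarrow> bspline t E q i x = 0" for i q x
  proof (induction q arbitrary: i)
    case 0
    then show ?case using base[of x i] by simp
  next
    case (Suc q)
    then show ?case by simp
  qed
  show 2: "i + q = p \<Longrightarrow> 0 \<le> x \<Longrightarrow> x < h \<Longrightarrow> bspline t E q i x = (1 - x / h) ^ q" for i q x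
  proof (induction q arbitrary: i)
    case 0
    then show ?case using base[of x i] by simp
  next
    case (Suc q)
    have "bspline t E q i x = 0" by (rule 1) (use Suc.prems in auto)
    moreover have "bspline t E q (i + 1) x = (1 - x / h) ^ q" by (rule Suc.IH) (use Suc.prems in auto)
    moreover have "t (i + 1) = 0" by (rule zero) (use Suc.prems in auto)
    moreover have "t (i + q + 2) = h" using Suc.prems h by (metis Suc_eq_plus1 add_2_eq_Suc' add_Suc_right)
    ultimately have "bspline t E (Suc q) i x = (h - x) / h * (1 - x / h) ^ q" by simp
    also have "(h - x) / h = 1 - x / h" using h by (simp add: field_simps)
    finally show ?case by simp
  qed
  show "p < i + q \<Longrightarrow> \<exists>R. continuous_on UNIV R \<and> R 0 = (if i + q = p + 1 then q / h else 0)
           \<and> (\<forall>x. 0 \<le> x \<and> x < h \<longrightarrow> bspline t E q i x = x * R x)"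
  proof (induction q arbitrary: i)
    case 0
    then show ?case using base[of _ i] by (intro exI[of _ "\<lambda>x. 0"]) auto
  next
    case (Suc q)
    define d where "d = t (i + q + 1) - t i"
    define e where "e = t (i + q + 2) - t (i + 1)"
    obtain R2 where R2: "continuous_on UNIV R2" "R2 0 = (if i + 1 + q = p + 1 then q / h else 0)"
      "\<And>x. 0 \<le> x \<Longrightarrow> x < h \<Longrightarrow> bspline t E q (i + 1) x = x * R2 x"
      using Suc.IH[of "i + 1"] Suc.prems by auto
    show ?case
    proof (cases "i + q = p")
      case True
      have ti: "t i = 0" "d = h" using True zero[of i] h by (auto simp: d_def)
      \<comment> \<open>For \<open>q > 0\<close> the knot \<open>t (i + 1)\<close> is still 0, so
        the weight at \<open>x = 0\<close> is 1. For \<open>q = 0\<close> that knot is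
        \<open>h\<close> and the weight may differ from 1, but then \<open>R2 0\<close> is
        0.\<close>
      have e1: "t (i + q + 2) / e * R2 0 = q / h"
      proof (cases "q = 0")
        case True
        then show ?thesis using R2(2) by auto
      next
        case False
        then have "t (i + 1) = 0" using True zero[of "i + 1"] by simp
        moreover have "0 < t (i + q + 2)" using m[of "p + 1" "i + q + 2"] True h by simp
        ultimately show ?thesis using R2(2) True by (simp add: e_def)
      qed
      show ?thesis
      proof (intro exI conjI allI impI)
        show "continuous_on UNIV (\<lambda>x. 1 / h * (1 - x / h) ^ q + (t (i + q + 2) - x) / e * R2 x)"
          using R2(1) by (auto simp: divide_inverse intro!: continuous_intros)
        show "1 / h * (1 - 0 / h) ^ q + (t (i + q + 2) - 0) / e * R2 0
          = (if i + Suc q = p + 1 then real (Suc q) / h else 0)"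
          using e1 True by (simp add: add_divide_distrib)
        show "bspline t E (Suc q) i x = x * (1 / h * (1 - x / h) ^ q + (t (i + q + 2) - x) / e * R2 x)"
          if "0 \<le> x \<and> x < h" for x
          using that 2[OF True, of x] R2(3)[of x] ti by (simp add: d_def e_def algebra_simps)
      qed
    next
      case False
      then obtain R1 where R1: "continuous_on UNIV R1" "R1 0 = (if i + q = p + 1 then q / h else 0)"
        "\<And>x. 0 \<le> x \<Longrightarrow> x < h \<Longrightarrow> bspline t E q i x = x * R1 x"
        using Suc.IH[of i] Suc.prems by auto
      \<comment> \<open>Either \<open>R1\<close> vanishes at 0, or \<open>i + q = p + 1\<close> with
        \<open>q > 0\<close>, and then \<open>i <= p\<close> is the index of a zero knot.\<close>
      have e1: "t i * R1 0 = 0"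
      proof (cases "q = 0 \<or> i + q \<noteq> p + 1")
        case True
        then show ?thesis using R1(2) by auto
      next
        case False
        then show ?thesis using zero[of i] by auto
      qed
      have e2: "R2 0 = 0" using R2(2) False Suc.prems by auto
      show ?thesis
      proof (intro exI conjI allI impI)
        show "continuous_on UNIV (\<lambda>x. (x - t i) / d * R1 x + (t (i + q + 2) - x) / e * R2 x)"
          using R2(1) R1(1) by (auto simp: divide_inverse intro!: continuous_intros)
        show "(0 - t i) / d * R1 0 + (t (i + q + 2) - 0) / e * R2 0
          = (if i + Suc q = p + 1 then real (Suc q) / h else 0)"
          using e1 e2 False by auto
        show "bspline t E (Suc q) i x = x * ((x - t i) / d * R1 x + (t (i + q + 2) - x) / e * R2 x)"
          if "0 \<le> x \<and> x < h" for x
          using that R1(3)[of x] R2(3)[of x] by (simp add: d_def e_def algebra_simps)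
      qed
    qed
  qed
qed

section \<open>Radial splines\<close>

locale spline_space =
  fixes D :: spline_data
  assumes open_knots: "open_knots D"
begin

abbreviation "p \<equiv> degr D"
abbreviation "ns \<equiv> nrad D"
abbreviation "L \<equiv> len D"
definition "h = knot D (p + 1)"
definition "\<kappa> = real p / h"

text \<open>\<open>knot D\<close> is unspecified beyond index \<open>ns + p\<close>. Freezing it
  there gives a function that is monotone on all of \<open>nat\<close>, as the general B-spline
  lemmas require.\<close>

definition clamped :: "nat \<Rightarrow> real" where "clamped k = knot D (min k (ns + p))"

lemma p_pos: "1 \<le> p" and L_pos: "0 < L" and p_ns: "p < ns" and nang_pos: "1 \<le> nang D"
  and knot_0: "k \<le> p \<Longrightarrow> knot D k = 0"
  and knot_less: "p \<le> k \<Longrightarrow> k < ns \<Longrightarrow> knot D k < knot D (Suc k)"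
  and knot_L: "ns \<le> k \<Longrightarrow> k \<le> ns + p \<Longrightarrow> knot D k = L"
  using open_knots unfolding open_knots_def by auto

lemma knot_mono1: "k < ns + p \<Longrightarrow> knot D k \<le> knot D (Suc k)"
  using knot_0[of k] knot_0[of "Suc k"] knot_less[of k] knot_L[of k] knot_L[of "Suc k"]
  by (cases "k < p"; cases "k < ns") (auto simp: not_less)

lemma mono_clamped: "mono clamped"
  unfolding mono_iff_le_Suc clamped_def
proof
  fix k
  show "knot D (min k (ns + p)) \<le> knot D (min (Suc k) (ns + p))"
    using knot_mono1[of k] by (cases "k < ns + p") (auto simp: min_def Suc_le_eq)
qed

lemma clamped_eq: "k \<le> ns + p \<Longrightarrow> clamped k = knot D k"
  by (simp add: clamped_def)

lemma bspline_clamped: "i + q + 1 \<le> ns + p \<Longrightarrow> bspline (knot D) E q i x = bspline clamped E q i x"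
  by (rule bspline_cong) (auto simp: clamped_eq)

lemma h_pos: "0 < h" and h_le: "h \<le> L"
proof -
  show "0 < h" using knot_less[of p] knot_0[of p] p_ns by (simp add: h_def)
  have "clamped (p + 1) \<le> clamped ns" using mono_clamped p_ns by (auto simp: mono_def)
  then show "h \<le> L" using p_ns knot_L[of ns] by (simp add: clamped_eq h_def)
qed

lemma \<kappa>_pos: "0 < \<kappa>"
  using p_pos h_pos by (simp add: \<kappa>_def)

lemma clamped_le_L: "clamped k \<le> L"
proof -
  have "clamped k \<le> clamped (max k (ns + p))" using mono_clamped by (auto simp: mono_def)
  also have "\<dots> = L" using knot_L[of "ns + p"] by (simp add: clamped_def)
  finally show ?thesis .
qed

text \<open>This and the next two facts discharge the side conditions of
  \<open>bspline_1_continuous_on\<close> with \<open>E = {L}\<close>: in an open knot vector a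
  repeated knot can only sit at one of the two ends.\<close>

lemma clamped_simple: "clamped (k + 1) < clamped (k + 2) \<Longrightarrow> clamped (k + 1) \<noteq> L"
  using clamped_le_L[of "k + 2"] by simp

lemma clamped_double_left:
  assumes "clamped k = clamped (k + 1)" "clamped (k + 1) < clamped (k + 2)"
  shows "clamped k = 0"
proof (cases "k < p")
  case True
  then show ?thesis using knot_0[of k] by (simp add: clamped_eq)
next
  case False
  have "k < ns"
  proof (rule ccontr)
    assume "\<not> k < ns"
    then have "clamped ns \<le> clamped (k + 1)" using mono_clamped by (auto simp: mono_def)
    then show False using assms clamped_le_L[of "k + 2"] knot_L[of ns] by (simp add: clamped_eq)
  qed
  then show ?thesis using knot_less[of k] False assms by (simp add: clamped_eq)
qed

lemma clamped_double_right:
  assumes "clamped k < clamped (k + 1)" "clamped (k + 1) = clamped (k + 2)"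
  shows "clamped (k + 1) = L"
proof (cases "k + 1 < ns")
  case True
  have "p \<le> k + 1"
  proof (rule ccontr)
    assume "\<not> p \<le> k + 1"
    then show False using knot_0[of k] knot_0[of "k + 1"] assms by (simp add: clamped_eq)
  qed
  then show ?thesis using knot_less[of "k + 1"] True assms p_ns by (simp add: clamped_eq)
next
  case False
  then have "clamped ns \<le> clamped (k + 1)" using mono_clamped by (auto simp: mono_def)
  then show ?thesis using clamped_le_L[of "k + 1"] knot_L[of ns] by (simp add: clamped_eq)
qed

lemma bspline_continuous: "continuous_on {0..L} (bspline clamped {L} (Suc q) i)"
proof (rule bspline_Suc_continuous_on)
  show "continuous_on {0..L} (bspline clamped {L} 1 i)" for i
  proof (rule bspline_1_continuous_on)
    show "clamped i \<le> clamped (i + 1)" "clamped (i + 1) \<le> clamped (i + 2)"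
      using mono_clamped by (auto simp: mono_def)
  next
    assume "clamped i < clamped (i + 1)" "clamped (i + 1) < clamped (i + 2)"
    then show "clamped (i + 1) \<notin> {L}" using clamped_simple by simp
  next
    assume "clamped i = clamped (i + 1)" "clamped (i + 1) < clamped (i + 2)"
    then show "{0..L} \<subseteq> {clamped i..}" using clamped_double_left[of i] by auto
  next
    assume "clamped i < clamped (i + 1)" "clamped (i + 1) = clamped (i + 2)"
    then show "{0..L} \<subseteq> {..clamped (i + 1)} \<and> clamped (i + 1) \<in> {L}"
      using clamped_double_right by simp
  qed
qed (rule order_refl)

section \<open>Continuity and derivatives of the radial splines\<close>

lemma Bs_eq: "i < ns \<Longrightarrow> Bs D i x = bspline clamped {L} p i x"
  unfolding Bs_def by (rule bspline_clamped) simp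

lemma Ms_eq: "i < ns \<Longrightarrow> Ms D i x = real p / (clamped (i + p + 1) - clamped (i + 1)) * bspline clamped {L} (p - 1) (i + 1) x"
  unfolding Ms_def using p_pos
  by (subst bspline_clamped) (auto simp: clamped_eq)

lemma Bs_continuous: "i < ns \<Longrightarrow> continuous_on {0..L} (Bs D i)"
  using bspline_continuous[of "p - 1" i] p_pos
  by (subst continuous_on_cong[OF refl Bs_eq]) auto

lemma Ms_continuous: "2 \<le> p \<Longrightarrow> i < ns \<Longrightarrow> continuous_on {0..L} (Ms D i)"
proof -
  assume p: "2 \<le> p" and i: "i < ns"
  then have "Suc (p - 2) = p - 1" by simp
  then have "continuous_on {0..L} (bspline clamped {L} (p - 1) (i + 1))"
    using bspline_continuous[of "p - 2" "i + 1"] by simp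
  then show ?thesis unfolding Ms_eq[OF i, abs_def] by (intro continuous_on_mult continuous_on_const)
qed

text \<open>The knots \<open>s_{ns}\<close> and \<open>s_{ns+p}\<close> coincide, and division by
  zero supplies the convention \<open>M_{ns-1} = 0\<close>.\<close>

lemma Ms_last: "Ms D (ns - 1) x = 0"
  using knot_L[of ns] knot_L[of "ns + p"] p_ns by (simp add: Ms_def)

lemma Bs_deriv:
  assumes "2 \<le> p" "i < ns" "x \<in> {0..L}"
  shows "(Bs D i has_real_derivative (if i = 0 then 0 else Ms D (i - 1) x) - Ms D i x) (at x within {0..L})"
proof -
  define g where "g x = (if i = 0 then 0 else Ms D (i - 1) x) - Ms D i x" for x
  have "(Bs D i has_real_derivative g x) (at x within {0..L})"
  proof (rule has_real_derivative_within_removable[where S = "clamped ` {i..i + p + 1}"])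
    show "continuous_on {0..L} (Bs D i)" by (rule Bs_continuous) fact
    show "continuous_on {0..L} g"
      unfolding g_def using Ms_continuous[of i] Ms_continuous[of "i - 1"] assms
      by (cases "i = 0") (auto intro!: continuous_intros)
    fix y assume y: "y \<in> {0<..<L} - clamped ` {i..i + p + 1}"
    have pS: "Suc (p - 1) = p" using assms by simp
    have "(bspline clamped {L} (Suc (p - 1)) i has_real_derivative real (Suc (p - 1)) *
       (bspline clamped {L} (p - 1) i y / (clamped (i + (p - 1) + 1) - clamped i)
       - bspline clamped {L} (p - 1) (i + 1) y / (clamped (i + (p - 1) + 2) - clamped (i + 1)))) (at y)"
      by (rule bspline_has_real_derivative[OF mono_clamped]) (use y assms in auto)
    then have "(bspline clamped {L} p i has_real_derivative real p *
       (bspline clamped {L} (p - 1) i y / (clamped (i + p) - clamped i)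
       - bspline clamped {L} (p - 1) (i + 1) y / (clamped (i + p + 1) - clamped (i + 1)))) (at y)"
      using assms by (simp add: pS del: of_nat_Suc)
    also have "real p * (bspline clamped {L} (p - 1) i y / (clamped (i + p) - clamped i)
       - bspline clamped {L} (p - 1) (i + 1) y / (clamped (i + p + 1) - clamped (i + 1))) = g y"
    \<comment> \<open>For \<open>i = 0\<close> the knots \<open>s_0\<close> and \<open>s_p\<close>
      coincide, so the first quotient is 0; this is the convention
      \<open>M_{-1} = 0\<close>.\<close>
    proof (cases "i = 0")
      case True
      then have "clamped (i + p) - clamped i = 0" using knot_0[of 0] knot_0[of p] by (simp add: clamped_eq)
      then show ?thesis using True assms by (simp add: g_def Ms_eq right_diff_distrib)
    next
      case False
      then show ?thesis using assms by (simp add: g_def Ms_eq right_diff_distrib)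
    qed
    finally show "(Bs D i has_real_derivative g y) (at y)"
      using Bs_eq[OF \<open>i < ns\<close>, abs_def] by simp
  qed (use assms in auto)
  then show ?thesis by (simp add: g_def)
qed

section \<open>Radial splines on the first knot span\<close>

lemma clamped_pole: "k \<le> p \<Longrightarrow> clamped k = 0" "clamped (p + 1) = h"
  using p_ns by (simp_all add: clamped_eq knot_0 h_def)

lemmas near_pole = bspline_near_first_knot[OF mono_clamped clamped_pole h_pos]

lemma Bs_0_near_pole: "0 \<le> x \<Longrightarrow> x < h \<Longrightarrow> Bs D 0 x = (1 - x / h) ^ p"
  using p_ns by (simp add: Bs_eq near_pole(2))

lemma Bs_near_pole:
  assumes "0 < i" "i < ns"
  obtains R where "continuous_on UNIV R" "R 0 = (if i = 1 then \<kappa> else 0)"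
    "\<And>x. 0 \<le> x \<Longrightarrow> x < h \<Longrightarrow> Bs D i x = x * R x"
  using near_pole(3)[of i p "{L}"] assms by (auto simp: Bs_eq \<kappa>_def)

lemma Ms_0_near_pole: "0 \<le> x \<Longrightarrow> x < h \<Longrightarrow> Ms D 0 x = \<kappa> * (1 - x / h) ^ (p - 1)"
  using p_ns p_pos clamped_pole(1)[of 1] clamped_pole(2)
  by (simp add: Ms_eq near_pole(2) \<kappa>_def)

lemma Ms_near_pole:
  assumes "0 < i" "i < ns"
  obtains R where "continuous_on UNIV R" "\<And>x. 0 \<le> x \<Longrightarrow> x < h \<Longrightarrow> Ms D i x = x * R x"
proof -
  obtain R where "continuous_on UNIV R" "\<And>x. 0 \<le> x \<Longrightarrow> x < h \<Longrightarrow> bspline clamped {L} (p - 1) (i + 1) x = x * R x"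
    using near_pole(3)[of "i + 1" "p - 1" "{L}"] assms p_pos by auto
  then show ?thesis
    by (intro that[of "\<lambda>x. real p / (clamped (i + p + 1) - clamped (i + 1)) * R x"] continuous_on_mult continuous_on_const)
      (use assms in \<open>auto simp: Ms_eq\<close>)
qed

lemma at_pole: "Bs D 0 0 = 1" "Ms D 0 0 = \<kappa>"
  "0 < i \<Longrightarrow> i < ns \<Longrightarrow> Bs D i 0 = 0" "0 < i \<Longrightarrow> i < ns \<Longrightarrow> Ms D i 0 = 0"
proof -
  show "Bs D 0 0 = 1" using Bs_0_near_pole[of 0] h_pos by simp
  show "Ms D 0 0 = \<kappa>" using Ms_0_near_pole[of 0] h_pos by simp
  show "Bs D i 0 = 0" if "0 < i" "i < ns" by (rule Bs_near_pole[OF that]) (use h_pos in auto)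
  show "Ms D i 0 = 0" if "0 < i" "i < ns" by (rule Ms_near_pole[OF that]) (use h_pos in auto)
qed

text \<open>The degree 0 splines of later spans are zero on \<open>[0, h)\<close>, so in degree 1
  only \<open>B_0\<close>, \<open>B_1\<close> and \<open>M_0\<close> survive there.\<close>

lemma degree_1_near_pole:
  assumes "p = 1" "0 \<le> x" "x < h"
  shows "0 < i \<Longrightarrow> i < ns \<Longrightarrow> Ms D i x = 0" "1 < i \<Longrightarrow> i < ns \<Longrightarrow> Bs D i x = 0" "Bs D 1 x = x / h"
proof -
  have z: "bspline clamped {L} 0 k x = 0" if "1 < k" for k
  proof -
    have "clamped 2 \<le> clamped k" using that mono_clamped by (auto simp: mono_def)
    then have "h \<le> clamped k" using clamped_pole(2) assms by (simp add: numeral_2_eq_2)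
    then show ?thesis using assms by auto
  qed
  show "0 < i \<Longrightarrow> i < ns \<Longrightarrow> Ms D i x = 0" using z[of "i + 1"] assms
    by (simp add: Ms_eq del: bspline.simps)
  show "1 < i \<Longrightarrow> i < ns \<Longrightarrow> Bs D i x = 0" using z[of "i + 1"] z[of i] assms
    by (simp add: Bs_eq bspline.simps(2) del: bspline.simps(1))
  have "bspline clamped {L} 0 1 x = 1" using near_pole(2)[of 1 0 x "{L}"] assms by (simp del: bspline.simps)
  moreover have "clamped 1 = 0" "clamped 2 = h" using clamped_pole assms(1) by (simp_all add: numeral_2_eq_2)
  ultimately show "Bs D 1 x = x / h" using z[of 2] assms p_ns
    by (simp add: Bs_eq bspline.simps(2) numeral_2_eq_2 del: bspline.simps(1))
qed

lemma Ms_measurable [measurable]: "Ms D i \<in> borel_measurable borel"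
  unfolding Ms_def[abs_def] by measurable

lemma Ms_bounded: "\<exists>C. \<forall>x\<in>{0..L}. \<bar>Ms D i x\<bar> \<le> C"
proof -
  obtain C where "\<And>x. \<bar>x\<bar> \<le> L \<Longrightarrow> \<bar>bspline (knot D) {len D} (degr D - 1) (i + 1) x\<bar> \<le> C"
    using bspline_bounded by blast
  then show ?thesis
    unfolding Ms_def abs_mult
    by (intro exI[of _ "\<bar>real (degr D) / (knot D (i + degr D + 1) - knot D (i + 1))\<bar> * C"] ballI mult_left_mono) auto
qed

text \<open>The factor \<open>x\<close> later compensates the Jacobian in a density. Near 0 it comes
  from the factorization in \<open>Ms_near_pole\<close>; beyond \<open>h\<close> a bounded function
  is at most a multiple of \<open>x\<close>, since \<open>x / h >= 1\<close>.\<close>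

lemma Ms_le_linear:
  assumes "0 < i" "i < ns"
  shows "\<exists>C. \<forall>x\<in>{0..L}. \<bar>Ms D i x\<bar> \<le> C * x"
proof -
  obtain R where R: "continuous_on UNIV R" "\<And>x. 0 \<le> x \<Longrightarrow> x < h \<Longrightarrow> Ms D i x = x * R x"
    using Ms_near_pole[OF assms] by blast
  have "compact (R ` {0..h})"
    by (intro compact_continuous_image) (use R(1) in \<open>auto intro: continuous_on_subset\<close>)
  then obtain A where A: "\<And>x. x \<in> {0..h} \<Longrightarrow> \<bar>R x\<bar> \<le> A"
    using compact_imp_bounded by (fastforce simp: bounded_iff)
  obtain C where C: "\<And>x. x \<in> {0..L} \<Longrightarrow> \<bar>Ms D i x\<bar> \<le> C" using Ms_bounded
    by blast
  have C0: "0 \<le> C" using C[of 0] L_pos by auto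
  have A0: "0 \<le> A" using A[of 0] h_pos by auto
  show ?thesis
  proof (intro exI ballI)
    fix x assume x: "x \<in> {0..L}"
    show "\<bar>Ms D i x\<bar> \<le> (A + C / h) * x"
    proof (cases "x < h")
      case True
      have "\<bar>Ms D i x\<bar> = x * \<bar>R x\<bar>" using R(2)[of x] x True by (simp add: abs_mult)
      also have "\<dots> \<le> x * A" using A[of x] x True by (intro mult_left_mono) auto
      also have "\<dots> \<le> (A + C / h) * x" using x C0 h_pos by (simp add: algebra_simps)
      finally show ?thesis .
    next
      case False
      then have "C \<le> C / h * x" using C0 h_pos by (simp add: field_simps mult_left_mono)
      then show ?thesis using C[OF x] A0 x by (simp add: algebra_simps) (smt (verit) mult_nonneg_nonneg)
    qed
  qed
qed

text \<open>Summation by parts in the radial index. There are no boundary terms because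
  \<open>M_{-1}\<close> and, by \<open>Ms_last\<close>, the last \<open>M\<close> are zero.\<close>

lemma sum_Bs_deriv:
  fixes c :: "nat \<Rightarrow> 'a::real_vector"
  shows "(\<Sum>i<ns. ((if i = 0 then 0 else Ms D (i - 1) x) - Ms D i x) *\<^sub>R c i)
    = (\<Sum>i<ns - 1. Ms D i x *\<^sub>R (c (Suc i) - c i))"
proof -
  obtain m where m: "ns = Suc m" using p_ns by (cases ns) auto
  have "(\<Sum>i<ns. ((if i = 0 then 0 else Ms D (i - 1) x) - Ms D i x) *\<^sub>R c i)
    = (\<Sum>i<Suc m. (if i = 0 then 0 else Ms D (i - 1) x) *\<^sub>R c i) - (\<Sum>i<Suc m. Ms D i x *\<^sub>R c i)"
    by (simp add: m scaleR_left_diff_distrib sum_subtractf)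
  also have "(\<Sum>i<Suc m. (if i = 0 then 0 else Ms D (i - 1) x) *\<^sub>R c i) = (\<Sum>i<m. Ms D i x *\<^sub>R c (Suc i))"
    by (subst sum.lessThan_Suc_shift) simp
  also have "(\<Sum>i<Suc m. Ms D i x *\<^sub>R c i) = (\<Sum>i<m. Ms D i x *\<^sub>R c i)"
    using Ms_last[of x] by (simp add: m)
  finally show ?thesis by (simp add: m scaleR_right_diff_distrib sum_subtractf)
qed

end

section \<open>Periodic splines\<close>

lemma periodize_eq_sum:
  assumes supp: "\<And>x. f x \<noteq> 0 \<Longrightarrow> \<bar>x\<bar> \<le> R"
    and K: "R + T \<le> 2 * pi * of_int K" and t: "\<bar>t\<bar> \<le> T"
  shows "periodize f t = (\<Sum>k\<in>{-K..K}. f (t + 2 * pi * of_int k))"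
proof -
  have "f (t + 2 * pi * of_int k) = 0" if "k \<notin> {-K..K}" for k
  proof (rule ccontr)
    assume "f (t + 2 * pi * of_int k) \<noteq> 0"
    then have "\<bar>2 * pi * of_int k\<bar> \<le> R + T" using supp t by fastforce
    moreover have "\<bar>2 * pi * of_int k\<bar> = 2 * pi * \<bar>of_int k\<bar>" by (simp add: abs_mult)
    ultimately have "2 * pi * \<bar>of_int k\<bar> \<le> 2 * pi * of_int K" using K by linarith
    then have "\<bar>real_of_int k\<bar> \<le> of_int K" using mult_le_cancel_left_pos[of "2 * pi"] pi_gt_zero
      by auto
    then have "\<bar>k\<bar> \<le> K" by linarith
    then show False using that by auto
  qed
  then have "infsum (\<lambda>k. f (t + 2 * pi * of_int k)) UNIV = infsum (\<lambda>k. f (t + 2 * pi * of_int k)) {-K..K}"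
    by (intro infsum_cong_neutral) auto
  then show ?thesis by (simp add: periodize_def)
qed

lemma obtain_period_bound:
  obtains K :: int where "X \<le> 2 * pi * of_int K"
proof (rule that[of "\<lceil>X / (2 * pi)\<rceil>"])
  have "X / (2 * pi) \<le> of_int \<lceil>X / (2 * pi)\<rceil>" by linarith
  then show "X \<le> 2 * pi * of_int \<lceil>X / (2 * pi)\<rceil>"
    using pi_gt_zero by (subst (asm) pos_divide_le_eq) (auto simp: mult.commute)
qed

lemma periodize_periodic: "periodize f (t + 2 * pi) = periodize f t"
proof -
  have "(\<Sum>\<^sub>\<infinity>k. f (t + 2 * pi * of_int (k + 1))) = (\<Sum>\<^sub>\<infinity>k. f (t + 2 * pi * of_int k))"
    by (rule infsum_reindex_bij_betw) (rule bij_betw_byWitness[where f' = "\<lambda>k. k - 1"], auto)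
  then show ?thesis by (simp add: periodize_def algebra_simps)
qed

lemma periodize_shift: "periodize (\<lambda>x. f (x - 2 * pi)) t = periodize f t"
  using periodize_periodic[of "\<lambda>x. f (x - 2 * pi)" t] by (simp add: periodize_def algebra_simps)

lemma periodize_continuous:
  assumes supp: "\<And>x. f x \<noteq> 0 \<Longrightarrow> \<bar>x\<bar> \<le> R" and "continuous_on UNIV f"
  shows "continuous_on UNIV (periodize f)"
proof -
  have "continuous_on {-T<..<T} (periodize f)" for T
  proof -
    obtain K :: int where "R + T \<le> 2 * pi * of_int K" by (rule obtain_period_bound)
    note K = periodize_eq_sum[OF supp this]
    have "continuous_on {-T<..<T} (\<lambda>t. \<Sum>k\<in>{-K..K}. f (t + 2 * pi * of_int k))"
      by (intro continuous_on_sum continuous_on_compose2[OF assms(2)]) (auto intro!: continuous_intros)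
    then show ?thesis by (subst continuous_on_cong[OF refl K]) auto
  qed
  then have "isCont (periodize f) t" for t
    by (rule continuous_on_interior[of "{-(\<bar>t\<bar> + 1)<..<\<bar>t\<bar> + 1}"]) (auto simp: interior_open)
  then show ?thesis by (simp add: continuous_at_imp_continuous_on)
qed

lemma periodize_deriv:
  assumes supp: "\<And>x. f x \<noteq> 0 \<Longrightarrow> \<bar>x\<bar> \<le> R"
    and suppg: "\<And>x. g x \<noteq> 0 \<Longrightarrow> \<bar>x\<bar> \<le> R'"
    and "\<And>x. (f has_real_derivative g x) (at x)"
  shows "(periodize f has_real_derivative periodize g t) (at t)"
proof -
  obtain K :: int where K: "max R R' + (\<bar>t\<bar> + 1) \<le> 2 * pi * of_int K"
    by (rule obtain_period_bound)
  have K1: "periodize f s = (\<Sum>k\<in>{-K..K}. f (s + 2 * pi * of_int k))" if "\<bar>s\<bar> \<le> \<bar>t\<bar> + 1" for s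
    by (rule periodize_eq_sum[OF supp _ that]) (use K in auto)
  have K2: "periodize g t = (\<Sum>k\<in>{-K..K}. g (t + 2 * pi * of_int k))"
    by (rule periodize_eq_sum[OF suppg, where T = "\<bar>t\<bar> + 1"]) (use K in auto)
  have "((\<lambda>s. \<Sum>k\<in>{-K..K}. f (s + 2 * pi * of_int k)) has_real_derivative
      (\<Sum>k\<in>{-K..K}. g (t + 2 * pi * of_int k))) (at t)"
    by (intro DERIV_sum DERIV_shift[THEN iffD1] assms(3))
  moreover have "\<forall>\<^sub>F s in nhds t. periodize f s = (\<Sum>k\<in>{-K..K}. f (s + 2 * pi * of_int k))"
  proof -
    have "\<forall>\<^sub>F s in nhds t. s \<in> ball t 1" by (intro eventually_nhds_in_open) auto
    then show ?thesis
    proof eventually_elim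
      case (elim s)
      then have "\<bar>s\<bar> \<le> \<bar>t\<bar> + 1" by (auto simp: dist_real_def)
      then show ?case by (rule K1)
    qed
  qed
  ultimately show ?thesis
    by (subst DERIV_cong_ev[OF refl _ K2]) auto
qed

text \<open>The uniform B-spline with integer knots \<open>0, ..., q + 1\<close>. Every angular
  spline is a scaled translate of it (\<open>bspline_uniform\<close>), so sums over angular indices
  become sums over integer translates.\<close>

primrec cardinal_spline :: "nat \<Rightarrow> real \<Rightarrow> real" where
  "cardinal_spline 0 y = (if 0 \<le> y \<and> y < 1 then 1 else 0)"
| "cardinal_spline (Suc q) y = y / (real q + 1) * cardinal_spline q y
     + (real q + 2 - y) / (real q + 1) * cardinal_spline q (y - 1)"

lemma bspline_uniform:
  assumes "0 < d"
  shows "bspline (\<lambda>k. real k * d) {} q j x = cardinal_spline q (x / d - real j)"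
proof (induction q arbitrary: j)
  case 0
  show ?case using assms by (auto simp: field_simps)
next
  case (Suc q)
  have 1: "(x - real j * d) / (real (j + q + 1) * d - real j * d) = (x / d - real j) / (real q + 1)"
    using assms by (simp add: field_simps)
  have 2: "(real (j + q + 2) * d - x) / (real (j + q + 2) * d - real (j + 1) * d)
    = (real q + 2 - (x / d - real j)) / (real q + 1)"
    using assms by (simp add: field_simps)
  have 3: "x / d - real (j + 1) = x / d - real j - 1" by simp
  show ?case unfolding bspline.simps(2) cardinal_spline.simps(2) Suc 1 2 3 ..
qed

lemma cardinal_spline_eq_0: "y < 0 \<or> real q + 1 \<le> y \<Longrightarrow> cardinal_spline q y = 0"
  by (induction q arbitrary: y) auto

lemma cardinal_spline_nonneg: "0 \<le> cardinal_spline q y"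
proof (induction q arbitrary: y)
  case (Suc q)
  consider "y < 0" | "0 \<le> y" "y \<le> real q + 2" | "real q + 2 < y" by linarith
  then show ?case
  proof cases
    case 2
    then show ?thesis using Suc by simp
  qed (auto simp: cardinal_spline_eq_0)
qed simp

text \<open>At \<open>y\<close> only the translates with index from \<open>floor y - q\<close> to
  \<open>floor y\<close> are active, so every window containing these gives the full sum. After
  shifting the second sum of the recursion by one, the two weights of each translate add up to
  1.\<close>

lemma cardinal_spline_partition:
  fixes a b :: int
  assumes "a \<le> \<lfloor>y\<rfloor> - int q" "\<lfloor>y\<rfloor> \<le> b"
  shows "(\<Sum>m\<in>{a..b}. cardinal_spline q (y - of_int m)) = 1"
  using assms
proof (induction q)
  case 0
  have "(\<Sum>m\<in>{a..b}. cardinal_spline 0 (y - of_int m)) = (\<Sum>m\<in>{a..b}. if m = \<lfloor>y\<rfloor> then 1 else 0)"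
  proof (intro sum.cong refl)
    fix m :: int
    have "(0 \<le> y - of_int m \<and> y - of_int m < 1) = (m = \<lfloor>y\<rfloor>)" by linarith
    then show "cardinal_spline 0 (y - of_int m) = (if m = \<lfloor>y\<rfloor> then 1 else 0)" by simp
  qed
  then show ?case using 0 by simp
next
  case (Suc q)
  let ?c = "\<lambda>m::int. cardinal_spline q (y - of_int m)"
  have ab: "a \<le> b" using Suc.prems by linarith
  have "(\<Sum>m\<in>{a..b}. (real q + 2 - (y - of_int m)) / (real q + 1) * cardinal_spline q (y - of_int m - 1))
    = (\<Sum>m\<in>{a + 1..b + 1}. (real q + 1 - (y - of_int m)) / (real q + 1) * ?c m)"
    by (rule sum.reindex_bij_witness[where i = "\<lambda>m. m - 1" and j = "\<lambda>m. m + 1"])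
      (auto simp: algebra_simps)
  also have "\<dots> = (\<Sum>m\<in>{a..b}. (real q + 1 - (y - of_int m)) / (real q + 1) * ?c m)"
  \<comment> \<open>The shift moves the window by one; the translates at its two ends are inactive
    at \<open>y\<close>.\<close>
  proof (rule sum.mono_neutral_cong)
    fix m assume "m \<in> {a + 1..b + 1} - {a..b}"
    then have "y - of_int m < 0" using ab Suc.prems by auto linarith
    then show "(real q + 1 - (y - of_int m)) / (real q + 1) * ?c m = 0" by (simp add: cardinal_spline_eq_0)
  next
    fix m assume "m \<in> {a..b} - {a + 1..b + 1}"
    then have "m = a" by auto
    then have "real q + 1 \<le> y - of_int m" using Suc.prems by linarith
    then show "(real q + 1 - (y - of_int m)) / (real q + 1) * ?c m = 0" by (simp add: cardinal_spline_eq_0)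
  qed auto
  finally have "(\<Sum>m\<in>{a..b}. cardinal_spline (Suc q) (y - of_int m))
    = (\<Sum>m\<in>{a..b}. (y - of_int m) / (real q + 1) * ?c m) + (\<Sum>m\<in>{a..b}. (real q + 1 - (y - of_int m)) / (real q + 1) * ?c m)"
    by (simp add: sum.distrib)
  also have "\<dots> = (\<Sum>m\<in>{a..b}. ?c m)"
    unfolding sum.distrib[symmetric]
    by (intro sum.cong refl) (simp add: add_divide_distrib[symmetric] distrib_right[symmetric])
  also have "\<dots> = 1" using Suc by simp
  finally show ?case .
qed

lemma cardinal_spline_piecewise_poly:
  "\<exists>P :: real poly. \<forall>y. of_int m \<le> y \<and> y < of_int m + 1 \<longrightarrow> cardinal_spline q y = poly P y"
proof (induction q arbitrary: m)
  case 0
  show ?case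
  proof (cases "m = 0")
    case True
    then show ?thesis by (intro exI[of _ 1]) auto
  next
    case False
    have "cardinal_spline 0 y = 0" if "of_int m \<le> y" "y < of_int m + 1" for y
    proof -
      have "y < 0 \<or> 1 \<le> y"
      proof (cases "m < 0")
        case True
        then have "m + 1 \<le> 0" by simp
        then have "of_int m + (1::real) \<le> 0" by linarith
        then show ?thesis using that by linarith
      next
        case f: False
        then have "1 \<le> m" using False by simp
        then have "(1::real) \<le> of_int m" by linarith
        then show ?thesis using that by linarith
      qed
      then show ?thesis by auto
    qed
    then show ?thesis by (intro exI[of _ 0]) auto
  qed
next
  case (Suc q)
  obtain P where P: "\<And>y. of_int m \<le> y \<Longrightarrow> y < of_int m + 1 \<Longrightarrow> cardinal_spline q y = poly P y"
    using Suc by blast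
  obtain Q where Q: "\<And>y. of_int (m - 1) \<le> y \<Longrightarrow> y < of_int (m - 1) + 1 \<Longrightarrow> cardinal_spline q y = poly Q y"
    using Suc by blast
  show ?case
  proof (intro exI allI impI)
    fix y :: real assume y: "of_int m \<le> y \<and> y < of_int m + 1"
    show "cardinal_spline (Suc q) y = poly (smult (1 / (real q + 1)) ([:0, 1:] * P)
        + smult (1 / (real q + 1)) ([:real q + 2, -1:] * pcompose Q [:-1, 1:])) y"
      using P[of y] Q[of "y - 1"] y by (simp add: poly_pcompose left_diff_distrib distrib_right)
  qed
qed

text \<open>Differentiation lowers the degree of the polynomial but only rotates the pair
  \<open>(g1, g2)\<close>, so the claim reduces to a constant polynomial. Then the first and second
  derivative of the trigonometric side vanish, and the sum of their squares is
  \<open>g1^2 + g2^2\<close>.\<close>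

lemma poly_eq_trig:
  fixes P :: "real poly"
  assumes "\<And>t. t \<in> {a<..<b} \<Longrightarrow> poly P t = g1 * cos t + g2 * sin t" "a < b"
  shows "g1 = 0 \<and> g2 = 0"
  using assms(1)
proof (induction "degree P" arbitrary: P g1 g2 rule: less_induct)
  case less
  have d: "poly (pderiv Q) t = h2 * cos t + (- h1) * sin t"
    if Q: "\<And>t. t \<in> {a<..<b} \<Longrightarrow> poly Q t = h1 * cos t + h2 * sin t"
      and t: "t \<in> {a<..<b}" for Q :: "real poly" and h1 h2 t
  proof (rule DERIV_unique)
    show "(poly Q has_real_derivative poly (pderiv Q) t) (at t)" by (rule poly_DERIV)
    have "((\<lambda>t. h1 * cos t + h2 * sin t) has_real_derivative h2 * cos t + (- h1) * sin t) (at t)"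
      by (auto intro!: derivative_eq_intros)
    then show "(poly Q has_real_derivative h2 * cos t + (- h1) * sin t) (at t)"
      by (rule has_field_derivative_transform_within_open[OF _ _ t]) (use Q in auto)
  qed
  show ?case
  proof (cases "degree P = 0")
    case True
    then have z: "pderiv P = 0" by (simp add: pderiv_eq_0_iff)
    obtain t where t: "t \<in> {a<..<b}" using dense[OF assms(2)] by auto
    have 1: "h2 * cos t + (- h1) * sin t = 0" if "\<And>s. s \<in> {a<..<b} \<Longrightarrow> poly P s = h1 * cos s + h2 * sin s" for h1 h2
      using d[OF that t] z by simp
    have e1: "g2 * cos t - g1 * sin t = 0" using 1[OF less.prems] by simp
    have "poly 0 s = g2 * cos s + (- g1) * sin s" if "s \<in> {a<..<b}" for s
      using d[OF less.prems that] z by simp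
    from d[OF this t] have e2: "g1 * cos t + g2 * sin t = 0" by simp
    have sc: "(cos t)\<^sup>2 + (sin t)\<^sup>2 = 1" by simp
    have "x\<^sup>2 + z\<^sup>2 = 1 \<Longrightarrow> g1\<^sup>2 + g2\<^sup>2 = (g2 * x - g1 * z)\<^sup>2 + (g1 * x + g2 * z)\<^sup>2" for x z
      by algebra
    from this[OF sc] have "g1\<^sup>2 + g2\<^sup>2 = (g2 * cos t - g1 * sin t)\<^sup>2 + (g1 * cos t + g2 * sin t)\<^sup>2" .
    also have "\<dots> = 0" unfolding e1 e2 by simp
    finally show ?thesis by (simp add: sum_power2_eq_zero_iff)
  next
    case False
    then have "degree (pderiv P) < degree P" by (simp add: degree_pderiv)
    from less.hyps[OF this, of g2 "- g1"] d[OF less.prems] show ?thesis by auto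
  qed
qed

context spline_space
begin

abbreviation "n \<equiv> nang D"
definition "\<delta> = 2 * pi / real n"

abbreviation "angular q j \<equiv> bspline (angle D) {} q j"

section \<open>Angular splines: support, smoothness and periodicity\<close>

lemma n_pos: "0 < n" using nang_pos by simp
lemma \<delta>_pos: "0 < \<delta>" using n_pos by (simp add: \<delta>_def)
lemma n_\<delta>: "real n * \<delta> = 2 * pi" using n_pos by (simp add: \<delta>_def)

lemma angle_eq: "angle D = (\<lambda>j. real j * \<delta>)"
  by (simp add: fun_eq_iff angle_def \<delta>_def)

lemma angular_eq: "angular q j x = cardinal_spline q (x / \<delta> - real j)"
  unfolding angle_eq by (rule bspline_uniform[OF \<delta>_pos])

lemma mono_angle: "mono (angle D)"
  unfolding angle_eq using \<delta>_pos by (auto simp: mono_def)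

lemma angular_support: "angular q j x \<noteq> 0 \<Longrightarrow> \<bar>x\<bar> \<le> real (j + q + 1) * \<delta>"
proof -
  assume "angular q j x \<noteq> 0"
  then have "angle D j \<le> x" "x \<le> angle D (j + q + 1)"
    using bspline_eq_0[OF mono_angle, of x j q "{}"] by force+
  moreover have "0 \<le> angle D j" using \<delta>_pos by (simp add: angle_eq)
  ultimately show ?thesis by (simp add: angle_eq)
qed

lemma angular_continuous: "continuous_on S (angular (Suc q) j)"
proof (rule bspline_Suc_continuous_on[OF _ order_refl])
  have l: "angle D k < angle D (k + 1)" for k using \<delta>_pos by (simp add: angle_eq)
  show "continuous_on S (angular 1 k)" for k
    by (rule bspline_1_continuous_on) (use l[of k] l[of "k + 1"] in auto)
qed

text \<open>For \<open>q >= 1\<close> the right-hand side is continuous, so the removable-point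
  lemma on \<open>[x - 1, x + 1]\<close> gives the derivative also when \<open>x\<close> is a
  knot.\<close>

lemma angular_deriv:
  assumes "1 \<le> q"
  shows "(angular (Suc q) j has_real_derivative (angular q j x - angular q (j + 1) x) / \<delta>) (at x)"
proof -
  define g where "g x = (angular q j x - angular q (j + 1) x) / \<delta>" for x
  have q: "Suc (q - 1) = q" using assms by simp
  have "(angular (Suc q) j has_real_derivative g x) (at x within {x - 1..x + 1})"
  proof (rule has_real_derivative_within_removable[where S = "angle D ` {j..j + q + 2}"])
    show "continuous_on {x - 1..x + 1} (angular (Suc q) j)" by (rule angular_continuous)
    show "continuous_on {x - 1..x + 1} g"
      unfolding g_def using angular_continuous[of _ "q - 1"] \<delta>_pos unfolding q
      by (auto intro!: continuous_intros)
    fix y assume "y \<in> {x - 1<..<x + 1} - angle D ` {j..j + q + 2}"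
    then have "(angular (Suc q) j has_real_derivative
       real (Suc q) * (angular q j y / (angle D (j + q + 1) - angle D j)
       - angular q (j + 1) y / (angle D (j + q + 2) - angle D (j + 1)))) (at y)"
      by (intro bspline_has_real_derivative[OF mono_angle]) auto
    moreover have "angle D (j + q + 1) - angle D j = real (Suc q) * \<delta>"
      "angle D (j + q + 2) - angle D (j + 1) = real (Suc q) * \<delta>"
      by (simp_all add: angle_eq algebra_simps)
    moreover have "real (Suc q) * (u / (real (Suc q) * \<delta>) - v / (real (Suc q) * \<delta>)) = (u - v) / \<delta>" for u v
      using \<delta>_pos by (simp add: right_diff_distrib diff_divide_distrib)
    ultimately show "(angular (Suc q) j has_real_derivative g y) (at y)" unfolding g_def by metis
  qed auto
  then have "(angular (Suc q) j has_real_derivative g x) (at x)"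
    by (subst (asm) at_within_interior) (auto simp: interior_atLeastAtMost_real)
  then show ?thesis by (simp add: g_def)
qed

lemma Bt_eq: "Bt D j = periodize (angular p j)"
  by (simp add: Bt_def)

lemma Mt_eq: "Mt D j t = periodize (angular (p - 1) (j + 1)) t / \<delta>"
  by (simp add: Mt_def \<delta>_def)

lemma Bt_periodic: "Bt D j (t + 2 * pi) = Bt D j t"
  by (simp add: Bt_eq periodize_periodic)

lemma Mt_periodic: "Mt D j (t + 2 * pi) = Mt D j t"
  by (simp add: Mt_eq periodize_periodic)

lemma Bt_continuous: "continuous_on UNIV (Bt D j)"
proof -
  have "continuous_on UNIV (angular p j)" using angular_continuous[of UNIV "p - 1" j] p_pos by simp
  then show ?thesis unfolding Bt_eq by (rule periodize_continuous[OF angular_support, rotated])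
qed

lemma Mt_continuous: "2 \<le> p \<Longrightarrow> continuous_on UNIV (Mt D j)"
proof -
  assume "2 \<le> p"
  then have "Suc (p - 2) = p - 1" by simp
  then have "continuous_on UNIV (angular (p - 1) (j + 1))" using angular_continuous[of UNIV "p - 2" "j + 1"]
    by simp
  then have "continuous_on UNIV (periodize (angular (p - 1) (j + 1)))"
    by (rule periodize_continuous[OF angular_support, rotated])
  then show ?thesis unfolding Mt_eq[abs_def] using \<delta>_pos by (auto intro!: continuous_intros)
qed

text \<open>Moving the index by \<open>n\<close> translates by a full turn. This closes the index
  cycle in \<open>Bt_deriv\<close>, where the predecessor of \<open>j = 0\<close> is the last
  index.\<close>

lemma angular_shift: "periodize (angular q (j + n)) t = periodize (angular q j) t"
proof -
  have "angular q (j + n) = (\<lambda>x. angular q j (x - 2 * pi))"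
    using \<delta>_pos n_\<delta>
    by (simp add: angular_eq fun_eq_iff diff_divide_distrib eq_divide_eq[symmetric] algebra_simps)
      (simp add: field_simps)
  then show ?thesis by (simp add: periodize_shift)
qed

lemma periodize_lincomb:
  assumes "\<And>x. f x \<noteq> 0 \<Longrightarrow> \<bar>x\<bar> \<le> R" "\<And>x. g x \<noteq> 0 \<Longrightarrow> \<bar>x\<bar> \<le> R"
  shows "periodize (\<lambda>x. (f x - g x) / d) t = (periodize f t - periodize g t) / d"
proof -
  obtain K :: int where K: "R + \<bar>t\<bar> \<le> 2 * pi * of_int K" by (rule obtain_period_bound)
  have 1: "periodize f t = (\<Sum>k\<in>{-K..K}. f (t + 2 * pi * of_int k))"
    by (rule periodize_eq_sum[OF assms(1) K order_refl])
  have 2: "periodize g t = (\<Sum>k\<in>{-K..K}. g (t + 2 * pi * of_int k))"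
    by (rule periodize_eq_sum[OF assms(2) K order_refl])
  have "periodize (\<lambda>x. (f x - g x) / d) t = (\<Sum>k\<in>{-K..K}. (f (t + 2 * pi * of_int k) - g (t + 2 * pi * of_int k)) / d)"
    by (rule periodize_eq_sum[OF _ K order_refl]) (metis assms diff_self div_0)
  then show ?thesis unfolding 1 2 by (simp only: sum_subtractf[symmetric] sum_divide_distrib)
qed

lemma Bt_deriv:
  assumes "2 \<le> p" "j < n"
  shows "(Bt D j has_real_derivative Mt D ((j + n - 1) mod n) t - Mt D j t) (at t)"
proof -
  let ?R = "real (j + 1 + (p - 1) + 1) * \<delta>"
  have pS: "Suc (p - 1) = p" using assms by simp
  have s1: "\<bar>x\<bar> \<le> ?R" if "angular (p - 1) j x \<noteq> 0" for x
    using angular_support[OF that] \<delta>_pos by (simp add: algebra_simps)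
  have s2: "\<bar>x\<bar> \<le> ?R" if "angular (p - 1) (j + 1) x \<noteq> 0" for x
    using angular_support[OF that] by simp
  have d: "(angular p j has_real_derivative (angular (p - 1) j x - angular (p - 1) (j + 1) x) / \<delta>) (at x)" for x
    using angular_deriv[of "p - 1" j x] assms unfolding pS by simp
  have "(Bt D j has_real_derivative periodize (\<lambda>x. (angular (p - 1) j x - angular (p - 1) (j + 1) x) / \<delta>) t) (at t)"
    unfolding Bt_eq
    by (rule periodize_deriv[where R = "real (j + p + 1) * \<delta>" and R' = ?R, OF angular_support _ d], assumption)
      (use s1 s2 in \<open>metis diff_self div_0\<close>)
  also have "periodize (\<lambda>x. (angular (p - 1) j x - angular (p - 1) (j + 1) x) / \<delta>) t
    = periodize (angular (p - 1) j) t / \<delta> - Mt D j t"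
    unfolding Mt_eq diff_divide_distrib[symmetric] by (rule periodize_lincomb[OF s1 s2])
  also have "periodize (angular (p - 1) j) t / \<delta> = Mt D ((j + n - 1) mod n) t"
  proof (cases "j = 0")
    case True
    then show ?thesis using angular_shift[of "p - 1" 0 t] n_pos by (simp add: Mt_eq)
  next
    case False
    then have "(j + n - 1) mod n = j - 1" using assms
      by (metis Nat.diff_add_assoc2 One_nat_def Suc_leI bot_nat_0.not_eq_extremum less_imp_diff_less mod_add_self2 mod_less)
    then show ?thesis using False by (simp add: Mt_eq)
  qed
  finally show ?thesis .
qed

text \<open>Cyclic summation by parts: predecessor and successor modulo \<open>n\<close> are inverse
  bijections, so there are no boundary terms.\<close>

lemma sum_Bt_deriv:
  fixes c :: "nat \<Rightarrow> 'a::real_vector"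
  shows "(\<Sum>j<n. (Mt D ((j + n - 1) mod n) t - Mt D j t) *\<^sub>R c j) = (\<Sum>j<n. Mt D j t *\<^sub>R (c (Suc j mod n) - c j))"
proof -
  have "(\<Sum>j<n. Mt D ((j + n - 1) mod n) t *\<^sub>R c j) = (\<Sum>j<n. Mt D j t *\<^sub>R c (Suc j mod n))"
  proof (rule sum.reindex_bij_witness[where i = "\<lambda>j. Suc j mod n"
    and j = "\<lambda>j. (j + n - 1) mod n"])
    fix j assume "j \<in> {..<n}"
    then have j: "j < n" by simp
    have "Suc ((j + n - 1) mod n) mod n = Suc (j + n - 1) mod n" by (simp add: mod_Suc_eq)
    then show a: "Suc ((j + n - 1) mod n) mod n = j" using j n_pos by simp
    show "(j + n - 1) mod n \<in> {..<n}" using n_pos by simp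
    show "Mt D ((j + n - 1) mod n) t *\<^sub>R c (Suc ((j + n - 1) mod n) mod n) = Mt D ((j + n - 1) mod n) t *\<^sub>R c j"
      unfolding a ..
  next
    fix j assume "j \<in> {..<n}"
    then have j: "j < n" by simp
    show "Suc j mod n \<in> {..<n}" using n_pos by simp
    show "(Suc j mod n + n - 1) mod n = j"
      using j by (cases "Suc j = n") auto
  qed
  then show ?thesis by (simp add: scaleR_left_diff_distrib scaleR_right_diff_distrib sum_subtractf)
qed

text \<open>Adding a full turn to \<open>t\<close> lowers the index of a cardinal translate by
  \<open>n\<close>, so periodization collects exactly one residue class. The offset \<open>r\<close>
  is 0 for \<open>Bt\<close> and 1 for \<open>Mt\<close>, whose knots start one step later.\<close>

lemma periodize_angular_residue:
  assumes "j < n" "a \<le> \<lfloor>t / \<delta>\<rfloor> - int r - int q" "\<lfloor>t / \<delta>\<rfloor> - int r \<le> b"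
  shows "periodize (angular q (j + r)) t
    = (\<Sum>m\<in>{m\<in>{a..b}. m mod int n = int j}. cardinal_spline q (t / \<delta> - real r - of_int m))"
proof -
  let ?f = "\<lambda>m::int. cardinal_spline q (t / \<delta> - real r - of_int m)"
  have "bij_betw (\<lambda>k. int j - int n * k) UNIV {m. m mod int n = int j}"
  proof (rule bij_betw_byWitness[where f' = "\<lambda>m. - (m div int n)"])
    show "\<forall>k\<in>UNIV. - ((int j - int n * k) div int n) = k"
    proof
      fix k
      have "(int j - int n * k) div int n = (int j + int n * (- k)) div int n" by simp
      also have "\<dots> = - k" using assms(1) by (subst div_mult_self2) auto
      finally show "- ((int j - int n * k) div int n) = k" by simp
    qed
    show "\<forall>m\<in>{m. m mod int n = int j}. int j - int n * - (m div int n) = m"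
    proof clarsimp
      fix m assume "m mod int n = int j"
      then show "int j + int n * (m div int n) = m" using mod_mult_div_eq[of m "int n"] by simp
    qed
    show "(\<lambda>k. int j - int n * k) ` UNIV \<subseteq> {m. m mod int n = int j}"
    proof clarsimp
      fix k
      have "(int j - int n * k) mod int n = (int j + int n * (- k)) mod int n" by simp
      also have "\<dots> = int j" using assms(1) by (subst mod_mult_self2) auto
      finally show "(int j - int n * k) mod int n = int j" .
    qed
  qed auto
  then have "(\<Sum>\<^sub>\<infinity>k. ?f (int j - int n * k)) = (\<Sum>\<^sub>\<infinity>m\<in>{m. m mod int n = int j}. ?f m)"
    by (rule infsum_reindex_bij_betw)
  also have "\<dots> = (\<Sum>\<^sub>\<infinity>m\<in>{m\<in>{a..b}. m mod int n = int j}. ?f m)"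
  proof (rule infsum_cong_neutral)
    fix m assume "m \<in> {m. m mod int n = int j} - {m\<in>{a..b}. m mod int n = int j}"
    then have "m < a \<or> b < m" by auto
    then have "t / \<delta> - real r - of_int m < 0 \<or> real q + 1 \<le> t / \<delta> - real r - of_int m"
      using assms(2,3) by linarith
    then show "?f m = 0" by (rule cardinal_spline_eq_0)
  qed auto
  also have "\<dots> = (\<Sum>m\<in>{m\<in>{a..b}. m mod int n = int j}. ?f m)"
    by (rule infsum_finite) (rule finite_subset[of _ "{a..b}"], auto)
  finally have *: "(\<Sum>\<^sub>\<infinity>k. ?f (int j - int n * k)) = (\<Sum>m\<in>{m\<in>{a..b}. m mod int n = int j}. ?f m)" .
  have "angular q (j + r) (t + 2 * pi * of_int k) = ?f (int j - int n * k)" for k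
  proof -
    have "2 * pi * real_of_int k / \<delta> = real n * real_of_int k" unfolding n_\<delta>[symmetric]
      using \<delta>_pos by simp
    then have "(t + 2 * pi * of_int k) / \<delta> = t / \<delta> + real n * of_int k"
      by (simp add: add_divide_distrib)
    then show ?thesis unfolding angular_eq by (simp add: algebra_simps)
  qed
  then show ?thesis using * by (simp add: periodize_def)
qed

text \<open>Grouping the active integer translates by residue modulo \<open>n\<close> undoes the
  periodization. The coefficients form an \<open>n\<close>-periodic function on the integers, so
  that a window crossing the angle 0 needs no special treatment.\<close>

lemma angular_lincomb:
  fixes c :: "int \<Rightarrow> real"
  assumes "a \<le> \<lfloor>t / \<delta>\<rfloor> - int r - int q" "\<lfloor>t / \<delta>\<rfloor> - int r \<le> b" "\<And>m. c (m mod int n) = c m"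
  shows "(\<Sum>j<n. c (int j) * periodize (angular q (j + r)) t)
    = (\<Sum>m\<in>{a..b}. c m * cardinal_spline q (t / \<delta> - real r - of_int m))"
proof -
  let ?f = "\<lambda>m::int. cardinal_spline q (t / \<delta> - real r - of_int m)"
  have "(\<Sum>j<n. c (int j) * periodize (angular q (j + r)) t)
    = (\<Sum>j<n. \<Sum>m\<in>{m\<in>{a..b}. nat (m mod int n) = j}. c m * ?f m)"
  proof (intro sum.cong refl)
    fix j assume "j \<in> {..<n}"
    then have j: "j < n" by simp
    have s: "{m\<in>{a..b}. m mod int n = int j} = {m\<in>{a..b}. nat (m mod int n) = j}" using n_pos by auto
    have "c (int j) * periodize (angular q (j + r)) t
      = (\<Sum>m\<in>{m\<in>{a..b}. m mod int n = int j}. c (int j) * ?f m)"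
      unfolding periodize_angular_residue[OF j assms(1,2)] by (rule sum_distrib_left)
    also have "\<dots> = (\<Sum>m\<in>{m\<in>{a..b}. m mod int n = int j}. c m * ?f m)"
    proof (intro sum.cong refl)
      fix m assume "m \<in> {m\<in>{a..b}. m mod int n = int j}"
      then have "c (int j) = c m" using assms(3)[of m] by simp
      then show "c (int j) * ?f m = c m * ?f m" by simp
    qed
    finally show "c (int j) * periodize (angular q (j + r)) t
      = (\<Sum>m\<in>{m\<in>{a..b}. nat (m mod int n) = j}. c m * ?f m)" unfolding s .
  qed
  also have "\<dots> = (\<Sum>m\<in>{a..b}. c m * ?f m)"
  proof (rule sum.group)
    show "(\<lambda>m. nat (m mod int n)) ` {a..b} \<subseteq> {..<n}" using n_pos
      by (auto simp: nat_less_iff)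
  qed auto
  finally show ?thesis .
qed

lemma Bt_partition: "(\<Sum>j<n. Bt D j t) = 1"
proof -
  have "(\<Sum>j<n. 1 * periodize (angular p (j + 0)) t)
    = (\<Sum>m\<in>{\<lfloor>t / \<delta>\<rfloor> - int p..\<lfloor>t / \<delta>\<rfloor>}. 1 * cardinal_spline p (t / \<delta> - real 0 - of_int m))"
    by (rule angular_lincomb[where c = "\<lambda>_. 1"]) auto
  also have "\<dots> = 1" using cardinal_spline_partition[of _ "t / \<delta>" p] by simp
  finally show ?thesis by (simp add: Bt_eq)
qed

text \<open>The interval runs from \<open>t0\<close> to the next knot on its right and contains
  \<open>t0\<close>, as knot spans are closed on the left. One \<open>\<epsilon>\<close> serves all
  indices \<open>j\<close> because all angular splines have their knots at multiples of
  \<open>\<delta>\<close>.\<close>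

lemma angular_piecewise_poly:
  obtains \<epsilon> and P :: "nat \<Rightarrow> real poly" where "0 < \<epsilon>"
    "\<And>j t. t0 \<le> t \<Longrightarrow> t < t0 + \<epsilon> \<Longrightarrow> periodize (angular q j) t = poly (P j) t"
proof -
  define m where "m = \<lfloor>t0 / \<delta>\<rfloor>"
  define \<epsilon> where "\<epsilon> = (of_int m + 1) * \<delta> - t0"
  have "t0 / \<delta> < of_int m + 1" unfolding m_def by linarith
  then have eps: "0 < \<epsilon>" using \<delta>_pos by (simp add: \<epsilon>_def field_simps)
  have "\<exists>P :: real poly. \<forall>t. t0 \<le> t \<and> t < t0 + \<epsilon> \<longrightarrow> periodize (angular q j) t = poly P t" for j
  proof -
    obtain K :: int
      where "real (j + q + 1) * \<delta> + (\<bar>t0\<bar> + \<epsilon>) \<le> 2 * pi * of_int K"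
        by (rule obtain_period_bound)
    note K = periodize_eq_sum[OF angular_support this]
    have "\<forall>k. \<exists>P :: real poly. \<forall>y. of_int (m + int n * k - int j) \<le> y \<and> y < of_int (m + int n * k - int j) + 1
        \<longrightarrow> cardinal_spline q y = poly P y"
      using cardinal_spline_piecewise_poly by blast
    then obtain P :: "int \<Rightarrow> real poly"
      where P: "\<And>k y. of_int (m + int n * k - int j) \<le> y \<Longrightarrow> y < of_int (m + int n * k - int j) + 1
        \<Longrightarrow> cardinal_spline q y = poly (P k) y" by metis
    show ?thesis
    proof (intro exI allI impI)
      fix t assume t: "t0 \<le> t \<and> t < t0 + \<epsilon>"
      have "t0 / \<delta> \<le> t / \<delta>" using t \<delta>_pos by (simp add: divide_right_mono)
      then have y1: "of_int m \<le> t / \<delta>" unfolding m_def by linarith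
      have y2: "t / \<delta> < of_int m + 1" using t \<delta>_pos by (simp add: \<epsilon>_def field_simps)
      have "periodize (angular q j) t = (\<Sum>k\<in>{-K..K}. angular q j (t + 2 * pi * of_int k))"
        by (rule K) (use t in auto)
      also have "\<dots> = (\<Sum>k\<in>{-K..K}. poly (pcompose (P k) [:real n * of_int k - real j, 1 / \<delta>:]) t)"
      proof (intro sum.cong refl)
        fix k :: int
        have "2 * pi * real_of_int k / \<delta> = real n * real_of_int k" unfolding n_\<delta>[symmetric]
          using \<delta>_pos by simp
        then have e: "(t + 2 * pi * of_int k) / \<delta> - real j = t / \<delta> + real n * of_int k - real j"
          by (simp add: add_divide_distrib)
        show "angular q j (t + 2 * pi * of_int k) = poly (pcompose (P k) [:real n * of_int k - real j, 1 / \<delta>:]) t"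
          unfolding angular_eq e using P[of k "t / \<delta> + real n * of_int k - real j"] y1 y2
          by (simp add: poly_pcompose algebra_simps)
      qed
      also have "\<dots> = poly (\<Sum>k\<in>{-K..K}. pcompose (P k) [:real n * of_int k - real j, 1 / \<delta>:]) t"
        by (simp add: poly_sum)
      finally show "periodize (angular q j) t = poly (\<Sum>k\<in>{-K..K}. pcompose (P k) [:real n * of_int k - real j, 1 / \<delta>:]) t" .
    qed
  qed
  then show ?thesis using that[OF eps] by metis
qed


text \<open>One-sided in order to cover degree 0, where the splines jump at knots. It lets a nonzero
  value at one angle persist on an interval of angles.\<close>

lemma angular_right_continuous: "((\<lambda>t. periodize (angular q j) t) \<longlongrightarrow> periodize (angular q j) t0) (at_right t0)"
proof -
  obtain \<epsilon> and P :: "nat \<Rightarrow> real poly" where "0 < \<epsilon>"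
    and P: "\<And>j t. t0 \<le> t \<Longrightarrow> t < t0 + \<epsilon> \<Longrightarrow> periodize (angular q j) t = poly (P j) t"
    using angular_piecewise_poly[of t0 q] by blast
  have "\<forall>\<^sub>F t in at_right t0. periodize (angular q j) t = poly (P j) t"
    using eventually_at_right_real[of t0 "t0 + \<epsilon>"] \<open>0 < \<epsilon>\<close> P
    by (auto elim!: eventually_mono)
  moreover have "(poly (P j) \<longlongrightarrow> poly (P j) t0) (at_right t0)"
    by (metis isCont_def poly_isCont filterlim_at_split)
  ultimately show ?thesis using P[of t0 j] \<open>0 < \<epsilon>\<close> by (auto simp: tendsto_cong)
qed

lemma Bt_lincomb_trig:
  assumes "\<And>t. (\<Sum>j<n. c j * Bt D j t) = g1 * cos t + g2 * sin t"
  shows "g1 = 0 \<and> g2 = 0"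
proof -
  obtain \<epsilon> and P :: "nat \<Rightarrow> real poly" where "0 < \<epsilon>"
    and P: "\<And>j t. 0 \<le> t \<Longrightarrow> t < 0 + \<epsilon> \<Longrightarrow> periodize (angular p j) t = poly (P j) t"
    using angular_piecewise_poly[of 0 p] by blast
  have "poly (\<Sum>j<n. smult (c j) (P j)) t = g1 * cos t + g2 * sin t" if "t \<in> {0<..<\<epsilon>}" for t
    using assms[of t] P[of t] that by (simp add: poly_sum Bt_eq)
  then show ?thesis using poly_eq_trig \<open>0 < \<epsilon>\<close> by blast
qed

section \<open>The closed spline curve of the first control ring\<close>

lemma trig_angle_mod:
  "cos (of_int (m mod int n) * \<delta>) = cos (of_int m * \<delta>)" "sin (of_int (m mod int n) * \<delta>) = sin (of_int m * \<delta>)"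
proof -
  have "of_int m = of_int (m mod int n) + real n * real_of_int (m div int n)"
    by (metis mod_mult_div_eq of_int_add of_int_mult of_int_of_nat_eq)
  then have "of_int m * \<delta> = of_int (m mod int n) * \<delta> + real n * \<delta> * real_of_int (m div int n)"
    by (metis distrib_right mult.assoc mult.commute)
  then have e: "of_int m * \<delta> = of_int (m mod int n) * \<delta> + 2 * pi * real_of_int (m div int n)"
    unfolding n_\<delta> .
  have "sin (2 * pi * real_of_int k) = 0" "cos (2 * pi * real_of_int k) = 1" for k
    using sin_int_2pin[of k] cos_int_2pin[of k] by simp_all
  then show "cos (of_int (m mod int n) * \<delta>) = cos (of_int m * \<delta>)" "sin (of_int (m mod int n) * \<delta>) = sin (of_int m * \<delta>)"
    unfolding e cos_add sin_add by simp_all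
qed

lemma trig_angle_Suc_mod:
  "cos (angle D (Suc j mod n)) = cos (angle D (Suc j))" "sin (angle D (Suc j mod n)) = sin (angle D (Suc j))"
  using trig_angle_mod[of "int (Suc j)"] by (simp_all add: angle_eq zmod_int[symmetric] del: of_nat_Suc)

text \<open>\<open>(cosB, sinB)\<close> is the closed spline curve with \<open>n\<close> equally
  spaced control points on the unit circle. \<open>(cosM, sinM)\<close> has the edges of the control
  polygon as coefficients and is the derivative of that curve for degree at least 2.\<close>

definition "cosB t = (\<Sum>j<n. cos (angle D j) * Bt D j t)"
definition "sinB t = (\<Sum>j<n. sin (angle D j) * Bt D j t)"
definition "cosM t = (\<Sum>j<n. (cos (angle D (Suc j mod n)) - cos (angle D j)) * Mt D j t)"
definition "sinM t = (\<Sum>j<n. (sin (angle D (Suc j mod n)) - sin (angle D j)) * Mt D j t)"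

lemma trigB_window:
  assumes "a \<le> \<lfloor>t / \<delta>\<rfloor> - int p" "\<lfloor>t / \<delta>\<rfloor> \<le> b"
  shows "cosB t = (\<Sum>m\<in>{a..b}. cos (of_int m * \<delta>) * cardinal_spline p (t / \<delta> - of_int m))"
    "sinB t = (\<Sum>m\<in>{a..b}. sin (of_int m * \<delta>) * cardinal_spline p (t / \<delta> - of_int m))"
proof -
  show "cosB t = (\<Sum>m\<in>{a..b}. cos (of_int m * \<delta>) * cardinal_spline p (t / \<delta> - of_int m))"
    using angular_lincomb[of a t 0 p b "\<lambda>m. cos (of_int m * \<delta>)"] assms
    by (simp add: cosB_def Bt_eq angle_eq trig_angle_mod)
  show "sinB t = (\<Sum>m\<in>{a..b}. sin (of_int m * \<delta>) * cardinal_spline p (t / \<delta> - of_int m))"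
    using angular_lincomb[of a t 0 p b "\<lambda>m. sin (of_int m * \<delta>)"] assms
    by (simp add: sinB_def Bt_eq angle_eq trig_angle_mod)
qed

text \<open>The factor \<open>\<delta>\<close> clears the normalization of \<open>Mt\<close>. The
  window may end one index earlier than for \<open>cosB\<close>, because \<open>Mt D j\<close>
  begins at knot \<open>j + 1\<close>.\<close>

lemma trigM_window:
  assumes "a \<le> \<lfloor>t / \<delta>\<rfloor> - int p" "\<lfloor>t / \<delta>\<rfloor> \<le> b + 1"
  shows "\<delta> * cosM t = (\<Sum>m\<in>{a..b}. (cos ((of_int m + 1) * \<delta>) - cos (of_int m * \<delta>)) * cardinal_spline (p - 1) (t / \<delta> - 1 - of_int m))"
    "\<delta> * sinM t = (\<Sum>m\<in>{a..b}. (sin ((of_int m + 1) * \<delta>) - sin (of_int m * \<delta>)) * cardinal_spline (p - 1) (t / \<delta> - 1 - of_int m))"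
proof -
  have e: "\<delta> * (x * (y / \<delta>)) = x * y" for x y using \<delta>_pos by simp
  have m: "cos ((of_int (m mod int n) + 1) * \<delta>) = cos ((of_int m + 1) * \<delta>)"
    "sin ((of_int (m mod int n) + 1) * \<delta>) = sin ((of_int m + 1) * \<delta>)" for m
    unfolding distrib_right cos_add sin_add trig_angle_mod by simp_all
  show "\<delta> * cosM t = (\<Sum>m\<in>{a..b}. (cos ((of_int m + 1) * \<delta>) - cos (of_int m * \<delta>)) * cardinal_spline (p - 1) (t / \<delta> - 1 - of_int m))"
    unfolding cosM_def Mt_eq sum_distrib_left e trig_angle_Suc_mod
    using angular_lincomb[of a t 1 "p - 1" b "\<lambda>m. cos ((of_int m + 1) * \<delta>) - cos (of_int m * \<delta>)"] assms p_pos
      m trig_angle_mod by (simp add: angle_eq add.commute)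
  show "\<delta> * sinM t = (\<Sum>m\<in>{a..b}. (sin ((of_int m + 1) * \<delta>) - sin (of_int m * \<delta>)) * cardinal_spline (p - 1) (t / \<delta> - 1 - of_int m))"
    unfolding sinM_def Mt_eq sum_distrib_left e trig_angle_Suc_mod
    using angular_lincomb[of a t 1 "p - 1" b "\<lambda>m. sin ((of_int m + 1) * \<delta>) - sin (of_int m * \<delta>)"] assms p_pos
      m trig_angle_mod by (simp add: angle_eq add.commute)
qed

text \<open>
  The control polygon is traversed counterclockwise, and all control points that are active at a
  given angle lie within a quarter turn of each other because \<open>p \<le> n / 4\<close>.
\<close>

lemma trigB_wronskian_pos:
  assumes "4 * p \<le> n"
  shows "0 < cosB t * sinM t - sinB t * cosM t"
proof -
  define y where "y = t / \<delta>"
  define A where "A = {\<lfloor>y\<rfloor> - int p..\<lfloor>y\<rfloor>}"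
  define A' where "A' = {\<lfloor>y\<rfloor> - int p..\<lfloor>y\<rfloor> - 1}"
  define f where "f m = cardinal_spline p (y - of_int m)" for m :: int
  define g where "g m = cardinal_spline (p - 1) (y - 1 - of_int m)" for m :: int
  \<comment> \<open>The cross product of control point \<open>a\<close> with polygon edge
    \<open>b\<close> is \<open>2 sin(\<delta>/2) cos((b - a + 1/2) \<delta>)\<close>. For active
    indices \<open>b - a + 1/2\<close> has absolute value at most \<open>p - 1/2\<close>, and
    \<open>\<mu>\<close> is the value at that extreme; it is positive because
    \<open>p \<delta> <= pi / 2\<close>.\<close>
  define \<mu> where "\<mu> = 2 * sin (\<delta> / 2) * cos ((real p - 1 / 2) * \<delta>)"
  have pd: "real p * \<delta> \<le> pi / 2"
  proof -
    have "4 * (real p * \<delta>) \<le> real n * \<delta>" using assms \<delta>_pos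
      by (metis (mono_tags, lifting) mult.assoc mult_right_mono less_imp_le of_nat_le_iff of_nat_mult of_nat_numeral)
    then show ?thesis unfolding n_\<delta> by linarith
  qed
  have d2: "\<delta> \<le> pi / 2" using pd p_pos \<delta>_pos
    by (smt (verit) mult_le_cancel_right1 of_nat_1 of_nat_le_iff)
  have half: "(real p - 1 / 2) * \<delta> < pi / 2" "0 \<le> (real p - 1 / 2) * \<delta>"
    using pd \<delta>_pos p_pos by (auto simp: left_diff_distrib)
  have mu: "0 < \<mu>" unfolding \<mu>_def
    using half \<delta>_pos d2 pi_gt_zero by (intro mult_pos_pos cos_gt_zero_pi sin_gt_zero) auto
  have bound: "\<mu> \<le> cos (of_int a * \<delta>) * (sin ((of_int b + 1) * \<delta>) - sin (of_int b * \<delta>))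
      - sin (of_int a * \<delta>) * (cos ((of_int b + 1) * \<delta>) - cos (of_int b * \<delta>))"
    if "a \<in> A" "b \<in> A'" for a b :: int
  proof -
    define x where "x = \<bar>of_int b - of_int a + 1 / 2\<bar> * \<delta>"
    have "\<bar>2 * b - 2 * a + 1\<bar> \<le> 2 * int p - 1" using that by (auto simp: A_def A'_def)
    then have "\<bar>of_int b - of_int a + 1 / 2\<bar> \<le> real p - 1 / 2" by linarith
    then have x: "0 \<le> x" "x \<le> (real p - 1 / 2) * \<delta>" using \<delta>_pos
      by (auto simp: x_def intro: mult_right_mono)
    have "cos ((real p - 1 / 2) * \<delta>) \<le> cos x"
      by (rule cos_monotone_0_pi_le) (use x half pi_gt_zero in linarith)+
    also have "cos x = cos ((of_int b - of_int a + 1 / 2) * \<delta>)"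
      using cos_abs_real[of "(of_int b - of_int a + 1 / 2) * \<delta>"] \<delta>_pos
      by (simp add: x_def abs_mult)
    finally have "\<mu> \<le> 2 * sin (\<delta> / 2) * cos ((of_int b - of_int a + 1 / 2) * \<delta>)"
      unfolding \<mu>_def using d2 \<delta>_pos pi_gt_zero
      by (intro mult_left_mono) (auto intro!: sin_ge_zero)
    also have "\<dots> = sin ((of_int b + 1) * \<delta> - of_int a * \<delta>) - sin (of_int b * \<delta> - of_int a * \<delta>)"
      unfolding sin_diff_sin by (simp add: field_simps)
    also have "\<dots> = cos (of_int a * \<delta>) * (sin ((of_int b + 1) * \<delta>) - sin (of_int b * \<delta>))
      - sin (of_int a * \<delta>) * (cos ((of_int b + 1) * \<delta>) - cos (of_int b * \<delta>))"
      unfolding sin_diff by (simp add: algebra_simps)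
    finally show ?thesis .
  qed
  have f0: "0 \<le> f m" and g0: "0 \<le> g m" for m by (simp_all add: f_def g_def cardinal_spline_nonneg)
  have f1: "(\<Sum>m\<in>A. f m) = 1" unfolding f_def A_def by (rule cardinal_spline_partition) auto
  have g1: "(\<Sum>m\<in>A'. g m) = 1" unfolding g_def A'_def
    by (rule cardinal_spline_partition) (use p_pos in \<open>auto simp: of_nat_diff\<close>)
  have C: "cosB t = (\<Sum>m\<in>A. cos (of_int m * \<delta>) * f m)" "sinB t = (\<Sum>m\<in>A. sin (of_int m * \<delta>) * f m)"
    using trigB_window[of "\<lfloor>y\<rfloor> - int p" t "\<lfloor>y\<rfloor>"]
    by (simp_all add: A_def f_def y_def)
  have S: "\<delta> * cosM t = (\<Sum>m\<in>A'. (cos ((of_int m + 1) * \<delta>) - cos (of_int m * \<delta>)) * g m)"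
    "\<delta> * sinM t = (\<Sum>m\<in>A'. (sin ((of_int m + 1) * \<delta>) - sin (of_int m * \<delta>)) * g m)"
    using trigM_window[of "\<lfloor>y\<rfloor> - int p" t "\<lfloor>y\<rfloor> - 1"]
    by (simp_all add: A'_def g_def y_def)
  \<comment> \<open>Both families of weights are nonnegative with sum 1, so the bilinear expression
    is an average of the cross products and keeps their lower bound.\<close>
  have "\<mu> = (\<Sum>a\<in>A. \<Sum>b\<in>A'. \<mu> * (f a * g b))"
    unfolding sum_distrib_left[symmetric] sum_product[symmetric] using f1 g1 by simp
  also have "\<dots> \<le> (\<Sum>a\<in>A. \<Sum>b\<in>A'. (cos (of_int a * \<delta>) * (sin ((of_int b + 1) * \<delta>) - sin (of_int b * \<delta>))
      - sin (of_int a * \<delta>) * (cos ((of_int b + 1) * \<delta>) - cos (of_int b * \<delta>))) * (f a * g b))"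
    by (intro sum_mono mult_right_mono bound mult_nonneg_nonneg f0 g0)
  also have "\<dots> = cosB t * (\<delta> * sinM t) - sinB t * (\<delta> * cosM t)"
    unfolding C S sum_product sum_subtractf[symmetric] by (intro sum.cong refl) (simp add: algebra_simps)
  also have "\<dots> = \<delta> * (cosB t * sinM t - sinB t * cosM t)" by (simp add: algebra_simps)
  finally have "0 < \<delta> * (cosB t * sinM t - sinB t * cosM t)" using mu by linarith
  then show ?thesis using \<delta>_pos by (simp add: zero_less_mult_iff)
qed

text \<open>In degree 1 the curve is piecewise linear. The hat function of index 1 peaks at
  \<open>2 * \<delta>\<close>, where the slopes on the two sides are
  \<open>sin \<delta> / \<delta>\<close> and
  \<open>(sin (2 \<delta>) - sin \<delta>) / \<delta>\<close>. They agree only if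
  \<open>cos \<delta> = 1\<close>, which \<open>n >= 4\<close> excludes.\<close>

lemma sinB_corner:
  assumes "p = 1" "4 \<le> n"
  shows "\<not> sinB differentiable at (2 * \<delta>)"
proof
  assume "sinB differentiable at (2 * \<delta>)"
  then obtain d where d: "(sinB has_real_derivative d) (at (2 * \<delta>))" using real_differentiable_def
    by blast
  have win: "sinB t = (\<Sum>m\<in>{0..2}. sin (of_int m * \<delta>) * cardinal_spline 1 (t / \<delta> - of_int m))"
    if "1 \<le> t / \<delta>" "t / \<delta> < 3" for t
    using trigB_window(2)[of 0 t 2] that assms by (simp add: le_floor_iff floor_le_iff)
  have s3: "{0..2} = {0::int, 1, 2}" by auto
  have l: "sinB t = sin \<delta> / \<delta> * (t - 2 * \<delta>) + sin \<delta>" if "t \<in> {\<delta>..2 * \<delta>}" for t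
  proof (cases "t = 2 * \<delta>")
    case True
    then show ?thesis using win[of t] \<delta>_pos by (simp add: s3)
  next
    case False
    then have "1 \<le> t / \<delta>" "t / \<delta> < 2" using that \<delta>_pos by (auto simp: field_simps)
    then show ?thesis using win[of t] \<delta>_pos by (simp add: s3) (simp add: field_simps)
  qed
  have r: "sinB t = (sin (2 * \<delta>) - sin \<delta>) / \<delta> * (t - 2 * \<delta>) + sin \<delta>" if "t \<in> {2 * \<delta>..5 / 2 * \<delta>}" for t
  proof -
    have y: "2 \<le> t / \<delta>" "t / \<delta> < 3" using that \<delta>_pos by (auto simp: field_simps)
    then have "sinB t = sin \<delta> * (2 - (t / \<delta> - 1)) + sin (2 * \<delta>) * (t / \<delta> - 2)"
      using win[of t] by (simp add: s3)
    also have "\<dots> = (sin (2 * \<delta>) - sin \<delta>) * (t / \<delta> - 2) + sin \<delta>"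
      by (simp add: algebra_simps)
    also have "t / \<delta> - 2 = (t - 2 * \<delta>) / \<delta>" using \<delta>_pos by (simp add: field_simps)
    finally show ?thesis by simp
  qed
  have aff: "((\<lambda>t. k * (t - 2 * \<delta>) + sin \<delta>) has_real_derivative k) (at (2 * \<delta>) within S)" for k S
    by (auto intro!: derivative_eq_intros)
  have "(sinB has_real_derivative sin \<delta> / \<delta>) (at (2 * \<delta>) within {\<delta>..2 * \<delta>})"
    unfolding has_field_derivative_def
    by (rule has_derivative_transform[OF _ l aff[unfolded has_field_derivative_def]]) (use \<delta>_pos in auto)
  moreover have "(sinB has_real_derivative d) (at (2 * \<delta>) within {\<delta>..2 * \<delta>})"
    using d by (rule has_field_derivative_at_within)
  moreover have "at (2 * \<delta>) within {\<delta>..2 * \<delta>} \<noteq> bot"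
    using \<delta>_pos by (simp add: at_within_Icc_at_left)
  ultimately have d1: "d = sin \<delta> / \<delta>" using has_field_derivative_unique by blast
  have "(sinB has_real_derivative (sin (2 * \<delta>) - sin \<delta>) / \<delta>) (at (2 * \<delta>) within {2 * \<delta>..5 / 2 * \<delta>})"
    unfolding has_field_derivative_def
    by (rule has_derivative_transform[OF _ r aff[unfolded has_field_derivative_def]]) (use \<delta>_pos in auto)
  moreover have "(sinB has_real_derivative d) (at (2 * \<delta>) within {2 * \<delta>..5 / 2 * \<delta>})"
    using d by (rule has_field_derivative_at_within)
  moreover have "at (2 * \<delta>) within {2 * \<delta>..5 / 2 * \<delta>} \<noteq> bot"
    using \<delta>_pos by (simp add: at_within_Icc_at_right)
  ultimately have "d = (sin (2 * \<delta>) - sin \<delta>) / \<delta>" using has_field_derivative_unique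
    by blast
  then have "sin (2 * \<delta>) = 2 * sin \<delta>" using d1 \<delta>_pos by (simp add: field_simps)
  then have "2 * sin \<delta> * cos \<delta> = 2 * sin \<delta>" by (simp add: sin_double)
  moreover have d2: "\<delta> \<le> pi / 2"
  proof -
    have "4 * \<delta> \<le> real n * \<delta>" using assms \<delta>_pos by (intro mult_right_mono) auto
    then show ?thesis unfolding n_\<delta> by simp
  qed
  moreover have "0 < sin \<delta>" by (rule sin_gt_zero) (use \<delta>_pos d2 pi_gt_zero in linarith)+
  ultimately have "cos \<delta> = 1" by simp
  moreover have "cos \<delta> < cos 0"
    by (rule cos_monotone_0_pi) (use \<delta>_pos d2 pi_gt_zero in linarith)+
  ultimately show False by simp
qed

end

section \<open>Integration in the plane\<close>

abbreviation (input) pt :: "real \<Rightarrow> real \<Rightarrow> real^2"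
  where "pt s t \<equiv> vector [s, t]"

lemma pt_nth [simp]: "pt s t $ 1 = s" "pt s t $ 2 = t"
  by (simp_all add: vector_2)

lemma pt_eta [simp]: "pt (z $ 1) (z $ 2) = z"
  by (simp add: vec_eq_iff forall_2)

lemma pt_eq_iff [simp]: "pt s t = pt s' t' \<longleftrightarrow> s = s' \<and> t = t'"
  by (simp add: vec_eq_iff forall_2)

lemma vec2_eq_iff: "z = (w :: real^2) \<longleftrightarrow> z $ 1 = w $ 1 \<and> z $ 2 = w $ 2"
  by (simp add: vec_eq_iff forall_2)

lemma pt_eq_axis: "pt s t = s *\<^sub>R axis 1 1 + t *\<^sub>R axis 2 1"
  by (simp add: vec_eq_iff forall_2 axis_def)

lemma inner_vec2: "v \<bullet> w = v $ 1 * w $ 1 + v $ 2 * w $ 2" for v w :: "real^2"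
  by (simp add: inner_vec_def sum_2)

lemma continuous_on_pt [continuous_intros]:
  "continuous_on S f \<Longrightarrow> continuous_on S g \<Longrightarrow> continuous_on S (\<lambda>x. pt (f x) (g x))"
  unfolding pt_eq_axis by (intro continuous_intros)

lemma has_derivative_pt:
  "(f has_derivative f') F \<Longrightarrow> (g has_derivative g') F \<Longrightarrow>
    ((\<lambda>x. pt (f x) (g x)) has_derivative (\<lambda>h. pt (f' h) (g' h))) F"
  unfolding pt_eq_axis by (auto intro!: derivative_eq_intros)

lemma Basis_vec2: "(Basis :: (real^2) set) = {axis 1 1, axis 2 1}"
  unfolding Basis_vec_def by (auto simp: UNIV_2)

lemma cbox_pt: "cbox (pt a c) (pt b d) = {z. a \<le> z $ 1 \<and> z $ 1 \<le> b \<and> c \<le> z $ 2 \<and> z $ 2 \<le> d}"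
  by (auto simp: mem_box_cart forall_2)

lemma box_pt: "box (pt a c) (pt b d) = {z. a < z $ 1 \<and> z $ 1 < b \<and> c < z $ 2 \<and> z $ 2 < d}"
  by (auto simp: mem_box_cart forall_2)

lemma pt_measurable [measurable]: "(\<lambda>(s, t). pt s t) \<in> borel_measurable borel"
  by (rule borel_measurable_continuous_onI) (auto simp: case_prod_beta intro!: continuous_intros)

text \<open>Comparison on boxes identifies Lebesgue measure on \<open>real^2\<close> with the
  product measure, which opens Fubini's theorem to the coordinates \<open>(s, t)\<close>.\<close>

lemma distr_pt: "distr lborel borel (\<lambda>(s, t). pt s t) = lborel"
proof (rule lborel_eqI[symmetric])
  fix l u :: "real^2" assume lu: "\<And>b. b \<in> Basis \<Longrightarrow> l \<bullet> b \<le> u \<bullet> b"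
  have lu12: "l $ 1 \<le> u $ 1" "l $ 2 \<le> u $ 2"
    using lu[of "axis 1 1"] lu[of "axis 2 1"] by (auto simp: Basis_vec2 inner_axis)
  have "(\<lambda>(s, t). pt s t) -` box l u \<inter> space lborel = box (l $ 1, l $ 2) (u $ 1, u $ 2)"
    by (auto simp: mem_box Basis_vec2 Basis_prod_def inner_axis)
  then have "emeasure (distr lborel borel (\<lambda>(s, t). pt s t)) (box l u)
    = emeasure lborel (box (l $ 1, l $ 2) (u $ 1, u $ 2))"
    by (subst emeasure_distr) auto
  also have "\<dots> = ennreal ((u $ 1 - l $ 1) * (u $ 2 - l $ 2))"
    using lu12 by (subst emeasure_lborel_box) (auto simp: Basis_prod_def)
  also have "(u $ 1 - l $ 1) * (u $ 2 - l $ 2) = (\<Prod>b\<in>Basis. (u - l) \<bullet> b)"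
    by (simp add: Basis_vec2 axis_eq_axis inner_axis)
  finally show "emeasure (distr lborel borel (\<lambda>(s, t). pt s t)) (box l u) = (\<Prod>b\<in>Basis. (u - l) \<bullet> b)"
    by simp
qed simp

lemma integral_lborel_pt:
  fixes f :: "real^2 \<Rightarrow> real"
  assumes "integrable lborel f"
  shows "integrable (lborel \<Otimes>\<^sub>M lborel) (\<lambda>(s, t). f (pt s t))"
    "(\<integral>s. \<integral>t. f (pt s t) \<partial>lborel \<partial>lborel) = integral\<^sup>L lborel f"
    "(\<integral>t. \<integral>s. f (pt s t) \<partial>lborel \<partial>lborel) = integral\<^sup>L lborel f"
proof -
  have [measurable]: "f \<in> borel_measurable borel" using borel_measurable_integrable[OF assms] by simp
  have "integrable (distr lborel borel (\<lambda>(s, t). pt s t)) f" using assms by (simp add: distr_pt)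
  then have 1: "integrable lborel (\<lambda>(s, t). f (pt s t))"
    by (subst (asm) integrable_distr_eq) (use pt_measurable in \<open>auto simp: case_prod_unfold\<close>)
  then show i: "integrable (lborel \<Otimes>\<^sub>M lborel) (\<lambda>(s, t). f (pt s t))"
    by (simp add: lborel_prod)
  have "integral\<^sup>L lborel f = integral\<^sup>L (distr lborel borel (\<lambda>(s, t). pt s t)) f"
    by (simp add: distr_pt)
  also have "\<dots> = (\<integral>x. f (case x of (s, t) \<Rightarrow> pt s t) \<partial>lborel)"
    by (rule integral_distr) auto
  finally have 2: "integral\<^sup>L lborel f = (\<integral>(s, t). f (pt s t) \<partial>(lborel \<Otimes>\<^sub>M lborel))"
    by (simp add: case_prod_unfold lborel_prod)
  show "(\<integral>s. \<integral>t. f (pt s t) \<partial>lborel \<partial>lborel) = integral\<^sup>L lborel f"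
    unfolding 2 by (rule lborel_pair.integral_fst[OF i])
  show "(\<integral>t. \<integral>s. f (pt s t) \<partial>lborel \<partial>lborel) = integral\<^sup>L lborel f"
    unfolding 2 by (rule lborel_pair.integral_snd[OF i])
qed

lemma integral_cbox_pt:
  fixes f :: "real^2 \<Rightarrow> real"
  assumes "continuous_on (cbox (pt a c) (pt b d)) f"
  shows "integral (cbox (pt a c) (pt b d)) f
      = (\<integral>s. indicator {a..b} s *\<^sub>R (\<integral>t. indicator {c..d} t *\<^sub>R f (pt s t) \<partial>lborel) \<partial>lborel)"
    "integral (cbox (pt a c) (pt b d)) f
      = (\<integral>t. indicator {c..d} t *\<^sub>R (\<integral>s. indicator {a..b} s *\<^sub>R f (pt s t) \<partial>lborel) \<partial>lborel)"
proof -
  let ?Q = "cbox (pt a c) (pt b d)"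
  have i: "integrable lborel (\<lambda>z. indicator ?Q z *\<^sub>R f z)"
    by (rule borel_integrable_compact) (use assms in auto)
  then have "integral ?Q f = (\<integral>z. indicator ?Q z *\<^sub>R f z \<partial>lborel)"
    using set_borel_integral_eq_integral(2)[of ?Q f]
    by (simp add: set_integrable_def set_lebesgue_integral_def)
  moreover have "indicator ?Q (pt s t) = (indicator {a..b} s * indicator {c..d} t :: real)" for s t
    by (auto simp: cbox_pt indicator_def)
  ultimately show "integral ?Q f
      = (\<integral>s. indicator {a..b} s *\<^sub>R (\<integral>t. indicator {c..d} t *\<^sub>R f (pt s t) \<partial>lborel) \<partial>lborel)"
    "integral ?Q f = (\<integral>t. indicator {c..d} t *\<^sub>R (\<integral>s. indicator {a..b} s *\<^sub>R f (pt s t) \<partial>lborel) \<partial>lborel)"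
    using integral_lborel_pt(2,3)[OF i]
    by (simp_all add: mult.assoc mult.left_commute flip: Bochner_Integration.integral_mult_right_zero)
qed

text \<open>Integrate first in the differentiated variable. In the chart, equality of the two
  boundary values comes from periodicity in the angle; the companion for the first variable is used
  with boundary values that vanish.\<close>

lemma integral_cbox_deriv_2:
  fixes g g' :: "real^2 \<Rightarrow> real"
  assumes "c \<le> d" and cont: "continuous_on (cbox (pt a c) (pt b d)) g'"
    and der: "\<And>s t. s \<in> {a..b} \<Longrightarrow> t \<in> {c..d} \<Longrightarrow> ((\<lambda>t. g (pt s t)) has_real_derivative g' (pt s t)) (at t within {c..d})"
    and bd: "\<And>s. s \<in> {a..b} \<Longrightarrow> g (pt s c) = g (pt s d)"
  shows "integral (cbox (pt a c) (pt b d)) g' = 0"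
proof -
  have "(\<integral>t. indicator {c..d} t *\<^sub>R g' (pt s t) \<partial>lborel) = 0" if s: "s \<in> {a..b}" for s
  proof -
    have "continuous_on {c..d} (\<lambda>t. g' (pt s t))"
      by (rule continuous_on_compose2[OF cont]) (use s in \<open>auto simp: cbox_pt intro!: continuous_intros\<close>)
    then have "(\<integral>t. indicator {c..d} t *\<^sub>R g' (pt s t) \<partial>lborel) = g (pt s d) - g (pt s c)"
      using der[OF s]
      by (intro integral_FTC_Icc assms) (auto simp: has_real_derivative_iff_has_vector_derivative[symmetric])
    then show ?thesis using bd[OF s] by simp
  qed
  then have *: "indicator {a..b} s *\<^sub>R (\<integral>t. indicator {c..d} t *\<^sub>R g' (pt s t) \<partial>lborel) = 0" for s
    by (cases "s \<in> {a..b}") auto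
  show ?thesis unfolding integral_cbox_pt(1)[OF cont] * by simp
qed

lemma integral_cbox_deriv_1:
  fixes g g' :: "real^2 \<Rightarrow> real"
  assumes "a \<le> b" and cont: "continuous_on (cbox (pt a c) (pt b d)) g'"
    and der: "\<And>s t. s \<in> {a..b} \<Longrightarrow> t \<in> {c..d} \<Longrightarrow> ((\<lambda>s. g (pt s t)) has_real_derivative g' (pt s t)) (at s within {a..b})"
    and bd: "\<And>t. t \<in> {c..d} \<Longrightarrow> g (pt a t) = g (pt b t)"
  shows "integral (cbox (pt a c) (pt b d)) g' = 0"
proof -
  have "(\<integral>s. indicator {a..b} s *\<^sub>R g' (pt s t) \<partial>lborel) = 0" if t: "t \<in> {c..d}" for t
  proof -
    have "continuous_on {a..b} (\<lambda>s. g' (pt s t))"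
      by (rule continuous_on_compose2[OF cont]) (use t in \<open>auto simp: cbox_pt intro!: continuous_intros\<close>)
    then have "(\<integral>s. indicator {a..b} s *\<^sub>R g' (pt s t) \<partial>lborel) = g (pt b t) - g (pt a t)"
      using der[OF _ t]
      by (intro integral_FTC_Icc assms) (auto simp: has_real_derivative_iff_has_vector_derivative[symmetric])
    then show ?thesis using bd[OF t] by simp
  qed
  then have *: "indicator {c..d} t *\<^sub>R (\<integral>s. indicator {a..b} s *\<^sub>R g' (pt s t) \<partial>lborel) = 0" for t
    by (cases "t \<in> {c..d}") auto
  show ?thesis unfolding integral_cbox_pt(2)[OF cont] * by simp
qed

text \<open>Fubini reduces the claim to the logarithmic divergence of \<open>1 / s\<close> at
  0.\<close>

lemma inverse_not_integrable_box:
  assumes "0 < e" "a < b"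
  shows "\<not> (\<lambda>z::real^2. 1 / z $ 1) absolutely_integrable_on box (pt 0 a) (pt e b)"
proof
  let ?B = "box (pt 0 a) (pt e b)"
  assume "(\<lambda>z::real^2. 1 / z $ 1) absolutely_integrable_on ?B"
  then have "integrable lebesgue (\<lambda>z. indicator ?B z *\<^sub>R (1 / z $ 1))"
    by (simp add: set_integrable_def)
  then have "integrable lborel (\<lambda>z. indicator ?B z *\<^sub>R (1 / z $ 1))"
    by (subst (asm) integrable_completion) measurable
  then have "integrable (lborel \<Otimes>\<^sub>M lborel) (\<lambda>(s, t). indicator ?B (pt s t) *\<^sub>R (1 / pt s t $ 1))"
    by (rule integral_lborel_pt(1))
  then have "integrable lborel (\<lambda>s. \<integral>t. indicator ?B (pt s t) *\<^sub>R (1 / pt s t $ 1) \<partial>lborel)"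
    using lborel_pair.integrable_fst'[of "\<lambda>(s, t). indicator ?B (pt s t) *\<^sub>R (1 / pt s t $ 1)"]
    by simp
  moreover have *: "(\<integral>t. indicator ?B (pt s t) *\<^sub>R (1 / pt s t $ 1) \<partial>lborel) = (b - a) * (indicator {0<..<e} s * (1 / s))" for s
  proof -
    have "indicator ?B (pt s t) = (indicator {0<..<e} s * indicator {a<..<b} t :: real)" for t
      by (auto simp: box_pt indicator_def)
    then have "(\<integral>t. indicator ?B (pt s t) *\<^sub>R (1 / pt s t $ 1) \<partial>lborel)
      = (\<integral>t. (indicator {0<..<e} s * (1 / s)) * indicator {a<..<b} t \<partial>lborel)"
      by (simp add: mult_ac)
    also have "\<dots> = (indicator {0<..<e} s * (1 / s)) * (b - a)"
      using assms by (subst Bochner_Integration.integral_mult_right_zero) simp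
    finally show ?thesis by (simp only: mult.commute)
  qed
  ultimately have "integrable lborel (\<lambda>s. (b - a) * (indicator {0<..<e} s * (1 / s)))"
    unfolding * by simp
  from integrable_mult_right[OF this, of "1 / (b - a)"] have "set_integrable lborel {0<..<e} (\<lambda>s. 1 / s)"
    using assms by (simp add: set_integrable_def)
  then have int: "(\<lambda>s::real. 1 / s) integrable_on {0<..<e}"
    by (rule set_borel_integral_eq_integral(1))
  define I where "I = integral {0<..<e} (\<lambda>s::real. 1 / s)"
  define r where "r = e / 2"
  \<comment> \<open>Chosen so that \<open>ln r - ln \<eta>\<close> is at least
    \<open>|I| + 1\<close>, more than the supposed integral \<open>I\<close>; the bound by
    \<open>r / 2\<close> keeps \<open>\<eta>\<close> below \<open>r\<close>.\<close>
  define \<eta> where "\<eta> = min (r / 2) (exp (ln r - \<bar>I\<bar> - 1))"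
  have r: "0 < r" "r < e" using assms by (auto simp: r_def)
  have eta: "0 < \<eta>" "\<eta> < r" using r by (auto simp: \<eta>_def min_def)
  have "((\<lambda>s::real. 1 / s) has_integral (ln r - ln \<eta>)) {\<eta>..r}"
    by (rule fundamental_theorem_of_calculus)
      (use eta in \<open>auto simp: has_real_derivative_iff_has_vector_derivative[symmetric] intro!: derivative_eq_intros\<close>)
  then have "ln r - ln \<eta> \<le> I"
    unfolding I_def using int r eta
    by (intro has_integral_subset_le[OF _ _ integrable_integral]) auto
  moreover have "ln \<eta> \<le> ln (exp (ln r - \<bar>I\<bar> - 1))"
    by (rule ln_mono) (use eta in \<open>auto simp: \<eta>_def\<close>)
  ultimately show False by simp
qed

text \<open>The change of variables for vector-valued integrands, read through
  \<open>real^1\<close>.\<close>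

lemma has_absolute_integral_change_of_variables_real:
  fixes f :: "real^2 \<Rightarrow> real" and g :: "real^2 \<Rightarrow> real^2"
  assumes "S \<in> sets lebesgue"
    and "\<And>x. x \<in> S \<Longrightarrow> (g has_derivative g' x) (at x within S)"
    and "inj_on g S"
  shows "(\<lambda>x. \<bar>det (matrix (g' x))\<bar> * f (g x)) absolutely_integrable_on S \<and>
           integral S (\<lambda>x. \<bar>det (matrix (g' x))\<bar> * f (g x)) = b
     \<longleftrightarrow> f absolutely_integrable_on (g ` S) \<and> integral (g ` S) f = b"
proof -
  have "(\<lambda>x. \<bar>det (matrix (g' x))\<bar> *\<^sub>R vec (f(g x)) :: real ^ 1) absolutely_integrable_on S \<and>
           integral S (\<lambda>x. \<bar>det (matrix (g' x))\<bar> *\<^sub>R vec (f(g x))) = (vec b :: real ^ 1)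
         \<longleftrightarrow> (\<lambda>x. vec (f x) :: real ^ 1) absolutely_integrable_on (g ` S) \<and>
           integral (g ` S) (\<lambda>x. vec (f x)) = (vec b :: real ^ 1)"
    by (rule has_absolute_integral_change_of_variables[OF assms])
  thus ?thesis
    by (simp add: absolutely_integrable_on_1_iff integral_on_1_eq)
qed

section \<open>Classical and weak gradients\<close>

lemma C1_iff:
  assumes S: "open S"
  shows "f \<in> C1 S \<longleftrightarrow> (\<exists>g. continuous_on S g \<and> (\<forall>x\<in>S. GDERIV f x :> g x))"
proof
  assume "f \<in> C1 S"
  then have f: "f differentiable_on S" "\<And>v. continuous_on S (\<lambda>x. frechet_derivative f (at x within S) v)"
    by (auto simp: C1_def)
  define g where "g x = pt (frechet_derivative f (at x within S) (axis 1 1)) (frechet_derivative f (at x within S) (axis 2 1))" for x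
  have "GDERIV f x :> g x" if x: "x \<in> S" for x
  proof -
    have d: "(f has_derivative frechet_derivative f (at x within S)) (at x within S)"
      using f(1) x by (simp add: differentiable_on_def frechet_derivative_works)
    then interpret linear "frechet_derivative f (at x within S)" by (rule has_derivative_linear)
    have "frechet_derivative f (at x within S) = (\<lambda>h. h \<bullet> g x)"
    proof
      fix h
      have "frechet_derivative f (at x within S) h = frechet_derivative f (at x within S) (pt (h $ 1) (h $ 2))"
        by simp
      also have "\<dots> = h \<bullet> g x" unfolding pt_eq_axis add scaleR by (simp add: g_def inner_vec2)
      finally show "frechet_derivative f (at x within S) h = h \<bullet> g x" .
    qed
    then show ?thesis using d at_within_open[OF x S] unfolding gderiv_def by metis
  qed
  moreover have "continuous_on S g" unfolding g_def by (intro continuous_intros f)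
  ultimately show "\<exists>g. continuous_on S g \<and> (\<forall>x\<in>S. GDERIV f x :> g x)" by blast
next
  assume "\<exists>g. continuous_on S g \<and> (\<forall>x\<in>S. GDERIV f x :> g x)"
  then obtain g where g: "continuous_on S g" "\<And>x. x \<in> S \<Longrightarrow> GDERIV f x :> g x" by blast
  have d: "(f has_derivative (\<lambda>h. h \<bullet> g x)) (at x)" if "x \<in> S" for x using g(2)[OF that]
    by (simp add: gderiv_def)
  have "frechet_derivative f (at x within S) v = v \<bullet> g x" if "x \<in> S" for x v
    using frechet_derivative_at[OF d[OF that]] at_within_open[OF that S] by metis
  then have "continuous_on S (\<lambda>x. frechet_derivative f (at x within S) v)" for v
    using g(1) by (subst continuous_on_cong[OF refl]) (auto intro!: continuous_intros)
  moreover have "f differentiable_on S"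
    unfolding differentiable_on_def differentiable_def using d has_derivative_at_withinI by blast
  ultimately show "f \<in> C1 S" by (simp add: C1_def)
qed

lemma test_function_GDERIV:
  assumes "\<psi> \<in> test_functions \<Omega>"
  obtains g where "continuous_on UNIV g" "\<And>x. GDERIV \<psi> x :> g x" "\<And>k x. partial k \<psi> x = g x $ k"
proof -
  have "Ck_on 1 UNIV \<psi>" using assms unfolding test_functions_def by blast
  then have "\<psi> \<in> C1 UNIV" by (simp add: C1_def)
  then obtain g where g: "continuous_on UNIV g" "\<And>x. GDERIV \<psi> x :> g x" using C1_iff[of UNIV \<psi>]
    by auto
  have "partial k \<psi> x = g x $ k" for k x
  proof -
    have "(\<psi> has_derivative (\<lambda>h. h \<bullet> g x)) (at x)" using g(2)[of x]
      by (simp add: gderiv_def)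
    from frechet_derivative_at[OF this] have "frechet_derivative \<psi> (at x) = (\<lambda>h. h \<bullet> g x)"
      by simp
    then show ?thesis by (simp add: partial_def inner_axis' )
  qed
  then show ?thesis using that g by blast
qed

text \<open>On the boundary of a square strictly larger than \<open>K\<close> the function
  \<open>u\<close> is zero, so integrating the derivative in direction \<open>k\<close> first gives
  0.\<close>

lemma integral_partial_compact_support:
  fixes u :: "real^2 \<Rightarrow> real"
  assumes "compact K" "\<And>x. x \<notin> K \<Longrightarrow> u x = 0" "\<And>x. x \<notin> K \<Longrightarrow> g x = 0"
    and g: "continuous_on UNIV g" "\<And>x. GDERIV u x :> g x"
  shows "(\<lambda>x. g x $ k) absolutely_integrable_on UNIV" "integral UNIV (\<lambda>x. g x $ k) = 0"
proof -
  obtain R where R: "0 < R" "\<And>x. x \<in> K \<Longrightarrow> norm x < R"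
    using compact_imp_bounded[OF assms(1)] bounded_pos_less by blast
  let ?Q = "cbox (pt (-R) (-R)) (pt R R)"
  have KQ: "\<bar>x $ 1\<bar> < R \<and> \<bar>x $ 2\<bar> < R" if "x \<in> K" for x
    using R(2)[OF that] component_le_norm_cart[of x 1] component_le_norm_cart[of x 2] by auto
  have z: "g x $ k = 0" if "x \<notin> ?Q" for x
  proof -
    have "x \<notin> K" using that KQ[of x] by (auto simp: cbox_pt)
    then show ?thesis using assms(3) by simp
  qed
  have cont: "continuous_on ?Q (\<lambda>x. g x $ k)" using g(1)
    by (intro continuous_intros) (auto intro: continuous_on_subset)
  have eq: "(\<lambda>x. g x $ k) = (\<lambda>x. if x \<in> ?Q then g x $ k else 0)" using z by auto
  have "(\<lambda>x. g x $ k) absolutely_integrable_on ?Q" by (rule absolutely_integrable_continuous[OF cont])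
  then show "(\<lambda>x. g x $ k) absolutely_integrable_on UNIV"
    by (subst eq) (simp only: absolutely_integrable_restrict_UNIV)
  have d: "(u has_derivative (\<lambda>h. h \<bullet> g x)) (at x)" for x using g(2)[of x]
    by (simp add: gderiv_def)
  have d1: "((\<lambda>s. u (pt s t)) has_real_derivative g (pt s t) $ 1) (at s within S)" for s t S
  proof -
    have "((\<lambda>s. pt s t) has_derivative (\<lambda>h. pt h 0)) (at s within S)"
      by (rule has_derivative_pt) (auto intro!: derivative_eq_intros)
    from has_derivative_compose[OF this d] show ?thesis
      by (simp add: has_field_derivative_def inner_vec2 mult_commute_abs)
  qed
  have d2: "((\<lambda>t. u (pt s t)) has_real_derivative g (pt s t) $ 2) (at t within S)" for s t S
  proof -
    have "((\<lambda>t. pt s t) has_derivative (\<lambda>h. pt 0 h)) (at t within S)"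
      by (rule has_derivative_pt) (auto intro!: derivative_eq_intros)
    from has_derivative_compose[OF this d] show ?thesis
      by (simp add: has_field_derivative_def inner_vec2 mult_commute_abs)
  qed
  have bd: "u (pt s t) = 0" if "\<bar>s\<bar> = R \<or> \<bar>t\<bar> = R" for s t
    using KQ[of "pt s t"] that assms(2)[of "pt s t"] by auto
  have "integral ?Q (\<lambda>x. g x $ k) = 0"
  proof (cases "k = 1")
    case True
    then show ?thesis
      using integral_cbox_deriv_1[of "-R" R "-R" R "\<lambda>x. g x $ k" u] R(1) cont d1 bd by auto
  next
    case False
    then have "k = 2" by (metis exhaust_2)
    then show ?thesis
      using integral_cbox_deriv_2[of "-R" R "-R" R "\<lambda>x. g x $ k" u] R(1) cont d2 bd by auto
  qed
  then show "integral UNIV (\<lambda>x. g x $ k) = 0" by (subst eq) (simp only: integral_restrict_UNIV)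
qed

text \<open>Pasting on the cover of the whole space by the open sets \<open>\<Omega>\<close> and
  \<open>- K\<close>; the boundary of \<open>\<Omega>\<close> lies inside the second one, where the
  extension is constantly 0.\<close>

lemma continuous_zero_extension:
  fixes f :: "'a::topological_space \<Rightarrow> 'b::real_normed_vector"
  assumes "open \<Omega>" "closed K" "K \<subseteq> \<Omega>" "continuous_on \<Omega> f" "\<And>x. x \<in> \<Omega> \<Longrightarrow> x \<notin> K \<Longrightarrow> f x = 0"
  shows "continuous_on UNIV (\<lambda>x. if x \<in> \<Omega> then f x else 0)"
proof -
  have "continuous_on (\<Omega> \<union> - K) (\<lambda>x. if x \<in> \<Omega> then f x else 0)"
  proof (rule continuous_on_open_Un)
    show "continuous_on \<Omega> (\<lambda>x. if x \<in> \<Omega> then f x else 0)" using assms(4)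
      by (simp cong: continuous_on_cong)
    have "(if x \<in> \<Omega> then f x else 0) = 0" if "x \<in> - K" for x using assms(5) that by auto
    then show "continuous_on (- K) (\<lambda>x. if x \<in> \<Omega> then f x else 0)"
      by (intro continuous_on_eq[OF continuous_on_const[of _ 0]]) auto
  qed (use assms in auto)
  moreover have "\<Omega> \<union> - K = UNIV" using assms(3) by auto
  ultimately show ?thesis by simp
qed

text \<open>The product \<open>f \<psi>\<close>, extended by zero, is continuously differentiable
  with compact support, so the integral of its partial derivative is zero. The two terms of the
  product rule are the two sides of the identity.\<close>

lemma weak_gradient_C1:
  assumes \<Omega>: "open \<Omega>"
    and g: "continuous_on \<Omega> g" "\<And>x. x \<in> \<Omega> \<Longrightarrow> GDERIV f x :> g x"
  shows "weak_gradient \<Omega> f g"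
  unfolding weak_gradient_def
proof (intro ballI allI)
  fix \<psi> k assume psi: "\<psi> \<in> test_functions \<Omega>"
  obtain q where q: "continuous_on UNIV q" "\<And>x. GDERIV \<psi> x :> q x" "\<And>k x. partial k \<psi> x = q x $ k"
    using test_function_GDERIV[OF psi] by blast
  obtain K where K: "compact K" "K \<subseteq> \<Omega>" "\<And>x. x \<notin> K \<Longrightarrow> \<psi> x = 0"
    using psi unfolding test_functions_def by blast
  have cK: "closed K" using K(1) by (rule compact_imp_closed)
  have q0: "q x = 0" if "x \<notin> K" for x
  proof -
    have "(\<psi> has_derivative (\<lambda>h. h \<bullet> q x)) (at x)" using q(2)[of x]
      by (simp add: gderiv_def)
    moreover have "(\<psi> has_derivative (\<lambda>h. 0)) (at x)"
      by (rule has_derivative_transform_within_open[of "\<lambda>_. 0" _ _ _ "- K"]) (use cK that K(3) in auto)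
    ultimately have "(\<lambda>h. h \<bullet> q x) = (\<lambda>h. 0)" by (rule has_derivative_unique)
    then show ?thesis by (metis inner_eq_zero_iff)
  qed
  have fc: "continuous_on \<Omega> f"
    using g(2) by (meson continuous_at_imp_continuous_on gderiv_def has_derivative_continuous)
  have \<psi>c: "continuous_on \<Omega> \<psi>"
    using q(2) by (meson continuous_at_imp_continuous_on gderiv_def has_derivative_continuous)
  have qc: "continuous_on \<Omega> q" using q(1) continuous_on_subset by blast
  define u where "u x = (if x \<in> \<Omega> then f x * \<psi> x else 0)" for x
  define w1 where "w1 x = (if x \<in> \<Omega> then f x *\<^sub>R q x else 0)" for x
  define w2 where "w2 x = (if x \<in> \<Omega> then \<psi> x *\<^sub>R g x else 0)" for x
  have c1: "continuous_on UNIV w1" unfolding w1_def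
    by (rule continuous_zero_extension[OF \<Omega> cK K(2)]) (use fc qc q0 in \<open>auto intro!: continuous_intros\<close>)
  have c2: "continuous_on UNIV w2" unfolding w2_def
    by (rule continuous_zero_extension[OF \<Omega> cK K(2)]) (use \<psi>c g(1) K(3) in \<open>auto intro!: continuous_intros\<close>)
  have du: "GDERIV u x :> w1 x + w2 x" for x
  proof (cases "x \<in> \<Omega>")
    case True
    have "GDERIV (\<lambda>x. f x * \<psi> x) x :> f x *\<^sub>R q x + \<psi> x *\<^sub>R g x"
      by (rule GDERIV_mult) (use g(2) q(2) True in auto)
    then have "((\<lambda>x. f x * \<psi> x) has_derivative (\<lambda>h. h \<bullet> (w1 x + w2 x))) (at x)"
      using True by (simp add: gderiv_def w1_def w2_def)
    then have "(u has_derivative (\<lambda>h. h \<bullet> (w1 x + w2 x))) (at x)"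
      by (rule has_derivative_transform_within_open[OF _ \<Omega> True]) (simp add: u_def)
    then show ?thesis by (simp add: gderiv_def)
  next
    case False
    then have "x \<in> - K" using K(2) by auto
    have "(u has_derivative (\<lambda>h. 0)) (at x)"
      by (rule has_derivative_transform_within_open[of "\<lambda>_. 0" _ _ _ "- K"]) (use cK \<open>x \<in> - K\<close> K(3) in \<open>auto simp: u_def\<close>)
    then show ?thesis using False by (simp add: gderiv_def w1_def w2_def)
  qed
  have i: "(\<lambda>x. w x $ k) absolutely_integrable_on UNIV" if "continuous_on UNIV w" "\<And>x. x \<notin> K \<Longrightarrow> w x = 0" for w :: "real^2 \<Rightarrow> real^2"
  proof -
    have "(\<lambda>x. w x $ k) absolutely_integrable_on K"
    proof -
      have "continuous_on K (\<lambda>x. w x $ k)"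
        by (intro continuous_intros continuous_on_subset[OF that(1)]) auto
      from borel_integrable_compact[OF K(1) this] show ?thesis
        unfolding set_integrable_def by (subst integrable_completion) auto
    qed
    then have "(\<lambda>x. if x \<in> K then w x $ k else 0) absolutely_integrable_on UNIV"
      by (simp only: absolutely_integrable_restrict_UNIV)
    moreover have "(\<lambda>x. w x $ k) = (\<lambda>x. if x \<in> K then w x $ k else 0)" using that(2)
      by auto
    ultimately show ?thesis by simp
  qed
  have i1: "(\<lambda>x. w1 x $ k) absolutely_integrable_on UNIV" by (rule i[OF c1]) (simp add: w1_def q0)
  have i2: "(\<lambda>x. w2 x $ k) absolutely_integrable_on UNIV" by (rule i[OF c2]) (simp add: w2_def K(3))
  have "integral UNIV (\<lambda>x. (w1 x + w2 x) $ k) = 0"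
    by (rule integral_partial_compact_support[OF K(1), of u])
      (use c1 c2 du K(2,3) q0 in \<open>auto simp: u_def w1_def w2_def intro!: continuous_on_add\<close>)
  then have "integral UNIV (\<lambda>x. w1 x $ k) = - integral UNIV (\<lambda>x. w2 x $ k)"
    using i1 i2 by (simp add: integral_add set_lebesgue_integral_eq_integral(1))
  moreover have "(LINT x|lebesgue_on \<Omega>. h x) = integral UNIV (\<lambda>x. if x \<in> \<Omega> then h x else 0)"
    if "(\<lambda>x. if x \<in> \<Omega> then h x else 0) absolutely_integrable_on UNIV" for h :: "real^2 \<Rightarrow> real"
  proof -
    have "h absolutely_integrable_on \<Omega>" using that by (simp only: absolutely_integrable_restrict_UNIV)
    then have "integrable (lebesgue_on \<Omega>) h"
      using \<Omega> by (simp add: integrable_restrict_space set_integrable_def)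
    then show ?thesis using \<Omega> by (simp add: lebesgue_integral_eq_integral integral_restrict_UNIV)
  qed
  note L = this
  have "(LINT x|lebesgue_on \<Omega>. f x * partial k \<psi> x) = integral UNIV (\<lambda>x. w1 x $ k)"
    using L[of "\<lambda>x. f x * partial k \<psi> x"] i1
    by (simp add: w1_def q(3) if_distrib[of "\<lambda>v. v $ k"] cong: if_cong)
  moreover have "(LINT x|lebesgue_on \<Omega>. g x $ k * \<psi> x) = integral UNIV (\<lambda>x. w2 x $ k)"
    using L[of "\<lambda>x. g x $ k * \<psi> x"] i2
    by (simp add: w2_def mult.commute if_distrib[of "\<lambda>v. v $ k"] cong: if_cong)
  ultimately show "(LINT x|lebesgue_on \<Omega>. f x * partial k \<psi> x) = - (LINT x|lebesgue_on \<Omega>. g x $ k * \<psi> x)"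
    by simp
qed

section \<open>Polar charts\<close>

definition det2 :: "real^2 \<Rightarrow> real^2 \<Rightarrow> real" where
  "det2 u v = u $ 1 * v $ 2 - u $ 2 * v $ 1"

lemma det2_linear:
  "det2 (u + v) w = det2 u w + det2 v w" "det2 w (u + v) = det2 w u + det2 w v"
  "det2 (c *\<^sub>R u) w = c * det2 u w" "det2 w (c *\<^sub>R u) = c * det2 w u" "det2 u u = 0"
  by (simp_all add: det2_def algebra_simps)

lemma small_multiple_2pi: "\<bar>2 * pi * real_of_int k\<bar> < 2 * pi \<Longrightarrow> k = 0"
proof (rule ccontr)
  assume a: "\<bar>2 * pi * real_of_int k\<bar> < 2 * pi" "k \<noteq> 0"
  then have "1 \<le> \<bar>k\<bar>" by simp
  then have "1 \<le> \<bar>real_of_int k\<bar>" by linarith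
  then have "2 * pi * 1 \<le> 2 * pi * \<bar>real_of_int k\<bar>" by (intro mult_left_mono) auto
  moreover have "\<bar>2 * pi * real_of_int k\<bar> = 2 * pi * \<bar>real_of_int k\<bar>"
    by (simp add: abs_mult)
  ultimately show False using a by linarith
qed

lemma periodic_int:
  assumes "\<And>t. f (t + 2 * pi) = f t"
  shows "f (t + 2 * pi * of_int k) = f t"
proof (induction k rule: int_induct[where k = 0])
  case (step1 i)
  have "f (t + 2 * pi * of_int (i + 1)) = f (t + 2 * pi * of_int i + 2 * pi)" by (simp add: algebra_simps)
  then show ?case using assms step1 by simp
next
  case (step2 i)
  have "f (t + 2 * pi * of_int (i - 1)) = f (t + 2 * pi * of_int (i - 1) + 2 * pi)" using assms by simp
  also have "\<dots> = f (t + 2 * pi * of_int i)" by (simp add: algebra_simps)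
  finally show ?case using step2 by simp
qed simp

lemma angle_reduce:
  obtains k :: int where "0 \<le> t + 2 * pi * of_int k" "t + 2 * pi * of_int k < 2 * pi"
proof (rule that[of "- \<lfloor>t / (2 * pi)\<rfloor>"])
  define q where "q = t / (2 * pi)"
  have t: "t = 2 * pi * q" by (simp add: q_def)
  have "of_int \<lfloor>q\<rfloor> \<le> q" "q < of_int \<lfloor>q\<rfloor> + 1" by linarith+
  then have "2 * pi * of_int \<lfloor>q\<rfloor> \<le> 2 * pi * q" "2 * pi * q < 2 * pi * (of_int \<lfloor>q\<rfloor> + 1)"
    by (auto intro!: mult_left_mono mult_strict_left_mono)
  then have "0 \<le> t + 2 * pi * of_int (- \<lfloor>q\<rfloor>)" "t + 2 * pi * of_int (- \<lfloor>q\<rfloor>) < 2 * pi"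
    unfolding t by (simp_all add: distrib_left)
  then show "0 \<le> t + 2 * pi * of_int (- \<lfloor>t / (2 * pi)\<rfloor>)" "t + 2 * pi * of_int (- \<lfloor>t / (2 * pi)\<rfloor>) < 2 * pi"
    by (simp_all only: q_def)
qed

text \<open>One period is compact, so continuity on it is uniform, and periodicity carries the
  estimate to all angles.\<close>

lemma uniform_at_left_edge:
  fixes g :: "real \<Rightarrow> real \<Rightarrow> 'a::metric_space"
  assumes "0 < d" and cont: "continuous_on ({0..d} \<times> UNIV) (\<lambda>(s, t). g s t)"
    and per: "\<And>s t. s \<in> {0..d} \<Longrightarrow> g s (t + 2 * pi) = g s t"
    and y: "\<And>t. g 0 t = y" and "0 < e"
  obtains d' where "0 < d'" "d' \<le> d" "\<And>s t. 0 \<le> s \<Longrightarrow> s < d' \<Longrightarrow> dist (g s t) y < e"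
proof -
  have "compact ({0..d} \<times> {0..2 * pi})" by (intro compact_Times) auto
  then have "uniformly_continuous_on ({0..d} \<times> {0..2 * pi}) (\<lambda>(s, t). g s t)"
    by (rule compact_uniformly_continuous[rotated]) (rule continuous_on_subset[OF cont], auto)
  then obtain r
    where r: "0 < r" "\<And>z w. z \<in> {0..d} \<times> {0..2 * pi} \<Longrightarrow> w \<in> {0..d} \<times> {0..2 * pi} \<Longrightarrow> dist w z < r \<Longrightarrow>
      dist (case w of (s, t) \<Rightarrow> g s t) (case z of (s, t) \<Rightarrow> g s t) < e"
    using \<open>0 < e\<close> unfolding uniformly_continuous_on_def by blast
  show ?thesis
  proof (rule that[of "min r d"])
    fix s t assume s: "0 \<le> s" "s < min r d"
    obtain k :: int where k: "0 \<le> t + 2 * pi * of_int k" "t + 2 * pi * of_int k < 2 * pi"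
      by (rule angle_reduce)
    have "dist (g s (t + 2 * pi * of_int k)) (g 0 (t + 2 * pi * of_int k)) < e"
      using r(2)[of "(0, t + 2 * pi * of_int k)" "(s, t + 2 * pi * of_int k)"] s k \<open>0 < d\<close>
      by (simp add: dist_prod_def dist_real_def)
    moreover have "g s (t + 2 * pi * of_int k) = g s t" by (rule periodic_int) (use per s in auto)
    ultimately show "dist (g s t) y < e" by (simp add: y)
  qed (use r \<open>0 < d\<close> in auto)
qed

text \<open>The derivative relative to the strip is unique also on its edges, because every
  coordinate direction admits small steps that stay in the strip. Hence \<open>jac\<close> has the
  columns \<open>u\<close> and \<open>s *\<^sub>R e\<close>.\<close>

lemma jac_polar:
  assumes "0 < R" "s \<in> {0..R}"
    and F': "(F has_derivative (\<lambda>h. h $ 1 *\<^sub>R u + (h $ 2 * s) *\<^sub>R e)) (at (pt s t) within strip R)"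
  shows "jac R F (pt s t) $ i $ 1 = u $ i" "jac R F (pt s t) $ i $ 2 = s * e $ i"
    and "det (jac R F (pt s t)) = s * det2 u e"
proof -
  let ?F' = "\<lambda>h::real^2. h $ 1 *\<^sub>R u + (h $ 2 * s) *\<^sub>R e"
  have "F differentiable (at (pt s t) within strip R)" using F' by (rule differentiableI)
  then have "(F has_derivative frechet_derivative F (at (pt s t) within strip R)) (at (pt s t) within strip R)"
    by (simp add: frechet_derivative_works)
  then have "frechet_derivative F (at (pt s t) within strip R) = ?F'"
  proof (rule frechet_derivative_unique_within[OF _ F'])
    fix i :: "real^2" and \<epsilon> :: real assume i: "i \<in> Basis" and e: "0 < \<epsilon>"
    \<comment> \<open>At the outer edge the step must go inward; otherwise it goes outward, by at
      most \<open>R - s\<close>. The same \<open>d\<close> serves the angular direction, which the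
      strip does not restrict.\<close>
    define d where "d = (if s = R then - min (\<epsilon> / 2) (R / 2) else min (\<epsilon> / 2) (R - s))"
    have "0 < \<bar>d\<bar>" "\<bar>d\<bar> < \<epsilon>" "0 \<le> s + d" "s + d \<le> R" using e assms(1,2)
      by (auto simp: d_def min_def abs_if)
    then show "\<exists>d. 0 < \<bar>d\<bar> \<and> \<bar>d\<bar> < \<epsilon> \<and> pt s t + d *\<^sub>R i \<in> strip R"
      using i assms(2) by (intro exI[of _ d]) (auto simp: Basis_vec2 strip_def axis_def)
  qed
  then have J: "jac R F (pt s t) = matrix ?F'" by (simp add: jac_def)
  show 1: "jac R F (pt s t) $ i $ 1 = u $ i" for i by (simp add: J matrix_def axis_def)
  show 2: "jac R F (pt s t) $ i $ 2 = s * e $ i" for i by (simp add: J matrix_def axis_def)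
  show "det (jac R F (pt s t)) = s * det2 u e"
    unfolding det_2 1 2 by (simp add: det2_def algebra_simps)
qed

text \<open>
  The angular derivative of the chart is \<open>s *\<^sub>R E\<close>, so that the Jacobian determinant vanishes exactly
  to first order at the pole.
\<close>

locale polar_chart =
  fixes R :: real and F :: "real^2 \<Rightarrow> real^2" and \<Omega> :: "(real^2) set"
    and x\<^sub>0 :: "real^2"
    and Fs E :: "real \<Rightarrow> real \<Rightarrow> real^2"
  assumes R_pos: "0 < R" and open_\<Omega>: "open \<Omega>" and pole_in: "x\<^sub>0 \<in> \<Omega>"
    and F_per: "\<And>s t. s \<in> {0..R} \<Longrightarrow> F (pt s (t + 2 * pi)) = F (pt s t)"
    and F_pole: "\<And>t. F (pt 0 t) = x\<^sub>0"
    and F_inj: "\<And>s t s' t'. s \<in> {0<..R} \<Longrightarrow> s' \<in> {0<..R} \<Longrightarrow> F (pt s t) = F (pt s' t') \<Longrightarrow>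
        s = s' \<and> (\<exists>k::int. t = t' + 2 * pi * of_int k)"
    and F_not_pole: "\<And>s t. s \<in> {0<..R} \<Longrightarrow> F (pt s t) \<noteq> x\<^sub>0"
    and F_onto: "\<And>x. x \<in> \<Omega> - {x\<^sub>0} \<Longrightarrow> \<exists>s t. 0 < s \<and> s < R \<and> x = F (pt s t)"
    and F_outer: "\<And>t. F (pt R t) \<notin> \<Omega>"
    and F_deriv: "\<And>s t. s \<in> {0..R} \<Longrightarrow>
        (F has_derivative (\<lambda>h. h $ 1 *\<^sub>R Fs s t + (h $ 2 * s) *\<^sub>R E s t)) (at (pt s t) within strip R)"
    and Fs_cont: "continuous_on ({0..R} \<times> UNIV) (\<lambda>(s, t). Fs s t)"
    and E_cont: "continuous_on ({0..R} \<times> UNIV) (\<lambda>(s, t). E s t)"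
    and Fs_per: "\<And>s t. s \<in> {0..R} \<Longrightarrow> Fs s (t + 2 * pi) = Fs s t"
    and E_per: "\<And>s t. s \<in> {0..R} \<Longrightarrow> E s (t + 2 * pi) = E s t"
    and det_pos: "\<And>s t. s \<in> {0..R} \<Longrightarrow> 0 < det2 (Fs s t) (E s t)"
begin

text \<open>The angle is taken in \<open>[0, 2 pi)\<close>. For \<open>2 pi\<close>-periodic
  \<open>g\<close> every other chart angle of the point gives the same value
  (\<open>push_F\<close>).\<close>

definition push :: "(real \<Rightarrow> real \<Rightarrow> 'a) \<Rightarrow> real^2 \<Rightarrow> 'a" where
  "push g x = g (pcoord R F x $ 1) (pcoord R F x $ 2)"

section \<open>Inverting the chart and continuity of pushforwards\<close>

lemma F_per_int: "s \<in> {0..R} \<Longrightarrow> F (pt s (t + 2 * pi * of_int k)) = F (pt s t)"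
  by (rule periodic_int[where f = "\<lambda>t. F (pt s t)"]) (rule F_per)

lemma pcoord_F:
  assumes "s \<in> {0<..R}"
  obtains k :: int where "pcoord R F (F (pt s t)) = pt s (t + 2 * pi * of_int k)"
    "0 \<le> t + 2 * pi * of_int k" "t + 2 * pi * of_int k < 2 * pi"
proof -
  obtain k :: int where k: "0 \<le> t + 2 * pi * of_int k" "t + 2 * pi * of_int k < 2 * pi"
    by (rule angle_reduce)
  have "pcoord R F (F (pt s t)) = pt s (t + 2 * pi * of_int k)"
    unfolding pcoord_def
  proof (rule the_equality)
    show "pt s (t + 2 * pi * of_int k) \<in> strip_pos R \<and> 0 \<le> pt s (t + 2 * pi * of_int k) $ 2
        \<and> pt s (t + 2 * pi * of_int k) $ 2 < 2 * pi \<and> F (pt s (t + 2 * pi * of_int k)) = F (pt s t)"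
      using k assms F_per_int[of s t k] by (auto simp: strip_pos_def)
  next
    fix z assume z: "z \<in> strip_pos R \<and> 0 \<le> z $ 2 \<and> z $ 2 < 2 * pi \<and> F z = F (pt s t)"
    then have "z $ 1 = s \<and> (\<exists>k::int. z $ 2 = t + 2 * pi * of_int k)"
      using F_inj[of "z $ 1" s "z $ 2" t] assms by (auto simp: strip_pos_def)
    then obtain l :: int where l: "z $ 1 = s" "z $ 2 = t + 2 * pi * of_int l" by auto
    have "2 * pi * real_of_int (l - k) = 2 * pi * of_int l - 2 * pi * of_int k"
      by (simp add: right_diff_distrib)
    then have "\<bar>2 * pi * real_of_int (l - k)\<bar> < 2 * pi" using z k l(2) by linarith
    from small_multiple_2pi[OF this] have "l = k" by simp
    then show "z = pt s (t + 2 * pi * of_int k)" using l by (simp add: vec2_eq_iff)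
  qed
  then show ?thesis using that k by blast
qed

lemma push_F:
  assumes "s \<in> {0<..R}" "\<And>t. g s (t + 2 * pi) = g s t"
  shows "push g (F (pt s t)) = g s t"
proof -
  obtain k :: int where "pcoord R F (F (pt s t)) = pt s (t + 2 * pi * of_int k)" using pcoord_F[OF assms(1)]
    by blast
  then show ?thesis using periodic_int[of "g s" t k] assms(2) by (simp add: push_def)
qed

lemma \<Omega>_cases:
  assumes "x \<in> \<Omega> - {x\<^sub>0}"
  obtains s t where "0 < s" "s < R" "x = F (pt s t)"
  using F_onto[OF assms] by blast

lemma F_cont: "continuous_on (strip R) F"
  unfolding continuous_on_eq_continuous_within
proof
  fix z assume "z \<in> strip R"
  then have "z $ 1 \<in> {0..R}" by (simp add: strip_def)
  from F_deriv[OF this, of "z $ 2"] show "continuous (at z within strip R) F"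
    by (simp add: has_derivative_continuous)
qed

lemma F_cont2: "continuous_on ({0..R} \<times> UNIV) (\<lambda>(s, t). F (pt s t))"
  unfolding case_prod_beta
  by (rule continuous_on_compose2[OF F_cont]) (auto simp: strip_def intro!: continuous_intros)

lemma F_inj_on: "inj_on F {z. 0 < z $ 1 \<and> z $ 1 < R \<and> \<bar>z $ 2 - t\<^sub>0\<bar> < pi}"
proof (rule inj_onI)
  fix z w assume z: "z \<in> {z. 0 < z $ 1 \<and> z $ 1 < R \<and> \<bar>z $ 2 - t\<^sub>0\<bar> < pi}"
    and w: "w \<in> {z. 0 < z $ 1 \<and> z $ 1 < R \<and> \<bar>z $ 2 - t\<^sub>0\<bar> < pi}" and "F z = F w"
  then have "z $ 1 = w $ 1 \<and> (\<exists>k::int. z $ 2 = w $ 2 + 2 * pi * of_int k)"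
    using F_inj[of "z $ 1" "w $ 1" "z $ 2" "w $ 2"] by auto
  then obtain k :: int where k: "z $ 1 = w $ 1" "z $ 2 = w $ 2 + 2 * pi * of_int k" by auto
  have "\<bar>z $ 2 - t\<^sub>0\<bar> < pi" "\<bar>w $ 2 - t\<^sub>0\<bar> < pi" using z w by auto
  then have "\<bar>2 * pi * of_int k\<bar> < 2 * pi" using k(2) by linarith
  then have "k = 0" by (rule small_multiple_2pi)
  then show "z = w" using k by (simp add: vec2_eq_iff)
qed

text \<open>Invariance of domain yields a continuous local inverse. The open sector of width
  \<open>2 pi\<close> is centred at \<open>t\<close>, so points on the cut at angle 0, where
  \<open>pcoord\<close> jumps, are covered as well.\<close>

lemma local_inverse:
  assumes "0 < s" "s < R"
  obtains U G where "open U" "F (pt s t) \<in> U" "G (F (pt s t)) = pt s t" "continuous_on U G"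
    "\<And>x. x \<in> U \<Longrightarrow> 0 < G x $ 1 \<and> G x $ 1 < R \<and> F (G x) = x"
proof -
  let ?N = "{z :: real^2. 0 < z $ 1 \<and> z $ 1 < R \<and> \<bar>z $ 2 - t\<bar> < pi}"
  have "?N = box (pt 0 (t - pi)) (pt R (t + pi))" by (auto simp: box_pt)
  then have oN: "open ?N" by (simp add: open_box)
  have cN: "continuous_on ?N F" by (rule continuous_on_subset[OF F_cont]) (auto simp: strip_def)
  obtain G where G: "homeomorphism ?N (F ` ?N) F G"
    using invariance_of_domain_homeomorphism[OF oN cN _ F_inj_on] by auto
  have "open (F ` ?N)" by (rule invariance_of_domain[OF cN oN F_inj_on])
  moreover have "pt s t \<in> ?N" using assms pi_gt_zero by simp
  moreover have "0 < G x $ 1 \<and> G x $ 1 < R \<and> F (G x) = x" if "x \<in> F ` ?N" for x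
  proof -
    have "G x \<in> ?N" using G that unfolding homeomorphism_def by blast
    then show ?thesis using G that unfolding homeomorphism_def by auto
  qed
  moreover have "continuous_on (F ` ?N) G" "G (F (pt s t)) = pt s t"
    using G \<open>pt s t \<in> ?N\<close> unfolding homeomorphism_def by blast+
  ultimately show ?thesis using that[of "F ` ?N" G] by blast
qed

lemma push_local_inverse:
  assumes "\<And>s t. s \<in> {0<..<R} \<Longrightarrow> g s (t + 2 * pi) = g s t" "0 < z $ 1" "z $ 1 < R" "F z = x"
  shows "push g x = g (z $ 1) (z $ 2)"
  using push_F[of "z $ 1" g "z $ 2"] assms by auto

lemma push_continuous:
  assumes cont: "continuous_on ({0<..<R} \<times> UNIV) (\<lambda>(s, t). g s t)"
    and per: "\<And>s t. s \<in> {0<..<R} \<Longrightarrow> g s (t + 2 * pi) = g s t"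
  shows "continuous_on (\<Omega> - {x\<^sub>0}) (push g)"
proof (rule continuous_at_imp_continuous_on, rule ballI)
  fix x assume "x \<in> \<Omega> - {x\<^sub>0}"
  then obtain s t where st: "0 < s" "s < R" "x = F (pt s t)" by (rule \<Omega>_cases)
  obtain U G where U: "open U" "F (pt s t) \<in> U" "G (F (pt s t)) = pt s t" "continuous_on U G"
    "\<And>x. x \<in> U \<Longrightarrow> 0 < G x $ 1 \<and> G x $ 1 < R \<and> F (G x) = x"
      using local_inverse[OF st(1,2)] by blast
  have "continuous_on U (\<lambda>y. case (G y $ 1, G y $ 2) of (s, t) \<Rightarrow> g s t)"
    by (rule continuous_on_compose2[OF cont]) (use U in \<open>auto intro!: continuous_intros\<close>)
  then have "continuous_on U (\<lambda>y. g (G y $ 1) (G y $ 2))" by simp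
  moreover have "push g y = g (G y $ 1) (G y $ 2)" if "y \<in> U" for y
    using push_local_inverse[of g "G y" y] per U(5)[OF that] by simp
  ultimately have "continuous_on U (push g)" by (simp cong: continuous_on_cong)
  then show "isCont (push g) x" using U(1,2) st(3) by (simp add: continuous_on_eq_continuous_at)
qed

text \<open>By compactness the part of the chart with \<open>s >= d\<close> keeps a positive
  distance from the pole. Read conversely, a point close to the pole has a small radius
  parameter.\<close>

lemma F_away:
  assumes "0 < d"
  obtains r where "0 < r" "\<And>s t. d \<le> s \<Longrightarrow> s \<le> R \<Longrightarrow> r \<le> dist (F (pt s t)) x\<^sub>0"
proof (cases "d \<le> R")
  case False
  then show ?thesis using that[of 1] by auto
next
  case True
  let ?K = "(\<lambda>(s, t). F (pt s t)) ` ({d..R} \<times> {0..2 * pi})"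
  have "compact ?K"
    by (rule compact_continuous_image[OF continuous_on_subset[OF F_cont2]]) (use assms in \<open>auto intro!: compact_Times\<close>)
  then have "closed ?K" by (rule compact_imp_closed)
  moreover have "x\<^sub>0 \<notin> ?K" 
  proof
    assume "x\<^sub>0 \<in> ?K"
    then obtain s t where "s \<in> {d..R}" "F (pt s t) = x\<^sub>0" by auto
    then show False using F_not_pole[of s t] assms by simp
  qed
  ultimately obtain r where r: "0 < r" "\<And>y. y \<in> ?K \<Longrightarrow> r \<le> dist x\<^sub>0 y"
    using separate_point_closed[of ?K x\<^sub>0] by blast
  show ?thesis
  proof (rule that[OF r(1)])
    fix s t assume s: "d \<le> s" "s \<le> R"
    obtain k :: int where k: "0 \<le> t + 2 * pi * of_int k" "t + 2 * pi * of_int k < 2 * pi"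
      by (rule angle_reduce)
    have "F (pt s (t + 2 * pi * of_int k)) \<in> ?K" using s k by force
    moreover have "F (pt s (t + 2 * pi * of_int k)) = F (pt s t)" by (rule F_per_int) (use s assms in auto)
    ultimately show "r \<le> dist (F (pt s t)) x\<^sub>0" using r(2) by (metis dist_commute)
  qed
qed

text \<open>Nearness to the pole bounds the radius by \<open>F_away\<close>, and convergence at
  \<open>s = 0\<close> is uniform in the angle. Continuity is asked on \<open>{0..d}\<close> only,
  so that the degree 1 case can use the first knot ring.\<close>

lemma push_tendsto_pole:
  fixes g :: "real \<Rightarrow> real \<Rightarrow> 'a::metric_space"
  assumes "0 < d" "d \<le> R" and cont: "continuous_on ({0..d} \<times> UNIV) (\<lambda>(s, t). g s t)"
    and per: "\<And>s t. s \<in> {0..d} \<Longrightarrow> g s (t + 2 * pi) = g s t"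
    and y: "\<And>t. g 0 t = y"
  shows "(push g \<longlongrightarrow> y) (at x\<^sub>0)"
proof (rule tendstoI)
  fix e :: real assume "0 < e"
  obtain d' where d': "0 < d'" "d' \<le> d" "\<And>s t. 0 \<le> s \<Longrightarrow> s < d' \<Longrightarrow> dist (g s t) y < e"
    using uniform_at_left_edge[OF \<open>0 < d\<close> cont per y \<open>0 < e\<close>] by blast
  obtain r where r: "0 < r" "\<And>s t. d' \<le> s \<Longrightarrow> s \<le> R \<Longrightarrow> r \<le> dist (F (pt s t)) x\<^sub>0"
    using F_away[OF d'(1)] by blast
  have "\<forall>\<^sub>F x in at x\<^sub>0. x \<in> ball x\<^sub>0 r \<inter> \<Omega> \<and> x \<noteq> x\<^sub>0"
    using eventually_at_in_open[of "ball x\<^sub>0 r \<inter> \<Omega>" x\<^sub>0] open_\<Omega> pole_in r(1)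
    by (auto simp: open_Int)
  then show "\<forall>\<^sub>F x in at x\<^sub>0. dist (push g x) y < e"
  proof eventually_elim
    case (elim x)
    then obtain s t where st: "0 < s" "s < R" "x = F (pt s t)" using \<Omega>_cases[of x] by blast
    have "s < d'"
    proof (rule ccontr)
      assume "\<not> s < d'"
      then have "r \<le> dist (F (pt s t)) x\<^sub>0" using r(2) st by auto
      then show False using elim st by (auto simp: dist_commute)
    qed
    moreover have "push g x = g s t" unfolding st(3)
      by (rule push_F) (use st per \<open>s < d'\<close> d'(2) in auto)
    ultimately show ?case using d'(3)[of s t] st by simp
  qed
qed

lemma F_near_pole:
  obtains e where "0 < e" "e \<le> R" "\<And>s t. 0 \<le> s \<Longrightarrow> s < e \<Longrightarrow> F (pt s t) \<in> \<Omega>"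
proof -
  obtain r where r: "0 < r" "ball x\<^sub>0 r \<subseteq> \<Omega>"
    using open_\<Omega> pole_in open_contains_ball by blast
  obtain e where "0 < e" "e \<le> R" "\<And>s t. 0 \<le> s \<Longrightarrow> s < e \<Longrightarrow> dist (F (pt s t)) x\<^sub>0 < r"
    using uniform_at_left_edge[of R "\<lambda>s t. F (pt s t)" x\<^sub>0 r] R_pos F_cont2 F_per F_pole r(1)
    by blast
  then show ?thesis using that[of e] r(2) by (auto simp: dist_commute subset_iff)
qed

lemma bounded_\<Omega>: "bounded \<Omega>"
proof -
  let ?K = "(\<lambda>(s, t). F (pt s t)) ` ({0..R} \<times> {0..2 * pi})"
  have "compact ?K"
    by (rule compact_continuous_image[OF continuous_on_subset[OF F_cont2]]) (auto intro!: compact_Times)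
  then have "bounded ?K" by (rule compact_imp_bounded)
  moreover have "\<Omega> \<subseteq> ?K"
  proof
    fix x assume x: "x \<in> \<Omega>"
    show "x \<in> ?K"
    proof (cases "x = x\<^sub>0")
      case True
      then show ?thesis using F_pole[of 0] R_pos by (intro image_eqI[of _ _ "(0, 0)"]) auto
    next
      case False
      then obtain s t where st: "0 < s" "s < R" "x = F (pt s t)" using x \<Omega>_cases[of x] by blast
      obtain k :: int where k: "0 \<le> t + 2 * pi * of_int k" "t + 2 * pi * of_int k < 2 * pi"
        by (rule angle_reduce)
      show ?thesis using st k F_per_int[of s t k]
        by (intro image_eqI[of _ _ "(s, t + 2 * pi * of_int k)"]) auto
    qed
  qed
  ultimately show ?thesis by (rule bounded_subset)
qed

lemmas jac_eq = jac_polar[OF R_pos _ F_deriv]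

text \<open>By Cramer's rule, the covector \<open>v\<close> with \<open>Fs \<bullet> v = w\<^sub>1\<close> and \<open>E \<bullet> v = w\<^sub>2\<close>.\<close>

definition cov :: "real \<Rightarrow> real \<Rightarrow> real \<Rightarrow> real \<Rightarrow> real^2" where
  "cov w\<^sub>1 w\<^sub>2 s t = (1 / det2 (Fs s t) (E s t)) *\<^sub>R
     pt (w\<^sub>1 * E s t $ 2 - w\<^sub>2 * Fs s t $ 2) (w\<^sub>2 * Fs s t $ 1 - w\<^sub>1 * E s t $ 1)"

lemma cov_solves:
  assumes "s \<in> {0..R}"
  shows "Fs s t \<bullet> cov w\<^sub>1 w\<^sub>2 s t = w\<^sub>1" "E s t \<bullet> cov w\<^sub>1 w\<^sub>2 s t = w\<^sub>2"
proof -
  have d: "det2 (Fs s t) (E s t) \<noteq> 0" using det_pos[OF assms, of t] by simp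
  have "Fs s t \<bullet> cov w\<^sub>1 w\<^sub>2 s t = (w\<^sub>1 * det2 (Fs s t) (E s t)) / det2 (Fs s t) (E s t)"
    by (simp add: cov_def inner_vec2 det2_def add_divide_distrib[symmetric] diff_divide_distrib[symmetric] algebra_simps)
  then show "Fs s t \<bullet> cov w\<^sub>1 w\<^sub>2 s t = w\<^sub>1" using d by simp
  have "E s t \<bullet> cov w\<^sub>1 w\<^sub>2 s t = (w\<^sub>2 * det2 (Fs s t) (E s t)) / det2 (Fs s t) (E s t)"
    by (simp add: cov_def inner_vec2 det2_def add_divide_distrib[symmetric] diff_divide_distrib[symmetric] algebra_simps)
  then show "E s t \<bullet> cov w\<^sub>1 w\<^sub>2 s t = w\<^sub>2" using d by simp
qed

lemma cov_unique:
  assumes "s \<in> {0..R}"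
  shows "v = cov (Fs s t \<bullet> v) (E s t \<bullet> v) s t"
proof -
  have d: "det2 (Fs s t) (E s t) \<noteq> 0" using det_pos[OF assms, of t] by simp
  have "det2 (Fs s t) (E s t) *\<^sub>R v = det2 (Fs s t) (E s t) *\<^sub>R cov (Fs s t \<bullet> v) (E s t \<bullet> v) s t"
    using d by (simp add: cov_def vec2_eq_iff inner_vec2) (simp add: det2_def algebra_simps)
  then show ?thesis using d by simp
qed

text \<open>The second column of the Jacobian is \<open>s E\<close>, so solving against its
  transpose divides the second component by \<open>s\<close>. The singularity at the pole is thereby
  moved from the matrix into that quotient.\<close>

lemma jac_transpose_inverse:
  assumes "s \<in> {0<..R}"
  shows "transpose (matrix_inv (jac R F (pt s t))) *v pt w\<^sub>1 w\<^sub>2 = cov w\<^sub>1 (w\<^sub>2 / s) s t"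
proof -
  let ?J = "jac R F (pt s t)" and ?v = "cov w\<^sub>1 (w\<^sub>2 / s) s t"
  have s: "s \<in> {0..R}" using assms by auto
  have "det ?J \<noteq> 0" using jac_eq(3)[OF s] det_pos[OF s, of t] assms by simp
  then have "\<exists>A. ?J ** A = mat 1 \<and> A ** ?J = mat 1" using invertible_det_nz
    unfolding invertible_def by blast
  then have J: "?J ** matrix_inv ?J = mat 1" unfolding matrix_inv_def by (rule someI2_ex) simp
  have "transpose ?J *v ?v = pt w\<^sub>1 w\<^sub>2"
    using cov_solves[OF s, of t w\<^sub>1 "w\<^sub>2 / s"] assms
    by (simp add: vec2_eq_iff matrix_vector_mult_def transpose_def sum_2 jac_eq[OF s] inner_vec2)
      (simp add: mult.assoc distrib_left[symmetric])
  then have "transpose (matrix_inv ?J) *v pt w\<^sub>1 w\<^sub>2 = (transpose (matrix_inv ?J) ** transpose ?J) *v ?v"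
    by (simp add: matrix_vector_mul_assoc[symmetric])
  also have "transpose (matrix_inv ?J) ** transpose ?J = mat 1"
    unfolding matrix_transpose_mul[symmetric] J by (simp add: transpose_mat)
  finally show ?thesis by simp
qed

lemma cov_continuous:
  assumes "continuous_on S (\<lambda>(s, t). w\<^sub>1 s t)" "continuous_on S (\<lambda>(s, t). w\<^sub>2 s t)" "S \<subseteq> {0..R} \<times> UNIV"
  shows "continuous_on S (\<lambda>(s, t). cov (w\<^sub>1 s t) (w\<^sub>2 s t) s t)"
proof -
  have c: "continuous_on S (\<lambda>z. Fs (fst z) (snd z))" "continuous_on S (\<lambda>z. E (fst z) (snd z))"
    using continuous_on_subset[OF Fs_cont assms(3)] continuous_on_subset[OF E_cont assms(3)]
    by (simp_all add: case_prod_beta)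
  have d: "det2 (Fs (fst z) (snd z)) (E (fst z) (snd z)) \<noteq> 0" if "z \<in> S" for z
    using det_pos[of "fst z" "snd z"] assms(3) that by fastforce
  have "continuous_on S (\<lambda>z. det2 (Fs (fst z) (snd z)) (E (fst z) (snd z)))"
    unfolding det2_def by (intro continuous_intros c)
  then show ?thesis
    using assms(1,2) d c unfolding case_prod_beta cov_def
    by (intro continuous_intros) auto
qed

text \<open>Writing the angular derivative as \<open>s * w\<^sub>2\<close> lets the factor
  \<open>s\<close> of the Jacobian cancel, so the gradient is the covector with pairings
  \<open>w\<^sub>1\<close> and \<open>w\<^sub>2\<close> against \<open>Fs\<close> and
  \<open>E\<close>.\<close>

lemma push_GDERIV:
  assumes "0 < s" "s < R" and per: "\<And>s t. s \<in> {0<..<R} \<Longrightarrow> g s (t + 2 * pi) = g s t"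
    and dg: "((\<lambda>z. g (z $ 1) (z $ 2)) has_derivative (\<lambda>h. h $ 1 * w\<^sub>1 + h $ 2 * (s * w\<^sub>2))) (at (pt s t))"
  shows "GDERIV (push g) (F (pt s t)) :> cov w\<^sub>1 w\<^sub>2 s t"
proof -
  obtain U G where U: "open U" "F (pt s t) \<in> U" "G (F (pt s t)) = pt s t" "continuous_on U G"
    "\<And>x. x \<in> U \<Longrightarrow> 0 < G x $ 1 \<and> G x $ 1 < R \<and> F (G x) = x"
      using local_inverse[OF assms(1,2)] by blast
  let ?d = "det2 (Fs s t) (E s t)"
  have s: "s \<in> {0..R}" using assms by auto
  have d: "?d \<noteq> 0" using det_pos[OF s, of t] by simp
  \<comment> \<open>The inverse of the Jacobian by Cramer's rule.\<close>
  define G' where "G' k = pt (det2 k (E s t) / ?d) (det2 (Fs s t) k / (s * ?d))" for k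
  have "pt s t \<in> interior (strip R)"
  proof (rule interiorI[of "box (pt 0 (t - 1)) (pt R (t + 1))"])
    show "pt s t \<in> box (pt 0 (t - 1)) (pt R (t + 1))" using assms by (simp add: box_pt)
    show "box (pt 0 (t - 1)) (pt R (t + 1)) \<subseteq> strip R" by (auto simp: box_pt strip_def)
  qed (rule open_box)
  then have at: "at (pt s t) within strip R = at (pt s t)" by (rule at_within_interior)
  have DF: "(F has_derivative (\<lambda>h. h $ 1 *\<^sub>R Fs s t + (h $ 2 * s) *\<^sub>R E s t)) (at (pt s t))"
    using F_deriv[OF s, of t] unfolding at .
  have lin: "linear G'"
    by (rule linearI) (simp_all add: G'_def vec2_eq_iff det2_linear add_divide_distrib)
  have "(G has_derivative G') (at (F (pt s t)))"
  proof (rule has_derivative_inverse_basic[where f = F and T = U])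
    show "(F has_derivative (\<lambda>h. h $ 1 *\<^sub>R Fs s t + (h $ 2 * s) *\<^sub>R E s t)) (at (G (F (pt s t))))"
      unfolding U(3) by (rule DF)
    show "bounded_linear G'" using lin by (rule linear_conv_bounded_linear[THEN iffD1])
    have "G' (h $ 1 *\<^sub>R Fs s t + (h $ 2 * s) *\<^sub>R E s t) = h" for h
    proof -
      have "det2 (h $ 1 *\<^sub>R Fs s t + (h $ 2 * s) *\<^sub>R E s t) (E s t) = h $ 1 * ?d"
        "det2 (Fs s t) (h $ 1 *\<^sub>R Fs s t + (h $ 2 * s) *\<^sub>R E s t) = h $ 2 * (s * ?d)"
        by (simp_all add: det2_linear)
      then show ?thesis using d assms(1) by (simp add: G'_def vec2_eq_iff)
    qed
    then show "G' \<circ> (\<lambda>h. h $ 1 *\<^sub>R Fs s t + (h $ 2 * s) *\<^sub>R E s t) = id"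
      by (simp add: fun_eq_iff)
    show "isCont G (F (pt s t))" using U by (simp add: continuous_on_eq_continuous_at)
  qed (use U in auto)
  then have "((\<lambda>x. g (G x $ 1) (G x $ 2)) has_derivative (\<lambda>k. G' k $ 1 * w\<^sub>1 + G' k $ 2 * (s * w\<^sub>2))) (at (F (pt s t)))"
    using has_derivative_compose[of G G' "F (pt s t)" UNIV "\<lambda>z. g (z $ 1) (z $ 2)"] dg U(3) by simp
  then have "(push g has_derivative (\<lambda>k. G' k $ 1 * w\<^sub>1 + G' k $ 2 * (s * w\<^sub>2))) (at (F (pt s t)))"
  proof (rule has_derivative_transform_within_open[OF _ U(1,2)])
    fix y assume "y \<in> U"
    then show "g (G y $ 1) (G y $ 2) = push g y"
      using push_local_inverse[of g "G y" y] per U(5) by simp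
  qed
  moreover have "G' k $ 1 * w\<^sub>1 + G' k $ 2 * (s * w\<^sub>2) = k \<bullet> cov w\<^sub>1 w\<^sub>2 s t" for k
  proof -
    have "G' k $ 1 * w\<^sub>1 + G' k $ 2 * (s * w\<^sub>2) = (det2 k (E s t) * w\<^sub>1 + det2 (Fs s t) k * w\<^sub>2) / ?d"
      using assms(1) by (simp add: G'_def add_divide_distrib)
    also have "\<dots> = k \<bullet> cov w\<^sub>1 w\<^sub>2 s t"
      by (simp add: cov_def inner_vec2 add_divide_distrib[symmetric]) (simp add: det2_def algebra_simps)
    finally show ?thesis .
  qed
  ultimately show ?thesis by (simp add: gderiv_def)
qed

end

text \<open>Mean value theorem on the segment from the pole to \<open>x\<close>: the segment meets
  the pole only at its end, where continuity of \<open>f\<close> suffices, and elsewhere the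
  gradient is within \<open>e\<close> of \<open>y\<close>.\<close>

lemma GDERIV_removable:
  fixes f :: "real^2 \<Rightarrow> real"
  assumes "open \<Omega>" "x\<^sub>0 \<in> \<Omega>"
    and d: "\<And>x. x \<in> \<Omega> - {x\<^sub>0} \<Longrightarrow> GDERIV f x :> g x"
    and lim: "(g \<longlongrightarrow> y) (at x\<^sub>0)" and cont: "isCont f x\<^sub>0"
  shows "GDERIV f x\<^sub>0 :> y"
  unfolding gderiv_def has_derivative_at_alt
proof (intro conjI allI impI)
  show "bounded_linear (\<lambda>h. h \<bullet> y)" by (rule bounded_linear_inner_left)
  fix e :: real assume "0 < e"
  then have "\<forall>\<^sub>F x in at x\<^sub>0. dist (g x) y < e" using lim by (rule tendstoD[rotated])
  then obtain r1
    where r1: "0 < r1" "\<And>x. x \<noteq> x\<^sub>0 \<Longrightarrow> dist x x\<^sub>0 < r1 \<Longrightarrow> dist (g x) y < e"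
    unfolding eventually_at by blast
  obtain r2 where r2: "0 < r2" "ball x\<^sub>0 r2 \<subseteq> \<Omega>" using assms(1,2) open_contains_ball
    by blast
  show "\<exists>r>0. \<forall>x. norm (x - x\<^sub>0) < r \<longrightarrow> norm (f x - f x\<^sub>0 - (x - x\<^sub>0) \<bullet> y) \<le> e * norm (x - x\<^sub>0)"
  proof (intro exI[of _ "min r1 r2"] conjI allI impI)
    show "0 < min r1 r2" using r1 r2 by simp
    fix x assume x: "norm (x - x\<^sub>0) < min r1 r2"
    show "norm (f x - f x\<^sub>0 - (x - x\<^sub>0) \<bullet> y) \<le> e * norm (x - x\<^sub>0)"
    proof (cases "x = x\<^sub>0")
      case False
      define l where "l t = x\<^sub>0 + t *\<^sub>R (x - x\<^sub>0)" for t :: real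
      have l_dist: "dist (l t) x\<^sub>0 = \<bar>t\<bar> * norm (x - x\<^sub>0)" for t
        by (simp add: l_def dist_norm)
      have near: "l t \<in> \<Omega> - {x\<^sub>0} \<and> dist (g (l t)) y < e" if "0 < t" "t \<le> 1" for t
      proof -
        have "dist (l t) x\<^sub>0 \<le> 1 * norm (x - x\<^sub>0)" unfolding l_dist using that
          by (intro mult_right_mono) auto
        then have "dist (l t) x\<^sub>0 < r1" "dist x\<^sub>0 (l t) < r2" using x by (auto simp: dist_commute)
        moreover have "l t \<noteq> x\<^sub>0" using False that by (simp add: l_def)
        ultimately show ?thesis using r1(2)[of "l t"] r2(2) by (auto simp: subset_iff)
      qed
      \<comment> \<open>Subtracting the candidate linear part leaves the error \<open>g - y\<close>
        along the segment as derivative.\<close>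
      define u where "u t = f (l t) - t * ((x - x\<^sub>0) \<bullet> y)" for t
      have dl: "(l has_derivative (\<lambda>k. k *\<^sub>R (x - x\<^sub>0))) (at t)" for t
        unfolding l_def by (auto intro!: derivative_eq_intros)
      have du: "(u has_derivative (\<lambda>k. k * ((x - x\<^sub>0) \<bullet> (g (l t) - y)))) (at t)" if "0 < t" "t \<le> 1" for t
      proof -
        have "(f has_derivative (\<lambda>h. h \<bullet> g (l t))) (at (l t))" using d near[OF that]
          by (simp add: gderiv_def)
        from has_derivative_compose[OF dl this]
        have "((\<lambda>t. f (l t)) has_derivative (\<lambda>k. (k *\<^sub>R (x - x\<^sub>0)) \<bullet> g (l t))) (at t)" .
        then have "(u has_derivative (\<lambda>k. (k *\<^sub>R (x - x\<^sub>0)) \<bullet> g (l t) - k * ((x - x\<^sub>0) \<bullet> y))) (at t)"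
          unfolding u_def by (auto intro!: derivative_eq_intros)
        then show ?thesis by (simp add: inner_diff_right right_diff_distrib)
      qed
      have "continuous_on {0..1} u"
      proof (rule continuous_at_imp_continuous_on, rule ballI)
        fix t :: real assume t: "t \<in> {0..1}"
        show "isCont u t"
        proof (cases "t = 0")
          case True
          have l0: "l 0 = x\<^sub>0" by (simp add: l_def)
          have "isCont l 0" using dl has_derivative_continuous by blast
          moreover have "isCont f (l 0)" using cont l0 by simp
          ultimately have "isCont (\<lambda>t. f (l t)) 0" by (rule isCont_o2)
          then show ?thesis unfolding u_def True by (intro continuous_intros)
        next
          case False
          then show ?thesis using du[of t] t has_derivative_continuous by auto
        qed
      qed
      moreover have "(u has_derivative (\<lambda>k. k * ((x - x\<^sub>0) \<bullet> (g (l t) - y)))) (at t)" if "0 < t" "t < 1" for t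
        by (rule du) (use that in auto)
      ultimately have "\<exists>t\<in>{0<..<1}. u 1 - u 0 = (1 - 0) * ((x - x\<^sub>0) \<bullet> (g (l t) - y))"
        by (rule mvt[OF zero_less_one]) auto
      then obtain t
        where t: "t \<in> {0<..<1}" "u 1 - u 0 = (1 - 0) * ((x - x\<^sub>0) \<bullet> (g (l t) - y))" by blast
      have "f x - f x\<^sub>0 - (x - x\<^sub>0) \<bullet> y = (x - x\<^sub>0) \<bullet> (g (l t) - y)"
        using t(2) by (simp add: u_def l_def)
      also have "norm \<dots> \<le> norm (x - x\<^sub>0) * norm (g (l t) - y)" using Cauchy_Schwarz_ineq2
        by simp
      also have "\<dots> \<le> norm (x - x\<^sub>0) * e" using near[of t] t(1)
        by (intro mult_left_mono) (auto simp: dist_norm)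
      finally show ?thesis by (simp add: mult.commute)
    qed simp
  qed
qed

section \<open>Change of variables\<close>

text \<open>The bound may fail at \<open>x\<^sub>0\<close>, since a point is a null set; this
  absorbs the arbitrary value at the pole.\<close>

lemma L2_bounded_measurable:
  fixes f :: "real^2 \<Rightarrow> 'b::euclidean_space"
  assumes "open \<Omega>" "bounded \<Omega>" and m: "f \<in> borel_measurable (lebesgue_on \<Omega>)"
    and "\<And>x. x \<in> \<Omega> - {x\<^sub>0} \<Longrightarrow> norm (f x) \<le> C"
  shows "f \<in> L2 \<Omega>"
proof -
  have "\<Omega> \<in> lmeasurable" using assms by (intro lmeasurable_open) auto
  then have "finite_measure (lebesgue_on \<Omega>)" by (simp add: finite_measure_lebesgue_on)
  then interpret finite_measure "lebesgue_on \<Omega>" .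
  have "AE x in lebesgue_on \<Omega>. x \<noteq> x\<^sub>0"
    using assms(1) by (subst AE_restrict_space_iff) (auto intro!: AE_I[of _ _ "{x\<^sub>0}"])
  then have "AE x in lebesgue_on \<Omega>. norm ((norm (f x))\<^sup>2) \<le> C\<^sup>2"
    using AE_space by eventually_elim (use assms(4) in \<open>auto intro!: power_mono\<close>)
  then have "integrable (lebesgue_on \<Omega>) (\<lambda>x. (norm (f x))\<^sup>2)"
    using m by (intro integrable_const_bound[of _ "C\<^sup>2"]) auto
  then show ?thesis using m by (simp add: L2_def)
qed

lemma L2_bounded_continuous:
  fixes f :: "real^2 \<Rightarrow> 'b::euclidean_space"
  assumes "open \<Omega>" "bounded \<Omega>" "continuous_on (\<Omega> - {x\<^sub>0}) f" "\<And>x. x \<in> \<Omega> - {x\<^sub>0} \<Longrightarrow> norm (f x) \<le> C"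
  shows "f \<in> L2 \<Omega>"
proof (rule L2_bounded_measurable[OF assms(1,2) _ assms(4)])
  have "f \<in> borel_measurable (lebesgue_on (\<Omega> - {x\<^sub>0}))"
    using assms(1,3) by (intro continuous_imp_measurable_on_sets_lebesgue) auto
  moreover have "sym_diff (\<Omega> - {x\<^sub>0}) \<Omega> \<subseteq> {x\<^sub>0}" by auto
  then have "negligible (sym_diff (\<Omega> - {x\<^sub>0}) \<Omega>)"
    by (rule negligible_subset[rotated]) simp
  ultimately show "f \<in> borel_measurable (lebesgue_on \<Omega>)"
    using measurable_on_spike_set[of f "\<Omega> - {x\<^sub>0}" \<Omega>] assms(1)
    by (simp add: measurable_on_iff_borel_measurable)
qed

lemma absolutely_integrable_iff_lebesgue_on:
  fixes h :: "real^2 \<Rightarrow> real"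
  assumes "open \<Omega>"
  shows "h absolutely_integrable_on \<Omega> \<longleftrightarrow> integrable (lebesgue_on \<Omega>) h"
  using assms by (simp add: integrable_restrict_space set_integrable_def)

context polar_chart
begin

section \<open>Integration over one period of the chart\<close>

definition sector :: "(real^2) set" where
  "sector = {z. 0 < z $ 1 \<and> z $ 1 < R \<and> 0 \<le> z $ 2 \<and> z $ 2 < 2 * pi}"

abbreviation "Q \<equiv> cbox (pt 0 0) (pt R (2 * pi))"

abbreviation "J z \<equiv> z $ 1 * det2 (Fs (z $ 1) (z $ 2)) (E (z $ 1) (z $ 2))"

lemma negligible_component: "negligible {z :: real^2. z $ k = c}"
  using negligible_standard_hyperplane[of "axis k 1 :: real^2" c] by (auto simp: inner_axis Basis_vec_def)

lemma sector_Q: "negligible (sym_diff sector Q)"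
proof (rule negligible_subset)
  show "negligible ({z :: real^2. z $ 1 = 0} \<union> {z. z $ 1 = R} \<union> {z. z $ 2 = 2 * pi})"
    by (intro negligible_Un negligible_component)
  show "sym_diff sector Q \<subseteq> {z. z $ 1 = 0} \<union> {z. z $ 1 = R} \<union> {z. z $ 2 = 2 * pi}"
    by (auto simp: sector_def cbox_pt)
qed

lemma sector_lebesgue: "sector \<in> sets lebesgue"
proof -
  have "sector = {z. 0 < z $ 1} \<inter> {z. z $ 1 < R} \<inter> {z. 0 \<le> z $ 2} \<inter> {z. z $ 2 < 2 * pi}"
    by (auto simp: sector_def)
  also have "\<dots> \<in> sets borel"
    by (intro sets.Int borel_open borel_closed open_Collect_less closed_Collect_le continuous_intros)
  finally show ?thesis by (simp add: sets_completionI_sets)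
qed

lemma sector_inj: "inj_on F sector"
proof (rule inj_onI)
  fix z w assume z: "z \<in> sector" and w: "w \<in> sector" and "F z = F w"
  then have "z $ 1 = w $ 1 \<and> (\<exists>k::int. z $ 2 = w $ 2 + 2 * pi * of_int k)"
    using F_inj[of "z $ 1" "w $ 1" "z $ 2" "w $ 2"] by (auto simp: sector_def)
  then obtain k :: int where k: "z $ 1 = w $ 1" "z $ 2 = w $ 2 + 2 * pi * of_int k" by auto
  then have "\<bar>2 * pi * of_int k\<bar> < 2 * pi" using z w by (auto simp: sector_def)
  then have "k = 0" by (rule small_multiple_2pi)
  then show "z = w" using k by (simp add: vec2_eq_iff)
qed

lemma \<Omega>_sector: "\<Omega> - {x\<^sub>0} \<subseteq> F ` sector"
proof
  fix x assume "x \<in> \<Omega> - {x\<^sub>0}"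
  then obtain s t where st: "0 < s" "s < R" "x = F (pt s t)" by (rule \<Omega>_cases)
  obtain k :: int where k: "0 \<le> t + 2 * pi * of_int k" "t + 2 * pi * of_int k < 2 * pi"
    by (rule angle_reduce)
  show "x \<in> F ` sector"
    using st k F_per_int[of s t k]
    by (intro image_eqI[of _ _ "pt s (t + 2 * pi * of_int k)"]) (auto simp: sector_def)
qed

lemma det_F': "det (matrix (\<lambda>h. h $ 1 *\<^sub>R Fs (z $ 1) (z $ 2) + (h $ 2 * z $ 1) *\<^sub>R E (z $ 1) (z $ 2))) = J z"
  by (simp add: det_2 matrix_def axis_def det2_def algebra_simps)

lemma F_deriv_subset:
  assumes "S \<subseteq> strip R" "z \<in> S"
  shows "(F has_derivative (\<lambda>h. h $ 1 *\<^sub>R Fs (z $ 1) (z $ 2) + (h $ 2 * z $ 1) *\<^sub>R E (z $ 1) (z $ 2))) (at z within S)"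
  using F_deriv[of "z $ 1" "z $ 2"] assms by (auto simp: strip_def intro: has_derivative_subset)

lemma J_pos: "0 < z $ 1 \<Longrightarrow> z $ 1 \<le> R \<Longrightarrow> 0 < J z"
  using det_pos[of "z $ 1" "z $ 2"] by simp

text \<open>The chart assumptions do not say that \<open>F\<close> maps the whole sector into
  \<open>\<Omega>\<close>. Hypothesis 2 makes parameters that leave \<open>\<Omega>\<close>
  contribute nothing; a test function, for instance, vanishes there.\<close>

lemma integral_\<Omega>_sector:
  fixes h :: "real^2 \<Rightarrow> real"
  assumes A: "A absolutely_integrable_on sector"
    and 1: "\<And>z. z \<in> sector \<Longrightarrow> F z \<in> \<Omega> \<Longrightarrow> J z * h (F z) = A z"
    and 2: "\<And>z. z \<in> sector \<Longrightarrow> F z \<notin> \<Omega> \<Longrightarrow> A z = 0"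
  shows "h absolutely_integrable_on \<Omega>" "integral \<Omega> h = integral sector A"
proof -
  define H where "H x = (if x \<in> \<Omega> then h x else 0)" for x
  have eq: "\<bar>J z\<bar> * H (F z) = A z" if "z \<in> sector" for z
    using 1[OF that] 2[OF that] J_pos[of z] that by (auto simp: H_def sector_def)
  have A': "(\<lambda>z. \<bar>J z\<bar> * H (F z)) absolutely_integrable_on sector"
    by (rule absolutely_integrable_spike[OF A negligible_empty]) (simp add: eq)
  have I: "integral sector (\<lambda>z. \<bar>J z\<bar> * H (F z)) = integral sector A"
    by (rule integral_cong) (rule eq)
  have D: "(F has_derivative (\<lambda>h. h $ 1 *\<^sub>R Fs (z $ 1) (z $ 2) + (h $ 2 * z $ 1) *\<^sub>R E (z $ 1) (z $ 2))) (at z within sector)"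
    if "z \<in> sector" for z
    by (rule F_deriv_subset[OF _ that]) (auto simp: sector_def strip_def)
  have "H absolutely_integrable_on F ` sector \<and> integral (F ` sector) H = integral sector A"
    using has_absolute_integral_change_of_variables_real[OF sector_lebesgue D sector_inj, of H "integral sector A"] A' I
    by (simp add: det_F')
  then have H: "(\<lambda>x. if x \<in> F ` sector then H x else 0) absolutely_integrable_on UNIV"
    "integral UNIV (\<lambda>x. if x \<in> F ` sector then H x else 0) = integral sector A"
    by (simp_all only: absolutely_integrable_restrict_UNIV integral_restrict_UNIV)
  have n: "negligible {x\<^sub>0}" by simp
  have e: "(if x \<in> \<Omega> then h x else 0) = (if x \<in> F ` sector then H x else 0)" if "x \<in> UNIV - {x\<^sub>0}" for x
    using \<Omega>_sector that by (auto simp: H_def)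
  have "(\<lambda>x. if x \<in> \<Omega> then h x else 0) absolutely_integrable_on UNIV"
    by (rule absolutely_integrable_spike[OF H(1) n e])
  then show "h absolutely_integrable_on \<Omega>" by (simp only: absolutely_integrable_restrict_UNIV)
  have "integral UNIV (\<lambda>x. if x \<in> F ` sector then H x else 0) = integral UNIV (\<lambda>x. if x \<in> \<Omega> then h x else 0)"
    by (rule integral_spike[OF n e])
  then have "integral UNIV (\<lambda>x. if x \<in> \<Omega> then h x else 0) = integral sector A"
    unfolding H(2) ..
  then show "integral \<Omega> h = integral sector A" by (simp only: integral_restrict_UNIV)
qed

lemma continuous_on_Q:
  assumes "continuous_on ({0..R} \<times> UNIV) (\<lambda>(s, t). g s t)"
  shows "continuous_on Q (\<lambda>z. g (z $ 1) (z $ 2))"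
proof -
  have "continuous_on Q (\<lambda>z. case (z $ 1, z $ 2) of (s, t) \<Rightarrow> g s t)"
    by (rule continuous_on_compose2[OF assms]) (auto simp: cbox_pt intro!: continuous_intros)
  then show ?thesis by simp
qed

lemma integral_sector_continuous:
  fixes A :: "real^2 \<Rightarrow> real"
  assumes "continuous_on Q A"
  shows "A absolutely_integrable_on sector" "integral sector A = integral Q A"
proof -
  have "A absolutely_integrable_on Q" by (rule absolutely_integrable_continuous[OF assms])
  then show "A absolutely_integrable_on sector"
    using absolutely_integrable_spike_set_eq[of sector Q A] sector_Q
    by (auto intro: negligible_subset)
  show "integral sector A = integral Q A"
    by (rule integral_spike_set) (use sector_Q in \<open>auto intro: negligible_subset\<close>)
qed

text \<open>
  In the chart the curl pairing becomes \<open>\<integral> X\<^sub>1 \<partial>\<^sub>t\<psi> - X\<^sub>2 \<partial>\<^sub>s\<psi>\<close>; the boundary terms vanish by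
  periodicity, because \<open>\<psi>\<close> vanishes at \<open>s = R\<close>, and because \<open>X\<^sub>2\<close> vanishes at the pole.
\<close>

lemma weak_curl_chart:
  assumes X1: "continuous_on ({0..R} \<times> UNIV) (\<lambda>(s, t). X1 s t)"
    and X2: "continuous_on ({0..R} \<times> UNIV) (\<lambda>(s, t). X2 s t)"
    and dX1: "continuous_on ({0..R} \<times> UNIV) (\<lambda>(s, t). dX1 s t)"
    and dX2: "continuous_on ({0..R} \<times> UNIV) (\<lambda>(s, t). dX2 s t)"
    and d1: "\<And>s t. s \<in> {0..R} \<Longrightarrow> (X1 s has_real_derivative dX1 s t) (at t)"
    and d2: "\<And>s t. s \<in> {0..R} \<Longrightarrow> ((\<lambda>s. X2 s t) has_real_derivative dX2 s t) (at s within {0..R})"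
    and per: "\<And>s t. s \<in> {0..R} \<Longrightarrow> X1 s (t + 2 * pi) = X1 s t"
    and X2_0: "\<And>t. X2 0 t = 0"
    and v: "\<And>s t. 0 < s \<Longrightarrow> s < R \<Longrightarrow> F (pt s t) \<in> \<Omega> \<Longrightarrow> v (F (pt s t)) = cov (X1 s t) (X2 s t / s) s t"
    and c: "\<And>s t. 0 < s \<Longrightarrow> s < R \<Longrightarrow> F (pt s t) \<in> \<Omega> \<Longrightarrow>
      c (F (pt s t)) = (dX2 s t - dX1 s t) / (s * det2 (Fs s t) (E s t))"
  shows "weak_curl \<Omega> v c"
  unfolding weak_curl_def
proof
  fix \<psi> assume psi: "\<psi> \<in> test_functions \<Omega>"
  obtain q where q: "continuous_on UNIV q" "\<And>x. GDERIV \<psi> x :> q x" "\<And>k x. partial k \<psi> x = q x $ k"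
    using test_function_GDERIV[OF psi] by blast
  obtain K where K: "compact K" "K \<subseteq> \<Omega>" "\<And>x. x \<notin> K \<Longrightarrow> \<psi> x = 0"
    using psi unfolding test_functions_def by blast
  have q0: "q x = 0" if "x \<notin> K" for x
  proof -
    have "(\<psi> has_derivative (\<lambda>h. h \<bullet> q x)) (at x)" using q(2)[of x]
      by (simp add: gderiv_def)
    moreover have "(\<psi> has_derivative (\<lambda>h. 0)) (at x)"
      by (rule has_derivative_transform_within_open[of "\<lambda>_. 0" _ _ _ "- K"])
        (use compact_imp_closed[OF K(1)] that K(3) in auto)
    ultimately have "(\<lambda>h. h \<bullet> q x) = (\<lambda>h. 0)" by (rule has_derivative_unique)
    then show ?thesis by (metis inner_eq_zero_iff)
  qed
  define ps where "ps s t = Fs s t \<bullet> q (F (pt s t))" for s t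
  define pe where "pe s t = s * (E s t \<bullet> q (F (pt s t)))" for s t
  define p0 where "p0 s t = \<psi> (F (pt s t))" for s t
  have cq: "continuous_on ({0..R} \<times> UNIV) (\<lambda>(s, t). q (F (pt s t)))"
    using continuous_on_compose2[OF q(1) F_cont2] by (simp add: case_prod_beta)
  have \<psi>c: "continuous_on UNIV \<psi>"
    using q(2) by (meson continuous_at_imp_continuous_on gderiv_def has_derivative_continuous)
  have cp: "continuous_on ({0..R} \<times> UNIV) (\<lambda>(s, t). p0 s t)"
    using continuous_on_compose2[OF \<psi>c F_cont2] by (simp add: case_prod_beta p0_def)
  have cps: "continuous_on ({0..R} \<times> UNIV) (\<lambda>(s, t). ps s t)" "continuous_on ({0..R} \<times> UNIV) (\<lambda>(s, t). pe s t)"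
    using cq Fs_cont E_cont unfolding ps_def pe_def case_prod_beta by (auto intro!: continuous_intros)
  have dF: "((\<lambda>z. \<psi> (F z)) has_derivative (\<lambda>h. h $ 1 * ps s t + h $ 2 * pe s t)) (at (pt s t) within strip R)"
    if "s \<in> {0..R}" for s t
  proof -
    have "(\<psi> has_derivative (\<lambda>h. h \<bullet> q (F (pt s t)))) (at (F (pt s t)))" using q(2)
      by (simp add: gderiv_def)
    from has_derivative_compose[OF F_deriv[OF that] this] show ?thesis
      by (simp add: ps_def pe_def inner_add_left mult.assoc)
  qed
  have dp1: "((\<lambda>s. p0 s t) has_real_derivative ps s t) (at s within {0..R})" if "s \<in> {0..R}" for s t
  proof -
    have "((\<lambda>s. pt s t) has_derivative (\<lambda>h. pt h 0)) (at s within {0..R})"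
      by (rule has_derivative_pt) (auto intro!: derivative_eq_intros)
    moreover have sub: "(\<lambda>s. pt s t) ` {0..R} \<subseteq> strip R" by (auto simp: strip_def)
    have "((\<lambda>z. \<psi> (F z)) has_derivative (\<lambda>h. h $ 1 * ps s t + h $ 2 * pe s t)) (at (pt s t) within (\<lambda>s. pt s t) ` {0..R})"
      by (rule has_derivative_subset[OF dF[OF that] sub])
    ultimately have "((\<lambda>s. \<psi> (F (pt s t))) has_derivative (\<lambda>h. pt h 0 $ 1 * ps s t + pt h 0 $ 2 * pe s t)) (at s within {0..R})"
      by (rule has_derivative_in_compose)
    then show ?thesis by (simp add: has_field_derivative_def p0_def mult_commute_abs)
  qed
  have dp2: "(p0 s has_real_derivative pe s t) (at t)" if "s \<in> {0..R}" for s t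
  proof -
    have "((\<lambda>t. pt s t) has_derivative (\<lambda>h. pt 0 h)) (at t within UNIV)"
      by (rule has_derivative_pt) (auto intro!: derivative_eq_intros)
    moreover have sub: "(\<lambda>t. pt s t) ` UNIV \<subseteq> strip R" using that by (auto simp: strip_def)
    have "((\<lambda>z. \<psi> (F z)) has_derivative (\<lambda>h. h $ 1 * ps s t + h $ 2 * pe s t)) (at (pt s t) within (\<lambda>t. pt s t) ` UNIV)"
      by (rule has_derivative_subset[OF dF[OF that] sub])
    ultimately have "((\<lambda>t. \<psi> (F (pt s t))) has_derivative (\<lambda>h. pt 0 h $ 1 * ps s t + pt 0 h $ 2 * pe s t)) (at t within UNIV)"
      by (rule has_derivative_in_compose)
    then show ?thesis by (simp add: has_field_derivative_def p0_def[abs_def] mult_commute_abs)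
  qed
  \<comment> \<open>\<open>A\<close> and \<open>B\<close> are the two integrands of the weak curl
    identity, multiplied by the Jacobian and written in the chart; \<open>ps\<close> and
    \<open>pe\<close> are the \<open>s\<close>- and \<open>t\<close>-derivatives of the test
    function \<open>p0\<close>.\<close>
  define A where "A z = X1 (z $ 1) (z $ 2) * pe (z $ 1) (z $ 2) - X2 (z $ 1) (z $ 2) * ps (z $ 1) (z $ 2)" for z :: "real^2"
  define B where "B z = (dX2 (z $ 1) (z $ 2) - dX1 (z $ 1) (z $ 2)) * p0 (z $ 1) (z $ 2)" for z :: "real^2"
  note CQ = continuous_on_Q[OF X1] continuous_on_Q[OF X2] continuous_on_Q[OF dX1] continuous_on_Q[OF dX2]
    continuous_on_Q[OF cp] continuous_on_Q[OF cps(1)] continuous_on_Q[OF cps(2)]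
  have cA: "continuous_on Q A" unfolding A_def by (intro continuous_intros CQ)
  have cB: "continuous_on Q B" unfolding B_def by (intro continuous_intros CQ)
  have "integral Q (\<lambda>z. X1 (z $ 1) (z $ 2) * pe (z $ 1) (z $ 2) + dX1 (z $ 1) (z $ 2) * p0 (z $ 1) (z $ 2)) = 0"
  proof (rule integral_cbox_deriv_2[where g = "\<lambda>z. X1 (z $ 1) (z $ 2) * p0 (z $ 1) (z $ 2)"])
    show "continuous_on Q (\<lambda>z. X1 (z $ 1) (z $ 2) * pe (z $ 1) (z $ 2) + dX1 (z $ 1) (z $ 2) * p0 (z $ 1) (z $ 2))"
      by (intro continuous_intros CQ)
    fix s t assume s: "s \<in> {0..R}"
    show "((\<lambda>t. X1 (pt s t $ 1) (pt s t $ 2) * p0 (pt s t $ 1) (pt s t $ 2)) has_real_derivative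
      X1 (pt s t $ 1) (pt s t $ 2) * pe (pt s t $ 1) (pt s t $ 2) + dX1 (pt s t $ 1) (pt s t $ 2) * p0 (pt s t $ 1) (pt s t $ 2))
        (at t within {0..2 * pi})"
      unfolding pt_nth
      by (intro DERIV_mult' has_field_derivative_at_within[OF d1] has_field_derivative_at_within[OF dp2] s)
  next
    fix s assume s: "s \<in> {0..R}"
    show "X1 (pt s 0 $ 1) (pt s 0 $ 2) * p0 (pt s 0 $ 1) (pt s 0 $ 2)
      = X1 (pt s (2 * pi) $ 1) (pt s (2 * pi) $ 2) * p0 (pt s (2 * pi) $ 1) (pt s (2 * pi) $ 2)"
      using per[OF s, of 0] F_per[OF s, of 0] by (simp add: p0_def)
  qed simp
  moreover have "integral Q (\<lambda>z. X2 (z $ 1) (z $ 2) * ps (z $ 1) (z $ 2) + dX2 (z $ 1) (z $ 2) * p0 (z $ 1) (z $ 2)) = 0"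
  proof (rule integral_cbox_deriv_1[where g = "\<lambda>z. X2 (z $ 1) (z $ 2) * p0 (z $ 1) (z $ 2)"])
    show "continuous_on Q (\<lambda>z. X2 (z $ 1) (z $ 2) * ps (z $ 1) (z $ 2) + dX2 (z $ 1) (z $ 2) * p0 (z $ 1) (z $ 2))"
      by (intro continuous_intros CQ)
    fix s t assume s: "s \<in> {0..R}"
    show "((\<lambda>s. X2 (pt s t $ 1) (pt s t $ 2) * p0 (pt s t $ 1) (pt s t $ 2)) has_real_derivative
      X2 (pt s t $ 1) (pt s t $ 2) * ps (pt s t $ 1) (pt s t $ 2) + dX2 (pt s t $ 1) (pt s t $ 2) * p0 (pt s t $ 1) (pt s t $ 2))
        (at s within {0..R})"
      unfolding pt_nth by (intro DERIV_mult' d2 dp1 s)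
  next
    fix t
    have "p0 R t = 0" using K(2,3) F_outer[of t] by (auto simp: p0_def)
    then show "X2 (pt 0 t $ 1) (pt 0 t $ 2) * p0 (pt 0 t $ 1) (pt 0 t $ 2)
      = X2 (pt R t $ 1) (pt R t $ 2) * p0 (pt R t $ 1) (pt R t $ 2)" using X2_0 by simp
  qed (use R_pos in simp)
  ultimately have "integral Q (\<lambda>z. (X1 (z $ 1) (z $ 2) * pe (z $ 1) (z $ 2) + dX1 (z $ 1) (z $ 2) * p0 (z $ 1) (z $ 2))
     - (X2 (z $ 1) (z $ 2) * ps (z $ 1) (z $ 2) + dX2 (z $ 1) (z $ 2) * p0 (z $ 1) (z $ 2))) = 0 - 0"
    by (subst integral_diff) (auto intro!: integrable_continuous continuous_intros CQ)
  moreover have "(X1 (z $ 1) (z $ 2) * pe (z $ 1) (z $ 2) + dX1 (z $ 1) (z $ 2) * p0 (z $ 1) (z $ 2))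
     - (X2 (z $ 1) (z $ 2) * ps (z $ 1) (z $ 2) + dX2 (z $ 1) (z $ 2) * p0 (z $ 1) (z $ 2)) = A z - B z" for z :: "real^2"
    by (simp add: A_def B_def algebra_simps)
  ultimately have "integral Q (\<lambda>z. A z - B z) = 0" by simp
  then have AB: "integral Q A = integral Q B"
    using cA cB by (subst (asm) integral_diff) (auto intro: integrable_continuous)
  have "(LINT x|lebesgue_on \<Omega>. v x $ 1 * partial 2 \<psi> x - v x $ 2 * partial 1 \<psi> x) = integral sector A"
  proof -
    let ?h = "\<lambda>x. v x $ 1 * partial 2 \<psi> x - v x $ 2 * partial 1 \<psi> x"
    have 1: "J z * ?h (F z) = A z" if z: "z \<in> sector" "F z \<in> \<Omega>" for z
    proof -
      define s t where "s = z $ 1" "t = z $ 2"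
      have s: "0 < s" "s < R" and zz: "z = pt s t" using z by (auto simp: sector_def s_t_def)
      have dd: "det2 (Fs s t) (E s t) \<noteq> 0" using det_pos[of s t] s by simp
      have vv: "v (F z) = cov (X1 s t) (X2 s t / s) s t" using v[OF s] z zz by simp
      \<comment> \<open>Cramer's rule turns the cross product of \<open>v\<close> with the gradient
        \<open>q\<close>, times the determinant, into the pairings of \<open>q\<close> with
        \<open>Fs\<close> and \<open>E\<close>.\<close>
      have "J z * ?h (F z) = s * (X1 s t * (E s t \<bullet> q (F z)) - X2 s t / s * (Fs s t \<bullet> q (F z)))"
        unfolding vv q(3) using dd s
        by (simp add: s_t_def[symmetric] cov_def inner_vec2) (simp add: field_simps)
      also have "\<dots> = A z" using s by (simp add: A_def pe_def ps_def zz right_diff_distrib)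
      finally show ?thesis .
    qed
    have 2: "A z = 0" if z: "z \<in> sector" "F z \<notin> \<Omega>" for z
    proof -
      have "q (F z) = 0" using q0 K(2) z by blast
      then show ?thesis by (simp add: A_def pe_def ps_def)
    qed
    note I = integral_\<Omega>_sector[OF integral_sector_continuous(1)[OF cA] 1 2]
    show ?thesis using I open_\<Omega>
      by (simp add: lebesgue_integral_eq_integral absolutely_integrable_iff_lebesgue_on)
  qed
  also have "\<dots> = integral sector B" using AB by (simp add: integral_sector_continuous cA cB)
  also have "\<dots> = (LINT x|lebesgue_on \<Omega>. c x * \<psi> x)"
  proof -
    have 1: "J z * (c (F z) * \<psi> (F z)) = B z" if z: "z \<in> sector" "F z \<in> \<Omega>" for z
    proof -
      define s t where "s = z $ 1" "t = z $ 2"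
      have s: "0 < s" "s < R" and zz: "z = pt s t" using z by (auto simp: sector_def s_t_def)
      have dd: "det2 (Fs s t) (E s t) \<noteq> 0" using det_pos[of s t] s by simp
      have "c (F z) = (dX2 s t - dX1 s t) / (s * det2 (Fs s t) (E s t))" using c[OF s] z zz by simp
      then show ?thesis using dd s by (simp add: s_t_def[symmetric] B_def p0_def) (simp add: zz)
    qed
    have 2: "B z = 0" if z: "z \<in> sector" "F z \<notin> \<Omega>" for z
    proof -
      have "\<psi> (F z) = 0" using K(2,3) z by blast
      then show ?thesis by (simp add: B_def p0_def)
    qed
    note I = integral_\<Omega>_sector[OF integral_sector_continuous(1)[OF cB] 1 2]
    show ?thesis using I open_\<Omega>
      by (simp add: lebesgue_integral_eq_integral absolutely_integrable_iff_lebesgue_on)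
  qed
  finally show "(LINT x|lebesgue_on \<Omega>. v x $ 1 * partial 2 \<psi> x - v x $ 2 * partial 1 \<psi> x)
    = (LINT x|lebesgue_on \<Omega>. c x * \<psi> x)" .
qed

text \<open>The bound on \<open>g\<close> cancels the \<open>s\<close> in the denominator, and the
  determinant has a positive minimum over one period. Measurability of \<open>f\<close> is a
  by-product of the change of variables, which also serves discontinuous \<open>g\<close>.\<close>

lemma L2_chart:
  fixes f :: "real^2 \<Rightarrow> real"
  assumes m: "(\<lambda>z::real^2. g (z $ 1) (z $ 2)) \<in> borel_measurable borel"
    and bd: "\<And>s t. s \<in> {0..R} \<Longrightarrow> \<bar>g s t\<bar> \<le> C * s"
    and f: "\<And>s t. 0 < s \<Longrightarrow> s < R \<Longrightarrow> F (pt s t) \<in> \<Omega> \<Longrightarrow> f (F (pt s t)) = g s t / (s * det2 (Fs s t) (E s t))"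
  shows "f \<in> L2 \<Omega>"
proof -
  define A where "A z = (if F z \<in> \<Omega> then g (z $ 1) (z $ 2) else 0)" for z
  have "A absolutely_integrable_on sector"
  proof (rule measurable_bounded_by_integrable_imp_absolutely_integrable[OF _ sector_lebesgue])
    have "continuous_on sector F" by (rule continuous_on_subset[OF F_cont]) (auto simp: sector_def strip_def)
    \<comment> \<open>An open set with the same trace on the sector as the preimage of
      \<open>\<Omega>\<close> makes the cut-off Borel measurable.\<close>
    then obtain V where V: "open V" "V \<inter> sector = F -` \<Omega> \<inter> sector"
      using open_\<Omega> continuous_on_open_invariant by metis
    have "(\<lambda>z. indicator V z * g (z $ 1) (z $ 2)) \<in> borel_measurable borel"
      using m V(1) by (intro borel_measurable_times borel_measurable_indicator) auto
    then have "(\<lambda>z. indicator V z * g (z $ 1) (z $ 2)) \<in> borel_measurable lborel" by simp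
    then have "(\<lambda>z. indicator V z * g (z $ 1) (z $ 2)) \<in> borel_measurable lebesgue"
      by (rule measurable_completion)
    then have "(\<lambda>z. indicator V z * g (z $ 1) (z $ 2)) \<in> borel_measurable (lebesgue_on sector)"
      by (rule measurable_restrict_space1)
    moreover have "indicator V z * g (z $ 1) (z $ 2) = A z" if "z \<in> sector" for z
      using V(2) that by (auto simp: A_def indicator_def)
    ultimately show "A \<in> borel_measurable (lebesgue_on sector)"
      by (subst measurable_cong[of _ _ "\<lambda>z. indicator V z * g (z $ 1) (z $ 2)"]) (auto simp: space_restrict_space)
    have "continuous_on Q (\<lambda>z::real^2. C * z $ 1)" by (intro continuous_intros)
    from integral_sector_continuous(1)[OF this] show "(\<lambda>z::real^2. C * z $ 1) integrable_on sector"
      by (rule set_lebesgue_integral_eq_integral(1))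
    fix y assume y: "y \<in> sector"
    then have "\<bar>g (y $ 1) (y $ 2)\<bar> \<le> C * y $ 1" by (intro bd) (auto simp: sector_def)
    moreover from this have "0 \<le> C * y $ 1" by linarith
    ultimately show "norm (A y) \<le> C * y $ 1" by (simp add: A_def)
  qed
  moreover have "J z * f (F z) = A z" if "z \<in> sector" "F z \<in> \<Omega>" for z
    using f[of "z $ 1" "z $ 2"] J_pos[of z] that by (auto simp: sector_def A_def)
  moreover have "A z = 0" if "z \<in> sector" "F z \<notin> \<Omega>" for z using that(2)
    by (simp only: A_def if_False)
  ultimately have "f absolutely_integrable_on \<Omega>" by (rule integral_\<Omega>_sector(1))
  then have "f \<in> borel_measurable (lebesgue_on \<Omega>)"
    using open_\<Omega> by (simp add: absolutely_integrable_iff_lebesgue_on borel_measurable_integrable)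
  moreover
  have cd: "continuous_on ({0..R} \<times> {0..2 * pi}) (\<lambda>z. det2 (Fs (fst z) (snd z)) (E (fst z) (snd z)))"
    unfolding det2_def
    using continuous_on_subset[OF Fs_cont, of "{0..R} \<times> {0..2 * pi}"] continuous_on_subset[OF E_cont, of "{0..R} \<times> {0..2 * pi}"]
    by (auto simp: case_prod_beta intro!: continuous_intros)
  obtain z0 where z0: "z0 \<in> {0..R} \<times> {0..2 * pi}"
    "\<And>z. z \<in> {0..R} \<times> {0..2 * pi} \<Longrightarrow> det2 (Fs (fst z0) (snd z0)) (E (fst z0) (snd z0)) \<le> det2 (Fs (fst z) (snd z)) (E (fst z) (snd z))"
    using continuous_attains_inf[OF _ _ cd] R_pos by (force intro: compact_Times)
  define \<mu> where "\<mu> = det2 (Fs (fst z0) (snd z0)) (E (fst z0) (snd z0))"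
  have mu: "0 < \<mu>" unfolding \<mu>_def using z0(1) by (intro det_pos) auto
  have "norm (f x) \<le> C / \<mu>" if x: "x \<in> \<Omega> - {x\<^sub>0}" for x
  proof -
    obtain z where zs: "z \<in> sector" "x = F z" using \<Omega>_sector x by blast
    define s t where "s = z $ 1" "t = z $ 2"
    have s: "0 < s" "s < R" "t \<in> {0..2 * pi}" and zz: "z = pt s t" using zs
      by (auto simp: sector_def s_t_def)
    have d: "\<mu> \<le> det2 (Fs s t) (E s t)" unfolding \<mu>_def using z0(2)[of "(s, t)"] s by auto
    have "f x = g s t / (s * det2 (Fs s t) (E s t))" using f[OF s(1,2), of t] x zs zz by simp
    then have "norm (f x) = \<bar>g s t\<bar> / (s * det2 (Fs s t) (E s t))" using s d mu
      by (simp add: abs_mult)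
    also have "\<dots> \<le> (C * s) / (s * \<mu>)"
    proof (rule frac_le)
      show "\<bar>g s t\<bar> \<le> C * s" using bd s by auto
      then show "0 \<le> C * s" by linarith
      show "s * \<mu> \<le> s * det2 (Fs s t) (E s t)" using s d by simp
      show "0 < s * \<mu>" using s mu by simp
    qed
    also have "\<dots> = C / \<mu>" using s by simp
    finally show ?thesis .
  qed
  ultimately show ?thesis by (rule L2_bounded_measurable[OF open_\<Omega> bounded_\<Omega>])
qed

text \<open>Squaring produces \<open>1 / s^2\<close> and the Jacobian gives back only one factor
  \<open>s\<close>, so near the pole the integrand dominates a multiple of
  \<open>1 / s\<close>.\<close>

lemma not_L2_chart:
  fixes f :: "real^2 \<Rightarrow> real"
  assumes f: "\<And>s t. 0 < s \<Longrightarrow> s < R \<Longrightarrow> F (pt s t) \<in> \<Omega> \<Longrightarrow> f (F (pt s t)) = g s t / (s * det2 (Fs s t) (E s t))"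
    and ab: "0 \<le> a" "a < b" "b \<le> 2 * pi" and "0 < e" "0 < \<eta>"
    and g: "\<And>s t. 0 < s \<Longrightarrow> s < e \<Longrightarrow> a < t \<Longrightarrow> t < b \<Longrightarrow> \<eta> \<le> \<bar>g s t\<bar>"
  shows "f \<notin> L2 \<Omega>"
proof
  assume "f \<in> L2 \<Omega>"
  then have L2: "(\<lambda>x. (f x)\<^sup>2) absolutely_integrable_on \<Omega>"
    using open_\<Omega> by (simp add: L2_def absolutely_integrable_iff_lebesgue_on)
  obtain e0 where e0: "0 < e0" "e0 \<le> R" "\<And>s t. 0 \<le> s \<Longrightarrow> s < e0 \<Longrightarrow> F (pt s t) \<in> \<Omega>"
    using F_near_pole by blast
  define r where "r = min e e0"
  have r: "0 < r" "r \<le> e" "r \<le> e0" using e0 \<open>0 < e\<close> by (auto simp: r_def)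
  let ?B = "box (pt 0 a) (pt r b)"
  have Bs: "?B \<subseteq> sector" using r e0 ab by (auto simp: box_pt sector_def)
  have cB: "continuous_on ?B F"
    by (rule continuous_on_subset[OF F_cont]) (use Bs in \<open>auto simp: sector_def strip_def\<close>)
  have iB: "inj_on F ?B" using sector_inj Bs by (rule inj_on_subset)
  have "open (F ` ?B)" by (rule invariance_of_domain[OF cB open_box iB])
  moreover have "F ` ?B \<subseteq> \<Omega>"
  proof clarify
    fix z assume "z \<in> ?B"
    then show "F z \<in> \<Omega>" using e0(3)[of "z $ 1" "z $ 2"] r by (simp add: box_pt)
  qed
  ultimately have "(\<lambda>x. (f x)\<^sup>2) absolutely_integrable_on F ` ?B"
    by (intro set_integrable_subset[OF L2]) auto
  moreover have D: "(F has_derivative (\<lambda>h. h $ 1 *\<^sub>R Fs (z $ 1) (z $ 2) + (h $ 2 * z $ 1) *\<^sub>R E (z $ 1) (z $ 2))) (at z within ?B)"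
    if "z \<in> ?B" for z
    by (rule F_deriv_subset[OF _ that]) (use Bs in \<open>auto simp: sector_def strip_def\<close>)
  ultimately have I: "(\<lambda>z. \<bar>J z\<bar> * (f (F z))\<^sup>2) absolutely_integrable_on ?B"
    using has_absolute_integral_change_of_variables_real[OF _ D iB, of "\<lambda>x. (f x)\<^sup>2"]
    by (auto simp: det_F')
  have cd: "continuous_on ({0..R} \<times> {0..2 * pi}) (\<lambda>z. det2 (Fs (fst z) (snd z)) (E (fst z) (snd z)))"
    unfolding det2_def
    using continuous_on_subset[OF Fs_cont, of "{0..R} \<times> {0..2 * pi}"] continuous_on_subset[OF E_cont, of "{0..R} \<times> {0..2 * pi}"]
    by (auto simp: case_prod_beta intro!: continuous_intros)
  obtain z0 where z0: "z0 \<in> {0..R} \<times> {0..2 * pi}"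
    "\<And>z. z \<in> {0..R} \<times> {0..2 * pi} \<Longrightarrow> det2 (Fs (fst z) (snd z)) (E (fst z) (snd z)) \<le> det2 (Fs (fst z0) (snd z0)) (E (fst z0) (snd z0))"
    using continuous_attains_sup[OF _ _ cd] R_pos by (force intro: compact_Times)
  define \<mu> where "\<mu> = det2 (Fs (fst z0) (snd z0)) (E (fst z0) (snd z0))"
  have mu: "0 < \<mu>" unfolding \<mu>_def using z0(1) by (intro det_pos) auto
  have "(\<lambda>z::real^2. 1 / z $ 1) absolutely_integrable_on ?B"
  proof (rule measurable_bounded_by_integrable_imp_absolutely_integrable)
    have "continuous_on ?B (\<lambda>z::real^2. 1 / z $ 1)" by (intro continuous_intros) (auto simp: box_pt)
    then show "(\<lambda>z::real^2. 1 / z $ 1) \<in> borel_measurable (lebesgue_on ?B)"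
      by (intro continuous_imp_measurable_on_sets_lebesgue) auto
    have "(\<lambda>z. \<bar>J z\<bar> * (f (F z))\<^sup>2) integrable_on ?B" using I
      by (rule set_lebesgue_integral_eq_integral(1))
    \<comment> \<open>\<open>\<mu>\<close> is the largest determinant over one period, so the
      pulled-back integrand is at least \<open>\<eta>\<^sup>2 / (s * \<mu>)\<close>; the constant in
      front normalizes this to \<open>1 / s\<close>.\<close>
    then show "(\<lambda>z. \<mu> / \<eta>\<^sup>2 * (\<bar>J z\<bar> * (f (F z))\<^sup>2)) integrable_on ?B"
      by (rule integrable_on_mult_right)
    fix z assume z: "z \<in> ?B"
    define s t where "s = z $ 1" "t = z $ 2"
    have s: "0 < s" "s < R" "s < e" "a < t" "t < b" and zz: "z = pt s t" using z r e0
      by (auto simp: box_pt s_t_def)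
    define d where "d = det2 (Fs s t) (E s t)"
    have d: "0 < d" "d \<le> \<mu>" unfolding d_def \<mu>_def using z0(2)[of "(s, t)"] s ab det_pos[of s t]
      by auto
    have "F z \<in> \<Omega>" using \<open>F ` ?B \<subseteq> \<Omega>\<close> z by blast
    then have "f (F z) = g s t / (s * d)" using f[OF s(1,2), of t] zz by (simp add: d_def)
    then have "\<bar>J z\<bar> * (f (F z))\<^sup>2 = (s * d) * (g s t / (s * d))\<^sup>2"
      using d s by (simp add: s_t_def[symmetric] d_def[symmetric])
    also have "\<dots> = (g s t)\<^sup>2 / (s * d)" using d s by (simp add: power2_eq_square)
    finally have e1: "\<bar>J z\<bar> * (f (F z))\<^sup>2 = (g s t)\<^sup>2 / (s * d)" .
    have "\<eta>\<^sup>2 \<le> (g s t)\<^sup>2"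
      using power_mono[OF g[OF s(1,3,4,5)], of 2] \<open>0 < \<eta>\<close> by simp
    then have "\<eta>\<^sup>2 / (s * \<mu>) \<le> (g s t)\<^sup>2 / (s * d)" using d s by (intro frac_le) auto
    then have "\<mu> / \<eta>\<^sup>2 * (\<eta>\<^sup>2 / (s * \<mu>)) \<le> \<mu> / \<eta>\<^sup>2 * (\<bar>J z\<bar> * (f (F z))\<^sup>2)"
      unfolding e1 using mu by (intro mult_left_mono) auto
    moreover have "\<mu> / \<eta>\<^sup>2 * (\<eta>\<^sup>2 / (s * \<mu>)) = 1 / s"
      using mu \<open>0 < \<eta>\<close> by simp
    ultimately show "norm (1 / z $ 1) \<le> \<mu> / \<eta>\<^sup>2 * (\<bar>J z\<bar> * (f (F z))\<^sup>2)"
      using s by (simp add: s_t_def[symmetric])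
  qed auto
  then show False using inverse_not_integrable_box[OF r(1) ab(2)] by blast
qed

end

section \<open>Tensor-product splines near the pole\<close>

text \<open>The symmetric partial sums are measurable, and at each \<open>t\<close> they are
  eventually equal to their limit.\<close>

lemma periodize_measurable:
  assumes supp: "\<And>x. f x \<noteq> 0 \<Longrightarrow> \<bar>x\<bar> \<le> R"
    and [measurable]: "f \<in> borel_measurable borel"
  shows "periodize f \<in> borel_measurable borel"
proof (rule borel_measurable_LIMSEQ_real)
  fix t :: real
  obtain K :: int where K: "R + \<bar>t\<bar> \<le> 2 * pi * of_int K" by (rule obtain_period_bound)
  have "periodize f t = (\<Sum>k\<in>{- int m..int m}. f (t + 2 * pi * of_int k))" if "nat K \<le> m" for m
  proof (rule periodize_eq_sum[OF supp _ order_refl])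
    have "2 * pi * real_of_int K \<le> 2 * pi * real_of_int (int m)" using that by (intro mult_left_mono) auto
    then show "R + \<bar>t\<bar> \<le> 2 * pi * of_int (int m)" using K by linarith
  qed
  then have "\<forall>\<^sub>F m in sequentially. (\<Sum>k\<in>{- int m..int m}. f (t + 2 * pi * of_int k)) = periodize f t"
    unfolding eventually_sequentially by metis
  then show "(\<lambda>m. \<Sum>k\<in>{- int m..int m}. f (t + 2 * pi * of_int k)) \<longlonglongrightarrow> periodize f t"
    by (rule tendsto_eventually)
qed measurable

context spline_space
begin

lemma Mt_measurable [measurable]: "Mt D j \<in> borel_measurable borel"
proof -
  have [measurable]: "periodize (angular (p - 1) (j + 1)) \<in> borel_measurable borel"
    by (rule periodize_measurable[OF angular_support]) auto
  show ?thesis unfolding Mt_eq[abs_def] by measurable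
qed

lemma Mt_nonneg: "0 \<le> Mt D j t"
  unfolding Mt_eq periodize_def using \<delta>_pos
  by (intro divide_nonneg_pos infsum_nonneg bspline_nonneg[OF mono_angle]) auto

lemma Mt_partition: "(\<Sum>j<n. Mt D j t) = 1 / \<delta>"
proof -
  have "(\<Sum>j<n. 1 * periodize (angular (p - 1) (j + 1)) t)
    = (\<Sum>m\<in>{\<lfloor>t / \<delta>\<rfloor> - 1 - int (p - 1)..\<lfloor>t / \<delta>\<rfloor> - 1}. 1 * cardinal_spline (p - 1) (t / \<delta> - real 1 - of_int m))"
    by (rule angular_lincomb[where c = "\<lambda>_. 1"]) auto
  also have "\<dots> = 1" using cardinal_spline_partition[of _ "t / \<delta> - 1" "p - 1"] by simp
  finally show ?thesis by (simp add: Mt_eq sum_divide_distrib[symmetric])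
qed

section \<open>Angular rows and tensor-product sums\<close>

definition rowB :: "(nat \<Rightarrow> real) \<Rightarrow> real \<Rightarrow> real"
  where "rowB f t = (\<Sum>j<n. f j * Bt D j t)"
definition rowM :: "(nat \<Rightarrow> real) \<Rightarrow> real \<Rightarrow> real"
  where "rowM f t = (\<Sum>j<n. f j * Mt D j t)"

abbreviation "shift f j \<equiv> f (Suc j mod n) - f j"

lemma rowB_cong: "(\<And>j. j < n \<Longrightarrow> f j = g j) \<Longrightarrow> rowB f = rowB g"
  by (auto simp: rowB_def fun_eq_iff intro!: sum.cong)

lemma rowM_cong: "(\<And>j. j < n \<Longrightarrow> f j = g j) \<Longrightarrow> rowM f = rowM g"
  by (auto simp: rowM_def fun_eq_iff intro!: sum.cong)

lemma rowB_const: "(\<And>j. j < n \<Longrightarrow> f j = y) \<Longrightarrow> rowB f t = y"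
  using Bt_partition[of t] by (simp add: rowB_def sum_distrib_left[symmetric])

lemma rowM_zero: "(\<And>j. j < n \<Longrightarrow> f j = 0) \<Longrightarrow> rowM f t = 0"
  by (simp add: rowM_def)

lemma rowB_linear: "rowB (\<lambda>j. f j - g j) t = rowB f t - rowB g t" "rowB (\<lambda>j. c * f j) t = c * rowB f t"
  "rowB (\<lambda>j. f j + g j) t = rowB f t + rowB g t"
  by (simp_all add: rowB_def left_diff_distrib distrib_right sum_subtractf sum.distrib sum_distrib_left mult.assoc)

lemma rowM_linear: "rowM (\<lambda>j. f j - g j) t = rowM f t - rowM g t" "rowM (\<lambda>j. c * f j) t = c * rowM f t"
  "rowM (\<lambda>j. f j + g j) t = rowM f t + rowM g t"
  by (simp_all add: rowM_def left_diff_distrib distrib_right sum_subtractf sum.distrib sum_distrib_left mult.assoc)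

lemma rowB_per: "rowB f (t + 2 * pi) = rowB f t" by (simp add: rowB_def Bt_periodic)
lemma rowM_per: "rowM f (t + 2 * pi) = rowM f t" by (simp add: rowM_def Mt_periodic)

lemma rowB_cont: "continuous_on UNIV (rowB f)"
  unfolding rowB_def by (intro continuous_intros Bt_continuous)

lemma rowM_cont: "2 \<le> p \<Longrightarrow> continuous_on UNIV (rowM f)"
  unfolding rowM_def by (intro continuous_intros Mt_continuous)

lemma rowM_measurable [measurable]: "rowM f \<in> borel_measurable borel"
  unfolding rowM_def by measurable

text \<open>Each \<open>Mt\<close> is nonnegative and together they sum to
  \<open>1 / \<delta>\<close>, so each is at most that; the argument covers the step functions of
  degree 1.\<close>

lemma rowM_bounded: "\<bar>rowM f t\<bar> \<le> (\<Sum>j<n. \<bar>f j\<bar>) / \<delta>"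
proof -
  have "Mt D j t \<le> 1 / \<delta>" if "j < n" for j
    using member_le_sum[of j "{..<n}" "\<lambda>j. Mt D j t"] that Mt_nonneg Mt_partition[of t] by simp
  then have "\<bar>f j * Mt D j t\<bar> \<le> \<bar>f j\<bar> * (1 / \<delta>)" if "j < n" for j
    unfolding abs_mult using that Mt_nonneg[of j t] by (intro mult_left_mono) auto
  then have "(\<Sum>j<n. \<bar>f j * Mt D j t\<bar>) \<le> (\<Sum>j<n. \<bar>f j\<bar> * (1 / \<delta>))"
    by (intro sum_mono) auto
  moreover have "\<bar>rowM f t\<bar> \<le> (\<Sum>j<n. \<bar>f j * Mt D j t\<bar>)" unfolding rowM_def
    by (rule sum_abs)
  ultimately show ?thesis by (simp add: sum_divide_distrib)
qed

lemma rowM_right_continuous: "(rowM f \<longlongrightarrow> rowM f t) (at_right t)"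
  unfolding rowM_def Mt_eq using \<delta>_pos by (intro tendsto_intros angular_right_continuous) auto

lemma rowB_deriv:
  assumes "2 \<le> p"
  shows "(rowB f has_real_derivative rowM (shift f) t) (at t)"
proof -
  have "(rowB f has_real_derivative (\<Sum>j<n. f j * (Mt D ((j + n - 1) mod n) t - Mt D j t))) (at t)"
    unfolding rowB_def by (intro DERIV_sum DERIV_cmult Bt_deriv assms) auto
  also have "(\<Sum>j<n. f j * (Mt D ((j + n - 1) mod n) t - Mt D j t)) = rowM (shift f) t"
    using sum_Bt_deriv[of t f] by (simp add: rowM_def mult.commute)
  finally show ?thesis .
qed

text \<open>Chart components of the pushed forward objects: \<open>sp0\<close> for functions,
  \<open>sps\<close> and \<open>spt\<close> for the radial and angular part of fields,
  \<open>sp2\<close> for densities.\<close>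

definition "sp0 c s t = (\<Sum>i<ns. Bs D i s * rowB (c i) t)"
definition "sps a s t = (\<Sum>i<ns - 1. Ms D i s * rowB (a i) t)"
definition "spt b s t = (\<Sum>i<ns. Bs D i s * rowM (b i) t)"
definition "sp2 c s t = (\<Sum>i<ns - 1. Ms D i s * rowM (c i) t)"

text \<open>\<open>Bs D i s / s\<close> with its limit filled in at \<open>s = 0\<close>. Thus
  \<open>spq b\<close> extends \<open>spt b s t / s\<close> to the pole once row 0 of
  \<open>b\<close> gives the zero function (\<open>spt_eq_spq\<close>).\<close>

definition "Bq i s = (if s = 0 then (if i = 1 then \<kappa> else 0) else Bs D i s / s)"
definition "spq b s t = (\<Sum>i\<in>{1..<ns}. Bq i s * rowM (b i) t)"

lemma ns_ge_2: "2 \<le> ns" using p_pos p_ns by simp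

lemma sum_split_0: "(\<Sum>i<ns. f i) = f 0 + (\<Sum>i\<in>{1..<ns}. f i)" for f :: "nat \<Rightarrow> real"
  using ns_ge_2 by (simp add: sum.atLeast_Suc_lessThan lessThan_atLeast0)

lemma sum_split_0': "(\<Sum>i<ns - 1. f i) = f 0 + (\<Sum>i\<in>{1..<ns - 1}. f i)" for f :: "nat \<Rightarrow> real"
  using ns_ge_2 by (simp add: sum.atLeast_Suc_lessThan lessThan_atLeast0)

text \<open>Glued from the relatively open pieces \<open>[0, h)\<close>, where it is the continuous
  factor of \<open>Bs_near_pole\<close>, and \<open>(0, L]\<close>, where it is a quotient of
  continuous functions.\<close>

lemma Bq_cont: "0 < i \<Longrightarrow> i < ns \<Longrightarrow> continuous_on {0..L} (Bq i)"
proof -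
  assume i: "0 < i" "i < ns"
  obtain Q where Q: "continuous_on UNIV Q" "Q 0 = (if i = 1 then \<kappa> else 0)"
    "\<And>x. 0 \<le> x \<Longrightarrow> x < h \<Longrightarrow> Bs D i x = x * Q x" using Bs_near_pole[OF i]
      by blast
  have "continuous_on ({0..<h} \<union> {0<..L}) (Bq i)"
  proof (rule continuous_on_Un_local_open)
    have "{0..<h} = ({0..<h} \<union> {0<..L}) \<inter> {..<h}" using h_pos h_le by auto
    then show "openin (top_of_set ({0..<h} \<union> {0<..L})) {0..<h}"
      by (metis openin_open_Int open_lessThan)
    have "{0<..L} = ({0..<h} \<union> {0<..L}) \<inter> {0<..}" using h_pos h_le by auto
    then show "openin (top_of_set ({0..<h} \<union> {0<..L})) {0<..L}"
      by (metis openin_open_Int open_greaterThan)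
    have "Q x = Bq i x" if "x \<in> {0..<h}" for x using Q(2) Q(3)[of x] that by (auto simp: Bq_def)
    then show "continuous_on {0..<h} (Bq i)"
      by (rule continuous_on_eq[OF continuous_on_subset[OF Q(1)], rotated]) auto
    have "continuous_on {0<..L} (Bs D i)" by (rule continuous_on_subset[OF Bs_continuous[OF i(2)]]) auto
    then have "continuous_on {0<..L} (\<lambda>x. Bs D i x / x)" by (intro continuous_intros) auto
    then show "continuous_on {0<..L} (Bq i)" by (rule continuous_on_eq) (auto simp: Bq_def)
  qed
  then show ?thesis by (rule continuous_on_subset) (use h_pos in auto)
qed

lemma spt_eq_spq: "rowM (b 0) t = 0 \<Longrightarrow> spt b s t = s * spq b s t"
proof -
  assume "rowM (b 0) t = 0"
  then have "spt b s t = (\<Sum>i\<in>{1..<ns}. Bs D i s * rowM (b i) t)" unfolding spt_def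
    by (simp add: sum_split_0)
  also have "\<dots> = (\<Sum>i\<in>{1..<ns}. s * (Bq i s * rowM (b i) t))"
  proof (intro sum.cong refl)
    fix i assume "i \<in> {1..<ns}"
    then show "Bs D i s * rowM (b i) t = s * (Bq i s * rowM (b i) t)"
      using at_pole(3)[of i] by (cases "s = 0") (auto simp: Bq_def)
  qed
  finally show ?thesis by (simp add: spq_def sum_distrib_left)
qed

lemma continuous_fst_snd:
  assumes "continuous_on {0..L} f" "continuous_on UNIV g"
  shows "continuous_on ({0..L} \<times> UNIV) (\<lambda>z. f (fst z) * g (snd z) :: real)"
  by (intro continuous_intros continuous_on_compose2[OF assms(1)] continuous_on_compose2[OF assms(2)]) auto

lemma sp0_cont: "continuous_on ({0..L} \<times> UNIV) (\<lambda>(s, t). sp0 c s t)"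
  unfolding sp0_def case_prod_beta
  by (intro continuous_on_sum continuous_fst_snd Bs_continuous rowB_cont) auto

lemma sps_cont: "2 \<le> p \<Longrightarrow> continuous_on ({0..L} \<times> UNIV) (\<lambda>(s, t). sps a s t)"
  unfolding sps_def case_prod_beta
  by (intro continuous_on_sum continuous_fst_snd Ms_continuous rowB_cont) auto

lemma spt_cont: "2 \<le> p \<Longrightarrow> continuous_on ({0..L} \<times> UNIV) (\<lambda>(s, t). spt b s t)"
  unfolding spt_def case_prod_beta
  by (intro continuous_on_sum continuous_fst_snd Bs_continuous rowM_cont) auto

lemma sp2_cont: "2 \<le> p \<Longrightarrow> continuous_on ({0..L} \<times> UNIV) (\<lambda>(s, t). sp2 c s t)"
  unfolding sp2_def case_prod_beta
  by (intro continuous_on_sum continuous_fst_snd Ms_continuous rowM_cont) auto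

lemma spq_cont: "2 \<le> p \<Longrightarrow> continuous_on ({0..L} \<times> UNIV) (\<lambda>(s, t). spq b s t)"
  unfolding spq_def case_prod_beta by (intro continuous_on_sum continuous_fst_snd Bq_cont rowM_cont) auto

lemma sp_per: "sp0 c s (t + 2 * pi) = sp0 c s t" "sps c s (t + 2 * pi) = sps c s t"
  "spt c s (t + 2 * pi) = spt c s t" "sp2 c s (t + 2 * pi) = sp2 c s t" "spq c s (t + 2 * pi) = spq c s t"
  by (simp_all add: sp0_def sps_def spt_def sp2_def spq_def rowB_per rowM_per)

lemma sp_at_pole: "sp0 c 0 t = rowB (c 0) t" "sps a 0 t = \<kappa> * rowB (a 0) t" "spq b 0 t = \<kappa> * rowM (b 1) t"
proof -
  show "sp0 c 0 t = rowB (c 0) t" unfolding sp0_def by (simp add: sum_split_0 at_pole)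
  show "sps a 0 t = \<kappa> * rowB (a 0) t" unfolding sps_def sum_split_0'
    by (auto simp: at_pole intro!: sum.neutral)
  have "spq b 0 t = (\<Sum>i\<in>{1..<ns}. if i = 1 then \<kappa> * rowM (b 1) t else 0)"
    unfolding spq_def by (intro sum.cong) (auto simp: Bq_def)
  then show "spq b 0 t = \<kappa> * rowM (b 1) t" using ns_ge_2 by simp
qed

text \<open>The angular derivative of \<open>sps\<close> and, in \<open>spt_deriv\<close>, the
  radial derivative of \<open>spt\<close> are combinations of the same products of an
  \<open>Ms\<close> with an \<open>Mt\<close>. This compatibility makes the curl of a spline field a
  spline density.\<close>

lemma sps_deriv:
  assumes "2 \<le> p"
  shows "(sps a s has_real_derivative sp2 (\<lambda>i. shift (a i)) s t) (at t)"
  unfolding sps_def[abs_def] sp2_def by (intro DERIV_sum DERIV_cmult rowB_deriv assms)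

lemma Bs_comb_deriv:
  assumes "2 \<le> p" "s \<in> {0..L}"
  shows "((\<lambda>s. \<Sum>i<ns. Bs D i s * r i) has_real_derivative (\<Sum>i<ns - 1. Ms D i s * (r (Suc i) - r i))) (at s within {0..L})"
proof -
  have "((\<lambda>s. \<Sum>i<ns. Bs D i s * r i) has_real_derivative
     (\<Sum>i<ns. ((if i = 0 then 0 else Ms D (i - 1) s) - Ms D i s) * r i)) (at s within {0..L})"
    by (intro DERIV_sum DERIV_cmult_right Bs_deriv assms) auto
  then show ?thesis using sum_Bs_deriv[of s r] by simp
qed

lemma spt_deriv:
  assumes "2 \<le> p" "s \<in> {0..L}"
  shows "((\<lambda>s. spt b s t) has_real_derivative sp2 (\<lambda>i j. b (Suc i) j - b i j) s t) (at s within {0..L})"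
  using Bs_comb_deriv[OF assms, of "\<lambda>i. rowM (b i) t"] by (simp add: spt_def sp2_def rowM_linear)

text \<open>Summation by parts in each index turns the two partial derivatives into the components
  of the spline field whose coefficients are differences of \<open>c\<close>.\<close>

lemma sp0_has_derivative:
  assumes "2 \<le> p" "s \<in> {0..L}"
  shows "((\<lambda>z. sp0 c (z $ 1) (z $ 2)) has_derivative
    (\<lambda>k. k $ 1 * sps (\<lambda>i j. c (Suc i) j - c i j) s t + k $ 2 * spt (\<lambda>i. shift (c i)) s t)) (at (pt s t) within strip L)"
proof -
  let ?B' = "\<lambda>i. (if i = 0 then 0 else Ms D (i - 1) s) - Ms D i s"
  have 1: "((\<lambda>z. Bs D i (z $ 1)) has_derivative (\<lambda>k. ?B' i * k $ 1)) (at (pt s t) within strip L)" if "i < ns" for i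
  proof -
    have p1: "((\<lambda>z::real^2. z $ 1) has_derivative (\<lambda>k. k $ 1)) (at (pt s t) within strip L)"
      by (rule bounded_linear.has_derivative[OF bounded_linear_vec_nth]) (rule has_derivative_ident)
    have "(Bs D i has_derivative (*) (?B' i)) (at (pt s t $ 1) within (\<lambda>z. z $ 1) ` strip L)"
      using Bs_deriv[OF assms(1) that assms(2)] unfolding has_field_derivative_def pt_nth
      by (rule has_derivative_subset) (auto simp: strip_def)
    from has_derivative_in_compose[OF p1 this] show ?thesis .
  qed
  have 2: "((\<lambda>z. rowB (c i) (z $ 2)) has_derivative (\<lambda>k. rowM (shift (c i)) t * k $ 2)) (at (pt s t) within strip L)" for i
  proof -
    have p2: "((\<lambda>z::real^2. z $ 2) has_derivative (\<lambda>k. k $ 2)) (at (pt s t) within strip L)"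
      by (rule bounded_linear.has_derivative[OF bounded_linear_vec_nth]) (rule has_derivative_ident)
    have "(rowB (c i) has_derivative (*) (rowM (shift (c i)) t)) (at (pt s t $ 2))"
      using rowB_deriv[OF assms(1)] unfolding has_field_derivative_def pt_nth by blast
    from has_derivative_compose[OF p2 this] show ?thesis .
  qed
  have "((\<lambda>z. sp0 c (z $ 1) (z $ 2)) has_derivative
    (\<lambda>k. \<Sum>i<ns. Bs D i (pt s t $ 1) * (rowM (shift (c i)) t * k $ 2) + (?B' i * k $ 1) * rowB (c i) (pt s t $ 2))) (at (pt s t) within strip L)"
    unfolding sp0_def by (intro has_derivative_sum has_derivative_mult 1 2) auto
  moreover have "(\<Sum>i<ns. Bs D i (pt s t $ 1) * (rowM (shift (c i)) t * k $ 2) + (?B' i * k $ 1) * rowB (c i) (pt s t $ 2))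
    = k $ 1 * sps (\<lambda>i j. c (Suc i) j - c i j) s t + k $ 2 * spt (\<lambda>i. shift (c i)) s t" for k :: "real^2"
  proof -
    have "(\<Sum>i<ns. ?B' i * rowB (c i) t) = sps (\<lambda>i j. c (Suc i) j - c i j) s t"
      using sum_Bs_deriv[of s "\<lambda>i. rowB (c i) t"] by (simp add: sps_def rowB_linear)
    moreover have "(\<Sum>i<ns. Bs D i (pt s t $ 1) * (rowM (shift (c i)) t * k $ 2) + (?B' i * k $ 1) * rowB (c i) (pt s t $ 2))
      = k $ 1 * (\<Sum>i<ns. ?B' i * rowB (c i) t) + k $ 2 * spt (\<lambda>i. shift (c i)) s t"
      unfolding pt_nth sum.distrib spt_def sum_distrib_left by (simp add: mult_ac)
    ultimately show ?thesis by simp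
  qed
  ultimately show ?thesis by simp
qed

section \<open>One-sided limits at the pole, in every degree\<close>

lemma eventually_near_pole: "\<forall>\<^sub>F s in at_right 0. s \<in> {0<..<h}"
  using eventually_at_right_real[OF h_pos] by simp

lemma tendsto_at_right_0:
  fixes Q :: "real \<Rightarrow> real"
  assumes "continuous_on UNIV Q"
  shows "(Q \<longlongrightarrow> Q 0) (at_right 0)"
  using assms by (simp add: continuous_on_def filterlim_at_split)

lemma lim_Ms_0: "(Ms D 0 \<longlongrightarrow> \<kappa>) (at_right 0)"
proof -
  have "((\<lambda>s. \<kappa> * (1 - s / h) ^ (p - 1)) \<longlongrightarrow> \<kappa> * (1 - 0 / h) ^ (p - 1)) (at_right 0)"
    using h_pos by (intro tendsto_intros) auto
  then show ?thesis
    by (subst tendsto_cong[OF eventually_mono[OF eventually_near_pole Ms_0_near_pole]]) auto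
qed

lemma lim_Ms: "0 < i \<Longrightarrow> i < ns \<Longrightarrow> (Ms D i \<longlongrightarrow> 0) (at_right 0)"
proof -
  assume i: "0 < i" "i < ns"
  obtain Q where Q: "continuous_on UNIV Q" "\<And>x. 0 \<le> x \<Longrightarrow> x < h \<Longrightarrow> Ms D i x = x * Q x"
    using Ms_near_pole[OF i] by blast
  have "((\<lambda>s. s * Q s) \<longlongrightarrow> 0 * Q 0) (at_right 0)"
    by (intro tendsto_mult tendsto_ident_at tendsto_at_right_0 Q)
  then show ?thesis by (subst tendsto_cong[OF eventually_mono[OF eventually_near_pole Q(2)]]) auto
qed

lemma lim_Bs_0: "(Bs D 0 \<longlongrightarrow> 1) (at_right 0)" "((\<lambda>s. (Bs D 0 s - 1) / s) \<longlongrightarrow> - \<kappa>) (at_right 0)"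
proof -
  have "((\<lambda>s. (1 - s / h) ^ p) \<longlongrightarrow> (1 - 0 / h) ^ p) (at_right 0)"
    using h_pos by (intro tendsto_intros) auto
  then show "(Bs D 0 \<longlongrightarrow> 1) (at_right 0)"
    by (subst tendsto_cong[OF eventually_mono[OF eventually_near_pole Bs_0_near_pole]]) auto
  have "((\<lambda>s. (1 - s / h) ^ p) has_real_derivative real p * (1 - 0 / h) ^ (p - 1) * (- (1 / h))) (at 0 within {0<..})"
    using h_pos by (auto intro!: derivative_eq_intros)
  then have "((\<lambda>s. ((1 - s / h) ^ p - 1) / s) \<longlongrightarrow> - \<kappa>) (at_right 0)"
    by (simp add: has_field_derivative_iff \<kappa>_def)
  moreover have "\<forall>\<^sub>F s in at_right 0. (Bs D 0 s - 1) / s = ((1 - s / h) ^ p - 1) / s"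
    using eventually_near_pole by eventually_elim (simp add: Bs_0_near_pole)
  ultimately show "((\<lambda>s. (Bs D 0 s - 1) / s) \<longlongrightarrow> - \<kappa>) (at_right 0)"
    by (simp only: tendsto_cong)
qed

lemma lim_Bs:
  assumes "0 < i" "i < ns"
  shows "(Bs D i \<longlongrightarrow> 0) (at_right 0)" "((\<lambda>s. Bs D i s / s) \<longlongrightarrow> (if i = 1 then \<kappa> else 0)) (at_right 0)"
proof -
  obtain Q where Q: "continuous_on UNIV Q" "Q 0 = (if i = 1 then \<kappa> else 0)"
    "\<And>x. 0 \<le> x \<Longrightarrow> x < h \<Longrightarrow> Bs D i x = x * Q x"
      using Bs_near_pole[OF assms] by blast
  have "((\<lambda>s. s * Q s) \<longlongrightarrow> 0 * Q 0) (at_right 0)"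
    by (intro tendsto_mult tendsto_ident_at tendsto_at_right_0 Q)
  then show "(Bs D i \<longlongrightarrow> 0) (at_right 0)"
    by (subst tendsto_cong[OF eventually_mono[OF eventually_near_pole Q(3)]]) auto
  have "\<forall>\<^sub>F s in at_right 0. Bs D i s / s = Q s" using eventually_near_pole
    by eventually_elim (simp add: Q(3))
  then show "((\<lambda>s. Bs D i s / s) \<longlongrightarrow> (if i = 1 then \<kappa> else 0)) (at_right 0)"
    using tendsto_at_right_0[OF Q(1)] Q(2) by (simp add: tendsto_cong)
qed

lemma lim_sps: "((\<lambda>s. sps a s t) \<longlongrightarrow> \<kappa> * rowB (a 0) t) (at_right 0)"
proof -
  have "((\<lambda>s. Ms D 0 s * rowB (a 0) t + (\<Sum>i\<in>{1..<ns - 1}. Ms D i s * rowB (a i) t)) \<longlongrightarrow>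
     \<kappa> * rowB (a 0) t + (\<Sum>i\<in>{1..<ns - 1}. 0 * rowB (a i) t)) (at_right 0)"
    by (intro tendsto_add tendsto_sum tendsto_mult tendsto_const lim_Ms_0 lim_Ms) auto
  then show ?thesis unfolding sps_def sum_split_0' by simp
qed

lemma lim_spt: "((\<lambda>s. spt b s t) \<longlongrightarrow> rowM (b 0) t) (at_right 0)"
proof -
  have "((\<lambda>s. Bs D 0 s * rowM (b 0) t + (\<Sum>i\<in>{1..<ns}. Bs D i s * rowM (b i) t)) \<longlongrightarrow>
     1 * rowM (b 0) t + (\<Sum>i\<in>{1..<ns}. 0 * rowM (b i) t)) (at_right 0)"
    by (intro tendsto_add tendsto_sum tendsto_mult tendsto_const lim_Bs_0 lim_Bs) auto
  then show ?thesis by (simp add: spt_def sum_split_0)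
qed

lemma lim_spt_quotient:
  assumes "rowM (b 0) t = 0"
  shows "((\<lambda>s. spt b s t / s) \<longlongrightarrow> \<kappa> * rowM (b 1) t) (at_right 0)"
proof -
  have "((\<lambda>s. \<Sum>i\<in>{1..<ns}. Bs D i s / s * rowM (b i) t) \<longlongrightarrow>
     (\<Sum>i\<in>{1..<ns}. (if i = 1 then \<kappa> else 0) * rowM (b i) t)) (at_right 0)"
    by (intro tendsto_sum tendsto_mult tendsto_const lim_Bs) auto
  moreover have "(\<Sum>i\<in>{1..<ns}. (if i = 1 then \<kappa> else 0) * rowM (b i) t) = \<kappa> * rowM (b 1) t"
    using ns_ge_2 by (simp add: if_distrib[of "\<lambda>x. x * _"] cong: if_cong)
  moreover have "spt b s t / s = (\<Sum>i\<in>{1..<ns}. Bs D i s / s * rowM (b i) t)" for s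
    using assms by (simp add: spt_def sum_split_0 sum_divide_distrib)
  ultimately show ?thesis by simp
qed

lemma lim_sp0: "((\<lambda>s. sp0 c s t) \<longlongrightarrow> rowB (c 0) t) (at_right 0)"
proof -
  have "((\<lambda>s. Bs D 0 s * rowB (c 0) t + (\<Sum>i\<in>{1..<ns}. Bs D i s * rowB (c i) t)) \<longlongrightarrow>
     1 * rowB (c 0) t + (\<Sum>i\<in>{1..<ns}. 0 * rowB (c i) t)) (at_right 0)"
    by (intro tendsto_add tendsto_sum tendsto_mult tendsto_const lim_Bs_0 lim_Bs) auto
  then show ?thesis by (simp add: sp0_def sum_split_0)
qed

text \<open>Row 0 contributes the slope \<open>- \<kappa>\<close> and row 1 the slope
  \<open>\<kappa>\<close>; all further rows vanish to higher order.\<close>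

lemma lim_sp0_quotient: "((\<lambda>s. (sp0 c s t - rowB (c 0) t) / s) \<longlongrightarrow> \<kappa> * (rowB (c 1) t - rowB (c 0) t)) (at_right 0)"
proof -
  have "((\<lambda>s. (Bs D 0 s - 1) / s * rowB (c 0) t + (\<Sum>i\<in>{1..<ns}. Bs D i s / s * rowB (c i) t)) \<longlongrightarrow>
     - \<kappa> * rowB (c 0) t + (\<Sum>i\<in>{1..<ns}. (if i = 1 then \<kappa> else 0) * rowB (c i) t)) (at_right 0)"
    by (intro tendsto_add tendsto_sum tendsto_mult tendsto_const lim_Bs_0 lim_Bs) auto
  moreover have "(\<Sum>i\<in>{1..<ns}. (if i = 1 then \<kappa> else 0) * rowB (c i) t) = \<kappa> * rowB (c 1) t"
    using ns_ge_2 by (simp add: if_distrib[of "\<lambda>x. x * _"] cong: if_cong)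
  moreover have "(sp0 c s t - rowB (c 0) t) / s = (Bs D 0 s - 1) / s * rowB (c 0) t + (\<Sum>i\<in>{1..<ns}. Bs D i s / s * rowB (c i) t)" for s
    unfolding sp0_def sum_split_0
    by (simp add: sum_divide_distrib diff_divide_distrib add_divide_distrib left_diff_distrib)
  ultimately show ?thesis by (simp add: right_diff_distrib)
qed

section \<open>Size of densities near the pole\<close>

lemma sp2_measurable: "(\<lambda>z::real^2. sp2 c (z $ 1) (z $ 2)) \<in> borel_measurable borel"
proof -
  have [measurable]: "(\<lambda>z::real^2. z $ k) \<in> borel_measurable borel" for k
    by (rule borel_measurable_continuous_onI) (intro continuous_intros)
  show ?thesis unfolding sp2_def by measurable
qed

text \<open>The radial factors from index 1 on are at most linear in \<open>s\<close> and the
  angular rows are bounded, so everything beyond row 0 is of order \<open>s\<close>, uniformly in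
  the angle.\<close>

lemma sp2_tail_bound:
  obtains C where "0 \<le> C" "\<And>s t. s \<in> {0..L} \<Longrightarrow> \<bar>\<Sum>i\<in>{1..<ns - 1}. Ms D i s * rowM (c i) t\<bar> \<le> C * s"
proof -
  have "\<forall>i. \<exists>A. 0 < i \<and> i < ns \<longrightarrow> (\<forall>s\<in>{0..L}. \<bar>Ms D i s\<bar> \<le> A * s)"
    using Ms_le_linear by blast
  then obtain A
    where A: "\<And>i s. 0 < i \<Longrightarrow> i < ns \<Longrightarrow> s \<in> {0..L} \<Longrightarrow> \<bar>Ms D i s\<bar> \<le> A i * s"
      by metis
  define M where "M i = (\<Sum>j<n. \<bar>c i j\<bar>) / \<delta>" for i
  have M0: "0 \<le> M i" for i using \<delta>_pos by (auto simp: M_def intro!: divide_nonneg_pos sum_nonneg)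
  have A0: "0 \<le> A i" if "0 < i" "i < ns" for i
  proof -
    have "0 \<le> A i * L" using A[OF that, of L] L_pos abs_ge_zero[of "Ms D i L"]
      by (auto intro: order_trans)
    then show ?thesis using L_pos by (simp add: zero_le_mult_iff)
  qed
  show ?thesis
  proof (rule that[of "\<Sum>i\<in>{1..<ns - 1}. A i * M i"])
    show "0 \<le> (\<Sum>i\<in>{1..<ns - 1}. A i * M i)" using A0 M0
      by (intro sum_nonneg mult_nonneg_nonneg) auto
    fix s t assume s: "s \<in> {0..L}"
    have "\<bar>\<Sum>i\<in>{1..<ns - 1}. Ms D i s * rowM (c i) t\<bar> \<le> (\<Sum>i\<in>{1..<ns - 1}. \<bar>Ms D i s * rowM (c i) t\<bar>)"
      by (rule sum_abs)
    also have "\<dots> \<le> (\<Sum>i\<in>{1..<ns - 1}. (A i * s) * M i)"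
    proof (rule sum_mono)
      fix i assume i: "i \<in> {1..<ns - 1}"
      then show "\<bar>Ms D i s * rowM (c i) t\<bar> \<le> (A i * s) * M i"
        unfolding abs_mult using A[of i s] s A0[of i] rowM_bounded[of "c i" t]
        by (intro mult_mono) (auto simp: M_def)
    qed
    finally show "\<bar>\<Sum>i\<in>{1..<ns - 1}. Ms D i s * rowM (c i) t\<bar> \<le> (\<Sum>i\<in>{1..<ns - 1}. A i * M i) * s"
      by (simp only: sum_distrib_left mult_ac)
  qed
qed

lemma sp2_split: "sp2 c s t = Ms D 0 s * rowM (c 0) t + (\<Sum>i\<in>{1..<ns - 1}. Ms D i s * rowM (c i) t)"
  unfolding sp2_def sum_split_0' ..

text \<open>Right continuity keeps row 0 away from 0 on an interval of angles, while the remaining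
  rows are of order \<open>s\<close>.\<close>

lemma sp2_bounded_away:
  assumes "rowM (c 0) t\<^sub>0 \<noteq> 0"
  obtains a b e \<eta> where "0 \<le> a" "a < b" "b \<le> 2 * pi" "0 < e" "0 < \<eta>"
    "\<And>s t. 0 < s \<Longrightarrow> s < e \<Longrightarrow> a < t \<Longrightarrow> t < b \<Longrightarrow> \<eta> \<le> \<bar>sp2 c s t\<bar>"
proof -
  obtain k :: int where k: "0 \<le> t\<^sub>0 + 2 * pi * of_int k" "t\<^sub>0 + 2 * pi * of_int k < 2 * pi"
    by (rule angle_reduce)
  define a where "a = t\<^sub>0 + 2 * pi * of_int k"
  define m where "m = \<bar>rowM (c 0) a\<bar>"
  have "rowM (c 0) a = rowM (c 0) t\<^sub>0" unfolding a_def by (rule periodic_int) (rule rowM_per)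
  then have m: "0 < m" using assms by (simp add: m_def)
  have "((\<lambda>t. \<bar>rowM (c 0) t\<bar>) \<longlongrightarrow> m) (at_right a)" unfolding m_def
    by (intro tendsto_rabs rowM_right_continuous)
  then have "\<forall>\<^sub>F t in at_right a. m / 2 < \<bar>rowM (c 0) t\<bar>"
    by (rule order_tendstoD) (use m in simp)
  then obtain b'
    where b': "a < b'" "\<And>t. a < t \<Longrightarrow> t < b' \<Longrightarrow> m / 2 < \<bar>rowM (c 0) t\<bar>"
    unfolding eventually_at_right_field by blast
  obtain C where C: "0 \<le> C" "\<And>s t. s \<in> {0..L} \<Longrightarrow> \<bar>\<Sum>i\<in>{1..<ns - 1}. Ms D i s * rowM (c i) t\<bar> \<le> C * s"
    using sp2_tail_bound[of c] by blast
  have "\<forall>\<^sub>F s in at_right 0. \<kappa> / 2 < Ms D 0 s"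
    by (rule order_tendstoD(1)[OF lim_Ms_0]) (use \<kappa>_pos in simp)
  moreover have "((\<lambda>s. C * s) \<longlongrightarrow> C * 0) (at_right 0)" by (intro tendsto_intros)
  \<comment> \<open>Row 0 will contribute at least \<open>\<kappa> m / 4\<close>, one half being
    lost in each factor, so a tail below \<open>\<kappa> m / 8\<close> leaves
    \<open>\<kappa> m / 8\<close>.\<close>
  then have "\<forall>\<^sub>F s in at_right 0. C * s < \<kappa> * m / 8"
    by (rule order_tendstoD(2)) (use m \<kappa>_pos in simp)
  moreover have "\<forall>\<^sub>F s in at_right 0. s \<in> {0<..<L}" using eventually_at_right_real[OF L_pos]
    by simp
  ultimately have "\<forall>\<^sub>F s in at_right 0. \<kappa> / 2 < Ms D 0 s \<and> C * s < \<kappa> * m / 8 \<and> s \<in> {0<..<L}"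
    by eventually_elim simp
  then obtain e
    where e: "0 < e" "\<And>s. 0 < s \<Longrightarrow> s < e \<Longrightarrow> \<kappa> / 2 < Ms D 0 s \<and> C * s < \<kappa> * m / 8 \<and> s \<in> {0<..<L}"
    unfolding eventually_at_right_field by blast
  show ?thesis
  proof (rule that[of a "min b' (2 * pi)" e "\<kappa> * m / 8"])
    show "0 \<le> a" "a < min b' (2 * pi)" "min b' (2 * pi) \<le> 2 * pi" using k b' by (auto simp: a_def)
    show "0 < e" "0 < \<kappa> * m / 8" using e m \<kappa>_pos by auto
    fix s t assume s: "0 < s" "s < e" and t: "a < t" "t < min b' (2 * pi)"
    have "\<kappa> / 2 * (m / 2) \<le> Ms D 0 s * \<bar>rowM (c 0) t\<bar>"
      using e(2)[OF s] b'(2)[of t] t m \<kappa>_pos by (intro mult_mono) auto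
    moreover have "\<bar>Ms D 0 s * rowM (c 0) t\<bar> = Ms D 0 s * \<bar>rowM (c 0) t\<bar>"
      using e(2)[OF s] \<kappa>_pos by (simp add: abs_mult)
    moreover have "\<bar>\<Sum>i\<in>{1..<ns - 1}. Ms D i s * rowM (c i) t\<bar> \<le> C * s"
      using C(2)[of s t] e(2)[OF s] by auto
    moreover have "C * s < \<kappa> * m / 8" using e(2)[OF s] by blast
    moreover have "\<kappa> / 2 * (m / 2) = 2 * (\<kappa> * m / 8)" by simp
    ultimately show "\<kappa> * m / 8 \<le> \<bar>sp2 c s t\<bar>" unfolding sp2_split by linarith
  qed
qed

end

lemma fun_upd_continuous_on:
  fixes f :: "'a::t2_space \<Rightarrow> 'b::topological_space"
  assumes "continuous_on (\<Omega> - {x\<^sub>0}) f" "open \<Omega>" "(f \<longlongrightarrow> y) (at x\<^sub>0)"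
  shows "continuous_on \<Omega> (f(x\<^sub>0 := y))"
proof (rule continuous_at_imp_continuous_on, rule ballI)
  fix x assume "x \<in> \<Omega>"
  show "isCont (f(x\<^sub>0 := y)) x"
  proof (cases "x = x\<^sub>0")
    case True
    have "((f(x\<^sub>0 := y)) \<longlongrightarrow> y) (at x\<^sub>0)"
      using assms(3) by (rule Lim_transform_eventually) (auto simp: eventually_at_filter)
    then show ?thesis using True by (simp add: isCont_def)
  next
    case False
    have "continuous_on (\<Omega> - {x\<^sub>0}) (f(x\<^sub>0 := y))" using assms(1)
      by (rule continuous_on_eq) auto
    moreover have "open (\<Omega> - {x\<^sub>0})" using assms(2) by (rule open_delete)
    ultimately show ?thesis using \<open>x \<in> \<Omega>\<close> False continuous_on_eq_continuous_at
      by blast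
  qed
qed

lemma continuous_on_fun_upd_tendsto:
  fixes f :: "'a::t2_space \<Rightarrow> 'b::topological_space"
  assumes "continuous_on \<Omega> (f(x\<^sub>0 := y))" "open \<Omega>" "x\<^sub>0 \<in> \<Omega>"
  shows "(f \<longlongrightarrow> y) (at x\<^sub>0)"
proof -
  have "isCont (f(x\<^sub>0 := y)) x\<^sub>0" using assms continuous_on_eq_continuous_at by blast
  then have "((f(x\<^sub>0 := y)) \<longlongrightarrow> y) (at x\<^sub>0)" by (simp add: isCont_def)
  then show ?thesis by (rule Lim_transform_eventually) (auto simp: eventually_at_filter)
qed

section \<open>Pushforwards\<close>

locale polar_spline = spline_space D + polar_chart "len D" F \<Omega> x\<^sub>0 Fs E
  for D F \<Omega> x\<^sub>0 Fs E
begin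

abbreviation "gradv a b s t \<equiv> cov (sps a s t) (spt b s t / s) s t"
abbreviation "densv c s t \<equiv> sp2 c s t / (s * det2 (Fs s t) (E s t))"

section \<open>Spline pushforwards in chart coordinates\<close>

lemma pcoord_strip:
  assumes "x \<in> \<Omega> - {x\<^sub>0}"
  obtains s t where "pcoord L F x = pt s t" "0 < s" "s < L" "x = F (pt s t)" "0 \<le> t" "t < 2 * pi"
proof -
  obtain s t where st: "0 < s" "s < L" "x = F (pt s t)" using \<Omega>_cases[OF assms] by blast
  obtain k :: int where k: "pcoord L F (F (pt s t)) = pt s (t + 2 * pi * of_int k)"
    "0 \<le> t + 2 * pi * of_int k" "t + 2 * pi * of_int k < 2 * pi" using pcoord_F[of s t] st by auto
  then show ?thesis using that[of s "t + 2 * pi * of_int k"] st F_per_int[of s t k] by auto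
qed

lemma comb0_eq: "comb0 D F \<Omega> x\<^sub>0 c x = (if x \<in> \<Omega> - {x\<^sub>0} then push (sp0 c) x else 0)"
proof (cases "x \<in> \<Omega> - {x\<^sub>0}")
  case True
  then show ?thesis by (simp add: comb0_def T0_def push_def sp0_def rowB_def Let_def sum_distrib_left mult_ac)
next
  case False
  then show ?thesis unfolding comb0_def T0_def by (simp only: if_False mult_zero_right sum.neutral_const)
qed

lemma cov_linear: "cov u w s t = u *\<^sub>R cov 1 0 s t + w *\<^sub>R cov 0 1 s t"
  by (simp add: cov_def vec2_eq_iff diff_divide_distrib)

lemma comb1_eq: "comb1 D F \<Omega> x\<^sub>0 a b x = (if x \<in> \<Omega> - {x\<^sub>0} then push (gradv a b) x else 0)"
proof (cases "x \<in> \<Omega> - {x\<^sub>0}")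
  case True
  obtain s t where st: "pcoord L F x = pt s t" "0 < s" "s < L" "x = F (pt s t)" using pcoord_strip[OF True]
    by metis
  have s: "s \<in> {0<..L}" using st by auto
  have T: "Ts D F \<Omega> x\<^sub>0 i j x = cov (Ms D i s * Bt D j t) 0 s t"
    "Tt D F \<Omega> x\<^sub>0 i j x = cov 0 (Bs D i s * Mt D j t / s) s t" for i j
    using True st jac_transpose_inverse[OF s] by (simp_all add: Ts_def Tt_def Let_def)
  then have T': "Ts D F \<Omega> x\<^sub>0 i j x = (Ms D i s * Bt D j t) *\<^sub>R cov 1 0 s t"
    "Tt D F \<Omega> x\<^sub>0 i j x = (Bs D i s * Mt D j t / s) *\<^sub>R cov 0 1 s t" for i j
    using cov_linear[of "Ms D i s * Bt D j t" 0 s t] cov_linear[of 0 "Bs D i s * Mt D j t / s" s t]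
    by simp_all
  have "push (gradv a b) x = gradv a b s t" by (simp add: push_def st(1))
  also have "\<dots> = cov (\<Sum>i<ns - 1. \<Sum>j<n. a i j * (Ms D i s * Bt D j t)) (\<Sum>i<ns. \<Sum>j<n. b i j * (Bs D i s * Mt D j t / s)) s t"
    by (simp add: sps_def spt_def rowB_def rowM_def sum_distrib_left sum_divide_distrib mult_ac)
  also have "\<dots> = comb1 D F \<Omega> x\<^sub>0 a b x"
    unfolding comb1_def T' by (subst cov_linear) (simp only: scaleR_sum_left scaleR_scaleR)
  finally show ?thesis using True by simp
next
  case False
  then show ?thesis unfolding comb1_def Ts_def Tt_def
    by (simp only: if_False scaleR_zero_right sum.neutral_const add_0)
qed

lemma comb2_eq: "comb2 D F \<Omega> x\<^sub>0 c x = (if x \<in> \<Omega> - {x\<^sub>0} then push (densv c) x else 0)"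
proof (cases "x \<in> \<Omega> - {x\<^sub>0}")
  case True
  obtain s t where st: "pcoord L F x = pt s t" "0 < s" "s < L" "x = F (pt s t)" using pcoord_strip[OF True]
    by metis
  have "det (jac L F (pt s t)) = s * det2 (Fs s t) (E s t)" by (rule jac_eq(3)) (use st in auto)
  then show ?thesis using True st
    by (auto simp: comb2_def T2_def Let_def push_def sp2_def rowM_def sum_distrib_left sum_divide_distrib divide_inverse mult_ac)
next
  case False
  then show ?thesis unfolding comb2_def T2_def by (simp only: if_False mult_zero_right sum.neutral_const)
qed

lemma comb0_F: "0 < s \<Longrightarrow> s < L \<Longrightarrow> F (pt s t) \<in> \<Omega> \<Longrightarrow> comb0 D F \<Omega> x\<^sub>0 c (F (pt s t)) = sp0 c s t"
  using push_F[of s "sp0 c" t] sp_per(1)[of c s] F_not_pole[of s t] by (simp add: comb0_eq)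

lemma chart_per: "s \<in> {0..L} \<Longrightarrow> cov u w s (t + 2 * pi) = cov u w s t"
  "s \<in> {0..L} \<Longrightarrow> det2 (Fs s (t + 2 * pi)) (E s (t + 2 * pi)) = det2 (Fs s t) (E s t)"
  by (simp_all add: cov_def Fs_per E_per)

lemma comb1_F: "0 < s \<Longrightarrow> s < L \<Longrightarrow> F (pt s t) \<in> \<Omega> \<Longrightarrow> comb1 D F \<Omega> x\<^sub>0 a b (F (pt s t)) = gradv a b s t"
  using push_F[of s "gradv a b" t] sp_per F_not_pole[of s t] chart_per(1)[of s] by (simp add: comb1_eq)

lemma comb2_F: "0 < s \<Longrightarrow> s < L \<Longrightarrow> F (pt s t) \<in> \<Omega> \<Longrightarrow> comb2 D F \<Omega> x\<^sub>0 c (F (pt s t)) = densv c s t"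
  using push_F[of s "densv c" t] sp_per F_not_pole[of s t] chart_per(2)[of s] by (simp add: comb2_eq)

lemma eventually_radius: "\<forall>\<^sub>F s in at_right 0. 0 < s \<and> s < L \<and> F (pt s t) \<in> \<Omega> \<and> F (pt s t) \<noteq> x\<^sub>0"
proof -
  obtain e where e: "0 < e" "e \<le> L" "\<And>s t. 0 \<le> s \<Longrightarrow> s < e \<Longrightarrow> F (pt s t) \<in> \<Omega>"
    using F_near_pole by blast
  have "\<forall>\<^sub>F s in at_right 0. s \<in> {0<..<e}" using eventually_at_right_real[OF e(1)] by simp
  then show ?thesis by eventually_elim (use e F_not_pole in auto)
qed

lemma ray_tendsto:
  fixes G :: "real \<Rightarrow> real \<Rightarrow> 'a::topological_space"
  assumes "continuous_on ({0..L} \<times> UNIV) (\<lambda>(s, t). G s t)"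
  shows "((\<lambda>s. G s t) \<longlongrightarrow> G 0 t) (at_right 0)"
proof -
  have "continuous_on {0..L} (\<lambda>s. case (s, t) of (s, t) \<Rightarrow> G s t)"
    by (rule continuous_on_compose2[OF assms]) (auto intro!: continuous_intros)
  then have "((\<lambda>s. G s t) \<longlongrightarrow> G 0 t) (at 0 within {0..L})" using L_pos
    by (simp add: continuous_on_def)
  then show ?thesis using L_pos by (simp add: at_within_Icc_at_right)
qed

lemma ray_tendsto_pole: "((\<lambda>s. F (pt s t)) \<longlongrightarrow> x\<^sub>0) (at_right 0)"
  using ray_tendsto[OF F_cont2, of t] by (simp add: F_pole)

text \<open>For fixed \<open>t\<close> the curve \<open>F (s, t)\<close> leaves the pole with
  velocity \<open>Fs 0 t\<close>. The chain rule gives the slope of the function along it, and the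
  first two rows of \<open>sp0\<close> give the same slope.\<close>

lemma C1_pole_conditions:
  assumes "GDERIV ((comb0 D F \<Omega> x\<^sub>0 c)(x\<^sub>0 := y)) x\<^sub>0 :> g"
  shows "rowB (c 0) t = y" "\<kappa> * (rowB (c 1) t - y) = Fs 0 t \<bullet> g"
proof -
  let ?f = "(comb0 D F \<Omega> x\<^sub>0 c)(x\<^sub>0 := y)"
  have df: "(?f has_derivative (\<lambda>h. h \<bullet> g)) (at x\<^sub>0)" using assms
    by (simp add: gderiv_def)
  have sub: "(\<lambda>s. pt s t) ` {0..L} \<subseteq> strip L" by (auto simp: strip_def)
  have "((\<lambda>s. pt s t) has_derivative (\<lambda>h. pt h 0)) (at 0 within {0..L})"
    by (rule has_derivative_pt) (auto intro!: derivative_eq_intros)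
  moreover have "(F has_derivative (\<lambda>h. h $ 1 *\<^sub>R Fs 0 t + (h $ 2 * 0) *\<^sub>R E 0 t)) (at (pt 0 t) within (\<lambda>s. pt s t) ` {0..L})"
    by (rule has_derivative_subset[OF F_deriv sub]) (use L_pos in simp)
  ultimately have "((\<lambda>s. F (pt s t)) has_derivative (\<lambda>h. pt h 0 $ 1 *\<^sub>R Fs 0 t + (pt h 0 $ 2 * 0) *\<^sub>R E 0 t)) (at 0 within {0..L})"
    by (rule has_derivative_in_compose)
  from has_derivative_compose[OF this, of ?f "\<lambda>h. h \<bullet> g"] df
  have "((\<lambda>s. ?f (F (pt s t))) has_real_derivative Fs 0 t \<bullet> g) (at 0 within {0..L})"
    by (simp add: F_pole has_field_derivative_def mult_commute_abs)
  then have "((\<lambda>s. (?f (F (pt s t)) - y) / s) \<longlongrightarrow> Fs 0 t \<bullet> g) (at_right 0)"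
    using L_pos by (simp add: has_field_derivative_iff F_pole at_within_Icc_at_right)
  moreover have ev: "\<forall>\<^sub>F s in at_right 0. ?f (F (pt s t)) = sp0 c s t"
    using eventually_radius[of t] by eventually_elim (simp add: comb0_F)
  then have "\<forall>\<^sub>F s in at_right 0. (?f (F (pt s t)) - y) / s = (sp0 c s t - y) / s"
    by eventually_elim simp
  ultimately have q: "((\<lambda>s. (sp0 c s t - y) / s) \<longlongrightarrow> Fs 0 t \<bullet> g) (at_right 0)"
    by (simp only: tendsto_cong)
  have "((\<lambda>s. ?f (F (pt s t))) \<longlongrightarrow> y) (at_right 0)"
  proof -
    have "isCont ?f x\<^sub>0" using df by (rule has_derivative_continuous)
    then show ?thesis using isCont_tendsto_compose[OF _ ray_tendsto_pole, of ?f t] by simp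
  qed
  then have "((\<lambda>s. sp0 c s t) \<longlongrightarrow> y) (at_right 0)" using ev
    by (simp only: tendsto_cong)
  then show y: "rowB (c 0) t = y" using lim_sp0 tendsto_unique trivial_limit_at_right_real by blast
  show "\<kappa> * (rowB (c 1) t - y) = Fs 0 t \<bullet> g"
    using lim_sp0_quotient[of c t] q unfolding y using tendsto_unique trivial_limit_at_right_real by blast
qed

text \<open>Pairing with \<open>Fs\<close> and with \<open>E\<close> isolates the components
  \<open>sps\<close> and \<open>spt / s\<close>, whose behaviour along each ray is known.\<close>

lemma C0_pole_conditions:
  assumes lim: "(comb1 D F \<Omega> x\<^sub>0 a b \<longlongrightarrow> y) (at x\<^sub>0)"
  shows "\<kappa> * rowB (a 0) t = Fs 0 t \<bullet> y" "rowM (b 0) t = 0" "\<kappa> * rowM (b 1) t = E 0 t \<bullet> y"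
proof -
  have "filterlim (\<lambda>s. F (pt s t)) (at x\<^sub>0) (at_right 0)"
    unfolding filterlim_at using ray_tendsto_pole[of t] eventually_radius[of t]
    by (auto elim: eventually_mono)
  from filterlim_compose[OF lim this] have v: "((\<lambda>s. comb1 D F \<Omega> x\<^sub>0 a b (F (pt s t))) \<longlongrightarrow> y) (at_right 0)" .
  have 1: "\<forall>\<^sub>F s in at_right 0. Fs s t \<bullet> comb1 D F \<Omega> x\<^sub>0 a b (F (pt s t)) = sps a s t"
    using eventually_radius[of t] by eventually_elim (auto simp: comb1_F cov_solves)
  have 2: "\<forall>\<^sub>F s in at_right 0. E s t \<bullet> comb1 D F \<Omega> x\<^sub>0 a b (F (pt s t)) = spt b s t / s"
    using eventually_radius[of t] by eventually_elim (auto simp: comb1_F cov_solves)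
  have "((\<lambda>s. Fs s t \<bullet> comb1 D F \<Omega> x\<^sub>0 a b (F (pt s t))) \<longlongrightarrow> Fs 0 t \<bullet> y) (at_right 0)"
    by (intro tendsto_inner ray_tendsto[OF Fs_cont] v)
  then have "((\<lambda>s. sps a s t) \<longlongrightarrow> Fs 0 t \<bullet> y) (at_right 0)" using 1
    by (simp only: tendsto_cong)
  then show "\<kappa> * rowB (a 0) t = Fs 0 t \<bullet> y"
    using lim_sps tendsto_unique trivial_limit_at_right_real by blast
  have "((\<lambda>s. E s t \<bullet> comb1 D F \<Omega> x\<^sub>0 a b (F (pt s t))) \<longlongrightarrow> E 0 t \<bullet> y) (at_right 0)"
    by (intro tendsto_inner ray_tendsto[OF E_cont] v)
  then have q: "((\<lambda>s. spt b s t / s) \<longlongrightarrow> E 0 t \<bullet> y) (at_right 0)" using 2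
    by (simp only: tendsto_cong)
  \<comment> \<open>A finite limit of the quotient forces \<open>spt\<close> itself to tend to 0, so
    row 0 of \<open>b\<close> vanishes; only then is the limit of the quotient governed by row
    1.\<close>
  then have "((\<lambda>s. s * (spt b s t / s)) \<longlongrightarrow> 0 * (E 0 t \<bullet> y)) (at_right 0)"
    by (intro tendsto_mult tendsto_ident_at)
  moreover have "\<forall>\<^sub>F s in at_right 0. s * (spt b s t / s) = spt b s t"
    using eventually_radius[of t] by eventually_elim auto
  ultimately have "((\<lambda>s. spt b s t) \<longlongrightarrow> 0) (at_right 0)" by (simp add: tendsto_cong)
  then show b0: "rowM (b 0) t = 0" using lim_spt tendsto_unique trivial_limit_at_right_real by blast
  show "\<kappa> * rowM (b 1) t = E 0 t \<bullet> y"
    using lim_spt_quotient[of b t] b0 q tendsto_unique trivial_limit_at_right_real by blast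
qed

lemma push_bounded:
  fixes G :: "real \<Rightarrow> real \<Rightarrow> 'a::real_normed_vector"
  assumes "continuous_on ({0..L} \<times> UNIV) (\<lambda>(s, t). G s t)"
  shows "\<exists>C. \<forall>x\<in>\<Omega> - {x\<^sub>0}. norm (push G x) \<le> C"
proof -
  have "compact ((\<lambda>(s, t). G s t) ` ({0..L} \<times> {0..2 * pi}))"
    by (intro compact_continuous_image compact_Times continuous_on_subset[OF assms]) auto
  then obtain C
    where C: "\<And>y. y \<in> (\<lambda>(s, t). G s t) ` ({0..L} \<times> {0..2 * pi}) \<Longrightarrow> norm y \<le> C"
    using compact_imp_bounded bounded_iff by metis
  have "norm (push G x) \<le> C" if x: "x \<in> \<Omega> - {x\<^sub>0}" for x
  proof -
    obtain s t where st: "pcoord L F x = pt s t" "0 < s" "s < L" "0 \<le> t" "t < 2 * pi"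
      using pcoord_strip[OF x] by metis
    show ?thesis unfolding push_def
      by (rule C) (use st in \<open>auto intro!: image_eqI[of _ _ "(s, t)"]\<close>)
  qed
  then show ?thesis by blast
qed

text \<open>Replacing \<open>spt / s\<close> by \<open>spq\<close> exhibits the field as the
  pushforward of a function continuous up to the edge \<open>s = 0\<close>.\<close>

lemma comb1_regular:
  assumes p: "2 \<le> p" and b0: "\<And>t. rowM (b 0) t = 0"
  shows "continuous_on ({0..L} \<times> UNIV) (\<lambda>(s, t). cov (sps a s t) (spq b s t) s t)"
    "x \<in> \<Omega> - {x\<^sub>0} \<Longrightarrow> comb1 D F \<Omega> x\<^sub>0 a b x = push (\<lambda>s t. cov (sps a s t) (spq b s t) s t) x"
proof -
  show "continuous_on ({0..L} \<times> UNIV) (\<lambda>(s, t). cov (sps a s t) (spq b s t) s t)"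
    by (intro cov_continuous sps_cont spq_cont p) auto
  assume x: "x \<in> \<Omega> - {x\<^sub>0}"
  obtain s t where st: "pcoord L F x = pt s t" "0 < s" using pcoord_strip[OF x] by metis
  then show "comb1 D F \<Omega> x\<^sub>0 a b x = push (\<lambda>s t. cov (sps a s t) (spq b s t) s t) x"
    using x spt_eq_spq[of b, OF b0] by (simp add: comb1_eq push_def)
qed

text \<open>On the edge \<open>s = 0\<close> the extended covector has the same pairings with
  \<open>Fs 0 t\<close> and \<open>E 0 t\<close> as \<open>y\<close>, hence equals \<open>y\<close>
  at every angle by \<open>cov_unique\<close>; this is the constancy that a limit at the pole
  requires.\<close>

lemma comb1_continuous:
  assumes p: "2 \<le> p" and b0: "\<And>t. rowM (b 0) t = 0"
    and a0: "\<And>t. \<kappa> * rowB (a 0) t = Fs 0 t \<bullet> y"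
    and b1: "\<And>t. \<kappa> * rowM (b 1) t = E 0 t \<bullet> y"
  shows "(comb1 D F \<Omega> x\<^sub>0 a b \<longlongrightarrow> y) (at x\<^sub>0)" "continuous_on (\<Omega> - {x\<^sub>0}) (comb1 D F \<Omega> x\<^sub>0 a b)"
    "\<exists>C. \<forall>x\<in>\<Omega> - {x\<^sub>0}. norm (comb1 D F \<Omega> x\<^sub>0 a b x) \<le> C"
proof -
  let ?G = "\<lambda>s t. cov (sps a s t) (spq b s t) s t"
  note G = comb1_regular[where a = a and b = b, OF p b0]
  have per: "?G s (t + 2 * pi) = ?G s t" if "s \<in> {0..L}" for s t using that
    by (simp add: sp_per chart_per)
  have "?G 0 t = y" for t using cov_unique[of 0 y t] L_pos unfolding sp_at_pole a0 b1 by simp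
  with G(1) per have "(push ?G \<longlongrightarrow> y) (at x\<^sub>0)"
    by (intro push_tendsto_pole[OF L_pos order_refl]) auto
  moreover have "\<forall>\<^sub>F x in at x\<^sub>0. push ?G x = comb1 D F \<Omega> x\<^sub>0 a b x"
    using eventually_at_in_open[OF open_\<Omega> pole_in] by eventually_elim (use G(2) in auto)
  ultimately show "(comb1 D F \<Omega> x\<^sub>0 a b \<longlongrightarrow> y) (at x\<^sub>0)"
    by (rule Lim_transform_eventually)
  have "continuous_on (\<Omega> - {x\<^sub>0}) (push ?G)"
    by (rule push_continuous) (use per in \<open>auto intro: continuous_on_subset[OF G(1)]\<close>)
  then show "continuous_on (\<Omega> - {x\<^sub>0}) (comb1 D F \<Omega> x\<^sub>0 a b)"
    by (rule continuous_on_eq) (use G(2) in auto)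
  show "\<exists>C. \<forall>x\<in>\<Omega> - {x\<^sub>0}. norm (comb1 D F \<Omega> x\<^sub>0 a b x) \<le> C"
    using push_bounded[OF G(1)] G(2) by simp
qed

lemma sp2_linear_bound:
  assumes "\<And>t. rowM (c 0) t = 0"
  obtains C where "\<And>s t. s \<in> {0..L} \<Longrightarrow> \<bar>sp2 c s t\<bar> \<le> C * s"
proof -
  obtain C where "\<And>s t. s \<in> {0..L} \<Longrightarrow> \<bar>\<Sum>i\<in>{1..<ns - 1}. Ms D i s * rowM (c i) t\<bar> \<le> C * s"
    using sp2_tail_bound[of c] by blast
  then show ?thesis using that[of C] assms unfolding sp2_split by simp
qed

lemma comb2_in_L2:
  assumes "\<And>t. rowM (c 0) t = 0"
  shows "comb2 D F \<Omega> x\<^sub>0 c \<in> L2 \<Omega>"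
proof -
  obtain C where "\<And>s t. s \<in> {0..L} \<Longrightarrow> \<bar>sp2 c s t\<bar> \<le> C * s"
    using sp2_linear_bound[of c, OF assms] by blast
  then show ?thesis by (rule L2_chart[OF sp2_measurable]) (auto simp: comb2_F)
qed

lemma comb2_L2_imp:
  assumes "comb2 D F \<Omega> x\<^sub>0 c \<in> modpole x\<^sub>0 (L2 \<Omega>)"
  shows "rowM (c 0) t = 0"
proof (rule ccontr)
  assume "rowM (c 0) t \<noteq> 0"
  then obtain a b e \<eta> where *: "0 \<le> a" "a < b" "b \<le> 2 * pi" "0 < e" "0 < \<eta>"
    "\<And>s t. 0 < s \<Longrightarrow> s < e \<Longrightarrow> a < t \<Longrightarrow> t < b \<Longrightarrow> \<eta> \<le> \<bar>sp2 c s t\<bar>"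
      using sp2_bounded_away by metis
  obtain y where "(comb2 D F \<Omega> x\<^sub>0 c)(x\<^sub>0 := y) \<in> L2 \<Omega>" using assms
    by (auto simp: modpole_def)
  moreover have "(comb2 D F \<Omega> x\<^sub>0 c)(x\<^sub>0 := y) \<notin> L2 \<Omega>"
    by (rule not_L2_chart[OF _ *]) (use F_not_pole in \<open>auto simp: comb2_F\<close>)
  ultimately show False by blast
qed

lemma U2_eq: "U2 D F \<Omega> x\<^sub>0 = {comb2 D F \<Omega> x\<^sub>0 c | c. \<forall>j<n. c 0 j = 0}"
proof (intro subset_antisym subsetI)
  fix f assume "f \<in> U2 D F \<Omega> x\<^sub>0"
  then obtain c where f: "f = comb2 D F \<Omega> x\<^sub>0 c" "f \<in> modpole x\<^sub>0 (L2 \<Omega>)"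
    by (auto simp: U2_def W2_def)
  then have 0: "rowM (c 0) t = 0" for t using comb2_L2_imp by blast
  let ?c = "c(0 := \<lambda>_. 0)"
  have "rowM (?c i) = rowM (c i)" for i using 0 rowM_zero[of "?c 0"]
    by (cases "i = 0") (auto simp: fun_eq_iff)
  then have "sp2 ?c = sp2 c" unfolding sp2_def[abs_def] by presburger
  then have "f = comb2 D F \<Omega> x\<^sub>0 ?c" unfolding f(1) fun_eq_iff comb2_eq by simp
  then show "f \<in> {comb2 D F \<Omega> x\<^sub>0 c | c. \<forall>j<n. c 0 j = 0}" by fastforce
next
  fix f assume "f \<in> {comb2 D F \<Omega> x\<^sub>0 c | c. \<forall>j<n. c 0 j = 0}"
  then obtain c where c: "f = comb2 D F \<Omega> x\<^sub>0 c" "\<forall>j<n. c 0 j = 0" by blast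
  have "f \<in> L2 \<Omega>" unfolding c(1) by (rule comb2_in_L2) (use c(2) rowM_zero in auto)
  then have "f(x\<^sub>0 := f x\<^sub>0) \<in> L2 \<Omega>" by simp
  then show "f \<in> U2 D F \<Omega> x\<^sub>0" using c(1) unfolding U2_def W2_def modpole_def by blast
qed

text \<open>The curl is the density with coefficients \<open>d\<close>. As row 0 of \<open>b\<close>
  is zero, the relation between row 1 of \<open>b\<close> and row 0 of \<open>a\<close> says that
  row 0 of \<open>d\<close> vanishes, which puts the curl in \<open>L2\<close>.\<close>

lemma comb1_Hcurl:
  assumes p: "2 \<le> p" and b0: "\<And>j. j < n \<Longrightarrow> b 0 j = 0"
    and ab: "\<And>j. j < n \<Longrightarrow> b 1 j = shift (a 0) j"
    and a0: "\<And>t. \<kappa> * rowB (a 0) t = Fs 0 t \<bullet> y"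
    and b1: "\<And>t. \<kappa> * rowM (b 1) t = E 0 t \<bullet> y"
  shows "(comb1 D F \<Omega> x\<^sub>0 a b)(x\<^sub>0 := y) \<in> Hcurl \<Omega>"
proof -
  let ?v = "(comb1 D F \<Omega> x\<^sub>0 a b)(x\<^sub>0 := y)"
  define d where "d i j = (b (Suc i) j - b i j) - shift (a i) j" for i j
  have r0: "rowM (b 0) t = 0" for t using b0 by (rule rowM_zero)
  note C = comb1_continuous[where a = a and b = b, OF p r0 a0 b1]
  obtain B where B: "\<And>x. x \<in> \<Omega> - {x\<^sub>0} \<Longrightarrow> norm (comb1 D F \<Omega> x\<^sub>0 a b x) \<le> B"
    using C(3) by blast
  have "continuous_on (\<Omega> - {x\<^sub>0}) ?v" using C(2) by (rule continuous_on_eq) auto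
  then have "?v \<in> L2 \<Omega>" using B
    by (intro L2_bounded_continuous[OF open_\<Omega> bounded_\<Omega>]) auto
  moreover have "comb2 D F \<Omega> x\<^sub>0 d \<in> L2 \<Omega>"
    by (rule comb2_in_L2, rule rowM_zero) (simp add: d_def b0 ab[symmetric])
  moreover have "weak_curl \<Omega> ?v (comb2 D F \<Omega> x\<^sub>0 d)"
  proof (rule weak_curl_chart[where ?X1.0 = "sps a" and ?X2.0 = "spt b"
    and ?dX1.0 = "sp2 (\<lambda>i. shift (a i))"
        and ?dX2.0 = "sp2 (\<lambda>i j. b (Suc i) j - b i j)"])
    show "spt b 0 t = 0" for t using spt_eq_spq[of b, OF r0, of 0] by simp
    fix s t assume s: "0 < s" "s < L" "F (pt s t) \<in> \<Omega>"
    show "?v (F (pt s t)) = cov (sps a s t) (spt b s t / s) s t" using s F_not_pole[of s t]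
      by (simp add: comb1_F)
    have "sp2 d s t = sp2 (\<lambda>i j. b (Suc i) j - b i j) s t - sp2 (\<lambda>i. shift (a i)) s t"
      unfolding sp2_def d_def rowM_linear(1)[of _ "shift (a _)"]
      by (simp add: right_diff_distrib sum_subtractf)
    then show "comb2 D F \<Omega> x\<^sub>0 d (F (pt s t))
      = (sp2 (\<lambda>i j. b (Suc i) j - b i j) s t - sp2 (\<lambda>i. shift (a i)) s t) / (s * det2 (Fs s t) (E s t))"
      using s by (simp add: comb2_F)
  qed (use p in \<open>auto intro!: sps_cont spt_cont sp2_cont sps_deriv spt_deriv simp: sp_per\<close>)
  ultimately show ?thesis unfolding Hcurl_def by blast
qed

text \<open>Off the pole the gradient is the field of coefficient differences \<open>a\<close>,
  \<open>b\<close>, to which \<open>comb1_continuous\<close> applies. It passes to the pole by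
  \<open>GDERIV_removable\<close>, and its boundedness yields \<open>H1\<close>.\<close>

lemma comb0_C1:
  assumes p: "2 \<le> p" and c0: "\<And>j. j < n \<Longrightarrow> c 0 j = y"
    and c1: "\<And>t. \<kappa> * (rowB (c 1) t - y) = Fs 0 t \<bullet> g"
    and m1: "\<And>t. \<kappa> * rowM (shift (c 1)) t = E 0 t \<bullet> g"
  shows "(comb0 D F \<Omega> x\<^sub>0 c)(x\<^sub>0 := y) \<in> C1 \<Omega>" "(comb0 D F \<Omega> x\<^sub>0 c)(x\<^sub>0 := y) \<in> H1 \<Omega>"
    "GDERIV ((comb0 D F \<Omega> x\<^sub>0 c)(x\<^sub>0 := y)) x\<^sub>0 :> g"
proof -
  let ?f = "(comb0 D F \<Omega> x\<^sub>0 c)(x\<^sub>0 := y)"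
  define a where "a i j = c (Suc i) j - c i j" for i j
  define b where "b i = shift (c i)" for i
  let ?v = "comb1 D F \<Omega> x\<^sub>0 a b"
  have r0: "rowM (b 0) t = 0" for t by (rule rowM_zero) (use n_pos in \<open>simp add: b_def c0\<close>)
  have "rowB (c 0) t = y" for t using c0 by (rule rowB_const)
  then have a0: "\<kappa> * rowB (a 0) t = Fs 0 t \<bullet> g" for t
  proof -
    have "a 0 = (\<lambda>j. c 1 j - c 0 j)" by (simp add: a_def fun_eq_iff)
    then show ?thesis using c1[of t] \<open>\<And>t. rowB (c 0) t = y\<close> by (simp add: rowB_linear)
  qed
  have b1: "\<kappa> * rowM (b 1) t = E 0 t \<bullet> g" for t using m1[of t] by (simp add: b_def)
  note C = comb1_continuous[where a = a and b = b, OF p r0 a0 b1]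
  have cont_v: "continuous_on \<Omega> (?v(x\<^sub>0 := g))"
    by (rule fun_upd_continuous_on[OF C(2) open_\<Omega> C(1)])
  have lim0: "(comb0 D F \<Omega> x\<^sub>0 c \<longlongrightarrow> y) (at x\<^sub>0)"
  proof -
    have "(push (sp0 c) \<longlongrightarrow> y) (at x\<^sub>0)"
      by (rule push_tendsto_pole[OF L_pos order_refl sp0_cont]) (use \<open>\<And>t. rowB (c 0) t = y\<close> in \<open>auto simp: sp_per sp_at_pole\<close>)
    moreover have "\<forall>\<^sub>F x in at x\<^sub>0. push (sp0 c) x = comb0 D F \<Omega> x\<^sub>0 c x"
      using eventually_at_in_open[OF open_\<Omega> pole_in] by eventually_elim (auto simp: comb0_eq)
    ultimately show ?thesis by (rule Lim_transform_eventually)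
  qed
  have gd: "GDERIV ?f x :> ?v x" if x: "x \<in> \<Omega> - {x\<^sub>0}" for x
  proof -
    obtain s t where st: "0 < s" "s < L" "x = F (pt s t)" using \<Omega>_cases[OF x] by blast
    have "pt s t \<in> interior (strip L)"
    proof (rule interiorI[of "box (pt 0 (t - 1)) (pt L (t + 1))"])
      show "pt s t \<in> box (pt 0 (t - 1)) (pt L (t + 1))" using st by (simp add: box_pt)
      show "box (pt 0 (t - 1)) (pt L (t + 1)) \<subseteq> strip L" by (auto simp: box_pt strip_def)
    qed (rule open_box)
    then have at: "at (pt s t) within strip L = at (pt s t)" by (rule at_within_interior)
    have "((\<lambda>z. sp0 c (z $ 1) (z $ 2)) has_derivative
      (\<lambda>k. k $ 1 * sps (\<lambda>i j. c (Suc i) j - c i j) s t + k $ 2 * spt (\<lambda>i. shift (c i)) s t)) (at (pt s t) within strip L)"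
      by (rule sp0_has_derivative[OF p]) (use st in auto)
    then have "((\<lambda>z. sp0 c (z $ 1) (z $ 2)) has_derivative (\<lambda>k. k $ 1 * sps a s t + k $ 2 * (s * (spt b s t / s)))) (at (pt s t))"
      using st unfolding at a_def[abs_def] b_def[abs_def] by simp
    from push_GDERIV[OF st(1,2) _ this] have "GDERIV (push (sp0 c)) (F (pt s t)) :> gradv a b s t"
      by (simp add: sp_per)
    then have "(push (sp0 c) has_derivative (\<lambda>h. h \<bullet> ?v x)) (at x)"
      using x st by (simp add: gderiv_def comb1_F)
    then have "(?f has_derivative (\<lambda>h. h \<bullet> ?v x)) (at x)"
      by (rule has_derivative_transform_within_open[OF _ open_delete[OF open_\<Omega>] x]) (auto simp: comb0_eq)
    then show ?thesis by (simp add: gderiv_def)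
  qed
  have "isCont ?f x\<^sub>0"
  proof -
    have "(?f \<longlongrightarrow> y) (at x\<^sub>0)"
      using lim0 by (rule Lim_transform_eventually) (auto simp: eventually_at_filter)
    then show ?thesis by (simp add: isCont_def)
  qed
  then show gp: "GDERIV ?f x\<^sub>0 :> g"
    by (rule GDERIV_removable[OF open_\<Omega> pole_in gd C(1), rotated])
  have gd': "GDERIV ?f x :> (?v(x\<^sub>0 := g)) x" if "x \<in> \<Omega>" for x using gd[of x] gp that by auto
  then show "?f \<in> C1 \<Omega>" using cont_v C1_iff[OF open_\<Omega>] by blast
  have "weak_gradient \<Omega> ?f (?v(x\<^sub>0 := g))"
    by (rule weak_gradient_C1[OF open_\<Omega> cont_v gd'])
  moreover obtain B where "\<And>x. x \<in> \<Omega> - {x\<^sub>0} \<Longrightarrow> norm (?v x) \<le> B"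
    using C(3) by blast
  then have "?v(x\<^sub>0 := g) \<in> L2 \<Omega>"
    using continuous_on_subset[OF cont_v]
    by (intro L2_bounded_continuous[OF open_\<Omega> bounded_\<Omega>, of x\<^sub>0]) auto
  moreover obtain B'
    where "\<And>x. x \<in> \<Omega> - {x\<^sub>0} \<Longrightarrow> norm (push (sp0 c) x) \<le> B'"
      using push_bounded[OF sp0_cont] by blast
  then have "?f \<in> L2 \<Omega>"
  proof (intro L2_bounded_continuous[OF open_\<Omega> bounded_\<Omega>, of x\<^sub>0])
    show "continuous_on (\<Omega> - {x\<^sub>0}) ?f"
      using gd by (meson continuous_at_imp_continuous_on gderiv_def has_derivative_continuous)
  qed (auto simp: comb0_eq)
  ultimately show "?f \<in> H1 \<Omega>" unfolding H1_def by blast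
qed

lemma comb0_replace:
  assumes "\<And>t. rowB (c 0) t = rowB (c' 0) t" "\<And>t. rowB (c 1) t = rowB (c' 1) t" "\<And>i. 2 \<le> i \<Longrightarrow> c i = c' i"
  shows "comb0 D F \<Omega> x\<^sub>0 c = comb0 D F \<Omega> x\<^sub>0 c'"
proof -
  have "rowB (c i) = rowB (c' i)" for i
    using assms(1,2) assms(3)[of i] by (intro ext) (cases "i = 0"; cases "i = 1"; simp)
  then have "sp0 c = sp0 c'" by (simp add: sp0_def[abs_def])
  then show ?thesis by (intro ext) (simp only: comb0_eq)
qed

lemma comb1_replace:
  assumes "\<And>t. rowB (a 0) t = rowB (a' 0) t" "\<And>i. 1 \<le> i \<Longrightarrow> a i = a' i"
    "\<And>t. rowM (b 0) t = rowM (b' 0) t" "\<And>t. rowM (b 1) t = rowM (b' 1) t" "\<And>i. 2 \<le> i \<Longrightarrow> b i = b' i"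
  shows "comb1 D F \<Omega> x\<^sub>0 a b = comb1 D F \<Omega> x\<^sub>0 a' b'"
proof -
  have "rowB (a i) = rowB (a' i)" for i using assms(1) assms(2)[of i] by (intro ext) (cases "i = 0"; simp)
  then have "sps a = sps a'" by (simp add: sps_def[abs_def])
  moreover have "rowM (b i) = rowM (b' i)" for i
    using assms(3,4) assms(5)[of i] by (intro ext) (cases "i = 0"; cases "i = 1"; simp)
  then have "spt b = spt b'" by (simp add: spt_def[abs_def])
  ultimately show ?thesis by (intro ext) (simp only: comb1_eq)
qed

end

section \<open>The analytical mapping\<close>

lemma GDERIV_unique:
  fixes f :: "real^2 \<Rightarrow> real"
  assumes "GDERIV f x :> g" "GDERIV f x :> g'"
  shows "g = g'"
proof -
  have "(\<lambda>h. h \<bullet> g) = (\<lambda>h. h \<bullet> g')"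
    using assms unfolding gderiv_def by (rule has_derivative_unique)
  then have "(g - g') \<bullet> (g - g') = 0" by (metis inner_diff_right right_minus_eq)
  then show ?thesis by simp
qed

lemma analytical_map_pt: "analytical_map x\<^sub>0 (pt s t) = x\<^sub>0 + pt (s * cos t) (s * sin t)"
  by (simp add: analytical_map_def)

lemma norm_pt_polar: "norm (pt (s * cos t) (s * sin t)) = \<bar>s\<bar>"
proof -
  have "(norm (pt (s * cos t) (s * sin t)))\<^sup>2 = (s * cos t)\<^sup>2 + (s * sin t)\<^sup>2"
    unfolding power2_norm_eq_inner inner_vec2 by (simp add: power2_eq_square)
  also have "\<dots> = s\<^sup>2 * ((cos t)\<^sup>2 + (sin t)\<^sup>2)"
    by (simp only: power_mult_distrib distrib_left)
  also have "\<dots> = \<bar>s\<bar>\<^sup>2" by simp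
  finally show ?thesis by (simp only: power2_eq_iff_nonneg norm_ge_zero abs_ge_zero)
qed

text \<open>\<open>Fs\<close> and \<open>E\<close> are the orthonormal polar frame, so their
  determinant is 1 also at the pole.\<close>

lemma polar_spline_analytical:
  assumes "open_knots D"
  shows "polar_spline D (analytical_map x\<^sub>0) (ball x\<^sub>0 (len D)) x\<^sub>0 (\<lambda>s t. pt (cos t) (sin t)) (\<lambda>s t. pt (- sin t) (cos t))"
proof -
  interpret spline_space D by unfold_locales fact
  show ?thesis
  proof unfold_locales
    show "0 < len D" by (rule L_pos)
    show "open (ball x\<^sub>0 (len D))" by simp
    show "x\<^sub>0 \<in> ball x\<^sub>0 (len D)" using L_pos by simp
    show "analytical_map x\<^sub>0 (pt s (t + 2 * pi)) = analytical_map x\<^sub>0 (pt s t)" for s t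
      by (simp add: analytical_map_pt)
    show "analytical_map x\<^sub>0 (pt 0 t) = x\<^sub>0" for t by (simp add: analytical_map_pt vec2_eq_iff)
    show "pt (cos (t + 2 * pi)) (sin (t + 2 * pi)) = pt (cos t) (sin t)"
      "pt (- sin (t + 2 * pi)) (cos (t + 2 * pi)) = pt (- sin t) (cos t)" for t by simp_all
    show "continuous_on ({0..len D} \<times> UNIV) (\<lambda>(s, t). pt (cos t) (sin t))"
      "continuous_on ({0..len D} \<times> UNIV) (\<lambda>(s, t). pt (- sin t) (cos t))"
      unfolding case_prod_beta by (intro continuous_intros)+
    show "0 < det2 (pt (cos t) (sin t)) (pt (- sin t) (cos t))" for t
      using sin_cos_squared_add3[of t] by (simp add: det2_def power2_eq_square)
  next
    fix s t s' t' assume s: "s \<in> {0<..len D}" "s' \<in> {0<..len D}"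
      and eq: "analytical_map x\<^sub>0 (pt s t) = analytical_map x\<^sub>0 (pt s' t')"
    then have pts: "pt (s * cos t) (s * sin t) = pt (s' * cos t') (s' * sin t')"
      by (simp add: analytical_map_pt)
    have "s = s'" using arg_cong[OF pts, of norm] s unfolding norm_pt_polar by simp
    moreover have "sin t = sin t' \<and> cos t = cos t'" using pts s \<open>s = s'\<close> by simp
    ultimately show "s = s' \<and> (\<exists>k::int. t = t' + 2 * pi * of_int k)" using sin_cos_eq_iff
      by blast
  next
    fix s t assume s: "s \<in> {0<..len D}"
    have "norm (analytical_map x\<^sub>0 (pt s t) - x\<^sub>0) = s" using s
      by (simp add: analytical_map_pt norm_pt_polar)
    then show "analytical_map x\<^sub>0 (pt s t) \<noteq> x\<^sub>0" using s by auto
  next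
    fix x assume x: "x \<in> ball x\<^sub>0 (len D) - {x\<^sub>0}"
    define s where "s = norm (x - x\<^sub>0)"
    have s: "0 < s" "s < len D" using x by (auto simp: s_def dist_norm norm_minus_commute)
    have "s\<^sup>2 = ((x - x\<^sub>0) $ 1)\<^sup>2 + ((x - x\<^sub>0) $ 2)\<^sup>2"
      unfolding s_def power2_norm_eq_inner inner_vec2 by (simp add: power2_eq_square)
    moreover have "((x - x\<^sub>0) $ 1 / s)\<^sup>2 + ((x - x\<^sub>0) $ 2 / s)\<^sup>2 = (((x - x\<^sub>0) $ 1)\<^sup>2 + ((x - x\<^sub>0) $ 2)\<^sup>2) / s\<^sup>2"
      by (simp only: power_divide add_divide_distrib)
    moreover have "s\<^sup>2 / s\<^sup>2 = 1" using s by simp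
    ultimately have "((x - x\<^sub>0) $ 1 / s)\<^sup>2 + ((x - x\<^sub>0) $ 2 / s)\<^sup>2 = 1"
      by (simp only:)
    then obtain t where t: "(x - x\<^sub>0) $ 1 / s = cos t" "(x - x\<^sub>0) $ 2 / s = sin t"
      by (rule sincos_total_2pi)
    have "x = analytical_map x\<^sub>0 (pt s t)"
      unfolding analytical_map_pt t[symmetric] using s by (simp add: vec2_eq_iff)
    then show "\<exists>s t. 0 < s \<and> s < len D \<and> x = analytical_map x\<^sub>0 (pt s t)" using s
      by blast
  next
    fix t
    have "dist x\<^sub>0 (analytical_map x\<^sub>0 (pt (len D) t)) = len D"
      using L_pos norm_pt_polar[of "len D" t] by (simp add: dist_norm analytical_map_pt)
    then show "analytical_map x\<^sub>0 (pt (len D) t) \<notin> ball x\<^sub>0 (len D)" by simp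
  next
    fix s t :: real
    have n: "((\<lambda>z::real^2. z $ k) has_derivative (\<lambda>h. h $ k)) (at (pt s t) within strip (len D))" for k
      by (rule bounded_linear.has_derivative[OF bounded_linear_vec_nth]) (rule has_derivative_ident)
    have c: "((\<lambda>z::real^2. cos (z $ 2)) has_derivative (\<lambda>h. - sin t * h $ 2)) (at (pt s t) within strip (len D))"
      using has_derivative_compose[OF n[of 2], of cos "(*) (- sin t)"] DERIV_cos[of t]
      by (simp add: has_field_derivative_def)
    have d: "((\<lambda>z::real^2. sin (z $ 2)) has_derivative (\<lambda>h. cos t * h $ 2)) (at (pt s t) within strip (len D))"
      using has_derivative_compose[OF n[of 2], of sin "(*) (cos t)"] DERIV_sin[of t]
      by (simp add: has_field_derivative_def)
    have "((\<lambda>z. x\<^sub>0 + pt (z $ 1 * cos (z $ 2)) (z $ 1 * sin (z $ 2))) has_derivative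
      (\<lambda>h. 0 + pt (pt s t $ 1 * (- sin t * h $ 2) + h $ 1 * cos (pt s t $ 2)) (pt s t $ 1 * (cos t * h $ 2) + h $ 1 * sin (pt s t $ 2))))
      (at (pt s t) within strip (len D))"
      by (intro has_derivative_add has_derivative_const has_derivative_pt has_derivative_mult n c d)
    moreover have "0 + pt (pt s t $ 1 * (- sin t * h $ 2) + h $ 1 * cos (pt s t $ 2)) (pt s t $ 1 * (cos t * h $ 2) + h $ 1 * sin (pt s t $ 2))
      = h $ 1 *\<^sub>R pt (cos t) (sin t) + (h $ 2 * s) *\<^sub>R pt (- sin t) (cos t)" for h :: "real^2"
      by (simp add: vec2_eq_iff)
    ultimately show "(analytical_map x\<^sub>0 has_derivative
      (\<lambda>h. h $ 1 *\<^sub>R pt (cos t) (sin t) + (h $ 2 * s) *\<^sub>R pt (- sin t) (cos t))) (at (pt s t) within strip (len D))"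
      unfolding analytical_map_def[abs_def] by (simp only: )
  qed
qed

context polar_spline
begin

section \<open>Membership in the spaces and values at the pole\<close>

lemma C1_fun_updD:
  assumes "f(x\<^sub>0 := y) \<in> C1 \<Omega>"
  shows "\<exists>g. GDERIV (f(x\<^sub>0 := y)) x\<^sub>0 :> g" "f \<in> C1 (\<Omega> - {x\<^sub>0})"
proof -
  obtain g where g: "continuous_on \<Omega> g" "\<And>x. x \<in> \<Omega> \<Longrightarrow> GDERIV (f(x\<^sub>0 := y)) x :> g x"
    using assms C1_iff[OF open_\<Omega>] by blast
  then show "\<exists>g. GDERIV (f(x\<^sub>0 := y)) x\<^sub>0 :> g" using pole_in by blast
  have "GDERIV f x :> g x" if x: "x \<in> \<Omega> - {x\<^sub>0}" for x
  proof -
    have "((f(x\<^sub>0 := y)) has_derivative (\<lambda>h. h \<bullet> g x)) (at x)" using g(2) x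
      by (simp add: gderiv_def del: fun_upd_apply)
    then have "(f has_derivative (\<lambda>h. h \<bullet> g x)) (at x)"
      by (rule has_derivative_transform_within_open[OF _ open_delete[OF open_\<Omega>] x]) auto
    then show ?thesis by (simp add: gderiv_def)
  qed
  then show "f \<in> C1 (\<Omega> - {x\<^sub>0})"
    using C1_iff[OF open_delete[OF open_\<Omega>], of f x\<^sub>0] continuous_on_subset[OF g(1)] by blast
qed

lemma C0_fun_updD:
  assumes "v(x\<^sub>0 := y) \<in> C0 \<Omega>"
  shows "(v \<longlongrightarrow> y) (at x\<^sub>0)" "v \<in> C0 (\<Omega> - {x\<^sub>0})"
proof -
  have c: "continuous_on \<Omega> (v(x\<^sub>0 := y))" using assms by (simp add: C0_def)
  then show "(v \<longlongrightarrow> y) (at x\<^sub>0)" using open_\<Omega> pole_in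
    by (rule continuous_on_fun_upd_tendsto)
  have "continuous_on (\<Omega> - {x\<^sub>0}) (v(x\<^sub>0 := y))" using c
    by (rule continuous_on_subset) auto
  then have "continuous_on (\<Omega> - {x\<^sub>0}) v" by (rule continuous_on_eq) auto
  then show "v \<in> C0 (\<Omega> - {x\<^sub>0})" by (simp add: C0_def)
qed

lemma C0_fun_updI: "v \<in> C0 (\<Omega> - {x\<^sub>0}) \<Longrightarrow> (v \<longlongrightarrow> y) (at x\<^sub>0) \<Longrightarrow> v(x\<^sub>0 := y) \<in> C0 \<Omega>"
  using fun_upd_continuous_on[OF _ open_\<Omega>, of x\<^sub>0 v y] by (simp add: C0_def)

lemma U_V: "U0 D F \<Omega> x\<^sub>0 = V0 D F \<Omega> x\<^sub>0 \<inter> modpole x\<^sub>0 (C1 \<Omega>)"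
  "U1 D F \<Omega> x\<^sub>0 = V1 D F \<Omega> x\<^sub>0 \<inter> modpole x\<^sub>0 (C0 \<Omega>)" "U2 D F \<Omega> x\<^sub>0 = V2 D F \<Omega> x\<^sub>0"
  by (simp_all add: U0_def V0_def U1_def V1_def U2_def V2_def)

lemma U0_I:
  assumes p: "2 \<le> p" and c0: "\<And>j. j < n \<Longrightarrow> c 0 j = y"
    and c1: "\<And>t. \<kappa> * (rowB (c 1) t - y) = Fs 0 t \<bullet> g"
    and m1: "\<And>t. \<kappa> * rowM (shift (c 1)) t = E 0 t \<bullet> g"
  shows "comb0 D F \<Omega> x\<^sub>0 c \<in> U0 D F \<Omega> x\<^sub>0"
proof -
  have "(comb0 D F \<Omega> x\<^sub>0 c)(x\<^sub>0 := y) \<in> C1 \<Omega>" "(comb0 D F \<Omega> x\<^sub>0 c)(x\<^sub>0 := y) \<in> H1 \<Omega>"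
    using comb0_C1[where c = c, OF p c0 c1 m1] by blast+
  then show ?thesis unfolding U0_def W0_def modpole_def by blast
qed

lemma U1_I:
  assumes p: "2 \<le> p" and b0: "\<And>j. j < n \<Longrightarrow> b 0 j = 0"
    and ab: "\<And>j. j < n \<Longrightarrow> b 1 j = shift (a 0) j"
    and a0: "\<And>t. \<kappa> * rowB (a 0) t = Fs 0 t \<bullet> y"
    and b1: "\<And>t. \<kappa> * rowM (b 1) t = E 0 t \<bullet> y"
  shows "comb1 D F \<Omega> x\<^sub>0 a b \<in> U1 D F \<Omega> x\<^sub>0"
proof -
  have r0: "rowM (b 0) t = 0" for t using b0 by (rule rowM_zero)
  note C = comb1_continuous[where a = a and b = b, OF p r0 a0 b1]
  have "(comb1 D F \<Omega> x\<^sub>0 a b)(x\<^sub>0 := y) \<in> C0 \<Omega>" using C(1,2)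
    by (intro C0_fun_updI) (simp_all add: C0_def)
  moreover have "(comb1 D F \<Omega> x\<^sub>0 a b)(x\<^sub>0 := y) \<in> Hcurl \<Omega>"
    by (rule comb1_Hcurl[where a = a and b = b, OF p b0 ab a0 b1])
  ultimately show ?thesis unfolding U1_def W1_def modpole_def by blast
qed

lemma U0_E:
  assumes "\<phi> \<in> U0 D F \<Omega> x\<^sub>0"
  shows "\<exists>c y g. \<phi> = comb0 D F \<Omega> x\<^sub>0 c \<and> GDERIV (\<phi>(x\<^sub>0 := y)) x\<^sub>0 :> g
    \<and> (\<forall>t. rowB (c 0) t = y) \<and> (\<forall>t. \<kappa> * (rowB (c 1) t - y) = Fs 0 t \<bullet> g)"
proof -
  obtain c where c: "\<phi> = comb0 D F \<Omega> x\<^sub>0 c" using assms by (auto simp: U0_def W0_def)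
  obtain y where y: "\<phi>(x\<^sub>0 := y) \<in> C1 \<Omega>" using assms by (auto simp: U0_def modpole_def)
  obtain g where g: "GDERIV (\<phi>(x\<^sub>0 := y)) x\<^sub>0 :> g" using C1_fun_updD(1)[OF y] by blast
  then have g': "GDERIV ((comb0 D F \<Omega> x\<^sub>0 c)(x\<^sub>0 := y)) x\<^sub>0 :> g" unfolding c .
  show ?thesis
    by (intro exI[of _ c] exI[of _ y] exI[of _ g] conjI allI c g C1_pole_conditions[OF g'])
qed

lemma U1_E:
  assumes "v \<in> U1 D F \<Omega> x\<^sub>0"
  shows "\<exists>a b y. v = comb1 D F \<Omega> x\<^sub>0 a b \<and> (v \<longlongrightarrow> y) (at x\<^sub>0) \<and> (\<forall>t. \<kappa> * rowB (a 0) t = Fs 0 t \<bullet> y)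
    \<and> (\<forall>t. rowM (b 0) t = 0) \<and> (\<forall>t. \<kappa> * rowM (b 1) t = E 0 t \<bullet> y)"
proof -
  obtain a b where ab: "v = comb1 D F \<Omega> x\<^sub>0 a b" using assms by (auto simp: U1_def W1_def)
  obtain y where y: "v(x\<^sub>0 := y) \<in> C0 \<Omega>" using assms by (auto simp: U1_def modpole_def)
  have lim: "(v \<longlongrightarrow> y) (at x\<^sub>0)" using C0_fun_updD(1)[OF y] .
  then have lim': "(comb1 D F \<Omega> x\<^sub>0 a b \<longlongrightarrow> y) (at x\<^sub>0)" unfolding ab .
  show ?thesis
    by (intro exI[of _ a] exI[of _ b] exI[of _ y] conjI allI ab lim C0_pole_conditions[OF lim'])
qed

end

locale analytical_spline = polar_spline D "analytical_map x\<^sub>0" "ball x\<^sub>0 (len D)" x\<^sub>0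
    "\<lambda>s t. pt (cos t) (sin t)" "\<lambda>s t. pt (- sin t) (cos t)"
  for D x\<^sub>0
begin

abbreviation "M \<equiv> analytical_map x\<^sub>0"
abbreviation "B \<equiv> ball x\<^sub>0 L"

lemma no_trig:
  assumes "\<And>t. rowB f t = pt (cos t) (sin t) \<bullet> g"
  shows "g = 0"
proof -
  have "g $ 1 = 0 \<and> g $ 2 = 0"
    by (rule Bt_lincomb_trig[of f]) (use assms in \<open>simp add: rowB_def inner_vec2 mult.commute\<close>)
  then show ?thesis by (simp add: vec2_eq_iff)
qed

lemma C1_cond:
  assumes "GDERIV ((comb0 D M B x\<^sub>0 c)(x\<^sub>0 := y)) x\<^sub>0 :> g"
  shows "g = 0" "rowB (c 0) t = y" "rowB (c 1) t = y"
proof -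
  note C = C1_pole_conditions[OF assms]
  \<comment> \<open>By the partition of unity the constant \<open>y\<close> is itself a row
    function, so the slope condition equates an angular spline with a combination of cosine and
    sine.\<close>
  have "rowB (\<lambda>j. \<kappa> * (c 1 j - y)) t = pt (cos t) (sin t) \<bullet> g" for t
    using C(2)[of t] rowB_linear(1)[of "c 1" "\<lambda>_. y" t] rowB_const[of "\<lambda>_. y" y t]
    by (simp add: rowB_linear(2))
  then show g: "g = 0" by (rule no_trig)
  show "rowB (c 0) t = y" by (rule C(1))
  show "rowB (c 1) t = y" using C(2)[of t] \<kappa>_pos by (simp add: g)
qed

lemma C0_cond:
  assumes "(comb1 D M B x\<^sub>0 a b \<longlongrightarrow> y) (at x\<^sub>0)"
  shows "y = 0" "rowB (a 0) t = 0" "rowM (b 0) t = 0" "rowM (b 1) t = 0"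
proof -
  note C = C0_pole_conditions[OF assms]
  have "rowB (\<lambda>j. \<kappa> * a 0 j) t = pt (cos t) (sin t) \<bullet> y" for t using C(1)[of t]
    by (simp add: rowB_linear)
  then show y: "y = 0" by (rule no_trig)
  show "rowB (a 0) t = 0" "rowM (b 0) t = 0" "rowM (b 1) t = 0" using C[of t] \<kappa>_pos
    by (simp_all add: y)
qed

abbreviation "S0 \<equiv> {comb0 D M B x\<^sub>0 c | c \<gamma>\<^sub>0. \<forall>j<n. c 0 j = \<gamma>\<^sub>0 \<and> c 1 j = \<gamma>\<^sub>0}"
abbreviation "S1 \<equiv> {comb1 D M B x\<^sub>0 a b | a b. \<forall>j<n. a 0 j = 0 \<and> b 0 j = 0 \<and> b 1 j = a 0 (Suc j mod n) - a 0 j}"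

lemma U0_sub: "U0 D M B x\<^sub>0 \<subseteq> S0"
proof
  fix \<phi> assume "\<phi> \<in> U0 D M B x\<^sub>0"
  then obtain c y g where c: "\<phi> = comb0 D M B x\<^sub>0 c"
    and g: "GDERIV (\<phi>(x\<^sub>0 := y)) x\<^sub>0 :> g" using U0_E by blast
  note r = C1_cond(2,3)[OF g[unfolded c]]
  let ?c = "c(0 := \<lambda>_. y, 1 := \<lambda>_. y)"
  have "\<phi> = comb0 D M B x\<^sub>0 ?c" unfolding c
    by (rule comb0_replace) (use r rowB_const[of "\<lambda>_. y" y] in auto)
  then show "\<phi> \<in> S0" by (intro CollectI exI[of _ ?c] exI[of _ y]) auto
qed

lemma U1_sub: "U1 D M B x\<^sub>0 \<subseteq> S1"
proof
  fix v assume "v \<in> U1 D M B x\<^sub>0"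
  then obtain a b y where v: "v = comb1 D M B x\<^sub>0 a b" "(v \<longlongrightarrow> y) (at x\<^sub>0)"
    using U1_E by blast
  then have lim: "(comb1 D M B x\<^sub>0 a b \<longlongrightarrow> y) (at x\<^sub>0)" by simp
  let ?a = "a(0 := \<lambda>_. 0)" and ?b = "b(0 := \<lambda>_. 0, 1 := \<lambda>_. 0)"
  have "v = comb1 D M B x\<^sub>0 ?a ?b" unfolding v(1)
    by (rule comb1_replace)
      (use C0_cond(2-4)[OF lim] rowB_const[of "\<lambda>_. 0" 0] rowM_zero[of "\<lambda>_. 0"] in auto)
  then show "v \<in> S1" by (intro CollectI exI[of _ ?a] exI[of _ ?b]) auto
qed

lemma U0_eq: "2 \<le> p \<Longrightarrow> U0 D M B x\<^sub>0 = S0"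
proof (rule subset_antisym[OF U0_sub], rule subsetI)
  fix \<phi> assume p: "2 \<le> p" and "\<phi> \<in> S0"
  then obtain c y
    where c: "\<phi> = comb0 D M B x\<^sub>0 c" "\<And>j. j < n \<Longrightarrow> c 0 j = y" "\<And>j. j < n \<Longrightarrow> c 1 j = y"
      by blast
  have 1: "\<kappa> * (rowB (c 1) t - y) = pt (cos t) (sin t) \<bullet> 0" for t
    using rowB_const[of "c 1" y t] c(3) by simp
  have 2: "\<kappa> * rowM (shift (c 1)) t = pt (- sin t) (cos t) \<bullet> 0" for t
    using rowM_zero[of "shift (c 1)" t] c(3) n_pos by simp
  show "\<phi> \<in> U0 D M B x\<^sub>0" unfolding c(1) by (rule U0_I[OF p c(2) 1 2])
qed

lemma U1_eq: "2 \<le> p \<Longrightarrow> U1 D M B x\<^sub>0 = S1"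
proof (rule subset_antisym[OF U1_sub], rule subsetI)
  fix v assume p: "2 \<le> p" and "v \<in> S1"
  then obtain a b
    where v: "v = comb1 D M B x\<^sub>0 a b" "\<And>j. j < n \<Longrightarrow> a 0 j = 0" "\<And>j. j < n \<Longrightarrow> b 0 j = 0"
    "\<And>j. j < n \<Longrightarrow> b 1 j = shift (a 0) j" by blast
  have 1: "\<kappa> * rowB (a 0) t = pt (cos t) (sin t) \<bullet> 0" for t using rowB_const[of "a 0" 0 t] v(2)
    by simp
  have 2: "\<kappa> * rowM (b 1) t = pt (- sin t) (cos t) \<bullet> 0" for t
    using rowM_zero[of "b 1" t] v(2,4) n_pos by simp
  show "v \<in> U1 D M B x\<^sub>0" unfolding v(1) by (rule U1_I[where a = a and b = b, OF p v(3,4) 1 2])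
qed

text \<open>In degree 1 splines are in general not differentiable across knot lines, so regularity
  off the pole stays a condition. Regularity at the pole follows from the coefficients: on the first
  knot ring only rows 0 and 1 act, both with value \<open>y\<close>, and the function is constant
  there.\<close>

lemma U0_eq_degree_1:
  assumes p: "p = 1"
  shows "U0 D M B x\<^sub>0 = S0 \<inter> (V0 D M B x\<^sub>0 \<inter> C1 (B - {x\<^sub>0}))"
proof (rule subset_antisym)
  show "U0 D M B x\<^sub>0 \<subseteq> S0 \<inter> (V0 D M B x\<^sub>0 \<inter> C1 (B - {x\<^sub>0}))"
  proof
    fix \<phi> assume u: "\<phi> \<in> U0 D M B x\<^sub>0"
    obtain y where "\<phi>(x\<^sub>0 := y) \<in> C1 B" using u by (auto simp: U0_def modpole_def)
    then have "\<phi> \<in> C1 (B - {x\<^sub>0})" by (rule C1_fun_updD(2))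
    then show "\<phi> \<in> S0 \<inter> (V0 D M B x\<^sub>0 \<inter> C1 (B - {x\<^sub>0}))"
      using u U0_sub U_V(1) by blast
  qed
  show "S0 \<inter> (V0 D M B x\<^sub>0 \<inter> C1 (B - {x\<^sub>0})) \<subseteq> U0 D M B x\<^sub>0"
  proof
    fix \<phi> assume a: "\<phi> \<in> S0 \<inter> (V0 D M B x\<^sub>0 \<inter> C1 (B - {x\<^sub>0}))"
    then obtain c y
      where c: "\<phi> = comb0 D M B x\<^sub>0 c" "\<And>j. j < n \<Longrightarrow> c 0 j = y" "\<And>j. j < n \<Longrightarrow> c 1 j = y"
        by blast
    have sp: "sp0 c s t = y" if "0 \<le> s" "s < h" for s t
    proof -
      have rows: "rowB (c 0) t = y" "rowB (c 1) t = y" using c(2,3) by (auto intro!: rowB_const)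
      have "(\<Sum>i\<in>{1..<ns}. Bs D i s * rowB (c i) t) = (\<Sum>i\<in>{1..<ns}. if i = 1 then s / h * y else 0)"
      proof (rule sum.cong[OF refl])
        fix i assume "i \<in> {1..<ns}"
        then show "Bs D i s * rowB (c i) t = (if i = 1 then s / h * y else 0)"
          using degree_1_near_pole(2,3)[OF p that] rows by (cases "i = 1") auto
      qed
      then have "sp0 c s t = Bs D 0 s * y + (\<Sum>i\<in>{1..<ns}. if i = 1 then s / h * y else 0)"
        unfolding sp0_def sum_split_0 rows by simp
      also have "\<dots> = (1 - s / h) * y + s / h * y" using Bs_0_near_pole[of s] that p ns_ge_2 by simp
      finally show ?thesis by (simp add: left_diff_distrib)
    qed
    \<comment> \<open>Points closer than \<open>r\<close> to the pole have radius parameter below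
      \<open>h\<close>, so they lie in the first knot ring.\<close>
    obtain r where r: "0 < r" "\<And>s t. h \<le> s \<Longrightarrow> s \<le> L \<Longrightarrow> r \<le> dist (M (pt s t)) x\<^sub>0"
      using F_away[OF h_pos] by blast
    let ?N = "ball x\<^sub>0 r \<inter> B" and ?f = "\<phi>(x\<^sub>0 := y)"
    have N: "open ?N" "x\<^sub>0 \<in> ?N" using r(1) L_pos by auto
    have const: "?f x = y" if "x \<in> ?N" for x
    proof (cases "x = x\<^sub>0")
      case False
      then have "x \<in> B - {x\<^sub>0}" using that by simp
      then obtain s t where st: "0 < s" "s < L" "x = M (pt s t)" by (rule \<Omega>_cases)
      have "s < h" using r(2)[of s t] st that by (force simp: dist_commute)
      then show ?thesis using False st that sp[of s t] comb0_F[of s t c] by (simp add: c(1))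
    qed simp
    have gN: "GDERIV ?f x :> 0" if "x \<in> ?N" for x
    proof -
      have "(?f has_derivative (\<lambda>h. 0)) (at x)"
        by (rule has_derivative_transform_within_open[of "\<lambda>_. y" _ _ _ ?N]) (use N that const in auto)
      then show ?thesis by (simp add: gderiv_def)
    qed
    obtain g where g: "continuous_on (B - {x\<^sub>0}) g" "\<And>x. x \<in> B - {x\<^sub>0} \<Longrightarrow> GDERIV \<phi> x :> g x"
      using a C1_iff[OF open_delete[OF open_\<Omega>]] by blast
    have gf: "GDERIV ?f x :> g x" if x: "x \<in> B - {x\<^sub>0}" for x
    proof -
      have "(\<phi> has_derivative (\<lambda>h. h \<bullet> g x)) (at x)" using g(2)[OF x]
        by (simp add: gderiv_def)
      then have "(?f has_derivative (\<lambda>h. h \<bullet> g x)) (at x)"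
        by (rule has_derivative_transform_within_open[OF _ open_delete[OF open_\<Omega>] x]) auto
      then show ?thesis by (simp add: gderiv_def)
    qed
    have "\<forall>\<^sub>F x in at x\<^sub>0. 0 = g x"
      using eventually_at_in_open[OF N] by eventually_elim (use GDERIV_unique[OF gN gf] in auto)
    then have "(g \<longlongrightarrow> 0) (at x\<^sub>0)"
      by (rule Lim_transform_eventually[OF tendsto_const])
    then have "continuous_on B (g(x\<^sub>0 := 0))" by (rule fun_upd_continuous_on[OF g(1) open_\<Omega>])
    moreover have "GDERIV ?f x :> (g(x\<^sub>0 := 0)) x" if "x \<in> B" for x
      using gf[of x] gN[OF N(2)] that by (cases "x = x\<^sub>0") auto
    ultimately have "?f \<in> C1 B" using C1_iff[OF open_\<Omega>] by blast
    then show "\<phi> \<in> U0 D M B x\<^sub>0" using a unfolding U_V(1) modpole_def by blast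
  qed
qed

text \<open>As for \<open>U0\<close>, but the field is identically zero on the first knot ring,
  because the rows acting there give zero functions.\<close>

lemma U1_eq_degree_1:
  assumes p: "p = 1"
  shows "U1 D M B x\<^sub>0 = S1 \<inter> (V1 D M B x\<^sub>0 \<inter> C0 (B - {x\<^sub>0}))"
proof (rule subset_antisym)
  show "U1 D M B x\<^sub>0 \<subseteq> S1 \<inter> (V1 D M B x\<^sub>0 \<inter> C0 (B - {x\<^sub>0}))"
  proof
    fix v assume u: "v \<in> U1 D M B x\<^sub>0"
    obtain y where "v(x\<^sub>0 := y) \<in> C0 B" using u by (auto simp: U1_def modpole_def)
    then have "v \<in> C0 (B - {x\<^sub>0})" by (rule C0_fun_updD(2))
    then show "v \<in> S1 \<inter> (V1 D M B x\<^sub>0 \<inter> C0 (B - {x\<^sub>0}))" using u U1_sub U_V(2)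
      by blast
  qed
  show "S1 \<inter> (V1 D M B x\<^sub>0 \<inter> C0 (B - {x\<^sub>0})) \<subseteq> U1 D M B x\<^sub>0"
  proof
    fix v assume a: "v \<in> S1 \<inter> (V1 D M B x\<^sub>0 \<inter> C0 (B - {x\<^sub>0}))"
    then obtain a b
      where v: "v = comb1 D M B x\<^sub>0 a b" "\<And>j. j < n \<Longrightarrow> a 0 j = 0" "\<And>j. j < n \<Longrightarrow> b 0 j = 0"
      "\<And>j. j < n \<Longrightarrow> b 1 j = shift (a 0) j" by blast
    have "b 1 j = 0" if "j < n" for j using v(2,4) that n_pos by simp
    then have r: "rowB (a 0) t = 0" "rowM (b 0) t = 0" "rowM (b 1) t = 0" for t
      using rowB_const[of "a 0" 0 t] rowM_zero[of "b 0" t] rowM_zero[of "b 1" t] v(2,3) by blast+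
    have z: "gradv a b s t = 0" if "0 \<le> s" "s < h" for s t
    proof -
      have "sps a s t = 0" unfolding sps_def sum_split_0' using r degree_1_near_pole(1)[OF p that]
        by (auto intro!: sum.neutral)
      moreover have "Bs D i s * rowM (b i) t = 0" if "i < ns" for i
        using r degree_1_near_pole(2)[OF p \<open>0 \<le> s\<close> \<open>s < h\<close>, of i] that
        by (cases "i = 0"; cases "i = 1") auto
      then have "spt b s t = 0" unfolding spt_def by (intro sum.neutral) auto
      ultimately show ?thesis by (simp add: cov_def vec2_eq_iff)
    qed
    have "(push (gradv a b) \<longlongrightarrow> 0) (at x\<^sub>0)"
    proof (rule push_tendsto_pole[of "h / 2"])
      show "continuous_on ({0..h / 2} \<times> UNIV) (\<lambda>(s, t). gradv a b s t)"
        by (rule continuous_on_eq[OF continuous_on_const[of _ 0]]) (use z h_pos in auto)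
      show "gradv a b 0 t = 0" for t by (rule z) (use h_pos in auto)
      show "gradv a b s (t + 2 * pi) = gradv a b s t" if "s \<in> {0..h / 2}" for s t
      proof -
        have s: "0 \<le> s" "s < h" using that h_pos by auto
        show ?thesis unfolding z[OF s] by (rule refl)
      qed
    qed (use h_pos h_le in auto)
    moreover have "\<forall>\<^sub>F x in at x\<^sub>0. push (gradv a b) x = v x"
      using eventually_at_in_open[OF open_\<Omega> pole_in] by eventually_elim (simp add: v(1) comb1_eq)
    ultimately have "(v \<longlongrightarrow> 0) (at x\<^sub>0)" by (rule Lim_transform_eventually)
    then have "v(x\<^sub>0 := 0) \<in> C0 B" using a by (intro C0_fun_updI) auto
    then show "v \<in> U1 D M B x\<^sub>0" using a unfolding U_V(2) modpole_def by blast
  qed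
qed

lemma U0_pole: "\<phi> \<in> U0 D M B x\<^sub>0 \<Longrightarrow> \<phi>(x\<^sub>0 := y) \<in> C1 B \<Longrightarrow> GDERIV (\<phi>(x\<^sub>0 := y)) x\<^sub>0 :> 0"
proof -
  assume u: "\<phi> \<in> U0 D M B x\<^sub>0" and y: "\<phi>(x\<^sub>0 := y) \<in> C1 B"
  obtain g where g: "GDERIV (\<phi>(x\<^sub>0 := y)) x\<^sub>0 :> g" using C1_fun_updD(1)[OF y] by blast
  obtain c where "\<phi> = comb0 D M B x\<^sub>0 c" using u by (auto simp: U0_def W0_def)
  then show ?thesis using C1_cond(1) g by blast
qed

lemma U1_pole: "v \<in> U1 D M B x\<^sub>0 \<Longrightarrow> v(x\<^sub>0 := y) \<in> C0 B \<Longrightarrow> y = 0"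
proof -
  assume u: "v \<in> U1 D M B x\<^sub>0" and y: "v(x\<^sub>0 := y) \<in> C0 B"
  obtain a b where "v = comb1 D M B x\<^sub>0 a b" using u by (auto simp: U1_def W1_def)
  then show ?thesis using C0_cond(1) C0_fun_updD(1)[OF y] by blast
qed

lemma comb0_pole:
  assumes "\<forall>j<n. c 0 j = \<gamma>\<^sub>0 \<and> c 1 j = \<gamma>\<^sub>0" "(comb0 D M B x\<^sub>0 c)(x\<^sub>0 := y) \<in> C1 B"
  shows "y = \<gamma>\<^sub>0"
proof -
  obtain g where "GDERIV ((comb0 D M B x\<^sub>0 c)(x\<^sub>0 := y)) x\<^sub>0 :> g"
    using C1_fun_updD(1)[OF assms(2)] by blast
  then have "rowB (c 0) 0 = y" by (rule C1_cond(2))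
  then show ?thesis using rowB_const[of "c 0" \<gamma>\<^sub>0 0] assms(1) by simp
qed

end

section \<open>Spline mappings\<close>

lemma spline_map_nth:
  "spline_map D x\<^sub>0 P z $ k = x\<^sub>0 $ k + (\<Sum>i<nrad D. \<Sum>j<nang D. P i j $ k * (Bs D i (z $ 1) * Bt D j (z $ 2)))"
  by (simp add: spline_map_def sum_component mult.commute)

context spline_space
begin

section \<open>Components of a spline map and its degree\<close>

lemma spline_map_eq: "spline_map D x\<^sub>0 P z $ k = x\<^sub>0 $ k + sp0 (\<lambda>i j. P i j $ k) (z $ 1) (z $ 2)"
  unfolding spline_map_nth sp0_def rowB_def sum_distrib_left by (simp add: mult_ac)

lemma rowB_trig: "rowB (\<lambda>j. u * cos (angle D j) + w * sin (angle D j)) t = u * cosB t + w * sinB t"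
  "rowM (\<lambda>j. shift (\<lambda>j. u * cos (angle D j) + w * sin (angle D j)) j) t = u * cosM t + w * sinM t"
  by (simp_all add: rowB_def rowM_def cosB_def sinB_def cosM_def sinM_def sum_distrib_left sum.distrib[symmetric] algebra_simps)

lemma spline_map_degree:
  assumes "spline_polar_mapping D x\<^sub>0 P \<rho> \<Omega>"
  shows "2 \<le> p"
proof (rule ccontr)
  assume "\<not> 2 \<le> p"
  then have p: "p = 1" using p_pos by simp
  let ?F = "spline_map D x\<^sub>0 P"
  have pm: "polar_mapping L ?F \<Omega> x\<^sub>0" and \<rho>: "\<rho> 0 = 0" "0 < \<rho> 1"
    and P: "\<And>i j. i \<in> {0, 1} \<Longrightarrow> j < n \<Longrightarrow> P i j = pt (\<rho> i * cos (angle D j)) (\<rho> i * sin (angle D j))"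
    and n4: "\<exists>n'. n = 4 * n' \<and> p \<le> n'"
    using assms unfolding spline_polar_mapping_def by blast+
  \<comment> \<open>Any positive radius in the first knot span serves: only \<open>B_0\<close> and
    \<open>B_1\<close> act there and row 0 of the control points is zero, so the second component is
    \<open>x\<^sub>0 $ 2\<close> plus a positive multiple of \<open>sinB\<close>.\<close>
  define s where "s = h / 2"
  define k where "k = s / h * \<rho> 1"
  have s: "0 \<le> s" "s < h" "s \<in> {0..L}" and k: "0 < k" using h_pos h_le \<rho>(2)
    by (auto simp: s_def k_def)
  have F2: "?F (pt s t) $ 2 = x\<^sub>0 $ 2 + k * sinB t" for t
  proof -
    let ?c = "\<lambda>i j. P i j $ 2"
    have rows: "rowB (?c 0) t = 0" "rowB (?c 1) t = \<rho> 1 * sinB t"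
    proof -
      show "rowB (?c 0) t = 0" by (rule rowB_const) (simp add: P \<rho>(1))
      have "rowB (?c 1) = rowB (\<lambda>j. 0 * cos (angle D j) + \<rho> 1 * sin (angle D j))"
        by (rule rowB_cong) (simp add: P)
      then show "rowB (?c 1) t = \<rho> 1 * sinB t" using rowB_trig(1)[of 0 "\<rho> 1" t] by simp
    qed
    have "(\<Sum>i\<in>{1..<ns}. Bs D i s * rowB (?c i) t) = (\<Sum>i\<in>{1..<ns}. if i = 1 then s / h * (\<rho> 1 * sinB t) else 0)"
    proof (rule sum.cong[OF refl])
      fix i assume "i \<in> {1..<ns}"
      then show "Bs D i s * rowB (?c i) t = (if i = 1 then s / h * (\<rho> 1 * sinB t) else 0)"
        using degree_1_near_pole(2,3)[OF p s(1,2)] rows by (cases "i = 1") auto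
    qed
    then have "sp0 ?c s t = s / h * (\<rho> 1 * sinB t)" unfolding sp0_def sum_split_0 rows using ns_ge_2
      by simp
    then show ?thesis by (simp add: spline_map_eq k_def)
  qed
  have "?F differentiable_on strip L" using pm unfolding polar_mapping_def by simp
  then have "?F differentiable (at (pt s (2 * \<delta>)) within strip L)" using s
    by (auto simp: differentiable_on_def strip_def)
  then obtain F' where F': "(?F has_derivative F') (at (pt s (2 * \<delta>)) within strip L)"
    unfolding differentiable_def by blast
  have sub: "(\<lambda>t. pt s t) ` UNIV \<subseteq> strip L" using s by (auto simp: strip_def)
  have "((\<lambda>t. pt s t) has_derivative (\<lambda>h. pt 0 h)) (at (2 * \<delta>) within UNIV)"
    by (rule has_derivative_pt) (auto intro!: derivative_eq_intros)
  from has_derivative_in_compose[OF this has_derivative_subset[OF F' sub]]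
  have "((\<lambda>t. ?F (pt s t)) has_derivative (\<lambda>h. F' (pt 0 h))) (at (2 * \<delta>))" .
  then have "((\<lambda>t. ?F (pt s t) $ 2) has_derivative (\<lambda>h. F' (pt 0 h) $ 2)) (at (2 * \<delta>))"
    by (rule bounded_linear.has_derivative[OF bounded_linear_vec_nth])
  then have "(\<lambda>t. ?F (pt s t) $ 2) differentiable at (2 * \<delta>)" by (rule differentiableI)
  then have "(\<lambda>t. (?F (pt s t) $ 2 - x\<^sub>0 $ 2) * (1 / k)) differentiable at (2 * \<delta>)"
    by (intro derivative_intros)
  moreover have "(\<lambda>t. (?F (pt s t) $ 2 - x\<^sub>0 $ 2) * (1 / k)) = sinB" using k
    by (simp add: F2 fun_eq_iff)
  ultimately have "sinB differentiable at (2 * \<delta>)" by simp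
  moreover have "4 \<le> n" using n4 p by auto
  ultimately show False using sinB_corner[OF p] by blast
qed

end

lemma Ck_on_1_continuous_on: "Ck_on 1 S f \<Longrightarrow> continuous_on S f"
  by (simp add: differentiable_imp_continuous_on)

text \<open>An outer point of the chart in the open set \<open>\<Omega>\<close> would contradict invariance of domain for a local lift.\<close>

lemma polar_mapping_outer:
  assumes pm: "polar_mapping R F \<Omega> x\<^sub>0" and R: "0 < R"
  shows "F (pt R t) \<notin> \<Omega>"
proof
  let ?z = "pt R t"
  assume in\<Omega>: "F ?z \<in> \<Omega>"
  have z: "?z \<in> strip_pos R" using R by (simp add: strip_pos_def)
  have "\<forall>z\<in>strip_pos R. \<exists>U G. open U \<and> F z \<in> U \<and> G (F z) = z
      \<and> (\<forall>x \<in> U \<inter> (closure \<Omega> - {x\<^sub>0}). G x \<in> strip_pos R \<and> F (G x) = x)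
      \<and> Ck_on 1 (U \<inter> (closure \<Omega> - {x\<^sub>0})) G"
    using pm unfolding polar_mapping_def by (elim conjE)
  from bspec[OF this z] obtain U G where UG: "open U \<and> F ?z \<in> U \<and> G (F ?z) = ?z
      \<and> (\<forall>x \<in> U \<inter> (closure \<Omega> - {x\<^sub>0}). G x \<in> strip_pos R \<and> F (G x) = x)
      \<and> Ck_on 1 (U \<inter> (closure \<Omega> - {x\<^sub>0})) G" by (elim exE)
  then have U: "open U" "F ?z \<in> U" "G (F ?z) = ?z"
    "\<And>x. x \<in> U \<inter> (closure \<Omega> - {x\<^sub>0}) \<Longrightarrow> G x \<in> strip_pos R \<and> F (G x) = x"
    "Ck_on 1 (U \<inter> (closure \<Omega> - {x\<^sub>0})) G" by blast+
  have o\<Omega>: "open \<Omega>" and im: "F ` strip_pos R = closure \<Omega> - {x\<^sub>0}" using pm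
    unfolding polar_mapping_def by blast+
  let ?N = "U \<inter> (\<Omega> - {x\<^sub>0})"
  have sub: "?N \<subseteq> U \<inter> (closure \<Omega> - {x\<^sub>0})" using closure_subset by auto
  have "F ?z \<noteq> x\<^sub>0" using im z by blast
  then have zN: "F ?z \<in> ?N" using U(2) in\<Omega> by simp
  have "continuous_on ?N G" by (rule continuous_on_subset[OF Ck_on_1_continuous_on[OF U(5)] sub])
  moreover have "open ?N" using U(1) o\<Omega> by (intro open_Int open_delete)
  moreover have "inj_on G ?N" by (rule inj_on_inverseI[of _ F]) (use U(4) sub in blast)
  ultimately have "open (G ` ?N)" by (rule invariance_of_domain)
  moreover have "?z \<in> G ` ?N" using zN U(3) by (metis imageI)
  ultimately obtain e where e: "0 < e" "ball ?z e \<subseteq> G ` ?N" using open_contains_ball by blast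
  \<comment> \<open>A small step towards larger \<open>s\<close> stays in the open image of the lift
    but leaves the strip.\<close>
  have "dist ?z (?z + (e / 2) *\<^sub>R axis 1 1) < e" using e(1) by (simp add: dist_norm norm_axis_1)
  then have "?z + (e / 2) *\<^sub>R axis 1 1 \<in> G ` ?N" using e(2) by auto
  then obtain x where x: "x \<in> ?N" "?z + (e / 2) *\<^sub>R axis 1 1 = G x" by (rule imageE)
  have "G x \<in> strip_pos R" using U(4)[OF subsetD[OF sub x(1)]] by (rule conjunct1)
  then have "?z + (e / 2) *\<^sub>R axis 1 1 \<in> strip_pos R" unfolding x(2) .
  then show False using e(1) by (simp add: strip_pos_def axis_def)
qed

locale spline_polar = spline_space D for D +
  fixes x\<^sub>0 P \<rho> \<Omega>
  assumes mapping: "spline_polar_mapping D x\<^sub>0 P \<rho> \<Omega>"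
begin

abbreviation "M \<equiv> spline_map D x\<^sub>0 P"

definition Fs :: "real \<Rightarrow> real \<Rightarrow> real^2" where
  "Fs s t = pt (sps (\<lambda>i j. P (Suc i) j $ 1 - P i j $ 1) s t) (sps (\<lambda>i j. P (Suc i) j $ 2 - P i j $ 2) s t)"

text \<open>The angular derivative of the map divided by \<open>s\<close>: row 0 of the control
  points is zero, so \<open>spt\<close> of their angular differences factors through
  \<open>spq\<close>.\<close>

definition E :: "real \<Rightarrow> real \<Rightarrow> real^2" where
  "E s t = pt (spq (\<lambda>i. shift (\<lambda>j. P i j $ 1)) s t) (spq (\<lambda>i. shift (\<lambda>j. P i j $ 2)) s t)"

lemma p2: "2 \<le> p" using mapping by (rule spline_map_degree)

lemma pm: "polar_mapping L M \<Omega> x\<^sub>0" and \<rho>: "\<rho> 0 = 0" "0 < \<rho> 1"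
  and P: "\<And>i j. i \<in> {0, 1} \<Longrightarrow> j < n \<Longrightarrow> P i j = pt (\<rho> i * cos (angle D j)) (\<rho> i * sin (angle D j))"
  and det_jac: "\<And>z. z \<in> strip_pos L \<Longrightarrow> 0 < det (jac L M z)" and n4: "4 * p \<le> n"
proof -
  show "polar_mapping L M \<Omega> x\<^sub>0" "\<rho> 0 = 0" "0 < \<rho> 1"
    using mapping unfolding spline_polar_mapping_def by blast+
  show "P i j = pt (\<rho> i * cos (angle D j)) (\<rho> i * sin (angle D j))" if "i \<in> {0, 1}" "j < n" for i j
    using mapping that unfolding spline_polar_mapping_def by blast
  show "0 < det (jac L M z)" if "z \<in> strip_pos L" for z
    using mapping that unfolding spline_polar_mapping_def by blast
  show "4 * p \<le> n" using mapping unfolding spline_polar_mapping_def by auto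
qed

section \<open>Verification of the chart for a spline map\<close>

lemma P0: "j < n \<Longrightarrow> P 0 j = 0" using P[of 0 j] \<rho>(1) by (simp add: vec2_eq_iff)
lemma P1: "j < n \<Longrightarrow> P 1 j = pt (\<rho> 1 * cos (angle D j)) (\<rho> 1 * sin (angle D j))"
  using P[of 1 j] by simp

lemma Fs_pole: "Fs 0 t = (\<kappa> * \<rho> 1) *\<^sub>R pt (cosB t) (sinB t)"
proof -
  have 1: "rowB (\<lambda>j. P (Suc 0) j $ 1 - P 0 j $ 1) = rowB (\<lambda>j. \<rho> 1 * cos (angle D j) + 0 * sin (angle D j))"
    by (rule rowB_cong) (use P0 P1 in simp)
  have 2: "rowB (\<lambda>j. P (Suc 0) j $ 2 - P 0 j $ 2) = rowB (\<lambda>j. 0 * cos (angle D j) + \<rho> 1 * sin (angle D j))"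
    by (rule rowB_cong) (use P0 P1 in simp)
  show ?thesis unfolding Fs_def sp_at_pole 1 2 rowB_trig by (simp add: vec2_eq_iff)
qed

lemma E_pole: "E 0 t = (\<kappa> * \<rho> 1) *\<^sub>R pt (cosM t) (sinM t)"
proof -
  have 1: "rowM (shift (\<lambda>j. P 1 j $ 1)) = rowM (shift (\<lambda>j. \<rho> 1 * cos (angle D j) + 0 * sin (angle D j)))"
    by (rule rowM_cong) (use P1 n_pos in simp)
  have 2: "rowM (shift (\<lambda>j. P 1 j $ 2)) = rowM (shift (\<lambda>j. 0 * cos (angle D j) + \<rho> 1 * sin (angle D j)))"
    by (rule rowM_cong) (use P1 n_pos in simp)
  show ?thesis unfolding E_def sp_at_pole 1 2 rowB_trig by (simp add: vec2_eq_iff)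
qed

lemma M_deriv:
  assumes "s \<in> {0..L}"
  shows "(M has_derivative (\<lambda>h. h $ 1 *\<^sub>R Fs s t + (h $ 2 * s) *\<^sub>R E s t)) (at (pt s t) within strip L)"
proof -
  let ?c = "\<lambda>k i j. P i j $ k"
  have r0: "rowM (shift (?c k 0)) t = 0" for k by (rule rowM_zero) (use P0 n_pos in simp)
  have d: "((\<lambda>z. sp0 (?c k) (z $ 1) (z $ 2)) has_derivative
    (\<lambda>h. h $ 1 * sps (\<lambda>i j. ?c k (Suc i) j - ?c k i j) s t + h $ 2 * (s * spq (\<lambda>i. shift (?c k i)) s t))) (at (pt s t) within strip L)" for k
    using sp0_has_derivative[OF p2 assms, of "?c k" t] spt_eq_spq[of "\<lambda>i. shift (?c k i)" t s] r0[of k]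
    by simp
  have "M = (\<lambda>z. x\<^sub>0 + pt (sp0 (?c 1) (z $ 1) (z $ 2)) (sp0 (?c 2) (z $ 1) (z $ 2)))"
    by (simp add: fun_eq_iff vec2_eq_iff spline_map_eq)
  moreover have "((\<lambda>z. x\<^sub>0 + pt (sp0 (?c 1) (z $ 1) (z $ 2)) (sp0 (?c 2) (z $ 1) (z $ 2))) has_derivative
    (\<lambda>h. 0 + pt (h $ 1 * sps (\<lambda>i j. ?c 1 (Suc i) j - ?c 1 i j) s t + h $ 2 * (s * spq (\<lambda>i. shift (?c 1 i)) s t))
      (h $ 1 * sps (\<lambda>i j. ?c 2 (Suc i) j - ?c 2 i j) s t + h $ 2 * (s * spq (\<lambda>i. shift (?c 2 i)) s t)))) (at (pt s t) within strip L)"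
    by (intro has_derivative_add has_derivative_const has_derivative_pt d)
  moreover have "0 + pt (h $ 1 * sps (\<lambda>i j. ?c 1 (Suc i) j - ?c 1 i j) s t + h $ 2 * (s * spq (\<lambda>i. shift (?c 1 i)) s t))
      (h $ 1 * sps (\<lambda>i j. ?c 2 (Suc i) j - ?c 2 i j) s t + h $ 2 * (s * spq (\<lambda>i. shift (?c 2 i)) s t))
    = h $ 1 *\<^sub>R Fs s t + (h $ 2 * s) *\<^sub>R E s t" for h :: "real^2"
    by (simp add: vec2_eq_iff Fs_def E_def)
  ultimately show ?thesis by simp
qed

lemma chart: "polar_spline D M \<Omega> x\<^sub>0 Fs E"
proof -
  have inj: "z $ 1 = w $ 1 \<and> (\<exists>k::int. z $ 2 = w $ 2 + 2 * pi * of_int k)"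
    if "z \<in> strip_pos L" "w \<in> strip_pos L" "M z = M w" for z w
    using pm that unfolding polar_mapping_def by blast
  have im: "M ` strip_pos L = closure \<Omega> - {x\<^sub>0}" using pm unfolding polar_mapping_def by blast
  show ?thesis
  proof unfold_locales
    show "0 < L" by (rule L_pos)
    show "open \<Omega>" "x\<^sub>0 \<in> \<Omega>" using pm unfolding polar_mapping_def by blast+
    show "M (pt s (t + 2 * pi)) = M (pt s t)" for s t by (simp add: vec2_eq_iff spline_map_eq sp_per)
    show "M (pt 0 t) = x\<^sub>0" for t
    proof -
      have "pt 0 t \<in> strip L" "pt 0 t $ 1 = 0" using L_pos by (auto simp: strip_def)
      then show ?thesis using pm unfolding polar_mapping_def by blast
    qed
    show "s = s' \<and> (\<exists>k::int. t = t' + 2 * pi * of_int k)"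
      if "s \<in> {0<..L}" "s' \<in> {0<..L}" "M (pt s t) = M (pt s' t')" for s t s' t'
      using inj[of "pt s t" "pt s' t'"] that by (simp add: strip_pos_def)
    show "M (pt s t) \<noteq> x\<^sub>0" if "s \<in> {0<..L}" for s t
    proof -
      have "pt s t \<in> strip_pos L" using that by (simp add: strip_pos_def)
      then show ?thesis using im by blast
    qed
    show "M (pt L t) \<notin> \<Omega>" for t by (rule polar_mapping_outer[OF pm L_pos])
    show "\<exists>s t. 0 < s \<and> s < L \<and> x = M (pt s t)" if x: "x \<in> \<Omega> - {x\<^sub>0}" for x
    proof -
      have "x \<in> M ` strip_pos L" unfolding im using x closure_subset by blast
      then obtain z where z: "z \<in> strip_pos L" "x = M z" by blast
      have "z $ 1 \<noteq> L" using polar_mapping_outer[OF pm L_pos, of "z $ 2"] x z(2)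
        by (metis DiffD1 pt_eta)
      then show ?thesis using z by (intro exI[of _ "z $ 1"] exI[of _ "z $ 2"]) (auto simp: strip_pos_def)
    qed
    show "(M has_derivative (\<lambda>h. h $ 1 *\<^sub>R Fs s t + (h $ 2 * s) *\<^sub>R E s t)) (at (pt s t) within strip L)" if "s \<in> {0..L}" for s t
      using that by (rule M_deriv)
    show "continuous_on ({0..L} \<times> UNIV) (\<lambda>(s, t). Fs s t)" "continuous_on ({0..L} \<times> UNIV) (\<lambda>(s, t). E s t)"
      unfolding Fs_def E_def case_prod_beta
      using sps_cont[OF p2] spq_cont[OF p2] by (auto simp: case_prod_beta intro!: continuous_on_pt)
    show "Fs s (t + 2 * pi) = Fs s t" "E s (t + 2 * pi) = E s t" for s t
      by (simp_all add: Fs_def E_def sp_per)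
    \<comment> \<open>At the pole the determinant is, up to a positive factor, the cross product of
      the control curve with its derivative; elsewhere it is the Jacobian determinant divided by
      \<open>s\<close>.\<close>
    show "0 < det2 (Fs s t) (E s t)" if s: "s \<in> {0..L}" for s t
    proof (cases "s = 0")
      case True
      have "det2 (Fs 0 t) (E 0 t) = (\<kappa> * \<rho> 1)\<^sup>2 * (cosB t * sinM t - sinB t * cosM t)"
        unfolding Fs_pole E_pole det2_linear by (simp add: det2_def power2_eq_square)
      then show ?thesis using True trigB_wronskian_pos[OF n4, of t] \<kappa>_pos \<rho>(2) by simp
    next
      case False
      then have "0 < det (jac L M (pt s t))" using s by (intro det_jac) (simp add: strip_pos_def)
      then show ?thesis using jac_polar(3)[OF L_pos s M_deriv[OF s]] False s by (simp add: zero_less_mult_iff)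
    qed
  qed
qed

sublocale polar_spline D M \<Omega> x\<^sub>0 Fs E by (rule chart)

lemma Fs_inner: "Fs 0 t \<bullet> y = \<kappa> * (\<rho> 1 * y $ 1 * cosB t + \<rho> 1 * y $ 2 * sinB t)"
  by (simp add: Fs_pole inner_vec2 algebra_simps)

lemma E_inner: "E 0 t \<bullet> y = \<kappa> * (\<rho> 1 * y $ 1 * cosM t + \<rho> 1 * y $ 2 * sinM t)"
  by (simp add: E_pole inner_vec2 algebra_simps)

text \<open>The covector whose pairings with \<open>Fs 0\<close> and \<open>E 0\<close> are
  \<open>\<kappa>\<close> times the rows with ring coefficients \<open>u\<close>, \<open>w\<close>
  (\<open>slope_inner\<close>); the factor \<open>1 / \<rho> 1\<close> undoes the radius of the
  first ring.\<close>

definition slope :: "real \<Rightarrow> real \<Rightarrow> real^2"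
  where "slope u w = (1 / \<rho> 1) *\<^sub>R pt u w"

lemma slope_inner: "Fs 0 t \<bullet> slope u w = \<kappa> * (u * cosB t + w * sinB t)" "E 0 t \<bullet> slope u w = \<kappa> * (u * cosM t + w * sinM t)"
proof -
  have "\<rho> 1 * slope u w $ 1 = u" "\<rho> 1 * slope u w $ 2 = w" using \<rho>(2)
    by (simp_all add: slope_def)
  then show "Fs 0 t \<bullet> slope u w = \<kappa> * (u * cosB t + w * sinB t)" "E 0 t \<bullet> slope u w = \<kappa> * (u * cosM t + w * sinM t)"
    unfolding Fs_inner E_inner by simp_all
qed

lemma rows_of_ring:
  assumes "\<And>j. j < n \<Longrightarrow> f j = g + u * cos (angle D j) + w * sin (angle D j)"
  shows "rowB f t = g + (u * cosB t + w * sinB t)" "rowM (shift f) t = u * cosM t + w * sinM t"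
proof -
  have "rowB f = rowB (\<lambda>j. g + (u * cos (angle D j) + w * sin (angle D j)))"
    by (rule rowB_cong) (simp add: assms)
  then show "rowB f t = g + (u * cosB t + w * sinB t)"
    using rowB_linear(3)[of "\<lambda>_. g"] rowB_const[of "\<lambda>_. g" g t] rowB_trig(1) by simp
  have "rowM (shift f) = rowM (shift (\<lambda>j. u * cos (angle D j) + w * sin (angle D j)))"
    by (rule rowM_cong) (use n_pos in \<open>simp add: assms\<close>)
  then show "rowM (shift f) t = u * cosM t + w * sinM t" using rowB_trig(2)[of u w t] by simp
qed

abbreviation "cond0 c g u w \<equiv> \<forall>j<n. c 0 j = g \<and> c 1 j = g + u * cos (angle D j) + w * sin (angle D j)"
abbreviation "cond1 a b u w \<equiv> \<forall>j<n. a 0 j = u * cos (angle D j) + w * sin (angle D j) \<and> b 0 j = 0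
  \<and> b 1 j = a 0 (Suc j mod n) - a 0 j"

lemma cond0_rows:
  assumes "cond0 c g u w"
  shows "\<kappa> * (rowB (c 1) t - g) = Fs 0 t \<bullet> slope u w" "\<kappa> * rowM (shift (c 1)) t = E 0 t \<bullet> slope u w"
  using rows_of_ring[of "c 1" g u w] assms by (simp_all add: slope_inner)

lemma cond1_rows:
  assumes "cond1 a b u w"
  shows "\<kappa> * rowB (a 0) t = Fs 0 t \<bullet> slope u w" "\<kappa> * rowM (b 1) t = E 0 t \<bullet> slope u w"
proof -
  show "\<kappa> * rowB (a 0) t = Fs 0 t \<bullet> slope u w" using rows_of_ring(1)[of "a 0" 0 u w] assms
    by (simp add: slope_inner)
  have "rowM (b 1) = rowM (shift (a 0))" by (rule rowM_cong) (use assms in simp)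
  then show "\<kappa> * rowM (b 1) t = E 0 t \<bullet> slope u w" using rows_of_ring(2)[of "a 0" 0 u w] assms
    by (simp add: slope_inner)
qed

section \<open>Spaces and pole values for a spline map\<close>

lemma U0_eq: "U0 D M \<Omega> x\<^sub>0 = {comb0 D M \<Omega> x\<^sub>0 c | c g u w. cond0 c g u w}"
proof (intro subset_antisym subsetI)
  fix \<phi> assume "\<phi> \<in> U0 D M \<Omega> x\<^sub>0"
  then obtain c y g where c: "\<phi> = comb0 D M \<Omega> x\<^sub>0 c"
    "\<forall>t. rowB (c 0) t = y" "\<forall>t. \<kappa> * (rowB (c 1) t - y) = Fs 0 t \<bullet> g" using U0_E
      by blast
  \<comment> \<open>These coefficients invert \<open>slope\<close>: by \<open>Fs_inner\<close> they
    reproduce the pairing of \<open>Fs 0\<close> with \<open>g\<close>.\<close>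
  define u w where "u = \<rho> 1 * g $ 1" "w = \<rho> 1 * g $ 2"
  let ?c = "c(0 := \<lambda>_. y, 1 := \<lambda>j. y + u * cos (angle D j) + w * sin (angle D j))"
  have cc: "cond0 ?c y u w" by simp
  have "\<phi> = comb0 D M \<Omega> x\<^sub>0 ?c" unfolding c(1)
  proof (rule comb0_replace)
    show "rowB (c 0) t = rowB (?c 0) t" for t using c(2) rowB_const[of "\<lambda>_. y" y t] by simp
    show "rowB (c 1) t = rowB (?c 1) t" for t
      using c(3)[rule_format, of t] rows_of_ring(1)[of "?c 1" y u w t] \<kappa>_pos
      by (simp add: Fs_inner u_w_def)
  qed simp
  then show "\<phi> \<in> {comb0 D M \<Omega> x\<^sub>0 c | c g u w. cond0 c g u w}" using cc by blast
next
  fix \<phi> assume "\<phi> \<in> {comb0 D M \<Omega> x\<^sub>0 c | c g u w. cond0 c g u w}"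
  then obtain c g u w where c: "\<phi> = comb0 D M \<Omega> x\<^sub>0 c" "cond0 c g u w" by blast
  then have "\<And>j. j < n \<Longrightarrow> c 0 j = g" by blast
  from U0_I[where c = c, OF p2 this cond0_rows[where c = c, OF c(2)]] show "\<phi> \<in> U0 D M \<Omega> x\<^sub>0"
    unfolding c(1) .
qed

lemma U1_eq: "U1 D M \<Omega> x\<^sub>0 = {comb1 D M \<Omega> x\<^sub>0 a b | a b u w. cond1 a b u w}"
proof (intro subset_antisym subsetI)
  fix v assume "v \<in> U1 D M \<Omega> x\<^sub>0"
  then obtain a b y where v: "v = comb1 D M \<Omega> x\<^sub>0 a b"
    "\<forall>t. \<kappa> * rowB (a 0) t = Fs 0 t \<bullet> y" "\<forall>t. rowM (b 0) t = 0" "\<forall>t. \<kappa> * rowM (b 1) t = E 0 t \<bullet> y"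
      using U1_E by blast
  define u w where "u = \<rho> 1 * y $ 1" "w = \<rho> 1 * y $ 2"
  let ?f = "\<lambda>j. u * cos (angle D j) + w * sin (angle D j)"
  let ?a = "a(0 := ?f)" and ?b = "b(0 := \<lambda>_. 0, 1 := shift ?f)"
  have cc: "cond1 ?a ?b u w" by simp
  have r: "rowB ?f t = u * cosB t + w * sinB t" "rowM (shift ?f) t = u * cosM t + w * sinM t" for t
    using rows_of_ring[of ?f 0 u w t] by simp_all
  have "v = comb1 D M \<Omega> x\<^sub>0 ?a ?b" unfolding v(1)
  proof (rule comb1_replace)
    show "rowB (a 0) t = rowB (?a 0) t" for t using v(2)[rule_format, of t] r(1)[of t] \<kappa>_pos
      by (simp add: Fs_inner u_w_def)
    show "rowM (b 0) t = rowM (?b 0) t" for t using v(3) rowM_zero[of "\<lambda>_. 0" t] by simp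
    show "rowM (b 1) t = rowM (?b 1) t" for t using v(4)[rule_format, of t] r(2)[of t] \<kappa>_pos
      by (simp add: E_inner u_w_def)
  qed simp_all
  then show "v \<in> {comb1 D M \<Omega> x\<^sub>0 a b | a b u w. cond1 a b u w}" using cc by blast
next
  fix v assume "v \<in> {comb1 D M \<Omega> x\<^sub>0 a b | a b u w. cond1 a b u w}"
  then obtain a b u w where v: "v = comb1 D M \<Omega> x\<^sub>0 a b" "cond1 a b u w" by blast
  then have "\<And>j. j < n \<Longrightarrow> b 0 j = 0" "\<And>j. j < n \<Longrightarrow> b 1 j = shift (a 0) j"
    by blast+
  from U1_I[where a = a and b = b, OF p2 this cond1_rows[where a = a
    and b = b, OF v(2)]] show "v \<in> U1 D M \<Omega> x\<^sub>0" unfolding v(1) .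
qed

lemma comb0_pole:
  assumes c: "cond0 c g u w" and y: "(comb0 D M \<Omega> x\<^sub>0 c)(x\<^sub>0 := y) \<in> C1 \<Omega>"
  shows "y = g" "GDERIV ((comb0 D M \<Omega> x\<^sub>0 c)(x\<^sub>0 := y)) x\<^sub>0 :> slope u w"
proof -
  obtain g' where "GDERIV ((comb0 D M \<Omega> x\<^sub>0 c)(x\<^sub>0 := y)) x\<^sub>0 :> g'"
    using C1_fun_updD(1)[OF y] by blast
  then have "rowB (c 0) 0 = y" by (rule C1_pole_conditions(1))
  then show yg: "y = g" using rowB_const[of "c 0" g 0] c by simp
  have "\<And>j. j < n \<Longrightarrow> c 0 j = g" using c by blast
  from comb0_C1(3)[where c = c, OF p2 this cond0_rows[where c = c, OF c]]
  show "GDERIV ((comb0 D M \<Omega> x\<^sub>0 c)(x\<^sub>0 := y)) x\<^sub>0 :> slope u w" unfolding yg .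
qed

lemma comb1_pole:
  assumes v: "cond1 a b u w" and y: "(comb1 D M \<Omega> x\<^sub>0 a b)(x\<^sub>0 := y) \<in> C0 \<Omega>"
  shows "y = slope u w"
proof -
  have r0: "\<And>t. rowM (b 0) t = 0" using v by (intro rowM_zero) blast
  have "(comb1 D M \<Omega> x\<^sub>0 a b \<longlongrightarrow> slope u w) (at x\<^sub>0)"
    by (rule comb1_continuous(1)[where a = a and b = b, OF p2 r0 cond1_rows[where a = a and b = b, OF v]])
  moreover have "(comb1 D M \<Omega> x\<^sub>0 a b \<longlongrightarrow> y) (at x\<^sub>0)"
    by (rule C0_fun_updD(1)[OF y])
  ultimately show ?thesis using tendsto_unique[of "at x\<^sub>0"] by (auto simp: trivial_limit_at)
qed

end

text \<open>The split by degree concerns the analytical map: in degree 1 the coefficient conditions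
  do not control smoothness across knot lines, which therefore stays a separate condition off the
  pole. For spline maps degree 1 cannot occur (\<open>spline_map_degree\<close>). Statements on pole
  values range over every \<open>y\<close> that makes the updated function regular, because the
  value 0 of a pushforward at the pole is only a convention.\<close>

theorem theorem3p3:
  fixes D :: spline_data and x\<^sub>0 :: "real^2"
  assumes "open_knots D"
  shows
    "(\<forall>F \<Omega>. F = analytical_map x\<^sub>0 \<and> \<Omega> = ball x\<^sub>0 (len D) \<longrightarrow>
        U0 D F \<Omega> x\<^sub>0 = V0 D F \<Omega> x\<^sub>0 \<inter> modpole x\<^sub>0 (C1 \<Omega>)
      \<and> U1 D F \<Omega> x\<^sub>0 = V1 D F \<Omega> x\<^sub>0 \<inter> modpole x\<^sub>0 (C0 \<Omega>)
      \<and> U2 D F \<Omega> x\<^sub>0 = V2 D F \<Omega> x\<^sub>0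
      \<and> (2 \<le> degr D \<longrightarrow>
          U0 D F \<Omega> x\<^sub>0 =
            {comb0 D F \<Omega> x\<^sub>0 c | c \<gamma>\<^sub>0. \<forall>j<nang D. c 0 j = \<gamma>\<^sub>0 \<and> c 1 j = \<gamma>\<^sub>0}
        \<and> U1 D F \<Omega> x\<^sub>0 =
            {comb1 D F \<Omega> x\<^sub>0 a b | a b. \<forall>j<nang D. a 0 j = 0 \<and> b 0 j = 0
               \<and> b 1 j = a 0 (Suc j mod nang D) - a 0 j})
      \<and> (degr D = 1 \<longrightarrow>
          U0 D F \<Omega> x\<^sub>0 =
            {comb0 D F \<Omega> x\<^sub>0 c | c \<gamma>\<^sub>0. \<forall>j<nang D. c 0 j = \<gamma>\<^sub>0 \<and> c 1 j = \<gamma>\<^sub>0}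
            \<inter> (V0 D F \<Omega> x\<^sub>0 \<inter> C1 (\<Omega> - {x\<^sub>0}))
        \<and> U1 D F \<Omega> x\<^sub>0 =
            {comb1 D F \<Omega> x\<^sub>0 a b | a b. \<forall>j<nang D. a 0 j = 0 \<and> b 0 j = 0
               \<and> b 1 j = a 0 (Suc j mod nang D) - a 0 j}
            \<inter> (V1 D F \<Omega> x\<^sub>0 \<inter> C0 (\<Omega> - {x\<^sub>0})))
      \<and> U2 D F \<Omega> x\<^sub>0 = {comb2 D F \<Omega> x\<^sub>0 c | c. \<forall>j<nang D. c 0 j = 0}
      \<and> (\<forall>c \<gamma>\<^sub>0 y. (\<forall>j<nang D. c 0 j = \<gamma>\<^sub>0 \<and> c 1 j = \<gamma>\<^sub>0)
            \<and> (comb0 D F \<Omega> x\<^sub>0 c)(x\<^sub>0 := y) \<in> C1 \<Omega> \<longrightarrow> y = \<gamma>\<^sub>0)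
      \<and> (\<forall>\<phi>\<in>U0 D F \<Omega> x\<^sub>0. \<forall>y. \<phi>(x\<^sub>0 := y) \<in> C1 \<Omega> \<longrightarrow> GDERIV (\<phi>(x\<^sub>0 := y)) x\<^sub>0 :> 0)
      \<and> (\<forall>v\<in>U1 D F \<Omega> x\<^sub>0. \<forall>y. v(x\<^sub>0 := y) \<in> C0 \<Omega> \<longrightarrow> y = 0))
   \<and> (\<forall>F P \<rho> \<Omega>. F = spline_map D x\<^sub>0 P \<and> spline_polar_mapping D x\<^sub>0 P \<rho> \<Omega> \<longrightarrow>
        U0 D F \<Omega> x\<^sub>0 = V0 D F \<Omega> x\<^sub>0 \<inter> modpole x\<^sub>0 (C1 \<Omega>)
      \<and> U1 D F \<Omega> x\<^sub>0 = V1 D F \<Omega> x\<^sub>0 \<inter> modpole x\<^sub>0 (C0 \<Omega>)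
      \<and> U2 D F \<Omega> x\<^sub>0 = V2 D F \<Omega> x\<^sub>0
      \<and> U0 D F \<Omega> x\<^sub>0 =
          {comb0 D F \<Omega> x\<^sub>0 c | c \<gamma>\<^sub>0 \<gamma>\<^sub>1 \<gamma>\<^sub>2. \<forall>j<nang D. c 0 j = \<gamma>\<^sub>0
             \<and> c 1 j = \<gamma>\<^sub>0 + \<gamma>\<^sub>1 * cos (angle D j) + \<gamma>\<^sub>2 * sin (angle D j)}
      \<and> U1 D F \<Omega> x\<^sub>0 =
          {comb1 D F \<Omega> x\<^sub>0 a b | a b \<eta>\<^sub>1 \<eta>\<^sub>2. \<forall>j<nang D.
             a 0 j = \<eta>\<^sub>1 * cos (angle D j) + \<eta>\<^sub>2 * sin (angle D j) \<and> b 0 j = 0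
             \<and> b 1 j = a 0 (Suc j mod nang D) - a 0 j}
      \<and> U2 D F \<Omega> x\<^sub>0 = {comb2 D F \<Omega> x\<^sub>0 c | c. \<forall>j<nang D. c 0 j = 0}
      \<and> (\<forall>c \<gamma>\<^sub>0 \<gamma>\<^sub>1 \<gamma>\<^sub>2 y.
            (\<forall>j<nang D. c 0 j = \<gamma>\<^sub>0
               \<and> c 1 j = \<gamma>\<^sub>0 + \<gamma>\<^sub>1 * cos (angle D j) + \<gamma>\<^sub>2 * sin (angle D j))
            \<and> (comb0 D F \<Omega> x\<^sub>0 c)(x\<^sub>0 := y) \<in> C1 \<Omega> \<longrightarrow>
            y = \<gamma>\<^sub>0
            \<and> GDERIV ((comb0 D F \<Omega> x\<^sub>0 c)(x\<^sub>0 := y)) x\<^sub>0 :> (1 / \<rho> 1) *\<^sub>R vector [\<gamma>\<^sub>1, \<gamma>\<^sub>2])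
      \<and> (\<forall>a b \<eta>\<^sub>1 \<eta>\<^sub>2 y.
            (\<forall>j<nang D. a 0 j = \<eta>\<^sub>1 * cos (angle D j) + \<eta>\<^sub>2 * sin (angle D j) \<and> b 0 j = 0
               \<and> b 1 j = a 0 (Suc j mod nang D) - a 0 j)
            \<and> (comb1 D F \<Omega> x\<^sub>0 a b)(x\<^sub>0 := y) \<in> C0 \<Omega> \<longrightarrow>
            y = (1 / \<rho> 1) *\<^sub>R vector [\<eta>\<^sub>1, \<eta>\<^sub>2]))"
proof (intro conjI allI impI; (elim conjE; hypsubst)?)
  interpret analytical_spline D x\<^sub>0
    unfolding analytical_spline_def using assms by (rule polar_spline_analytical)
  show "U0 D M B x\<^sub>0 = V0 D M B x\<^sub>0 \<inter> modpole x\<^sub>0 (C1 B)"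
    "U1 D M B x\<^sub>0 = V1 D M B x\<^sub>0 \<inter> modpole x\<^sub>0 (C0 B)" "U2 D M B x\<^sub>0 = V2 D M B x\<^sub>0" by (rule U_V)+
  show "U0 D M B x\<^sub>0 = S0" "U1 D M B x\<^sub>0 = S1" if "2 \<le> p" using that by (rule U0_eq, rule U1_eq)
  show "U0 D M B x\<^sub>0 = S0 \<inter> (V0 D M B x\<^sub>0 \<inter> C1 (B - {x\<^sub>0}))"
    "U1 D M B x\<^sub>0 = S1 \<inter> (V1 D M B x\<^sub>0 \<inter> C0 (B - {x\<^sub>0}))" if "p = 1"
    using that by (rule U0_eq_degree_1, rule U1_eq_degree_1)
  show "U2 D M B x\<^sub>0 = {comb2 D M B x\<^sub>0 c | c. \<forall>j<n. c 0 j = 0}" by (rule U2_eq)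
  show "y = \<gamma>" if "\<forall>j<n. c 0 j = \<gamma> \<and> c 1 j = \<gamma>" "(comb0 D M B x\<^sub>0 c)(x\<^sub>0 := y) \<in> C1 B" for c \<gamma> y
    using that by (rule comb0_pole)
  show "\<forall>\<phi>\<in>U0 D M B x\<^sub>0. \<forall>y. \<phi>(x\<^sub>0 := y) \<in> C1 B \<longrightarrow> GDERIV (\<phi>(x\<^sub>0 := y)) x\<^sub>0 :> 0"
    by (intro ballI allI impI) (rule U0_pole)
  show "\<forall>v\<in>U1 D M B x\<^sub>0. \<forall>y. v(x\<^sub>0 := y) \<in> C0 B \<longrightarrow> y = 0"
    by (intro ballI allI impI) (rule U1_pole)
next
  fix P \<rho> \<Omega> assume "spline_polar_mapping D x\<^sub>0 P \<rho> \<Omega>"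
  then interpret spline_polar D x\<^sub>0 P \<rho> \<Omega>
    using assms by (simp add: spline_polar_def spline_polar_axioms_def spline_space_def)
  show "U0 D M \<Omega> x\<^sub>0 = V0 D M \<Omega> x\<^sub>0 \<inter> modpole x\<^sub>0 (C1 \<Omega>)"
    "U1 D M \<Omega> x\<^sub>0 = V1 D M \<Omega> x\<^sub>0 \<inter> modpole x\<^sub>0 (C0 \<Omega>)" "U2 D M \<Omega> x\<^sub>0 = V2 D M \<Omega> x\<^sub>0" by (rule U_V)+
  show "U2 D M \<Omega> x\<^sub>0 = {comb2 D M \<Omega> x\<^sub>0 c | c. \<forall>j<n. c 0 j = 0}" by (rule U2_eq)
  show "U0 D M \<Omega> x\<^sub>0 = {comb0 D M \<Omega> x\<^sub>0 c | c g u w. cond0 c g u w}" by (rule U0_eq)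
  show "U1 D M \<Omega> x\<^sub>0 = {comb1 D M \<Omega> x\<^sub>0 a b | a b u w. cond1 a b u w}" by (rule U1_eq)
  show "y = g" "GDERIV ((comb0 D M \<Omega> x\<^sub>0 c)(x\<^sub>0 := y)) x\<^sub>0 :> (1 / \<rho> 1) *\<^sub>R vector [u, w]"
    if "cond0 c g u w" "(comb0 D M \<Omega> x\<^sub>0 c)(x\<^sub>0 := y) \<in> C1 \<Omega>" for c g u w y
    using comb0_pole[OF that] by (simp_all only: slope_def)
  show "y = (1 / \<rho> 1) *\<^sub>R vector [u, w]"
    if "cond1 a b u w" "(comb1 D M \<Omega> x\<^sub>0 a b)(x\<^sub>0 := y) \<in> C0 \<Omega>" for a b u w y
    using comb1_pole[OF that] by (simp only: slope_def)
qed

end
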